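(* Let $L,\nu,T\in(0,\infty)$, let $\alpha>0$ and $N\in\mathbb{N}$ be given and fixed, and assume $\mathbf{u}_0\in\mathbf{H}_0$ and $\mathbf{f}\in L^2([0,T];\mathbf{H}_{-1})$. Then the approximate deconvolution model $$\partial_t\mathbf{w}+\nabla\cdot(\overline{D_N(\mathbf{w})\otimes D_N(\mathbf{w})})-\nu\Delta\mathbf{w}+\nabla q=\overline{\mathbf{f}},\quad\nabla\cdot\mathbf{w}=0,\quad\mathbf{w}(0,\mathbf{x})=\overline{\mathbf{u}_0}(\mathbf{x}),$$ on $[0,T]\times\mathbb{T}_3$ has a unique regular weak solution $(\mathbf{w},q)$.
   Context: Torus and spaces. $\mathbb{T}_3=\mathbb{R}^3/(L\mathbb{Z}^3)$ is the 3D torus with period $L$; $\mathcal{T}_3=\frac{2\pi}{L}\mathbb{Z}^3$ is the set of wave numbers and $\mathcal{T}_3^\star=\mathcal{T}_3\setminus\{0\}$. All fields are real valued. For $s\in\mathbb{R}$, $\mathbf{H}_s$ is the space of real vector fields (distributions if $s<0$) $\mathbf{w}=\sum_{\mathbf{k}\in\mathcal{T}_3^\star}\widehat{\mathbf{w}}_{\mathbf{k}}e^{i\mathbf{k}\cdot\mathbf{x}}$ with $\mathbf{k}\cdot\widehat{\mathbf{w}}_{\mathbf{k}}=0$ for all $\mathbf{k}$ (divergence-free, zero mean) and $\|\mathbf{w}\|_s^2=\sum_{\mathbf{k}\in\mathcal{T}_3^\star}|\mathbf{k}|^{2s}|\widehat{\mathbf{w}}_{\mathbf{k}}|^2<\infty$.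 Filter. $A=\mathrm{I}-\alpha^2\Delta$ and $G=A^{-1}$, i.e. $G$ multiplies the Fourier coefficient of index $\mathbf{k}\in\mathcal{T}_3$ by $(1+\alpha^2|\mathbf{k}|^2)^{-1}$. For a scalar, vector or tensor field $\chi$ on $\mathbb{T}_3$, $\overline{\chi}=G(\chi)$ (componentwise). Deconvolution operator. For $N\in\mathbb{N}=\{0,1,2,\dots\}$, $D_N=\sum_{n=0}^N(\mathrm{I}-G)^n$, i.e. $D_N$ multiplies the Fourier coefficient of index $\mathbf{k}$ by $\sum_{n=0}^N\left(\frac{\alpha^2|\mathbf{k}|^2}{1+\alpha^2|\mathbf{k}|^2}\right)^n$. Regular weak solution. A pair $(\mathbf{w},q)$ is a regular weak solution of the model if: (1) $\mathbf{w}\in L^2([0,T];\mathbf{H}_2)\cap C([0,T];\mathbf{H}_1)$, $\partial_t\mathbf{w}\in L^2([0,T];\mathbf{H}_0)$, $q\in L^2([0,T];H^1(\mathbb{T}_3))$ with $\int_{\mathbb{T}_3}q\,d\mathbf{x}=0$ for a.e. $t$; (2) $\lim_{t\to0}\|\mathbf{w}(t,\cdot)-\overline{\mathbf{u}_0}\|_{\mathbf{H}_1}=0$; (3) for all $\mathbf{v}\in L^2([0,T];H^1(\mathbb{T}_3)^3)$, $$\int_0^T\!\!\int_{\mathbb{T}_3}\partial_t\mathbf{w}\cdot\mathbf{v}-\int_0^T\!\!\int_{\mathbb{T}_3}\overline{D_N(\mathbf{w})\otimes D_N(\mathbf{w})}:\nabla\mathbf{v}+\nu\int_0^T\!\!\int_{\mathbb{T}_3}\nabla\mathbf{w}:\nabla\mathbf{v}+\int_0^T\!\!\int_{\mathbb{T}_3}\nabla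 q\cdot\mathbf{v}=\int_0^T\!\!\int_{\mathbb{T}_3}\overline{\mathbf{f}}\cdot\mathbf{v}.$$ *)

theory Defs
  imports "HOL-Analysis.Analysis"
begin

section \<open>Fields on the torus and Fourier coefficients\<close>

text \<open>
  A field on the torus of period \<open>L\<close> is an \<open>L\<close>-periodic function on \<open>real^3\<close>, taken up to
  equality almost everywhere; integrals over the torus are integrals over one period cell.
\<close>

definition torus :: "real \<Rightarrow> (real^3) measure" where
  "torus L = lebesgue_on (cbox 0 (\<chi> i. L))"

definition periodic :: "real \<Rightarrow> (real^3 \<Rightarrow> 'b) \<Rightarrow> bool" where
  "periodic L u \<longleftrightarrow> (\<forall>x i. u (x + L *\<^sub>R axis i 1) = u x)"

definition L2_torus :: "real \<Rightarrow> (real^3 \<Rightarrow> 'b::euclidean_space) set" where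
  "L2_torus L = {u. periodic L u \<and> u \<in> borel_measurable (torus L)
     \<and> integrable (torus L) (\<lambda>x. (norm (u x))\<^sup>2)}"

definition wavenumbers :: "real \<Rightarrow> (real^3) set" where
  "wavenumbers L = {k. \<forall>i. \<exists>m::int. k $ i = 2 * pi / L * of_int m}"

definition fourier :: "real \<Rightarrow> (real^3 \<Rightarrow> real) \<Rightarrow> real^3 \<Rightarrow> complex" where
  "fourier L u k = (LINT x|torus L. complex_of_real (u x) * cis (- (k \<bullet> x))) / of_real (L ^ 3)"

definition vfourier :: "real \<Rightarrow> (real^3 \<Rightarrow> real^3) \<Rightarrow> real^3 \<Rightarrow> complex^3" where
  "vfourier L u k = (\<chi> j. fourier L (\<lambda>x. u x $ j) k)"

text \<open>
  The sum of a Fourier series: a representative of the real square-integrable field with the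
  coefficients \<open>c\<close>, which is unique up to null sets. It is only meaningful if \<open>c\<close> is square
  summable and \<open>c (- k)\<close> is conjugate to \<open>c k\<close>.
\<close>

definition of_fourier :: "real \<Rightarrow> (real^3 \<Rightarrow> complex) \<Rightarrow> real^3 \<Rightarrow> real" where
  "of_fourier L c = (SOME u. u \<in> L2_torus L \<and> (\<forall>k\<in>wavenumbers L. fourier L u k = c k))"

definition multiplier :: "real \<Rightarrow> (real^3 \<Rightarrow> complex) \<Rightarrow> (real^3 \<Rightarrow> real) \<Rightarrow> real^3 \<Rightarrow> real" where
  "multiplier L m u = of_fourier L (\<lambda>k. m k * fourier L u k)"

definition partial_deriv :: "real \<Rightarrow> 3 \<Rightarrow> (real^3 \<Rightarrow> real) \<Rightarrow> real^3 \<Rightarrow> real" where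
  "partial_deriv L j = multiplier L (\<lambda>k. \<i> * of_real (k $ j))"

definition grad :: "real \<Rightarrow> (real^3 \<Rightarrow> real) \<Rightarrow> real^3 \<Rightarrow> real^3" where
  "grad L u x = (\<chi> j. partial_deriv L j u x)"

definition vgrad :: "real \<Rightarrow> (real^3 \<Rightarrow> real^3) \<Rightarrow> real^3 \<Rightarrow> real^3^3" where
  "vgrad L u x = (\<chi> i. grad L (\<lambda>y. u y $ i) x)"


section \<open>Filter and deconvolution\<close>

definition filter_symbol :: "real \<Rightarrow> real^3 \<Rightarrow> real" where
  "filter_symbol \<alpha> k = 1 / (1 + \<alpha>\<^sup>2 * (norm k)\<^sup>2)"

definition deconv_symbol :: "real \<Rightarrow> nat \<Rightarrow> real^3 \<Rightarrow> real" where
  "deconv_symbol \<alpha> N k = (\<Sum>n=0..N. (\<alpha>\<^sup>2 * (norm k)\<^sup>2 / (1 + \<alpha>\<^sup>2 * (norm k)\<^sup>2)) ^ n)"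

definition gfilter :: "real \<Rightarrow> real \<Rightarrow> (real^3 \<Rightarrow> real) \<Rightarrow> real^3 \<Rightarrow> real" where
  "gfilter L \<alpha> = multiplier L (\<lambda>k. of_real (filter_symbol \<alpha> k))"

definition vfilter :: "real \<Rightarrow> real \<Rightarrow> (real^3 \<Rightarrow> real^3) \<Rightarrow> real^3 \<Rightarrow> real^3" where
  "vfilter L \<alpha> u x = (\<chi> i. gfilter L \<alpha> (\<lambda>y. u y $ i) x)"

definition tfilter :: "real \<Rightarrow> real \<Rightarrow> (real^3 \<Rightarrow> real^3^3) \<Rightarrow> real^3 \<Rightarrow> real^3^3" where
  "tfilter L \<alpha> A x = (\<chi> i j. gfilter L \<alpha> (\<lambda>y. A y $ i $ j) x)"

text \<open>The filter applied to a vector distribution given by its Fourier coefficients.\<close>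

definition dfilter :: "real \<Rightarrow> real \<Rightarrow> (real^3 \<Rightarrow> complex^3) \<Rightarrow> real^3 \<Rightarrow> real^3" where
  "dfilter L \<alpha> c x = (\<chi> i. of_fourier L (\<lambda>k. of_real (filter_symbol \<alpha> k) * c k $ i) x)"

definition deconv :: "real \<Rightarrow> real \<Rightarrow> nat \<Rightarrow> (real^3 \<Rightarrow> real^3) \<Rightarrow> real^3 \<Rightarrow> real^3" where
  "deconv L \<alpha> N u x =
     (\<chi> i. multiplier L (\<lambda>k. of_real (deconv_symbol \<alpha> N k)) (\<lambda>y. u y $ i) x)"

definition tensor :: "(real^3 \<Rightarrow> real^3) \<Rightarrow> (real^3 \<Rightarrow> real^3) \<Rightarrow> real^3 \<Rightarrow> real^3^3" where
  "tensor u v x = (\<chi> i j. u x $ i * v x $ j)"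


section \<open>Function spaces\<close>

text \<open>
  An element of \<open>H\<^sub>s\<close> is in general a distribution, here given by its Fourier coefficients:
  \<open>Hdist L s\<close>. The first condition says that the distribution is real. For \<open>s \<ge> 0\<close> the
  elements are square-integrable functions: \<open>Hfun L s\<close>.
\<close>

definition Hdist :: "real \<Rightarrow> real \<Rightarrow> (real^3 \<Rightarrow> complex^3) set" where
  "Hdist L s = {c.
     (\<forall>k\<in>wavenumbers L. \<forall>j. c (- k) $ j = cnj (c k $ j)) \<and>
     c 0 = 0 \<and>
     (\<forall>k\<in>wavenumbers L. (\<Sum>j\<in>UNIV. of_real (k $ j) * c k $ j) = 0) \<and>
     (\<lambda>k. norm k powr (2 * s) * (norm (c k))\<^sup>2) summable_on (wavenumbers L - {0})}"

definition Hdist_norm :: "real \<Rightarrow> real \<Rightarrow> (real^3 \<Rightarrow> complex^3) \<Rightarrow> real" where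
  "Hdist_norm L s c =
     sqrt (\<Sum>\<^sub>\<infinity>k\<in>wavenumbers L - {0}. norm k powr (2 * s) * (norm (c k))\<^sup>2)"

definition Hfun :: "real \<Rightarrow> real \<Rightarrow> (real^3 \<Rightarrow> real^3) set" where
  "Hfun L s = {u \<in> L2_torus L. vfourier L u \<in> Hdist L s}"

definition Hfun_norm :: "real \<Rightarrow> real \<Rightarrow> (real^3 \<Rightarrow> real^3) \<Rightarrow> real" where
  "Hfun_norm L s u = Hdist_norm L s (vfourier L u)"

definition Sobolev1 :: "real \<Rightarrow> (real^3 \<Rightarrow> real) set" where
  "Sobolev1 L = {u \<in> L2_torus L.
     (\<lambda>k. (1 + (norm k)\<^sup>2) * (norm (fourier L u k))\<^sup>2) summable_on wavenumbers L}"

definition Sobolev1_norm :: "real \<Rightarrow> (real^3 \<Rightarrow> real) \<Rightarrow> real" where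
  "Sobolev1_norm L u =
     sqrt (\<Sum>\<^sub>\<infinity>k\<in>wavenumbers L. (1 + (norm k)\<^sup>2) * (norm (fourier L u k))\<^sup>2)"

text \<open>
  \<open>L\<^sup>2([0,T]; V)\<close> and \<open>C([0,T]; V)\<close> for a space \<open>V\<close> of functions with norm \<open>nrm\<close>. The second
  condition in \<open>L2_time\<close> is strong (Bochner) measurability.
\<close>

definition L2_time ::
  "real \<Rightarrow> ('a \<Rightarrow> 'b::ab_group_add) set \<Rightarrow> (('a \<Rightarrow> 'b) \<Rightarrow> real) \<Rightarrow> (real \<Rightarrow> 'a \<Rightarrow> 'b) set" where
  "L2_time T V nrm = {u.
     (AE t in lebesgue_on {0..T}. u t \<in> V) \<and>
     (\<exists>s. (\<forall>n::nat. simple_function (lebesgue_on {0..T}) (s n) \<and> (\<forall>t\<in>{0..T}. s n t \<in> V)) \<and>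
       (AE t in lebesgue_on {0..T}. (\<lambda>n. nrm (\<lambda>x. s n t x - u t x)) \<longlonglongrightarrow> 0)) \<and>
     integrable (lebesgue_on {0..T}) (\<lambda>t. (nrm (u t))\<^sup>2)}"

definition C_time ::
  "real \<Rightarrow> ('a \<Rightarrow> 'b::ab_group_add) set \<Rightarrow> (('a \<Rightarrow> 'b) \<Rightarrow> real) \<Rightarrow> (real \<Rightarrow> 'a \<Rightarrow> 'b) set" where
  "C_time T V nrm = {u. \<forall>t\<in>{0..T}. u t \<in> V \<and>
     ((\<lambda>s. nrm (\<lambda>x. u s x - u t x)) \<longlongrightarrow> 0) (at t within {0..T})}"

definition test_function :: "real \<Rightarrow> (real \<Rightarrow> real) \<Rightarrow> bool" where
  "test_function T \<phi> \<longleftrightarrow>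
     (\<forall>n t. (deriv ^^ n) \<phi> differentiable (at t)) \<and> closure {t. \<phi> t \<noteq> 0} \<subseteq> {0<..<T}"

text \<open>
  \<open>g\<close> is the distributional derivative of \<open>w\<close> with respect to time: the two \<open>L\<^sup>2\<close>-valued
  integrals of \<open>\<phi>' w\<close> and \<open>- \<phi> g\<close> over \<open>[0,T]\<close> agree, expressed by pairing with every \<open>\<psi>\<close>.
\<close>

definition weak_time_deriv ::
  "real \<Rightarrow> real \<Rightarrow> (real \<Rightarrow> real^3 \<Rightarrow> real^3) \<Rightarrow> (real \<Rightarrow> real^3 \<Rightarrow> real^3) \<Rightarrow> bool" where
  "weak_time_deriv L T w g \<longleftrightarrow> (\<forall>\<phi> \<psi>. test_function T \<phi> \<longrightarrow> \<psi> \<in> L2_torus L \<longrightarrow>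
     (LINT t|lebesgue_on {0..T}. deriv \<phi> t * (LINT x|torus L. w t x \<bullet> \<psi> x)) =
     - (LINT t|lebesgue_on {0..T}. \<phi> t * (LINT x|torus L. g t x \<bullet> \<psi> x)))"


section \<open>Regular weak solutions\<close>

text \<open>
  The inner product on \<open>real^3^3\<close> is the double contraction of tensors. The force \<open>f t\<close> is a
  distribution, given by its Fourier coefficients; its filtered version is a function.
\<close>

definition regular_weak_solution ::
  "real \<Rightarrow> real \<Rightarrow> real \<Rightarrow> real \<Rightarrow> nat \<Rightarrow> (real^3 \<Rightarrow> real^3) \<Rightarrow> (real \<Rightarrow> real^3 \<Rightarrow> complex^3) \<Rightarrow>
   (real \<Rightarrow> real^3 \<Rightarrow> real^3) \<Rightarrow> (real \<Rightarrow> real^3 \<Rightarrow> real) \<Rightarrow> bool" where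
  "regular_weak_solution L T \<nu> \<alpha> N u\<^sub>0 f w q \<longleftrightarrow>
     w \<in> L2_time T (Hfun L 2) (Hfun_norm L 2) \<and>
     w \<in> C_time T (Hfun L 1) (Hfun_norm L 1) \<and>
     q \<in> L2_time T (Sobolev1 L) (Sobolev1_norm L) \<and>
     (AE t in lebesgue_on {0..T}. (LINT x|torus L. q t x) = 0) \<and>
     ((\<lambda>t. Hfun_norm L 1 (\<lambda>x. w t x - vfilter L \<alpha> u\<^sub>0 x)) \<longlongrightarrow> 0) (at 0 within {0..T}) \<and>
     (\<exists>w'. w' \<in> L2_time T (Hfun L 0) (Hfun_norm L 0) \<and> weak_time_deriv L T w w' \<and>
       (\<forall>v. (\<forall>j. (\<lambda>t x. v t x $ j) \<in> L2_time T (Sobolev1 L) (Sobolev1_norm L)) \<longrightarrow>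
         (LINT t|lebesgue_on {0..T}. LINT x|torus L. w' t x \<bullet> v t x)
         - (LINT t|lebesgue_on {0..T}. LINT x|torus L.
              tfilter L \<alpha> (tensor (deconv L \<alpha> N (w t)) (deconv L \<alpha> N (w t))) x \<bullet> vgrad L (v t) x)
         + \<nu> * (LINT t|lebesgue_on {0..T}. LINT x|torus L. vgrad L (w t) x \<bullet> vgrad L (v t) x)
         + (LINT t|lebesgue_on {0..T}. LINT x|torus L. grad L (q t) x \<bullet> v t x)
         = (LINT t|lebesgue_on {0..T}. LINT x|torus L. dfilter L \<alpha> (f t) x \<bullet> v t x)))"

end

(*
  On Fourier coefficients the model is w_k' = F_k - B_k(w, w) - nu |k|^2 w_k, where B is the Leray
  projection of the filtered flux and F the filtered force; the pressure restores what the
  projection removes. One Cauchy-Schwarz inequality with the weight 1 / |k|^4, summable in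
  dimension 3, together with the two derivatives gained by the filter, shows that B is bounded and
  bilinear on H_1. So the system has a globally Lipschitz truncation, solved by Picard iteration,
  and the difference of two solutions satisfies a Gronwall inequality. The nonlinear term drops
  out of the energy sum of (1 + alpha^2 |k|^2) D_N(k) |w_k|^2, so the H_1 norm has a bound that
  does not depend on the truncation level, which can therefore be removed.
  Weak solutions and coefficient solutions correspond by Parseval's identity; for the converse
  direction the weak form is tested with the indicator of a measurable set of times multiplied by
  a single real Fourier mode.
*)
theory Submission
  imports Defs "HOL-Analysis.Analysis"
begin

text \<open>The filtered force is square integrable in time with values in H_0 only, whereas the
  nonlinear term is controlled in H_1. The viscosity closes this gap: in the energy estimate of a
  single mode the source enters divided by \<nu> |k|^2, so multiplying by |k|^2 and summing bounds
  the H_1 norm at every time, and the H_2 norm in mean square, by the H_0 norm of the source alone.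
  The weight of the energy is forced. The factor 1 + \<alpha>^2 |k|^2 undoes the filter, and D_N
  turns w into u = D_N(w), so that the trilinear term becomes the classical one for the
  divergence-free field u. Since 1 <= D_N <= N + 1, the weight is comparable to |k|^2 away from k =
  0. Inside the analysis a time-dependent field is never a vector-valued function: it is a family of
  functions of time, one for each mode. What ties the modes together is the exchange of sums over
  modes with time integrals, each time justified by an integrable majorant. The truncation level may
  enter such a majorant, but it must not enter the energy bound itself. The mean needs separate care
  throughout, because the weight |k| does not see it.\<close>

abbreviation Leb :: "real \<Rightarrow> real measure" where "Leb t \<equiv> lebesgue_on {0..t}"

abbreviation (input) slice :: "('k \<Rightarrow> 't \<Rightarrow> 'c) \<Rightarrow> 't \<Rightarrow> 'k \<Rightarrow> 'c" where "slice w t \<equiv> %k. w k t"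

text \<open>The unqualified names denote facts on the gauge integral.\<close>

lemmas bochner_integrable_add = Bochner_Integration.integrable_add
 and bochner_integrable_bound = Bochner_Integration.integrable_bound
 and bochner_integrable_cong = Bochner_Integration.integrable_cong
 and bochner_integrable_diff = Bochner_Integration.integrable_diff
 and bochner_integrable_sum = Bochner_Integration.integrable_sum
 and bochner_integral_add = Bochner_Integration.integral_add
 and bochner_integral_cnj = Bochner_Integration.integral_cnj
 and bochner_integral_cong = Bochner_Integration.integral_cong
 and bochner_integral_diff = Bochner_Integration.integral_diff
 and bochner_integral_indicator = Bochner_Integration.integral_indicator
 and bochner_integral_nonneg = Bochner_Integration.integral_nonneg
 and bochner_integral_sum = Bochner_Integration.integral_sum

section \<open>Square summable families\<close>

text \<open>An exhaustion of a countable index type by finite sets. It turns unordered sums into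
  limits of sequences, to which measurability and convergence theorems for sequences apply.\<close>

definition initial :: "nat \<Rightarrow> 'k::countable set" where
 "initial n = {k. to_nat k < n}"

lemma finite_initial [simp]: "finite (initial n)"
proof -
 have "initial n \<subseteq> from_nat ` {..<n}"
  unfolding initial_def by (auto intro!: image_eqI[of _ _ "to_nat _"])
 then show ?thesis by (rule finite_subset) auto
qed

lemma filterlim_initial: "filterlim (initial :: nat \<Rightarrow> 'k::countable set) (finite_subsets_at_top UNIV) sequentially"
 unfolding filterlim_finite_subsets_at_top
proof (intro allI impI)
 fix X :: "'k set" assume X: "finite X \<and> X \<subseteq> UNIV"
 then obtain m where m: "\<forall>i\<in>to_nat ` X. i < m"
  using finite_nat_set_iff_bounded[of "to_nat ` X"] by auto
 show "eventually (%n. finite (initial n) \<and> X \<subseteq> initial n \<and> initial n \<subseteq> (UNIV::'k set)) sequentially"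
  using eventually_ge_at_top[of m]
 proof eventually_elim
  case (elim n)
  have "X \<subseteq> initial n" unfolding initial_def using m elim by fastforce
  then show ?case using finite_initial by blast
 qed
qed

lemma infsum_LIMSEQ:
 fixes f :: "'k::countable \<Rightarrow> 'a::real_normed_vector"
 assumes "f summable_on UNIV"
 shows "(%n. sum f (initial n)) \<longlonglongrightarrow> infsum f UNIV"
 using filterlim_compose[OF infsum_tendsto[OF assms] filterlim_initial] .

lemma summable_on_nonneg_if_bounded:
 fixes f :: "'k \<Rightarrow> real"
 assumes "\<And>k. f k \<ge> 0" "\<And>A. finite A \<Longrightarrow> sum f A \<le> C"
 shows "f summable_on UNIV" "infsum f UNIV \<le> C"
proof -
 show "f summable_on UNIV"
  by (rule nonneg_bdd_above_summable_on) (use assms in \<open>auto intro!: bdd_aboveI2\<close>)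
 then show "infsum f UNIV \<le> C"
  by (rule infsum_le_finite_sums) (use assms in auto)
qed

lemma summable_on_abs_iff:
 fixes f :: "'k \<Rightarrow> real"
 shows "(%k. \<bar>f k\<bar>) summable_on A \<longleftrightarrow> f summable_on A"
 using summable_on_iff_abs_summable_on_real[of f A] unfolding real_norm_def by blast

lemma infsum_comparison:
 fixes f g :: "'k \<Rightarrow> real"
 assumes "g summable_on UNIV" "\<And>k. \<bar>f k\<bar> \<le> g k"
 shows "f summable_on UNIV" "\<bar>infsum f UNIV\<bar> \<le> infsum g UNIV" "(%k. \<bar>f k\<bar>) summable_on UNIV"
proof -
 show *: "(%k. \<bar>f k\<bar>) summable_on UNIV"
  using summable_on_comparison_test[where f=g and g="%k. \<bar>f k\<bar>" and A=UNIV, OF assms(1)] assms(2) abs_ge_zero by blast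
 then show "f summable_on UNIV" by (simp add: summable_on_abs_iff)
 have "\<bar>infsum f UNIV\<bar> \<le> (\<Sum>\<^sub>\<infinity>k. \<bar>f k\<bar>)"
  using norm_infsum_bound[of f UNIV] * by simp
 also have "\<dots> \<le> infsum g UNIV"
  by (rule infsum_mono[OF * assms(1) assms(2)])
 finally show "\<bar>infsum f UNIV\<bar> \<le> infsum g UNIV" .
qed

text \<open>Unordered summability of reals is absolute summability, and bounded monotone partial
  sums are Cauchy. The right-hand side is a countable condition, hence measurable in a
  parameter.\<close>

lemma summable_on_iff_convergent_initial:
 fixes f :: "'k::countable \<Rightarrow> real"
 shows "f summable_on UNIV \<longleftrightarrow> Cauchy (%n. \<Sum>k\<in>initial n. \<bar>f k\<bar>)"
proof
 assume "f summable_on UNIV"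
 then have "(%k. \<bar>f k\<bar>) summable_on UNIV" by (simp add: summable_on_abs_iff)
 from infsum_LIMSEQ[OF this] show "Cauchy (%n. \<Sum>k\<in>initial n. \<bar>f k\<bar>)"
  using LIMSEQ_imp_Cauchy by blast
next
 assume "Cauchy (%n. \<Sum>k\<in>initial n. \<bar>f k\<bar>)"
 then have "Bseq (%n. \<Sum>k\<in>initial n. \<bar>f k\<bar>)" by (rule Cauchy_Bseq)
 then obtain C where C: "\<And>n. \<bar>\<Sum>k\<in>initial n. \<bar>f k\<bar>\<bar> \<le> C" unfolding Bseq_def by auto
 have "sum (%k. \<bar>f k\<bar>) A \<le> C" if A: "finite A" for A
 proof -
  obtain m where m: "\<forall>i\<in>to_nat ` A. i < m"
   using finite_nat_set_iff_bounded[of "to_nat ` A"] A by auto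
  then have "A \<subseteq> initial m" by (auto simp: initial_def)
  then have "sum (%k. \<bar>f k\<bar>) A \<le> sum (%k. \<bar>f k\<bar>) (initial m)"
   by (intro sum_mono2) auto
  then show ?thesis using C[of m] by auto
 qed
 from summable_on_nonneg_if_bounded(1)[OF _ this] show "f summable_on UNIV"
  by (simp add: summable_on_abs_iff)
qed

text \<open>Holds without any summability assumption: the points where the series is summable form a
  measurable set by the Cauchy criterion, and \<open>infsum\<close> takes its default value 0
  elsewhere.\<close>

lemma measurable_infsum_real [measurable (raw)]:
 fixes F :: "'k::countable \<Rightarrow> 'a \<Rightarrow> real"
 assumes [measurable]: "\<And>k. F k \<in> borel_measurable M"
 shows "(%x. \<Sum>\<^sub>\<infinity>k. F k x) \<in> borel_measurable M"
proof -
 have eq: "(\<Sum>\<^sub>\<infinity>k. F k x) =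
   (if Cauchy (%n. \<Sum>k\<in>initial n. \<bar>F k x\<bar>) then lim (%n. \<Sum>k\<in>initial n. F k x) else 0)" for x
  unfolding summable_on_iff_convergent_initial[symmetric]
  by (auto simp: infsum_not_exists dest!: infsum_LIMSEQ limI)
 have [measurable]: "Measurable.pred M (%x. Cauchy (%n. \<Sum>k\<in>initial n. \<bar>F k x\<bar>))"
  unfolding pred_def by (rule sets_Collect_Cauchy) measurable
 show ?thesis unfolding eq by measurable
qed

lemma measurable_infsum_banach:
 fixes F :: "'k::countable \<Rightarrow> 'a \<Rightarrow> 'b::{banach, second_countable_topology}"
 assumes [measurable]: "\<And>k. F k \<in> borel_measurable M"
 assumes "\<And>x. x \<in> space M \<Longrightarrow> (slice F x) summable_on UNIV"
 shows "(%x. \<Sum>\<^sub>\<infinity>k. F k x) \<in> borel_measurable M"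
 by (rule borel_measurable_LIMSEQ_metric[where f="%n x. \<Sum>k\<in>initial n. F k x"])
   (use infsum_LIMSEQ assms(2) in auto)

text \<open>Dominated convergence for the partial sums over \<open>initial n\<close>, all of which
  are bounded by the single majorant \<open>G\<close>. This is the tool by which sums over modes and
  time integrals are exchanged.\<close>

lemma infsum_integral_dominated:
 fixes F :: "'k::countable \<Rightarrow> 'a \<Rightarrow> real"
 assumes F [measurable]: "\<And>k. F k \<in> borel_measurable M"
  and dom: "AE x in M. (%k. \<bar>F k x\<bar>) summable_on UNIV \<and> (\<Sum>\<^sub>\<infinity>k. \<bar>F k x\<bar>) \<le> G x"
  and G: "integrable M G"
 shows "integrable M (F k)" "integrable M (%x. \<Sum>\<^sub>\<infinity>k. F k x)"
  "(%k. LINT x|M. \<bar>F k x\<bar>) summable_on UNIV"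
  "(\<Sum>\<^sub>\<infinity>k. LINT x|M. \<bar>F k x\<bar>) \<le> (LINT x|M. G x)"
  "((%k. LINT x|M. F k x) has_sum (LINT x|M. (\<Sum>\<^sub>\<infinity>k. F k x))) UNIV"
proof -
 have bd: "AE x in M. (\<Sum>k\<in>A. \<bar>F k x\<bar>) \<le> G x" if "finite A" for A
  using dom by eventually_elim (use finite_sum_le_infsum[OF _ that] in force)
 have int: "integrable M (F k)" for k
  by (rule bochner_integrable_bound[OF G])
    (use bd[of "{k}"] in \<open>auto elim!: eventually_mono\<close>)
 then show "integrable M (F k)" .
 have sA: "(\<Sum>k\<in>A. LINT x|M. \<bar>F k x\<bar>) \<le> (LINT x|M. G x)" if "finite A" for A
 proof -
  have "(\<Sum>k\<in>A. LINT x|M. \<bar>F k x\<bar>) = (LINT x|M. (\<Sum>k\<in>A. \<bar>F k x\<bar>))"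
   using int by (subst bochner_integral_sum) auto
  also have "\<dots> \<le> (LINT x|M. G x)"
   by (rule integral_mono_AE) (use G bd[OF that] int in auto)
  finally show ?thesis .
 qed
 show sm: "(%k. LINT x|M. \<bar>F k x\<bar>) summable_on UNIV"
  and "(\<Sum>\<^sub>\<infinity>k. LINT x|M. \<bar>F k x\<bar>) \<le> (LINT x|M. G x)"
  using summable_on_nonneg_if_bounded[OF _ sA] by auto
 have lim: "AE x in M. (%n. \<Sum>k\<in>initial n. F k x) \<longlonglongrightarrow> (\<Sum>\<^sub>\<infinity>k. F k x)"
  using dom by eventually_elim (rule infsum_LIMSEQ, simp add: summable_on_abs_iff)
 have bd2: "AE x in M. norm (\<Sum>k\<in>initial n. F k x) \<le> G x" for n
  using bd[OF finite_initial, of n]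
  by eventually_elim (use sum_abs in \<open>force intro: order_trans\<close>)
 show "integrable M (%x. \<Sum>\<^sub>\<infinity>k. F k x)"
  by (rule integrable_dominated_convergence[where s="%n x. \<Sum>k\<in>initial n. F k x" and w=G])
    (use G lim bd2 in auto)
 have "(%n. LINT x|M. (\<Sum>k\<in>initial n. F k x)) \<longlonglongrightarrow> (LINT x|M. (\<Sum>\<^sub>\<infinity>k. F k x))"
  by (rule integral_dominated_convergence[where w=G])
    (use G lim bd2 in auto)
 then have l1: "(%n. \<Sum>k\<in>initial n. LINT x|M. F k x) \<longlonglongrightarrow> (LINT x|M. (\<Sum>\<^sub>\<infinity>k. F k x))"
  using int by (subst (asm) bochner_integral_sum) auto
 have s2: "(%k. LINT x|M. F k x) summable_on UNIV"
  by (rule infsum_comparison(1)[OF sm]) simp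
 from infsum_LIMSEQ[OF this] l1 have "(LINT x|M. (\<Sum>\<^sub>\<infinity>k. F k x)) = (\<Sum>\<^sub>\<infinity>k. LINT x|M. F k x)"
  using LIMSEQ_unique by blast
 with s2 show "((%k. LINT x|M. F k x) has_sum (LINT x|M. (\<Sum>\<^sub>\<infinity>k. F k x))) UNIV"
  by simp
qed

lemma ennreal_sum_initial_SUP:
 fixes f :: "'k::countable \<Rightarrow> real"
 assumes "\<And>k. f k \<ge> 0" "(SUP n. ennreal (\<Sum>k\<in>initial n. f k)) \<noteq> \<infinity>"
 shows "f summable_on UNIV"
proof -
 from assms(2) obtain C where C: "(SUP n. ennreal (\<Sum>k\<in>initial n. f k)) = ennreal C" "C \<ge> 0"
  by (cases "(SUP n. ennreal (\<Sum>k\<in>initial n. f k))") auto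
 have b: "(\<Sum>k\<in>initial n. f k) \<le> C" for n
  using SUP_upper[of n UNIV "%n. ennreal (\<Sum>k\<in>initial n. f k)"] C
  by (simp add: ennreal_le_iff)
 show ?thesis
 proof (rule summable_on_nonneg_if_bounded(1)[where C=C])
  fix A :: "'k set" assume A: "finite A"
  obtain m where m: "\<forall>i\<in>to_nat ` A. i < m"
   using finite_nat_set_iff_bounded[of "to_nat ` A"] A by auto
  then have "A \<subseteq> initial m" by (auto simp: initial_def)
  then have "sum f A \<le> sum f (initial m)"
   by (intro sum_mono2) (use assms in auto)
  then show "sum f A \<le> C" using b[of m] by auto
 qed (rule assms)
qed

text \<open>Monotone convergence for the partial sums of absolute values: a finite integral of the
  supremum forces summability almost everywhere. It serves twice, for almost everywhere convergence
  in the Riesz-Fischer theorem and for the H_2 regularity of the solution.\<close>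

lemma infsum_integral_summable:
 fixes F :: "'k::countable \<Rightarrow> 'a \<Rightarrow> real"
 assumes F: "\<And>k. integrable M (F k)"
  and sm: "(%k. LINT x|M. \<bar>F k x\<bar>) summable_on UNIV"
 shows "AE x in M. (%k. \<bar>F k x\<bar>) summable_on UNIV"
  "integrable M (%x. \<Sum>\<^sub>\<infinity>k. \<bar>F k x\<bar>)"
proof -
 have [measurable]: "\<And>k. F k \<in> borel_measurable M" using F by auto
 define P where "P n x = (\<Sum>k\<in>initial n. \<bar>F k x\<bar>)" for n x
 define C where "C = (\<Sum>\<^sub>\<infinity>k. LINT x|M. \<bar>F k x\<bar>)"
 have Pm [measurable]: "P n \<in> borel_measurable M" for n unfolding P_def by measurable
 have inc: "incseq (%n x. ennreal (P n x))"
  unfolding incseq_def le_fun_def P_def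
  by (auto intro!: ennreal_leI sum_mono2 simp: initial_def)
    (use finite_initial[unfolded initial_def] in auto)
 have PI: "(\<integral>\<^sup>+x. ennreal (P n x) \<partial>M) \<le> ennreal C" for n
 proof -
  have "(\<integral>\<^sup>+x. ennreal (P n x) \<partial>M) = ennreal (LINT x|M. P n x)"
   by (rule nn_integral_eq_integral) (use F in \<open>auto simp: P_def intro!: sum_nonneg\<close>)
  also have "(LINT x|M. P n x) = (\<Sum>k\<in>initial n. LINT x|M. \<bar>F k x\<bar>)"
   unfolding P_def using F by (subst bochner_integral_sum) auto
  also have "\<dots> \<le> C" unfolding C_def
   by (rule finite_sum_le_infsum[OF sm]) auto
  finally show ?thesis by (simp add: ennreal_leI)
 qed
 have "(\<integral>\<^sup>+x. (SUP n. ennreal (P n x)) \<partial>M) = (SUP n. \<integral>\<^sup>+x. ennreal (P n x) \<partial>M)"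
  by (rule nn_integral_monotone_convergence_SUP[OF inc]) measurable
 also have "\<dots> \<le> ennreal C" by (rule SUP_least) (use PI in auto)
 finally have nn: "(\<integral>\<^sup>+x. (SUP n. ennreal (P n x)) \<partial>M) \<le> ennreal C" .
 then have "(\<integral>\<^sup>+x. (SUP n. ennreal (P n x)) \<partial>M) \<noteq> \<infinity>"
  using ennreal_less_top[of C] by (auto simp: top_unique)
 from nn_integral_PInf_AE[OF _ this]
 have "AE x in M. (SUP n. ennreal (P n x)) \<noteq> \<infinity>" by measurable
 then show ae: "AE x in M. (%k. \<bar>F k x\<bar>) summable_on UNIV"
  by eventually_elim (rule ennreal_sum_initial_SUP, auto simp: P_def)
 have "(\<integral>\<^sup>+x. ennreal (\<Sum>\<^sub>\<infinity>k. \<bar>F k x\<bar>) \<partial>M) \<le> (\<integral>\<^sup>+x. (SUP n. ennreal (P n x)) \<partial>M)"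
 proof (rule nn_integral_mono_AE)
  show "AE x in M. ennreal (\<Sum>\<^sub>\<infinity>k. \<bar>F k x\<bar>) \<le> (SUP n. ennreal (P n x))"
   using ae
  proof eventually_elim
   case (elim x)
   from tendsto_ennrealI[OF infsum_LIMSEQ[OF elim]]
   have "(%n. ennreal (P n x)) \<longlonglongrightarrow> ennreal (\<Sum>\<^sub>\<infinity>k. \<bar>F k x\<bar>)" unfolding P_def .
   then show ?case
    by (rule LIMSEQ_le_const2) (auto intro!: SUP_upper)
  qed
 qed
 also note nn
 finally have fin: "(\<integral>\<^sup>+x. ennreal (\<Sum>\<^sub>\<infinity>k. \<bar>F k x\<bar>) \<partial>M) < \<infinity>"
  by (rule order.strict_trans1) simp
 show "integrable M (%x. \<Sum>\<^sub>\<infinity>k. \<bar>F k x\<bar>)"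
  by (rule integrableI_nonneg) (use fin in \<open>auto intro!: infsum_nonneg AE_I2\<close>)
qed

text \<open>Dominated convergence for sums along an arbitrary filter. The generality is used:
  continuity in time needs the filter \<open>at t within {0..T}\<close>, approximation by simple
  functions needs sequences.\<close>

lemma infsum_tannery:
 fixes f :: "'i \<Rightarrow> 'k \<Rightarrow> real"
 assumes lim: "\<And>k. ((slice f k) \<longlongrightarrow> g k) F"
  and bd: "eventually (%i. \<forall>k. \<bar>f i k\<bar> \<le> B k) F"
  and B: "B summable_on UNIV" and nt: "F \<noteq> bot"
 shows "((%i. \<Sum>\<^sub>\<infinity>k. f i k) \<longlongrightarrow> (\<Sum>\<^sub>\<infinity>k. g k)) F"
proof (rule tendstoI)
 fix e :: real assume e: "e > 0"
 have gB: "\<bar>g k\<bar> \<le> B k" for k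
  by (rule tendsto_upperbound[OF tendsto_rabs[OF lim] _ nt])
    (use bd in \<open>auto elim!: eventually_mono\<close>)
 \<comment> \<open>Outside \<open>A\<close> the majorant has mass at most e/6, which bounds the
   tails of \<open>f i\<close> and of \<open>g\<close> alike; with the error on \<open>A\<close>
   itself the total stays at e/2.\<close>
 obtain A where A: "finite A" "dist (sum B A) (infsum B UNIV) \<le> e/6"
  using has_sum_finite_approximation[OF has_sum_infsum[OF B], of "e/6"] e by auto
 have split: "infsum h UNIV = sum h A + infsum h (-A) \<and> \<bar>infsum h (-A)\<bar> \<le> e/6"
  if h: "\<And>k. \<bar>h k\<bar> \<le> B k" for h
 proof -
  have hs: "h summable_on X" "(%k. \<bar>h k\<bar>) summable_on X" "B summable_on X" for X
   using infsum_comparison[OF B, of h] h B by (auto intro: summable_on_subset_banach)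
  have sp: "infsum h UNIV = sum h A + infsum h (-A)" if "h summable_on A" "h summable_on -A" for h :: "_ \<Rightarrow> real"
   using infsum_Un_disjoint[OF that] A(1) by simp
  have "\<bar>infsum h (-A)\<bar> \<le> (\<Sum>\<^sub>\<infinity>k\<in>-A. \<bar>h k\<bar>)"
   using norm_infsum_bound[of h "-A"] hs by simp
  also have "\<dots> \<le> infsum B (-A)" by (rule infsum_mono) (use hs h in auto)
  also have "\<dots> \<le> e/6" using A(2) sp[of B] hs by (simp add: dist_real_def)
  finally show ?thesis using sp[of h] hs by auto
 qed
 have "((%i. sum (f i) A) \<longlongrightarrow> sum g A) F" by (intro tendsto_sum lim)
 then have "eventually (%i. dist (sum (f i) A) (sum g A) < e/6) F"
  using e by (intro tendstoD) auto
 then show "eventually (%i. dist (\<Sum>\<^sub>\<infinity>k. f i k) (\<Sum>\<^sub>\<infinity>k. g k) < e) F"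
  using bd
 proof eventually_elim
  case (elim i)
  have "infsum (f i) UNIV = sum (f i) A + infsum (f i) (-A) \<and> \<bar>infsum (f i) (-A)\<bar> \<le> e/6"
   by (rule split) (use elim in blast)
  moreover have "infsum g UNIV = sum g A + infsum g (-A) \<and> \<bar>infsum g (-A)\<bar> \<le> e/6"
   by (rule split) (rule gB)
  ultimately show ?case using elim(1) e unfolding dist_real_def by linarith
 qed
qed

section \<open>Square summable families: Minkowski, Cauchy-Schwarz, limits\<close>

definition ell2 :: "('k \<Rightarrow> 'a::real_normed_vector) \<Rightarrow> bool" where
 "ell2 c \<longleftrightarrow> (%k. (norm (c k))^2) summable_on UNIV"

text \<open>For a family that is not square summable the value is 0, by the convention for
  \<open>infsum\<close>. A bound on \<open>ell2_norm\<close> is therefore informative only together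
  with \<open>ell2\<close>.\<close>

definition ell2_norm :: "('k \<Rightarrow> 'a::real_normed_vector) \<Rightarrow> real" where
 "ell2_norm c = sqrt (\<Sum>\<^sub>\<infinity>k. (norm (c k))^2)"

lemma ell2_norm_nonneg [simp]: "ell2_norm c \<ge> 0"
 unfolding ell2_norm_def by (auto intro!: infsum_nonneg)

lemma ell2_norm_square: "(ell2_norm c)^2 = (\<Sum>\<^sub>\<infinity>k. (norm (c k))^2)"
 unfolding ell2_norm_def by (auto intro!: real_sqrt_pow2 infsum_nonneg)

lemma ell2_finite_sum_le:
 assumes "ell2 c" "finite A"
 shows "(\<Sum>k\<in>A. (norm (c k))^2) \<le> (ell2_norm c)^2"
 unfolding ell2_norm_square by (rule finite_sum_le_infsum) (use assms in \<open>auto simp: ell2_def\<close>)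

lemma ell2_L2_set_le: "ell2 c \<Longrightarrow> finite A \<Longrightarrow> L2_set (%k. norm (c k)) A \<le> ell2_norm c"
 unfolding L2_set_def by (rule real_le_lsqrt) (auto intro: ell2_finite_sum_le sum_nonneg)

text \<open>Reduces the infinite case to finite index sets, so that Minkowski's inequality and lower
  semicontinuity below are inherited from \<open>L2_set\<close>.\<close>

lemma ell2_bounded:
 assumes "\<And>A. finite A \<Longrightarrow> L2_set (%k. norm (c k)) A \<le> C"
 shows "ell2 c" "ell2_norm c \<le> C"
proof -
 have C: "C \<ge> 0" using assms[of "{}"] by simp
 have b: "(\<Sum>k\<in>A. (norm (c k))^2) \<le> C^2" if "finite A" for A
  using power_mono[OF assms[OF that], of 2] by (simp add: L2_set_def sum_nonneg)
 from summable_on_nonneg_if_bounded[OF _ b]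
 show "ell2 c" "ell2_norm c \<le> C"
  using C by (auto simp: ell2_def ell2_norm_def intro!: real_le_lsqrt infsum_nonneg)
qed

lemma ell2_component_le: "ell2 c \<Longrightarrow> norm (c k) \<le> ell2_norm c"
 using ell2_L2_set_le[of c "{k}"] by simp

lemma ell2_mono:
 assumes "ell2 d" "\<And>k. norm (c k) \<le> norm (d k)"
 shows "ell2 c" "ell2_norm c \<le> ell2_norm d"
proof -
 have "L2_set (%k. norm (c k)) A \<le> ell2_norm d" if "finite A" for A
  using L2_set_mono[of A "%k. norm (c k)" "%k. norm (d k)"] assms ell2_L2_set_le[OF assms(1) that] by force
 from ell2_bounded[OF this] show "ell2 c" "ell2_norm c \<le> ell2_norm d" 
  by auto
qed

lemma ell2_add:
 assumes "ell2 c" "ell2 d"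
 shows "ell2 (%k. c k + d k)" "ell2_norm (%k. c k + d k) \<le> ell2_norm c + ell2_norm d"
proof -
 have "L2_set (%k. norm (c k + d k)) A \<le> ell2_norm c + ell2_norm d" if "finite A" for A
 proof -
  have "L2_set (%k. norm (c k + d k)) A \<le> L2_set (%k. norm (c k) + norm (d k)) A"
   by (intro L2_set_mono) (auto intro: norm_triangle_ineq)
  also have "\<dots> \<le> L2_set (%k. norm (c k)) A + L2_set (%k. norm (d k)) A" by (rule L2_set_triangle_ineq)
  finally show ?thesis using ell2_L2_set_le[OF assms(1) that] ell2_L2_set_le[OF assms(2) that] by auto
 qed
 from ell2_bounded[OF this] show "ell2 (%k. c k + d k)" "ell2_norm (%k. c k + d k) \<le> ell2_norm c + ell2_norm d"
  by auto
qed

lemma ell2_uminus [simp]: "ell2 (%k. - c k) = ell2 c" "ell2_norm (%k. - c k) = ell2_norm c"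
 by (simp_all add: ell2_def ell2_norm_def)

lemma ell2_minus_commute: "ell2_norm (%k. c k - d k) = ell2_norm (%k. d k - c k)"
 by (simp add: ell2_norm_def norm_minus_commute)

lemma ell2_diff:
 assumes "ell2 c" "ell2 d"
 shows "ell2 (%k. c k - d k)" "ell2_norm (%k. c k - d k) \<le> ell2_norm c + ell2_norm d"
 using ell2_add[of c "%k. - d k"] assms by simp_all

lemma ell2_scaleR:
 shows "ell2 c \<Longrightarrow> ell2 (%k. r *\<^sub>R c k)" "ell2_norm (%k. r *\<^sub>R c k) = \<bar>r\<bar> * ell2_norm c"
 by (auto simp: ell2_def ell2_norm_def power_mult_distrib infsum_cmult_right' real_sqrt_mult
   intro: summable_on_cmult_right)

lemma ell2_zero [simp]: "ell2 (%k. 0)" "ell2_norm (%k. 0) = 0"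
 by (auto simp: ell2_def ell2_norm_def)

lemma ell2_Cauchy_Schwarz:
 assumes "ell2 c" "ell2 d"
 shows "(%k. norm (c k) * norm (d k)) summable_on UNIV"
  "(\<Sum>\<^sub>\<infinity>k. norm (c k) * norm (d k)) \<le> ell2_norm c * ell2_norm d"
proof -
 have "(\<Sum>k\<in>A. norm (c k) * norm (d k)) \<le> ell2_norm c * ell2_norm d" if A: "finite A" for A
 proof -
  have "(\<Sum>k\<in>A. norm (c k) * norm (d k)) \<le> L2_set (%k. norm (c k)) A * L2_set (%k. norm (d k)) A"
   using L2_set_mult_ineq[of "%k. norm (c k)" "%k. norm (d k)" A] by simp
  also have "\<dots> \<le> ell2_norm c * ell2_norm d"
   by (intro mult_mono ell2_L2_set_le assms A) auto
  finally show ?thesis .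
 qed
 then show "(%k. norm (c k) * norm (d k)) summable_on UNIV"
  "(\<Sum>\<^sub>\<infinity>k. norm (c k) * norm (d k)) \<le> ell2_norm c * ell2_norm d"
  using summable_on_nonneg_if_bounded[of "%k. norm (c k) * norm (d k)"] by auto
qed

lemma ell2_inner:
 fixes c d :: "'k \<Rightarrow> 'a::real_inner"
 assumes "ell2 c" "ell2 d"
 shows "(%k. \<bar>c k \<bullet> d k\<bar>) summable_on UNIV" "(%k. c k \<bullet> d k) summable_on UNIV"
  "(\<Sum>\<^sub>\<infinity>k. \<bar>c k \<bullet> d k\<bar>) \<le> ell2_norm c * ell2_norm d"
proof -
 note * = infsum_comparison[OF ell2_Cauchy_Schwarz(1)[OF assms], of "%k. c k \<bullet> d k"]
 show "(%k. \<bar>c k \<bullet> d k\<bar>) summable_on UNIV" "(%k. c k \<bullet> d k) summable_on UNIV"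
  using * Cauchy_Schwarz_ineq2 by blast+
 have "(\<Sum>\<^sub>\<infinity>k. \<bar>c k \<bullet> d k\<bar>) \<le> (\<Sum>\<^sub>\<infinity>k. norm (c k) * norm (d k))"
  using infsum_comparison(2)[OF ell2_Cauchy_Schwarz(1)[OF assms], of "%k. \<bar>c k \<bullet> d k\<bar>"] Cauchy_Schwarz_ineq2
  by force
 then show "(\<Sum>\<^sub>\<infinity>k. \<bar>c k \<bullet> d k\<bar>) \<le> ell2_norm c * ell2_norm d"
  using ell2_Cauchy_Schwarz(2)[OF assms] by linarith
qed

text \<open>Lower semicontinuity of the norm under componentwise limits: on each finite set of
  indices the bound passes to the limit.\<close>

lemma ell2_limit:
 assumes lim: "\<And>k. (slice c k) \<longlonglongrightarrow> d k"
  and bd: "\<And>n. n \<ge> N \<Longrightarrow> ell2 (c n)" "\<And>n. n \<ge> N \<Longrightarrow> ell2_norm (c n) \<le> C"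
 shows "ell2 d" "ell2_norm d \<le> C"
proof -
 have "L2_set (%k. norm (d k)) A \<le> C" if A: "finite A" for A
 proof (rule LIMSEQ_le_const2)
  show "(%n. L2_set (%k. norm (c n k)) A) \<longlonglongrightarrow> L2_set (%k. norm (d k)) A"
   unfolding L2_set_def by (intro tendsto_intros lim)
  show "\<exists>N. \<forall>n\<ge>N. L2_set (%k. norm (c n k)) A \<le> C"
   using ell2_L2_set_le[OF bd(1) A] bd(2) by (intro exI[of _ N]) force
 qed
 from ell2_bounded[OF this] show "ell2 d" "ell2_norm d \<le> C" 
  by auto
qed

section \<open>Linear evolution equations\<close>

text \<open>The gauge integral supplies the splitting of intervals and the fundamental theorem of
  calculus, integration over \<open>lebesgue_on\<close> supplies dominated convergence; this bridge
  makes both available.\<close>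

lemma lebesgue_on_eq_integral:
 fixes h :: "real \<Rightarrow> 'a::euclidean_space"
 assumes "integrable (Leb T) h" "0 \<le> s" "t \<le> T"
 shows "integrable (lebesgue_on {s..t}) h" "h integrable_on {s..t}"
  "(LINT r|lebesgue_on {s..t}. h r) = integral {s..t} h"
proof -
 show i: "integrable (lebesgue_on {s..t}) h"
  by (rule integrable_subinterval[OF assms(1)]) (use assms in auto)
 show "h integrable_on {s..t}" using integrable_on_lebesgue_on[OF i] by auto
 show "(LINT r|lebesgue_on {s..t}. h r) = integral {s..t} h"
  using lebesgue_integral_eq_integral[OF i] by auto
qed

lemma lebesgue_on_integral_diff:
 fixes h :: "real \<Rightarrow> 'a::euclidean_space"
 assumes h: "integrable (Leb T) h" and "0 \<le> s" "s \<le> t" "t \<le> T"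
 shows "(LINT r|Leb t. h r) - (LINT r|Leb s. h r) = (LINT r|lebesgue_on {s..t}. h r)"
proof -
 have "integral {0..s} h + integral {s..t} h = integral {0..t} h"
  by (rule Henstock_Kurzweil_Integration.integral_combine)
    (use assms lebesgue_on_eq_integral(2)[OF h, of 0 t] in auto)
 then show ?thesis
  using assms lebesgue_on_eq_integral(3)[OF h, of 0 t] lebesgue_on_eq_integral(3)[OF h, of 0 s]
   lebesgue_on_eq_integral(3)[OF h, of s t] by (simp add: algebra_simps)
qed

lemma lebesgue_on_integral_continuous:
 fixes h :: "real \<Rightarrow> 'a::euclidean_space"
 assumes h: "integrable (Leb T) h"
 shows "continuous_on {0..T} (%t. LINT r|Leb t. h r)"
proof (cases "0 \<le> T")
 case True
 have "continuous_on {0..T} (%t. integral {0..t} h)"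
  by (rule indefinite_integral_continuous_1) (rule lebesgue_on_eq_integral(2)[OF h], use True in auto)
 then show ?thesis
  by (rule continuous_on_eq) (use lebesgue_on_eq_integral(3)[OF h] in auto)
qed auto

lemma borel_measurable_lebesgue_on_subset:
 assumes "h \<in> borel_measurable (Leb T)" "0 \<le> s" "t \<le> (T::real)"
 shows "h \<in> borel_measurable (lebesgue_on {s..t})"
 by (rule measurable_restrict_mono[OF assms(1)]) (use assms in auto)

lemma continuous_borel_measurable_lebesgue_on:
 fixes z :: "real \<Rightarrow> 'a::euclidean_space"
 shows "continuous_on {a..b} z \<Longrightarrow> z \<in> borel_measurable (lebesgue_on {a..b})"
 by (rule continuous_imp_measurable_on_sets_lebesgue) auto

lemma integrable_inner_continuous:
 fixes h z :: "real \<Rightarrow> 'a::euclidean_space"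
 assumes h: "integrable (lebesgue_on {a..b}) h" and z: "continuous_on {a..b} z"
 shows "integrable (lebesgue_on {a..b}) (%s. h s \<bullet> z s)"
proof -
 have "bounded (z ` {a..b})" using compact_continuous_image[OF z] by (simp add: compact_imp_bounded)
 then obtain B where B: "\<And>s. s \<in> {a..b} \<Longrightarrow> norm (z s) \<le> B" unfolding bounded_iff by blast
 have [measurable]: "z \<in> borel_measurable (lebesgue_on {a..b})" "h \<in> borel_measurable (lebesgue_on {a..b})"
  using h continuous_borel_measurable_lebesgue_on[OF z] by auto
 show ?thesis
 proof (rule bochner_integrable_bound)
  show "integrable (lebesgue_on {a..b}) (%s. norm (h s) * B)" using h by auto
  show "AE s in lebesgue_on {a..b}. norm (h s \<bullet> z s) \<le> norm (norm (h s) * B)"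
  proof (rule AE_I2)
   fix s assume "s \<in> space (lebesgue_on {a..b})"
   then have b: "norm (z s) \<le> B" by (intro B) simp
   have "norm (h s \<bullet> z s) \<le> norm (h s) * norm (z s)" by (simp add: Cauchy_Schwarz_ineq2)
   also have "\<dots> \<le> norm (h s) * B" by (intro mult_left_mono b) simp
   finally show "norm (h s \<bullet> z s) \<le> norm (norm (h s) * B)" by simp
  qed
 qed measurable
qed

text \<open>Telescoping over a partition of mesh below \<open>d\<close> bounds the total change by e
  times the total change of \<open>H\<close>, for every e. Applied to the defect of an integration
  formula, it replaces differentiation almost everywhere.\<close>

lemma eq_initial_value_if_increment_small:
 fixes Q H :: "real \<Rightarrow> real"
 assumes sm: "\<And>e. e > 0 \<Longrightarrow> \<exists>d>0. \<forall>s t. 0 \<le> s \<longrightarrow> s \<le> t \<longrightarrow> t \<le> T \<longrightarrow> t - s < d \<longrightarrow> \<bar>Q t - Q s\<bar> \<le> e * (H t - H s)"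
  and t: "0 \<le> t" "t \<le> T" and H: "H 0 \<le> H t"
 shows "Q t = Q 0"
proof -
 have "\<bar>Q t - Q 0\<bar> \<le> e * (H t - H 0)" if e: "e > 0" for e
 proof -
  obtain d where d: "d > 0" "\<And>s t. 0 \<le> s \<Longrightarrow> s \<le> t \<Longrightarrow> t \<le> T \<Longrightarrow> t - s < d \<Longrightarrow> \<bar>Q t - Q s\<bar> \<le> e * (H t - H s)"
   using sm[OF e] by metis
  obtain n :: nat where n: "real n > t / d" using reals_Archimedean2 by blast
  have n0: "real n > 0" using n t d by (meson divide_nonneg_pos le_less_trans)
  then have tn: "t / n < d" using n d by (simp add: field_simps)
  define p where "p i = t * real i / real n" for i
  have p: "p 0 = 0" "p n = t" "\<And>i. p (Suc i) - p i = t / n"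
   using n0 by (auto simp: p_def field_simps)
  have "\<bar>Q (p (Suc i)) - Q (p i)\<bar> \<le> e * (H (p (Suc i)) - H (p i))" if "i < n" for i
  proof (rule d(2))
   show "0 \<le> p i" using t n0 by (simp add: p_def)
   show "p i \<le> p (Suc i)" "p (Suc i) - p i < d" using p(3)[of i] divide_nonneg_pos[of t "real n"] t n0 tn by linarith+
   have "real (Suc i) \<le> real n" using that by (metis Suc_leI of_nat_le_iff)
   then have "t * real (Suc i) \<le> t * real n" by (rule mult_left_mono) (rule t)
   then have "p (Suc i) \<le> t" unfolding p_def pos_divide_le_eq[OF n0] .
   then show "p (Suc i) \<le> T" using t by simp
  qed
  then have "\<bar>\<Sum>i<n. Q (p (Suc i)) - Q (p i)\<bar> \<le> (\<Sum>i<n. e * (H (p (Suc i)) - H (p i)))"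
   by (intro order_trans[OF sum_abs] sum_mono) auto
  also have "\<dots> = e * (H t - H 0)"
   using sum_lessThan_telescope[of "%i. H (p i)" n] by (simp add: sum_distrib_left[symmetric] p)
  finally show ?thesis using sum_lessThan_telescope[of "%i. Q (p i)" n] by (simp add: p)
 qed
 then have *: "\<bar>Q t - Q 0\<bar> \<le> e * (H t - H 0)" if "e > 0" for e using that by blast
 have "\<bar>Q t - Q 0\<bar> \<le> 0"
 proof (rule field_le_epsilon)
  fix e :: real assume e: "e > 0"
  show "\<bar>Q t - Q 0\<bar> \<le> 0 + e"
  proof (cases "H t - H 0 = 0")
   case True then show ?thesis using *[of 1] e by simp
  next
   case False then show ?thesis using *[of "e / (H t - H 0)"] e H by simp
  qed
 qed
 then show ?thesis by simp
qed

lemma abs_inner_integral_le: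
 fixes h z :: "real \<Rightarrow> 'a::euclidean_space"
 assumes h: "integrable (lebesgue_on {s..t}) h" and z: "continuous_on {s..t} z"
  and B: "\<And>r. r \<in> {s..t} \<Longrightarrow> norm (z r) \<le> B"
 shows "\<bar>LINT r|lebesgue_on {s..t}. h r \<bullet> z r\<bar> \<le> B * (LINT r|lebesgue_on {s..t}. norm (h r))"
proof -
 have "\<bar>LINT r|lebesgue_on {s..t}. h r \<bullet> z r\<bar> \<le> (LINT r|lebesgue_on {s..t}. \<bar>h r \<bullet> z r\<bar>)"
  using integral_abs_bound by blast
 also have "\<dots> \<le> (LINT r|lebesgue_on {s..t}. B * norm (h r))"
 proof (rule integral_mono)
  fix r assume "r \<in> space (lebesgue_on {s..t})"
  then have b: "norm (z r) \<le> B" by (intro B) simp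
  have "\<bar>h r \<bullet> z r\<bar> \<le> norm (h r) * norm (z r)" by (simp add: Cauchy_Schwarz_ineq2)
  also have "\<dots> \<le> norm (h r) * B" by (intro mult_left_mono b) simp
  finally show "\<bar>h r \<bullet> z r\<bar> \<le> B * norm (h r)" by (simp add: mult.commute)
 qed (use integrable_inner_continuous[OF h z] h in auto)
 finally show ?thesis by simp
qed

text \<open>Integration by parts for primitives of merely integrable functions. The defect
  \<open>Q\<close> of the formula changes over a short interval by at most e times the integral of
  |h| + |k|, because \<open>y\<close> and \<open>z\<close> are uniformly continuous.\<close>

lemma integral_product_rule:
 fixes y z h k :: "real \<Rightarrow> 'a::euclidean_space"
 assumes h: "integrable (Leb T) h" and k: "integrable (Leb T) k"
  and y: "\<And>t. t \<in> {0..T} \<Longrightarrow> y t = y 0 + (LINT s|Leb t. h s)"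
  and z: "\<And>t. t \<in> {0..T} \<Longrightarrow> z t = z 0 + (LINT s|Leb t. k s)"
  and t: "t \<in> {0..T}"
 shows "y t \<bullet> z t = y 0 \<bullet> z 0 + (LINT s|Leb t. h s \<bullet> z s + k s \<bullet> y s)"
proof -
 have cy: "continuous_on {0..T} y"
  by (rule continuous_on_eq[OF continuous_on_add[OF continuous_on_const lebesgue_on_integral_continuous[OF h]]])
    (rule y[symmetric])
 have cz: "continuous_on {0..T} z"
  by (rule continuous_on_eq[OF continuous_on_add[OF continuous_on_const lebesgue_on_integral_continuous[OF k]]])
    (rule z[symmetric])
 define u where "u s = h s \<bullet> z s + k s \<bullet> y s" for s
 have u: "integrable (Leb T) u"
  unfolding u_def by (intro bochner_integrable_add integrable_inner_continuous h k cy cz)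
 define m where "m s = norm (h s) + norm (k s)" for s
 have m: "integrable (Leb T) m" unfolding m_def using h k by auto
 define Q where "Q t = y t \<bullet> z t - (LINT s|Leb t. u s)" for t
 define H where "H t = (LINT s|Leb t. m s)" for t
 have "Q t = Q 0"
 proof (rule eq_initial_value_if_increment_small[where H=H])
  fix e :: real assume e: "e > 0"
  have "uniformly_continuous_on {0..T} y" "uniformly_continuous_on {0..T} z"
   using cy cz compact_uniformly_continuous by auto
  then obtain d1 d2 where d: "d1 > 0" "d2 > 0"
   "\<And>a b. a \<in> {0..T} \<Longrightarrow> b \<in> {0..T} \<Longrightarrow> dist a b < d1 \<Longrightarrow> dist (y a) (y b) < e"
   "\<And>a b. a \<in> {0..T} \<Longrightarrow> b \<in> {0..T} \<Longrightarrow> dist a b < d2 \<Longrightarrow> dist (z a) (z b) < e"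
   using e unfolding uniformly_continuous_on_def by metis
  have "\<bar>Q b - Q a\<bar> \<le> e * (H b - H a)" if ab: "0 \<le> a" "a \<le> b" "b \<le> T" "b - a < min d1 d2" for a b
  proof -
   have ih: "integrable (lebesgue_on {a..b}) h" "integrable (lebesgue_on {a..b}) k"
    using lebesgue_on_eq_integral(1) h k ab by blast+
   have c: "continuous_on {a..b} y" "continuous_on {a..b} z"
    using cy cz ab by (auto elim: continuous_on_subset)
   have dy: "y b - y a = (LINT r|lebesgue_on {a..b}. h r)"
    using y[of a] y[of b] lebesgue_on_integral_diff[OF h ab(1-3)] ab by simp
   have dz: "z b - z a = (LINT r|lebesgue_on {a..b}. k r)"
    using z[of a] z[of b] lebesgue_on_integral_diff[OF k ab(1-3)] ab by simp
   have "y b \<bullet> z b - y a \<bullet> z a = (y b - y a) \<bullet> z b + (z b - z a) \<bullet> y a"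
    by (simp add: inner_diff_left inner_diff_right inner_commute)
   also have "\<dots> = (LINT r|lebesgue_on {a..b}. h r \<bullet> z b) + (LINT r|lebesgue_on {a..b}. k r \<bullet> y a)"
    unfolding dy dz using ih by simp
   finally have "Q b - Q a = (LINT r|lebesgue_on {a..b}. h r \<bullet> z b) + (LINT r|lebesgue_on {a..b}. k r \<bullet> y a)
     - (LINT r|lebesgue_on {a..b}. u r)"
    unfolding Q_def using lebesgue_on_integral_diff[OF u ab(1-3)] by simp
   also have "(LINT r|lebesgue_on {a..b}. u r) = (LINT r|lebesgue_on {a..b}. h r \<bullet> z r) + (LINT r|lebesgue_on {a..b}. k r \<bullet> y r)"
    unfolding u_def by (intro bochner_integral_add integrable_inner_continuous ih c)
   finally have "Q b - Q a = ((LINT r|lebesgue_on {a..b}. h r \<bullet> z b) - (LINT r|lebesgue_on {a..b}. h r \<bullet> z r))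
     + ((LINT r|lebesgue_on {a..b}. k r \<bullet> y a) - (LINT r|lebesgue_on {a..b}. k r \<bullet> y r))"
    by simp
   also have "(LINT r|lebesgue_on {a..b}. h r \<bullet> z b) - (LINT r|lebesgue_on {a..b}. h r \<bullet> z r)
     = (LINT r|lebesgue_on {a..b}. h r \<bullet> (z b - z r))"
    by (subst bochner_integral_diff[symmetric])
      (auto intro!: integrable_inner_continuous ih c simp: inner_diff_right)
   also have "(LINT r|lebesgue_on {a..b}. k r \<bullet> y a) - (LINT r|lebesgue_on {a..b}. k r \<bullet> y r)
     = (LINT r|lebesgue_on {a..b}. k r \<bullet> (y a - y r))"
    by (subst bochner_integral_diff[symmetric])
      (auto intro!: integrable_inner_continuous ih c simp: inner_diff_right)
   finally have "\<bar>Q b - Q a\<bar> \<le> \<bar>LINT r|lebesgue_on {a..b}. h r \<bullet> (z b - z r)\<bar> + \<bar>LINT r|lebesgue_on {a..b}. k r \<bullet> (y a - y r)\<bar>"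
    by simp
   also have "\<bar>LINT r|lebesgue_on {a..b}. h r \<bullet> (z b - z r)\<bar> \<le> e * (LINT r|lebesgue_on {a..b}. norm (h r))"
   proof (rule abs_inner_integral_le)
    fix r assume r: "r \<in> {a..b}"
    show "norm (z b - z r) \<le> e"
     using d(4)[of b r] r ab by (simp add: dist_norm)
   qed (intro ih continuous_intros c)+
   also have "\<bar>LINT r|lebesgue_on {a..b}. k r \<bullet> (y a - y r)\<bar> \<le> e * (LINT r|lebesgue_on {a..b}. norm (k r))"
   proof (rule abs_inner_integral_le)
    fix r assume r: "r \<in> {a..b}"
    show "norm (y a - y r) \<le> e"
     using d(3)[of a r] r ab by (simp add: dist_norm)
   qed (intro ih continuous_intros c)+
   also have "e * (LINT r|lebesgue_on {a..b}. norm (h r)) + e * (LINT r|lebesgue_on {a..b}. norm (k r))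
     = e * (LINT r|lebesgue_on {a..b}. m r)"
    unfolding m_def using ih by (subst bochner_integral_add) (auto simp: distrib_left)
   also have "(LINT r|lebesgue_on {a..b}. m r) = H b - H a"
    unfolding H_def using lebesgue_on_integral_diff[OF m ab(1-3)] by simp
   finally show ?thesis by simp
  qed
  then show "\<exists>d>0. \<forall>s t. 0 \<le> s \<longrightarrow> s \<le> t \<longrightarrow> t \<le> T \<longrightarrow> t - s < d \<longrightarrow> \<bar>Q t - Q s\<bar> \<le> e * (H t - H s)"
   using d by (intro exI[of _ "min d1 d2"]) auto
 next
  have "H t - H 0 = (LINT r|Leb t. m r)"
   unfolding H_def by (rule lebesgue_on_integral_diff[OF m]) (use t in auto)
  also have "\<dots> \<ge> 0" unfolding m_def by (intro bochner_integral_nonneg) auto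
  finally show "H 0 \<le> H t" by simp
 qed (use t in auto)
 moreover have "(LINT s|Leb 0. u s) = 0"
  using lebesgue_on_eq_integral(3)[OF u, of 0 0] t by auto
 ultimately show ?thesis unfolding Q_def u_def by simp
qed

text \<open>The integral form of y' = h - \<mu> y. Since \<open>h\<close> is only integrable in
  time, the equation has no pointwise meaning at every time.\<close>

definition linear_evolution :: "real \<Rightarrow> real \<Rightarrow> (real \<Rightarrow> 'a::euclidean_space) \<Rightarrow> (real \<Rightarrow> 'a) \<Rightarrow> bool" where
 "linear_evolution T \<mu> h y \<longleftrightarrow> integrable (Leb T) h \<and> continuous_on {0..T} y \<and>
   (\<forall>t\<in>{0..T}. y t = y 0 + (LINT s|Leb t. h s - \<mu> *\<^sub>R y s))"

lemma linear_evolutionD: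
 assumes "linear_evolution T \<mu> h y"
 shows "integrable (Leb T) h" "continuous_on {0..T} y"
  "\<And>t. t \<in> {0..T} \<Longrightarrow> y t = y 0 + (LINT s|Leb t. h s - \<mu> *\<^sub>R y s)"
 using assms unfolding linear_evolution_def by blast+

lemma linear_evolution_diff:
 assumes a: "linear_evolution T \<mu> h y" and b: "linear_evolution T \<mu> k z"
 shows "linear_evolution T \<mu> (%s. h s - k s) (%s. y s - z s)"
 unfolding linear_evolution_def
proof (intro conjI ballI)
 note a' = linear_evolutionD[OF a] and b' = linear_evolutionD[OF b]
 show "integrable (Leb T) (%s. h s - k s)" "continuous_on {0..T} (%s. y s - z s)"
  using a'(1,2) b'(1,2) by (auto intro: continuous_intros)
 fix t assume t: "t \<in> {0..T}"
 have i: "integrable (Leb t) h" "integrable (Leb t) k"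
  "integrable (Leb t) y" "integrable (Leb t) z"
  using t lebesgue_on_eq_integral(1)[OF a'(1), of 0 t] lebesgue_on_eq_integral(1)[OF b'(1), of 0 t]
   lebesgue_on_eq_integral(1)[OF continuous_imp_integrable_real[OF a'(2)], of 0 t]
   lebesgue_on_eq_integral(1)[OF continuous_imp_integrable_real[OF b'(2)], of 0 t] by simp_all
 have "y t - z t = (y 0 + (LINT s|Leb t. h s - \<mu> *\<^sub>R y s)) - (z 0 + (LINT s|Leb t. k s - \<mu> *\<^sub>R z s))"
  using a'(3)[OF t] b'(3)[OF t] by argo
 also have "\<dots> = y 0 - z 0 + ((LINT s|Leb t. h s - \<mu> *\<^sub>R y s) - (LINT s|Leb t. k s - \<mu> *\<^sub>R z s))"
  by simp
 also have "(LINT s|Leb t. h s - \<mu> *\<^sub>R y s) - (LINT s|Leb t. k s - \<mu> *\<^sub>R z s)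
   = (LINT s|Leb t. (h s - k s) - \<mu> *\<^sub>R (y s - z s))"
  using i by (subst bochner_integral_diff[symmetric]) (auto simp: algebra_simps)
 finally show "y t - z t = y 0 - z 0 + (LINT s|Leb t. (h s - k s) - \<mu> *\<^sub>R (y s - z s))" .
qed

text \<open>Used for two real-linear maps that express the constraints on a field: conjugation of a
  mode and its divergence.\<close>

lemma linear_evolution_bounded_linear:
 assumes a: "linear_evolution T \<mu> h y" and f: "bounded_linear f"
 shows "linear_evolution T \<mu> (%s. f (h s)) (%s. f (y s))"
 unfolding linear_evolution_def
proof (intro conjI ballI)
 interpret f: bounded_linear f by fact
 note a' = linear_evolutionD[OF a]
 show "integrable (Leb T) (%s. f (h s))"
  by (rule integrable_bounded_linear[OF f]) (rule a')
 show "continuous_on {0..T} (%s. f (y s))"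
  by (rule f.continuous_on) (rule a')
 fix t assume t: "t \<in> {0..T}"
 have i: "integrable (Leb t) h" "integrable (Leb t) y"
  using t lebesgue_on_eq_integral(1)[OF a'(1), of 0 t]
   lebesgue_on_eq_integral(1)[OF continuous_imp_integrable_real[OF a'(2)], of 0 t] by simp_all
 have "f (y t) = f (y 0) + f (LINT s|Leb t. h s - \<mu> *\<^sub>R y s)"
  by (subst a'(3)[OF t]) (rule f.add)
 also have "f (LINT s|Leb t. h s - \<mu> *\<^sub>R y s) = (LINT s|Leb t. f (h s - \<mu> *\<^sub>R y s))"
  by (rule integral_bounded_linear[OF f, symmetric]) (use i in auto)
 finally show "f (y t) = f (y 0) + (LINT s|Leb t. f (h s) - \<mu> *\<^sub>R f (y s))"
  by (simp add: f.diff f.scaleR)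
qed

text \<open>With \<open>H = \<integral> h\<close>, the difference \<open>z = y - H\<close> solves \<open>z' = - \<mu> (z + H)\<close>, whose right-hand side is continuous.\<close>

lemma linear_evolution_exists:
 fixes h :: "real \<Rightarrow> 'a::euclidean_space"
 assumes h: "integrable (Leb T) h" and T: "0 \<le> T"
 shows "\<exists>y. linear_evolution T \<mu> h y \<and> y 0 = y0"
proof -
 define H where "H t = (LINT s|Leb t. h s)" for t
 have cH: "continuous_on {0..T} H" unfolding H_def by (rule lebesgue_on_integral_continuous[OF h])
 \<comment> \<open>Variation of constants. The integrand is continuous, so \<open>z\<close> is a
   classical solution and the ordinary fundamental theorem applies to it.\<close>
 define E where "E t = integral {0..t} (%s. exp (\<mu> * s) *\<^sub>R H s)" for t
 define z where "z t = exp (- \<mu> * t) *\<^sub>R (y0 - \<mu> *\<^sub>R E t)" for t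
 have dE: "(E has_vector_derivative exp (\<mu> * t) *\<^sub>R H t) (at t within {0..T})" if "t \<in> {0..T}" for t
  unfolding E_def by (rule integral_has_vector_derivative) (use that in \<open>auto intro!: continuous_intros cH\<close>)
 have dz: "(z has_vector_derivative - \<mu> *\<^sub>R (z t + H t)) (at t within {0..T})" if "t \<in> {0..T}" for t
 proof -
  have "(z has_vector_derivative (exp (- \<mu> * t) *\<^sub>R (0 - \<mu> *\<^sub>R (exp (\<mu> * t) *\<^sub>R H t))
    + (exp (- \<mu> * t) * (- \<mu>)) *\<^sub>R (y0 - \<mu> *\<^sub>R E t))) (at t within {0..T})"
   unfolding z_def
   by (rule has_vector_derivative_scaleR)
     (auto intro!: derivative_eq_intros dE that has_vector_derivative_diff[OF has_vector_derivative_const]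
      bounded_linear.has_vector_derivative[OF bounded_linear_scaleR_right])
  also have "exp (- \<mu> * t) *\<^sub>R (0 - \<mu> *\<^sub>R (exp (\<mu> * t) *\<^sub>R H t)) = - \<mu> *\<^sub>R H t"
   by (simp add: exp_minus field_simps)
  also have "- \<mu> *\<^sub>R H t + (exp (- \<mu> * t) * (- \<mu>)) *\<^sub>R (y0 - \<mu> *\<^sub>R E t) = - \<mu> *\<^sub>R (z t + H t)"
   by (simp add: z_def algebra_simps)
  finally show ?thesis .
 qed
 have cz: "continuous_on {0..T} z"
  using dz by (meson continuous_on_eq_continuous_within has_vector_derivative_continuous)
 define y where "y t = z t + H t" for t
 have cy: "continuous_on {0..T} y" unfolding y_def by (intro continuous_intros cz cH)
 have H0: "H 0 = 0" using lebesgue_on_eq_integral(3)[OF h, of 0 0] T by (simp add: H_def)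
 have z0: "z 0 = y0" by (simp add: z_def E_def)
 have "y t = y 0 + (LINT s|Leb t. h s - \<mu> *\<^sub>R y s)" if t: "t \<in> {0..T}" for t
 proof -
  have ct: "continuous_on {0..t} (%s. - \<mu> *\<^sub>R y s)"
   by (intro continuous_intros continuous_on_subset[OF cy]) (use t in auto)
  have "((%s. - \<mu> *\<^sub>R y s) has_integral z t - z 0) {0..t}"
  proof (rule fundamental_theorem_of_calculus)
   show "(z has_vector_derivative - \<mu> *\<^sub>R y s) (at s within {0..t})" if "s \<in> {0..t}" for s
    unfolding y_def by (rule has_vector_derivative_within_subset[OF dz]) (use t that in auto)
  qed (use t in auto)
  then have "z t - z 0 = integral {0..t} (%s. - \<mu> *\<^sub>R y s)" by (rule integral_unique[symmetric])
  also have "\<dots> = (LINT s|Leb t. - \<mu> *\<^sub>R y s)"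
   by (rule lebesgue_integral_eq_integral[OF continuous_imp_integrable_real[OF ct], symmetric]) simp
  finally have zt: "z t = z 0 + (LINT s|Leb t. - \<mu> *\<^sub>R y s)"
   by (simp only: diff_eq_eq add.commute)
  have "y t = z t + H t" "y 0 = z 0" "H t = (LINT s|Leb t. h s)"
   unfolding y_def H0 by (simp_all add: H_def)
  with zt have "y t = y 0 + ((LINT s|Leb t. h s) + (LINT s|Leb t. - \<mu> *\<^sub>R y s))"
   by (simp only: add.assoc add.commute add.left_commute)
  also have "(LINT s|Leb t. h s) + (LINT s|Leb t. - \<mu> *\<^sub>R y s)
    = (LINT s|Leb t. h s + - \<mu> *\<^sub>R y s)"
   by (rule bochner_integral_add[symmetric])
     (use lebesgue_on_eq_integral(1)[OF h, of 0 t] t continuous_imp_integrable_real[OF ct] in auto)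
  finally show ?thesis by simp
 qed
 then have "linear_evolution T \<mu> h y" unfolding linear_evolution_def using h cy by blast
 then show ?thesis using H0 z0 by (intro exI[of _ y]) (simp add: y_def)
qed

text \<open>The product rule with both factors equal to \<open>y\<close>.\<close>

lemma linear_evolution_energy:
 assumes ev: "linear_evolution T \<mu> h y" and t: "t \<in> {0..T}"
 shows "(norm (y t))^2 + 2 * \<mu> * (LINT s|Leb t. (norm (y s))^2)
   = (norm (y 0))^2 + 2 * (LINT s|Leb t. h s \<bullet> y s)"
proof -
 have h: "integrable (Leb T) h" and cy: "continuous_on {0..T} y"
  and y: "\<And>t. t \<in> {0..T} \<Longrightarrow> y t = y 0 + (LINT s|Leb t. h s - \<mu> *\<^sub>R y s)"
  using linear_evolutionD[OF ev] by blast+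
 have iy: "integrable (Leb T) y" by (rule continuous_imp_integrable_real[OF cy])
 have i: "integrable (Leb T) (%s. h s - \<mu> *\<^sub>R y s)" using h iy by auto
 have i2: "integrable (Leb t) (%s. h s \<bullet> y s)" "integrable (Leb t) (%s. y s \<bullet> y s)"
  using t by (auto intro!: integrable_inner_continuous lebesgue_on_eq_integral(1)[OF h]
    lebesgue_on_eq_integral(1)[OF iy] continuous_on_subset[OF cy])
 have "y t \<bullet> y t = y 0 \<bullet> y 0 + (LINT s|Leb t. (h s - \<mu> *\<^sub>R y s) \<bullet> y s + (h s - \<mu> *\<^sub>R y s) \<bullet> y s)"
  by (rule integral_product_rule[OF i i y y t])
 also have "(LINT s|Leb t. (h s - \<mu> *\<^sub>R y s) \<bullet> y s + (h s - \<mu> *\<^sub>R y s) \<bullet> y s)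
   = (LINT s|Leb t. 2 * (h s \<bullet> y s) - 2 * \<mu> * (y s \<bullet> y s))"
  by (intro bochner_integral_cong) (auto simp: algebra_simps)
 also have "\<dots> = 2 * (LINT s|Leb t. h s \<bullet> y s) - 2 * \<mu> * (LINT s|Leb t. y s \<bullet> y s)"
  using i2 by (subst bochner_integral_diff) auto
 finally show ?thesis by (simp add: power2_norm_eq_inner)
qed

text \<open>Young's inequality with weight \<mu> spends half of the dissipation on the source. The
  factor 1 / \<mu> is the parabolic gain: with \<mu> = \<nu> |k|^2 and after multiplication by |k|^2
  it yields H_1 and H_2 bounds from a source in H_0.\<close>

lemma linear_evolution_estimate:
 assumes ev: "linear_evolution T \<mu> h y" and t: "t \<in> {0..T}" and l: "\<mu> > 0"
  and h2: "integrable (Leb T) (%s. (norm (h s))^2)"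
 shows "(norm (y t))^2 + \<mu> * (LINT s|Leb t. (norm (y s))^2)
   \<le> (norm (y 0))^2 + (LINT s|Leb t. (norm (h s))^2) / \<mu>"
proof -
 have h: "integrable (Leb T) h" and cy: "continuous_on {0..T} y"
  using linear_evolutionD[OF ev] by blast+
 have iy: "integrable (Leb T) y" by (rule continuous_imp_integrable_real[OF cy])
 have i2: "integrable (Leb t) (%s. h s \<bullet> y s)" "integrable (Leb t) (%s. y s \<bullet> y s)"
  using t by (auto intro!: integrable_inner_continuous lebesgue_on_eq_integral(1)[OF h]
    lebesgue_on_eq_integral(1)[OF iy] continuous_on_subset[OF cy])
 have h2': "integrable (Leb t) (%s. (norm (h s))^2)"
  using lebesgue_on_eq_integral(1)[OF h2] t by auto
 have "2 * (LINT s|Leb t. h s \<bullet> y s) = (LINT s|Leb t. 2 * (h s \<bullet> y s))" by simp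
 also have "\<dots> \<le> (LINT s|Leb t. (norm (h s))^2 / \<mu> + \<mu> * (norm (y s))^2)"
 proof (rule integral_mono)
  fix s
  have "0 \<le> (norm (h s - \<mu> *\<^sub>R y s))^2" by simp
  also have "\<dots> = (norm (h s))^2 - 2 * \<mu> * (h s \<bullet> y s) + \<mu> * \<mu> * (norm (y s))^2"
   by (simp add: power2_norm_eq_inner inner_diff_left inner_diff_right inner_commute algebra_simps)
  finally show "2 * (h s \<bullet> y s) \<le> (norm (h s))^2 / \<mu> + \<mu> * (norm (y s))^2"
   using l by (simp add: field_simps)
 qed (use i2 h2' in \<open>auto simp: power2_norm_eq_inner\<close>)
 also have "\<dots> = (LINT s|Leb t. (norm (h s))^2) / \<mu> + \<mu> * (LINT s|Leb t. (norm (y s))^2)"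
  using i2 h2' by (subst bochner_integral_add) (auto simp: power2_norm_eq_inner)
 finally show ?thesis using linear_evolution_energy[OF ev t] by simp
qed

lemma linear_evolution_zero:
 assumes ev: "linear_evolution T \<mu> (%s. 0) y" and t: "t \<in> {0..T}" and l: "\<mu> \<ge> 0" and "y 0 = 0"
 shows "y t = 0"
proof -
 have "(norm (y t))^2 + 2 * \<mu> * (LINT s|Leb t. (norm (y s))^2) = 0"
  using linear_evolution_energy[OF ev t] assms by simp
 moreover have "2 * \<mu> * (LINT s|Leb t. (norm (y s))^2) \<ge> 0"
  using l by (intro mult_nonneg_nonneg bochner_integral_nonneg) auto
 ultimately have "(norm (y t))^2 \<le> 0" by linarith
 then show ?thesis by simp
qed

lemma linear_evolution_unique:
 assumes "linear_evolution T \<mu> h y" "linear_evolution T \<mu> h z" "t \<in> {0..T}" "\<mu> \<ge> 0" "y 0 = z 0"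
 shows "y t = z t"
 using linear_evolution_zero[of T \<mu> "%s. y s - z s" t] linear_evolution_diff[OF assms(1,2)] assms by simp

section \<open>Weak derivatives in time\<close>

text \<open>For n = 0 the classical smooth function that is flat at the origin. The powers of 1 / x
  are included because differentiating produces them: the derivative of index n is a combination of
  the indices n + 1 and n + 2.\<close>

definition flat_exp :: "nat \<Rightarrow> real \<Rightarrow> real" where
 "flat_exp n x = (if x > 0 then exp (- 1 / x) / x ^ n else 0)"

lemma flat_exp_tendsto_0: "(flat_exp n \<longlongrightarrow> 0) (at 0)"
proof (rule filterlim_split_at)
 have "((%x::real. inverse x ^ n / exp (inverse x)) \<longlongrightarrow> 0) (at_right 0)"
  by (rule filterlim_compose[OF tendsto_power_div_exp_0 filterlim_inverse_at_top_right])
 then show "(flat_exp n \<longlongrightarrow> 0) (at_right 0)"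
  by (rule Lim_transform_eventually)
    (auto simp: flat_exp_def eventually_at_filter exp_minus field_simps intro!: always_eventually)
 show "(flat_exp n \<longlongrightarrow> 0) (at_left 0)"
  by (rule tendsto_eventually) (auto simp: flat_exp_def eventually_at_filter intro!: always_eventually)
qed

lemma flat_exp_has_derivative:
 "(flat_exp n has_real_derivative (flat_exp (n + 2) x - real n * flat_exp (n + 1) x)) (at x)"
proof (cases x "0::real" rule: linorder_cases)
 case less
 have "((%x. 0) has_real_derivative (flat_exp (n + 2) x - real n * flat_exp (n + 1) x)) (at x)"
  using less by (auto simp: flat_exp_def)
 then show ?thesis
  by (rule has_field_derivative_transform_within_open[where S="{..<0}"])
    (use less in \<open>auto simp: flat_exp_def\<close>)
next
 case greater
 have "((%x. exp (- 1 / x) / x ^ n) has_real_derivative (flat_exp (n + 2) x - real n * flat_exp (n + 1) x)) (at x)"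
 proof -
  have dp: "((%x. x ^ n) has_real_derivative real n * x ^ n / x) (at x)"
  proof -
   have "real n * x ^ (n - Suc 0) = real n * x ^ n / x" using greater by (cases n) auto
   then show ?thesis using DERIV_pow[of n x UNIV] by simp
  qed
  have de: "((%x. exp (- 1 / x)) has_real_derivative exp (- 1 / x) / (x * x)) (at x)"
   using greater by (auto intro!: derivative_eq_intros)
  have "((%x. exp (- 1 / x) / x ^ n) has_real_derivative
    (exp (- 1 / x) / (x * x) * x ^ n - exp (- 1 / x) * (real n * x ^ n / x)) / (x ^ n * x ^ n)) (at x)"
   by (rule DERIV_divide[OF de dp]) (use greater in simp)
  also have "(exp (- 1 / x) / (x * x) * x ^ n - exp (- 1 / x) * (real n * x ^ n / x)) / (x ^ n * x ^ n)
    = flat_exp (n + 2) x - real n * flat_exp (n + 1) x"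
   using greater by (simp add: flat_exp_def field_simps)
  finally show ?thesis .
 qed
 then show ?thesis
  by (rule has_field_derivative_transform_within_open[where S="{0<..}"])
    (use greater in \<open>auto simp: flat_exp_def\<close>)
next
 case equal
 \<comment> \<open>At the origin the difference quotient is \<open>flat_exp (n + 1)\<close> itself,
   so differentiability reduces to the limit already known for the next index.\<close>
 have "((%h. (flat_exp n (0 + h) - flat_exp n 0) / h) \<longlongrightarrow> 0) (at 0)"
  by (rule Lim_transform_eventually[OF flat_exp_tendsto_0[of "n + 1"]])
    (auto simp: flat_exp_def eventually_at_filter field_simps intro!: always_eventually)
 then show ?thesis using equal by (simp add: DERIV_def flat_exp_def)
qed

text \<open>An algebra of functions stable under differentiation. Membership gives differentiability
  of every iterated derivative, the form of smoothness in \<open>test_function\<close>, with no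
  formula for the higher derivatives.\<close>

inductive_set elementary_smooth :: "(real \<Rightarrow> real) set" where
 const: "(%x. c) \<in> elementary_smooth"
| flat: "(%x. flat_exp n (a * x + b)) \<in> elementary_smooth"
| add: "f \<in> elementary_smooth \<Longrightarrow> g \<in> elementary_smooth \<Longrightarrow> (%x. f x + g x) \<in> elementary_smooth"
| mult: "f \<in> elementary_smooth \<Longrightarrow> g \<in> elementary_smooth \<Longrightarrow> (%x. f x * g x) \<in> elementary_smooth"
| inverse: "f \<in> elementary_smooth \<Longrightarrow> (\<And>x. f x \<noteq> 0) \<Longrightarrow> (%x. inverse (f x)) \<in> elementary_smooth"

lemma elementary_smooth_derivative:
 "f \<in> elementary_smooth \<Longrightarrow> \<exists>f'\<in>elementary_smooth. \<forall>x. (f has_real_derivative f' x) (at x)"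
proof (induction rule: elementary_smooth.induct)
 case (const c)
 show ?case by (rule bexI[of _ "%x. 0"]) (auto intro: elementary_smooth.const)
next
 case (flat n a b)
 let ?d = "%x. a * (flat_exp (n + 2) (a * x + b) + (- real n) * flat_exp (n + 1) (a * x + b))"
 have d1: "?d \<in> elementary_smooth" by (intro elementary_smooth.intros)
 have d2: "((%x. flat_exp n (a * x + b)) has_real_derivative ?d x) (at x)" for x
 proof -
  have i: "((%x. a * x + b) has_real_derivative a) (at x)" by (auto intro!: derivative_eq_intros)
  show ?thesis
   using DERIV_chain2[OF flat_exp_has_derivative[of n "a * x + b"] i] by (simp add: mult.commute)
 qed
 show ?case
 proof (rule bexI[where x="?d"])
  show "\<forall>x. ((%x. flat_exp n (a * x + b)) has_real_derivative ?d x) (at x)" using d2 by blast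
 qed (rule d1)
next
 case (add f g)
 then obtain f' g' where d: "f' \<in> elementary_smooth" "g' \<in> elementary_smooth"
  "\<And>x. (f has_real_derivative f' x) (at x)" "\<And>x. (g has_real_derivative g' x) (at x)" by blast
 show ?case
 proof (rule bexI[where x="%x. f' x + g' x"])
  show "\<forall>x. ((%x. f x + g x) has_real_derivative f' x + g' x) (at x)" using DERIV_add d by blast
 qed (intro elementary_smooth.intros d)
next
 case (mult f g)
 then obtain f' g' where d: "f' \<in> elementary_smooth" "g' \<in> elementary_smooth"
  "\<And>x. (f has_real_derivative f' x) (at x)" "\<And>x. (g has_real_derivative g' x) (at x)" by blast
 show ?case
 proof (rule bexI[where x="%x. f x * g' x + f' x * g x"])
  show "\<forall>x. ((%x. f x * g x) has_real_derivative f x * g' x + f' x * g x) (at x)" using DERIV_mult' d by blast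
 qed (intro elementary_smooth.intros d mult.hyps)
next
 case (inverse f)
 then obtain f' where d: "f' \<in> elementary_smooth" "\<And>x. (f has_real_derivative f' x) (at x)" by blast
 show ?case
 proof (rule bexI[where x="%x. (- 1) * (inverse (f x) * f' x * inverse (f x))"])
  show "\<forall>x. ((%x. inverse (f x)) has_real_derivative (- 1) * (inverse (f x) * f' x * inverse (f x))) (at x)"
   using DERIV_inverse'[OF d(2) inverse.hyps(2)] by simp
 qed (intro elementary_smooth.intros d inverse.hyps)
qed

lemma elementary_smooth_deriv: "f \<in> elementary_smooth \<Longrightarrow> deriv f \<in> elementary_smooth"
proof -
 assume "f \<in> elementary_smooth"
 then obtain f' where f': "f' \<in> elementary_smooth" "\<And>x. (f has_real_derivative f' x) (at x)"
  using elementary_smooth_derivative by blast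
 then have "deriv f = f'" by (auto intro: DERIV_imp_deriv)
 with f' show ?thesis by simp
qed

lemma elementary_smooth_has_deriv: "f \<in> elementary_smooth \<Longrightarrow> (f has_real_derivative deriv f x) (at x)"
proof -
 assume "f \<in> elementary_smooth"
 then obtain f' where f': "\<And>x. (f has_real_derivative f' x) (at x)"
  using elementary_smooth_derivative by blast
 from f'[of x] DERIV_imp_deriv[OF f'[of x]] show ?thesis by simp
qed

lemma elementary_smooth_deriv_iterate: "f \<in> elementary_smooth \<Longrightarrow> (deriv ^^ n) f \<in> elementary_smooth"
 by (induction n) (auto intro: elementary_smooth_deriv)

lemma elementary_smooth_differentiable:
 "f \<in> elementary_smooth \<Longrightarrow> (deriv ^^ n) f differentiable (at x)"
 by (rule differentiableI) (use elementary_smooth_has_deriv[OF elementary_smooth_deriv_iterate] in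
   \<open>unfold has_field_derivative_def, blast\<close>)

lemma elementary_smooth_continuous: "f \<in> elementary_smooth \<Longrightarrow> continuous_on S f"
 by (intro continuous_at_imp_continuous_on ballI DERIV_isCont[OF elementary_smooth_has_deriv])

text \<open>The standard transition f(x) / (f(x) + f(1 - x)) with f = \<open>flat_exp 0\<close>: it
  vanishes for x <= 0 and equals 1 for x >= 1.\<close>

definition smooth_step :: "real \<Rightarrow> real" where
 "smooth_step x = flat_exp 0 (1 * x + 0) * inverse (flat_exp 0 (1 * x + 0) + flat_exp 0 ((- 1) * x + 1))"

lemma flat_exp_pos: "x > 0 \<Longrightarrow> flat_exp n x > 0" and flat_exp_nonneg: "flat_exp n x \<ge> 0"
 by (auto simp: flat_exp_def)

lemma smooth_step_denominator: "flat_exp 0 x + flat_exp 0 (1 - x) > 0"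
proof (cases "x > 0")
 case True then show ?thesis using flat_exp_pos[of x 0] flat_exp_nonneg[of 0 "1 - x"] by linarith
next
 case False then show ?thesis using flat_exp_pos[of "1 - x" 0] flat_exp_nonneg[of 0 "x"] by linarith
qed

lemma smooth_step_scaled_smooth: "(%x. smooth_step (a * x + b)) \<in> elementary_smooth"
proof -
 have "(%x. flat_exp 0 (a * x + b) * inverse (flat_exp 0 (a * x + b) + flat_exp 0 ((- a) * x + (1 - b)))) \<in> elementary_smooth"
 proof (intro elementary_smooth.intros)
  fix x
  have "(- a) * x + (1 - b) = 1 - (a * x + b)" by simp
  then show "flat_exp 0 (a * x + b) + flat_exp 0 ((- a) * x + (1 - b)) \<noteq> 0"
   using smooth_step_denominator[of "a * x + b"] by (metis less_irrefl)
 qed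
 then show ?thesis unfolding smooth_step_def by (simp add: algebra_simps)
qed

lemma smooth_step_eq_0: "x \<le> 0 \<Longrightarrow> smooth_step x = 0"
 by (simp add: smooth_step_def flat_exp_def)

lemma smooth_step_eq_1: "x \<ge> 1 \<Longrightarrow> smooth_step x = 1"
 by (simp add: smooth_step_def flat_exp_def)

definition mollified_step :: "real \<Rightarrow> real \<Rightarrow> real \<Rightarrow> real" where
 "mollified_step a \<epsilon> t = smooth_step ((1 / \<epsilon>) * t + (- a / \<epsilon>))"

lemma mollified_step_smooth: "mollified_step a \<epsilon> \<in> elementary_smooth"
 unfolding mollified_step_def by (rule smooth_step_scaled_smooth)

lemma mollified_step_values:
 assumes "\<epsilon> > 0"
 shows "t \<le> a \<Longrightarrow> mollified_step a \<epsilon> t = 0" "t \<ge> a + \<epsilon> \<Longrightarrow> mollified_step a \<epsilon> t = 1"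
proof -
 have e: "(1 / \<epsilon>) * t + (- a / \<epsilon>) = (t - a) / \<epsilon>" by (simp add: diff_divide_distrib)
 show "t \<le> a \<Longrightarrow> mollified_step a \<epsilon> t = 0"
  unfolding mollified_step_def e by (rule smooth_step_eq_0) (use assms in \<open>simp add: divide_nonpos_pos\<close>)
 show "t \<ge> a + \<epsilon> \<Longrightarrow> mollified_step a \<epsilon> t = 1"
  unfolding mollified_step_def e by (rule smooth_step_eq_1) (use assms in \<open>simp add: field_simps\<close>)
qed

lemma mollified_step_deriv:
 "deriv (mollified_step a \<epsilon>) t = deriv smooth_step ((1 / \<epsilon>) * t + (- a / \<epsilon>)) * (1 / \<epsilon>)"
proof (rule DERIV_imp_deriv)
 have s: "smooth_step \<in> elementary_smooth" using smooth_step_scaled_smooth[of 1 0] by simp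
 have i: "((%t. (1 / \<epsilon>) * t + (- a / \<epsilon>)) has_real_derivative 1 / \<epsilon>) (at t)"
  using DERIV_add[OF DERIV_cmult[OF DERIV_ident, of "1 / \<epsilon>"] DERIV_const[of "- a / \<epsilon>"]] by simp
 have "((%t. smooth_step ((1 / \<epsilon>) * t + (- a / \<epsilon>))) has_real_derivative
   deriv smooth_step ((1 / \<epsilon>) * t + (- a / \<epsilon>)) * (1 / \<epsilon>)) (at t)"
  by (rule DERIV_chain2[OF elementary_smooth_has_deriv[OF s] i])
 then show "(mollified_step a \<epsilon> has_real_derivative
   deriv smooth_step ((1 / \<epsilon>) * t + (- a / \<epsilon>)) * (1 / \<epsilon>)) (at t)"
  unfolding mollified_step_def .
qed

lemma mollified_step_deriv_eq_0:
 assumes "\<epsilon> > 0" "t < a \<or> t > a + \<epsilon>"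
 shows "deriv (mollified_step a \<epsilon>) t = 0"
proof (rule DERIV_imp_deriv)
 from assms(2) show "(mollified_step a \<epsilon> has_real_derivative 0) (at t)"
 proof
  assume "t < a"
  then show ?thesis
   by (intro has_field_derivative_transform_within_open[OF DERIV_const[of 0], where S="{..<a}"])
     (auto simp: mollified_step_values[OF assms(1)])
 next
  assume "t > a + \<epsilon>"
  then show ?thesis
   by (intro has_field_derivative_transform_within_open[OF DERIV_const[of 1], where S="{a + \<epsilon><..}"])
     (auto simp: mollified_step_values[OF assms(1)])
 qed
qed

lemma smooth_step_deriv_bound: "\<exists>C\<ge>0. \<forall>x\<in>{0..1}. \<bar>deriv smooth_step x\<bar> \<le> C"
proof -
 have s: "smooth_step \<in> elementary_smooth" using smooth_step_scaled_smooth[of 1 0] by simp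
 have "compact (deriv smooth_step ` {0..1})"
  by (intro compact_continuous_image elementary_smooth_continuous elementary_smooth_deriv s) simp
 then obtain C where "\<forall>y\<in>deriv smooth_step ` {0..1}. norm y \<le> C"
  using compact_imp_bounded bounded_iff by blast
 then show ?thesis by (intro exI[of _ "max C 0"]) force
qed

text \<open>The derivative of the step is an approximate identity at \<open>a\<close>: it has
  integral 1, is supported in an interval of length \<epsilon> starting at \<open>a\<close>, and is
  at most C / \<epsilon>. Taking \<epsilon> < T - a makes the step reach 1 before
  \<open>T\<close>.\<close>

lemma mollified_step_deriv_integral_tendsto:
 fixes z :: "real \<Rightarrow> real"
 assumes z: "continuous_on {0..T} z" and a: "0 < a" "a < T" and e: "e > 0"
 shows "\<exists>d>0. \<forall>\<epsilon>. 0 < \<epsilon> \<longrightarrow> \<epsilon> < d \<longrightarrow> \<bar>(LINT t|Leb T. deriv (mollified_step a \<epsilon>) t * z t) - z a\<bar> \<le> e"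
proof -
 obtain C where C: "C \<ge> 0" "\<And>x. x \<in> {0..1} \<Longrightarrow> \<bar>deriv smooth_step x\<bar> \<le> C"
  using smooth_step_deriv_bound by blast
 \<comment> \<open>The error is at most (C / \<epsilon>) times \<eta> on an interval of length
   \<epsilon>, that is C \<eta>. The summand 1 covers C = 0.\<close>
 define \<eta> where "\<eta> = e / (C + 1)"
 have eta: "\<eta> > 0" "C * \<eta> \<le> e" using e C(1) by (auto simp: \<eta>_def field_simps)
 obtain d0 where d0: "d0 > 0" "\<And>t. t \<in> {0..T} \<Longrightarrow> dist t a < d0 \<Longrightarrow> dist (z t) (z a) < \<eta>"
  using z a eta unfolding continuous_on_iff by (metis atLeastAtMost_iff less_imp_le)
 show ?thesis
 proof (intro exI[of _ "min d0 (T - a)"] conjI allI impI)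
  show "min d0 (T - a) > 0" using d0 a by auto
  fix \<epsilon> assume ep: "0 < \<epsilon>" "\<epsilon> < min d0 (T - a)"
  let ?\<phi> = "mollified_step a \<epsilon>"
  have c: "continuous_on S (deriv ?\<phi>)" for S
   by (intro elementary_smooth_continuous elementary_smooth_deriv mollified_step_smooth)
  have i1: "integrable (Leb T) (%t. deriv ?\<phi> t * z t)"
   by (intro continuous_imp_integrable_real continuous_intros z c)
  have i2: "integrable (Leb T) (deriv ?\<phi>)"
   by (intro continuous_imp_integrable_real c)
  have "(deriv ?\<phi> has_integral ?\<phi> T - ?\<phi> 0) {0..T}"
   by (rule fundamental_theorem_of_calculus)
     (use a elementary_smooth_has_deriv[OF mollified_step_smooth] in
      \<open>auto simp: has_real_derivative_iff_has_vector_derivative[symmetric] intro: DERIV_subset\<close>)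
  then have one: "(LINT t|Leb T. deriv ?\<phi> t) = 1"
   using a ep lebesgue_integral_eq_integral[OF i2] mollified_step_values[OF ep(1)]
   by (simp add: integral_unique)
  have "\<bar>(LINT t|Leb T. deriv ?\<phi> t * z t) - z a\<bar>
    = \<bar>(LINT t|Leb T. deriv ?\<phi> t * z t) - (LINT t|Leb T. deriv ?\<phi> t * z a)\<bar>"
   using one i2 by simp
  also have "\<dots> = \<bar>LINT t|Leb T. deriv ?\<phi> t * (z t - z a)\<bar>"
   using i1 i2 by (subst bochner_integral_diff[symmetric]) (auto simp: algebra_simps)
  also have "\<dots> \<le> (LINT t|Leb T. \<bar>deriv ?\<phi> t * (z t - z a)\<bar>)"
   by (rule integral_abs_bound)
  also have "\<dots> \<le> (LINT t|Leb T. (C / \<epsilon> * \<eta>) * indicator {a..a + \<epsilon>} t)"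
  proof (rule integral_mono)
   show "integrable (Leb T) (%t. \<bar>deriv ?\<phi> t * (z t - z a)\<bar>)"
    by (intro continuous_imp_integrable_real continuous_intros z c)
   show "integrable (Leb T) (%t. (C / \<epsilon> * \<eta>) * indicator {a..a + \<epsilon>} t)"
    using a ep by (intro integrable_mult_right integrable_real_indicator)
     (auto simp: sets_restrict_space emeasure_restrict_space intro!: image_eqI[of _ _ "{a..a+\<epsilon>}"])
   fix t assume "t \<in> space (Leb T)"
   then have t: "t \<in> {0..T}" by simp
   show "\<bar>deriv ?\<phi> t * (z t - z a)\<bar> \<le> (C / \<epsilon> * \<eta>) * indicator {a..a + \<epsilon>} t"
   proof (cases "t \<in> {a..a + \<epsilon>}")
    case False
    then show ?thesis using mollified_step_deriv_eq_0[OF ep(1), of t a] by (auto simp: not_le)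
   next
    case True
    have "(1 / \<epsilon>) * t + (- a / \<epsilon>) = (t - a) / \<epsilon>" by (simp add: diff_divide_distrib)
    moreover have "(t - a) / \<epsilon> \<in> {0..1}" using True ep by auto
    ultimately have "\<bar>deriv ?\<phi> t\<bar> \<le> C / \<epsilon>"
     unfolding mollified_step_deriv using C(2)[of "(t - a) / \<epsilon>"] ep
     by (simp add: abs_mult divide_right_mono)
    moreover have "\<bar>z t - z a\<bar> \<le> \<eta>"
     using d0(2)[OF t] True ep by (force simp: dist_real_def)
    ultimately have "\<bar>deriv ?\<phi> t\<bar> * \<bar>z t - z a\<bar> \<le> C / \<epsilon> * \<eta>"
     by (intro mult_mono) (use C(1) ep in auto)
    then show ?thesis using True by (simp add: abs_mult)
   qed
  qed
  also have "\<dots> = (C / \<epsilon> * \<eta>) * measure lebesgue {a..a + \<epsilon>}"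
  proof -
   have "{a..a + \<epsilon>} \<inter> {0..T} = {a..a + \<epsilon>}" using a ep by auto
   moreover have "(LINT t|Leb T. indicator {a..a + \<epsilon>} t) = measure (Leb T) ({a..a + \<epsilon>} \<inter> space (Leb T))"
    by (rule bochner_integral_indicator)
   moreover have "measure (Leb T) {a..a + \<epsilon>} = measure lebesgue {a..a + \<epsilon>}"
    by (rule measure_restrict_space) (use a ep in auto)
   ultimately show ?thesis by (simp only: integral_mult_right_zero space_lebesgue_on)
  qed
  also have "\<dots> = C * \<eta>" using ep by simp
  finally show "\<bar>(LINT t|Leb T. deriv ?\<phi> t * z t) - z a\<bar> \<le> e" using eta by simp
 qed
qed

section \<open>Test functions, and the passage from weak derivatives to integral equations\<close>

lemma test_function_mollified:
 assumes "0 < a" "a < b" "b + \<epsilon> < T" "0 < \<epsilon>"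
 shows "test_function T (%t. mollified_step a \<epsilon> t + (- 1) * mollified_step b \<epsilon> t)"
 unfolding test_function_def
proof (intro conjI allI)
 show "(deriv ^^ n) (%t. mollified_step a \<epsilon> t + (- 1) * mollified_step b \<epsilon> t) differentiable at t" for n t
  by (rule elementary_smooth_differentiable) (intro elementary_smooth.intros mollified_step_smooth)
 have "{t. mollified_step a \<epsilon> t + (- 1) * mollified_step b \<epsilon> t \<noteq> 0} \<subseteq> {a..b + \<epsilon>}"
 proof
  fix t assume t: "t \<in> {t. mollified_step a \<epsilon> t + (- 1) * mollified_step b \<epsilon> t \<noteq> 0}"
  have "\<not> t < a" using t mollified_step_values(1)[OF assms(4), of t a] mollified_step_values(1)[OF assms(4), of t b] assms(2) by auto
  moreover have "\<not> t > b + \<epsilon>"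
   using t mollified_step_values(2)[OF assms(4), of a t] mollified_step_values(2)[OF assms(4), of b t] assms(2) by auto
  ultimately show "t \<in> {a..b + \<epsilon>}" by simp
 qed
 then have "closure {t. mollified_step a \<epsilon> t + (- 1) * mollified_step b \<epsilon> t \<noteq> 0} \<subseteq> {a..b + \<epsilon>}"
  by (rule closure_minimal) simp
 then show "closure {t. mollified_step a \<epsilon> t + (- 1) * mollified_step b \<epsilon> t \<noteq> 0} \<subseteq> {0<..<T}"
  using assms by auto
qed

lemma test_function_deriv:
 assumes "test_function T \<phi>"
 shows "(\<phi> has_real_derivative deriv \<phi> t) (at t)" "continuous_on S \<phi>" "continuous_on S (deriv \<phi>)"
  "T > 0 \<Longrightarrow> \<phi> 0 = 0" "\<phi> T = 0"
proof -
 have d0: "\<phi> differentiable (at t)" for t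
 proof -
  have "(deriv ^^ 0) \<phi> differentiable (at t)" using assms unfolding test_function_def by blast
  then show ?thesis by simp
 qed
 have d1: "deriv \<phi> differentiable (at t)" for t
 proof -
  have "(deriv ^^ Suc 0) \<phi> differentiable (at t)" using assms unfolding test_function_def by blast
  then show ?thesis by simp
 qed
 show "(\<phi> has_real_derivative deriv \<phi> t) (at t)" using d0 DERIV_deriv_iff_real_differentiable by blast
 show "continuous_on S \<phi>" "continuous_on S (deriv \<phi>)"
  using d0 d1 by (auto intro!: continuous_at_imp_continuous_on differentiable_imp_continuous_within)
 have "{t. \<phi> t \<noteq> 0} \<subseteq> closure {t. \<phi> t \<noteq> 0}" by (rule closure_subset)
 also have "\<dots> \<subseteq> {0<..<T}" using assms unfolding test_function_def by (rule conjunct2)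
 finally have "{t. \<phi> t \<noteq> 0} \<subseteq> {0<..<T}" .
 then show "T > 0 \<Longrightarrow> \<phi> 0 = 0" "\<phi> T = 0" by auto
qed

text \<open>A step at \<open>a\<close> minus a step at \<open>b\<close> is a test function whose
  derivative approximates the difference of point masses at \<open>a\<close> and \<open>b\<close>,
  so z a = z b for interior points. Continuity extends this to both endpoints.\<close>

lemma weak_derivative_imp_constant:
 fixes z :: "real \<Rightarrow> real"
 assumes z: "continuous_on {0..T} z" and T: "T > 0"
  and weak: "\<And>\<phi>. test_function T \<phi> \<Longrightarrow> (LINT t|Leb T. deriv \<phi> t * z t) = 0"
  and t: "t \<in> {0..T}"
 shows "z t = z 0"
proof -
 have eq: "z a = z b" if ab: "0 < a" "a < b" "b < T" for a b
 proof -
  have "\<bar>z a - z b\<bar> \<le> 0 + e" if e: "e > 0" for e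
  proof -
   obtain d1 where d1: "d1 > 0" "\<And>\<epsilon>. 0 < \<epsilon> \<Longrightarrow> \<epsilon> < d1 \<Longrightarrow> \<bar>(LINT t|Leb T. deriv (mollified_step a \<epsilon>) t * z t) - z a\<bar> \<le> e / 2"
    using mollified_step_deriv_integral_tendsto[OF z, of a "e / 2"] ab e by auto
   obtain d2 where d2: "d2 > 0" "\<And>\<epsilon>. 0 < \<epsilon> \<Longrightarrow> \<epsilon> < d2 \<Longrightarrow> \<bar>(LINT t|Leb T. deriv (mollified_step b \<epsilon>) t * z t) - z b\<bar> \<le> e / 2"
    using mollified_step_deriv_integral_tendsto[OF z, of b "e / 2"] ab e by auto
   define \<epsilon> where "\<epsilon> = min (min d1 d2) (T - b) / 2"
   have ep: "0 < \<epsilon>" "\<epsilon> < d1" "\<epsilon> < d2" "b + \<epsilon> < T" using d1(1) d2(1) ab by (auto simp: \<epsilon>_def min_def field_simps)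
   have dv: "deriv (%t. mollified_step a \<epsilon> t + (- 1) * mollified_step b \<epsilon> t) t
     = deriv (mollified_step a \<epsilon>) t + (- 1) * deriv (mollified_step b \<epsilon>) t" for t
    by (rule DERIV_imp_deriv)
      (intro DERIV_add DERIV_cmult elementary_smooth_has_deriv mollified_step_smooth)
   have i: "integrable (Leb T) (%t. deriv (mollified_step c \<epsilon>) t * z t)" for c
    by (intro continuous_imp_integrable_real continuous_intros z elementary_smooth_continuous
      elementary_smooth_deriv mollified_step_smooth)
   have "0 = (LINT t|Leb T. deriv (%t. mollified_step a \<epsilon> t + (- 1) * mollified_step b \<epsilon> t) t * z t)"
    using weak[OF test_function_mollified[of a b \<epsilon> T]] ab ep by simp
   also have "\<dots> = (LINT t|Leb T. deriv (mollified_step a \<epsilon>) t * z t - deriv (mollified_step b \<epsilon>) t * z t)"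
    unfolding dv by (simp add: algebra_simps)
   also have "\<dots> = (LINT t|Leb T. deriv (mollified_step a \<epsilon>) t * z t) - (LINT t|Leb T. deriv (mollified_step b \<epsilon>) t * z t)"
    by (rule bochner_integral_diff[OF i i])
   finally show ?thesis using d1(2)[OF ep(1,2)] d2(2)[OF ep(1,3)] by linarith
  qed
  then have "\<bar>z a - z b\<bar> \<le> 0" by (rule field_le_epsilon)
  then show ?thesis by simp
 qed
 have cl: "closure {0<..<T} = {0..T}" using T by simp
 have int: "z x = z (T/2)" if "x \<in> {0<..<T}" for x
 proof (cases x "T/2" rule: linorder_cases)
  case less then show ?thesis by (intro eq) (use that T in auto)
 next
  case greater then show ?thesis by (intro eq[symmetric]) (use that T in auto)
 next
  case equal then show ?thesis by (rule arg_cong)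
 qed
 have mid: "z x = z (T/2)" if "x \<in> {0..T}" for x
  by (rule continuous_constant_on_closure[of "{0<..<T}" z, unfolded cl, OF z int that])
 have "z 0 = z (T/2)" by (rule mid) (use T in simp)
 then show ?thesis using mid[OF t] by (simp only:)
qed

lemma test_function_integral_by_parts:
 fixes y g :: "real \<Rightarrow> real"
 assumes \<phi>: "test_function T \<phi>" and T: "T > 0" and g: "integrable (Leb T) g"
  and y: "\<And>t. t \<in> {0..T} \<Longrightarrow> y t = y 0 + (LINT s|Leb t. g s)"
 shows "(LINT t|Leb T. deriv \<phi> t * y t) = - (LINT t|Leb T. \<phi> t * g t)"
proof -
 note d = test_function_deriv[OF \<phi>]
 have i: "integrable (Leb T) (deriv \<phi>)"
  by (rule continuous_imp_integrable_real[OF d(3)])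
 have p: "\<phi> t = \<phi> 0 + (LINT s|Leb t. deriv \<phi> s)" if "t \<in> {0..T}" for t
 proof -
  have "(deriv \<phi> has_integral \<phi> t - \<phi> 0) {0..t}"
   by (rule fundamental_theorem_of_calculus)
     (use that d(1) in \<open>auto simp: has_real_derivative_iff_has_vector_derivative[symmetric] intro: DERIV_subset\<close>)
  then show ?thesis using lebesgue_on_eq_integral(3)[OF i, of 0 t] that by (simp add: integral_unique)
 qed
 have cy: "continuous_on {0..T} y"
  by (rule continuous_on_eq[OF continuous_on_add[OF continuous_on_const lebesgue_on_integral_continuous[OF g]]])
    (rule y[symmetric])
 have "\<phi> T \<bullet> y T = \<phi> 0 \<bullet> y 0 + (LINT s|Leb T. deriv \<phi> s \<bullet> y s + g s \<bullet> \<phi> s)"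
  by (rule integral_product_rule[OF i g p y]) (use T in auto)
 then have "0 = (LINT s|Leb T. deriv \<phi> s \<bullet> y s + g s \<bullet> \<phi> s)"
  using d(4)[OF T] d(5) by simp
 also have "\<dots> = (LINT s|Leb T. deriv \<phi> s \<bullet> y s) + (LINT s|Leb T. g s \<bullet> \<phi> s)"
  by (intro bochner_integral_add integrable_inner_continuous i g cy d)
 finally show ?thesis by (simp add: mult.commute)
qed

text \<open>The du Bois-Reymond argument: \<open>y\<close> minus the primitive of \<open>g\<close>
  has weak derivative zero and is therefore constant.\<close>

lemma weak_derivative_imp_integral:
 fixes y g :: "real \<Rightarrow> real"
 assumes y: "continuous_on {0..T} y" and g: "integrable (Leb T) g" and T: "T > 0"
  and weak: "\<And>\<phi>. test_function T \<phi> \<Longrightarrow>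
    (LINT t|Leb T. deriv \<phi> t * y t) = - (LINT t|Leb T. \<phi> t * g t)"
  and t: "t \<in> {0..T}"
 shows "y t = y 0 + (LINT s|Leb t. g s)"
proof -
 define G where "G t = (LINT s|Leb t. g s)" for t
 have G0: "G 0 = 0" using lebesgue_on_eq_integral(3)[OF g, of 0 0] T by (simp add: G_def)
 have cG: "continuous_on {0..T} G" unfolding G_def by (rule lebesgue_on_integral_continuous[OF g])
 have "y t - G t = y 0 - G 0"
 proof (rule weak_derivative_imp_constant[OF _ T _ t])
  show "continuous_on {0..T} (%t. y t - G t)" by (intro continuous_intros y cG)
  fix \<phi> assume \<phi>: "test_function T \<phi>"
  note d = test_function_deriv[OF \<phi>]
  have "(LINT t|Leb T. deriv \<phi> t * G t) = - (LINT t|Leb T. \<phi> t * g t)"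
   by (rule test_function_integral_by_parts[OF \<phi> T g]) (simp add: G0, simp add: G_def)
  moreover have "(LINT t|Leb T. deriv \<phi> t * (y t - G t)) =
    (LINT t|Leb T. deriv \<phi> t * y t) - (LINT t|Leb T. deriv \<phi> t * G t)"
   unfolding right_diff_distrib
   by (intro bochner_integral_diff continuous_imp_integrable_real continuous_intros d y cG)
  ultimately show "(LINT t|Leb T. deriv \<phi> t * (y t - G t)) = 0"
   using weak[OF \<phi>] by simp
 qed
 then show ?thesis using G0 by (simp add: G_def)
qed

section \<open>The model on Fourier coefficients\<close>

lemma infsum_finite_sum:
 fixes f :: "'i \<Rightarrow> 'k \<Rightarrow> 'a::{topological_comm_monoid_add,t2_space}"
 assumes "finite I" "\<And>i. i \<in> I \<Longrightarrow> f i summable_on A"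
 shows "(%k. \<Sum>i\<in>I. f i k) summable_on A" "(\<Sum>\<^sub>\<infinity>k\<in>A. \<Sum>i\<in>I. f i k) = (\<Sum>i\<in>I. infsum (f i) A)"
proof -
 have "(%k. \<Sum>i\<in>I. f i k) summable_on A \<and> (\<Sum>\<^sub>\<infinity>k\<in>A. \<Sum>i\<in>I. f i k) = (\<Sum>i\<in>I. infsum (f i) A)"
  using assms
 proof (induction I rule: finite_induct)
  case (insert x I)
  then show ?case by (simp add: infsum_add summable_on_add)
 qed simp
 then show "(%k. \<Sum>i\<in>I. f i k) summable_on A" "(\<Sum>\<^sub>\<infinity>k\<in>A. \<Sum>i\<in>I. f i k) = (\<Sum>i\<in>I. infsum (f i) A)"
  by blast+
qed

lemma ell2_sum:
 fixes c :: "'i \<Rightarrow> 'k \<Rightarrow> 'a::real_normed_vector"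
 assumes "finite I" "\<And>i. i \<in> I \<Longrightarrow> ell2 (c i)"
 shows "ell2 (%k. \<Sum>i\<in>I. c i k)" "ell2_norm (%k. \<Sum>i\<in>I. c i k) \<le> (\<Sum>i\<in>I. ell2_norm (c i))"
proof -
 have "ell2 (%k. \<Sum>i\<in>I. c i k) \<and> ell2_norm (%k. \<Sum>i\<in>I. c i k) \<le> (\<Sum>i\<in>I. ell2_norm (c i))"
  using assms
 proof (induction I rule: finite_induct)
  case (insert x I)
  then have "ell2 (c x)" "ell2 (%k. \<Sum>i\<in>I. c i k)" "ell2_norm (%k. \<Sum>i\<in>I. c i k) \<le> (\<Sum>i\<in>I. ell2_norm (c i))"
   by auto
  with ell2_add[of "c x" "%k. \<Sum>i\<in>I. c i k"] insert(1,2) show ?case by auto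
 qed simp
 then show "ell2 (%k. \<Sum>i\<in>I. c i k)" "ell2_norm (%k. \<Sum>i\<in>I. c i k) \<le> (\<Sum>i\<in>I. ell2_norm (c i))"
  by blast+
qed

lemma ell2_norm_component:
 fixes c :: "'k \<Rightarrow> 'a::real_normed_vector"
 shows "ell2 (%k. norm (c k)) = ell2 c" "ell2_norm (%k. norm (c k)) = ell2_norm c"
 by (simp_all add: ell2_def ell2_norm_def)

lemma infsum_translate:
 fixes f :: "'k::ab_group_add \<Rightarrow> 'a::{topological_comm_monoid_add,t2_space}"
 shows "(\<Sum>\<^sub>\<infinity>l. f (k - l)) = (\<Sum>\<^sub>\<infinity>l. f l)" "(%l. f (k - l)) summable_on UNIV \<longleftrightarrow> f summable_on UNIV"
  "(\<Sum>\<^sub>\<infinity>l. f (l - k)) = (\<Sum>\<^sub>\<infinity>l. f l)" "(%l. f (l - k)) summable_on UNIV \<longleftrightarrow> f summable_on UNIV"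
  "(\<Sum>\<^sub>\<infinity>l. f (- l)) = (\<Sum>\<^sub>\<infinity>l. f l)" "(%l. f (- l)) summable_on UNIV \<longleftrightarrow> f summable_on UNIV"
proof -
 have b1: "bij_betw (%l. k - l) UNIV UNIV" by (rule bij_betwI[where g="%l. k - l"]) auto
 have b2: "bij_betw (%l. l - k) UNIV UNIV" by (rule bij_betwI[where g="%l. l + k"]) auto
 have b3: "bij_betw (%l::'k. - l) UNIV UNIV" by (rule bij_betwI[where g="%l. - l"]) auto
 show "(\<Sum>\<^sub>\<infinity>l. f (k - l)) = (\<Sum>\<^sub>\<infinity>l. f l)" "(%l. f (k - l)) summable_on UNIV \<longleftrightarrow> f summable_on UNIV"
  using infsum_reindex_bij_betw[OF b1, of f] summable_on_reindex_bij_betw[OF b1, of f] by auto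
 show "(\<Sum>\<^sub>\<infinity>l. f (l - k)) = (\<Sum>\<^sub>\<infinity>l. f l)" "(%l. f (l - k)) summable_on UNIV \<longleftrightarrow> f summable_on UNIV"
  using infsum_reindex_bij_betw[OF b2, of f] summable_on_reindex_bij_betw[OF b2, of f] by auto
 show "(\<Sum>\<^sub>\<infinity>l. f (- l)) = (\<Sum>\<^sub>\<infinity>l. f l)" "(%l. f (- l)) summable_on UNIV \<longleftrightarrow> f summable_on UNIV"
  using infsum_reindex_bij_betw[OF b3, of f] summable_on_reindex_bij_betw[OF b3, of f] by auto
qed

lemma infsum_diff:
 fixes f g :: "'k \<Rightarrow> 'a::real_normed_vector"
 assumes "f summable_on A" "g summable_on A"
 shows "(\<Sum>\<^sub>\<infinity>x\<in>A. f x - g x) = infsum f A - infsum g A"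
 using infsum_add[OF assms(1) summable_on_uminus[THEN iffD2, OF assms(2)]] by (simp add: infsum_uminus)

section \<open>Divergence and Leray projection on a single Fourier mode\<close>

lemma norm_vec_le_sum: "norm (z :: 'a::real_normed_vector^'n::finite) \<le> (\<Sum>i\<in>UNIV. norm (z $ i))"
 unfolding norm_vec_def by (rule L2_set_le_sum) simp

lemma cdot_le: 
 fixes x :: "real^'n::finite" and z :: "complex^'n"
 shows "norm (\<Sum>j\<in>UNIV. of_real (x $ j) * z $ j) \<le> norm x * norm z"
proof -
 have "norm (\<Sum>j\<in>UNIV. of_real (x $ j) * z $ j) \<le> (\<Sum>j\<in>UNIV. \<bar>x $ j\<bar> * \<bar>norm (z $ j)\<bar>)"
  by (rule order_trans[OF norm_sum]) (simp add: norm_mult)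
 also have "\<dots> \<le> L2_set (%j. x $ j) UNIV * L2_set (%j. norm (z $ j)) UNIV"
  by (rule L2_set_mult_ineq)
 also have "L2_set (%j. x $ j) UNIV = norm x" by (simp add: norm_vec_def L2_set_def)
 finally show ?thesis by (simp add: norm_vec_def)
qed

text \<open>The pairing is without conjugation: up to the factor i, \<open>cdot x z\<close> is the
  divergence of the mode with wave vector x and amplitude z.\<close>

definition cdot :: "real^3 \<Rightarrow> complex^3 \<Rightarrow> complex" where
 "cdot x z = (\<Sum>j\<in>UNIV. of_real (x $ j) * z $ j)"

lemma cdot_linear:
 "cdot x (y + z) = cdot x y + cdot x z" "cdot x (y - z) = cdot x y - cdot x z"
 "cdot x (r *\<^sub>R z) = r *\<^sub>R cdot x z" "cdot x 0 = 0"
 "cdot (- w) z = - cdot w z" "cdot (w - w') z = cdot w z - cdot w' z"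
 by (simp_all add: cdot_def sum.distrib sum_subtractf algebra_simps scaleR_sum_right sum_negf)

lemma bounded_linear_cdot: "bounded_linear (cdot x)"
proof (rule bounded_linear_intro[where K="norm x"])
 show "norm (cdot x z) \<le> norm z * norm x" for z
  using cdot_le[of x z] unfolding cdot_def by (simp only: mult.commute)
qed (simp_all only: cdot_linear)

definition vcnj :: "complex^3 \<Rightarrow> complex^3" where
 "vcnj z = (\<chi> j. cnj (z $ j))"

lemma vcnj_nth [simp]: "vcnj z $ j = cnj (z $ j)" by (simp add: vcnj_def)

lemma norm_vcnj [simp]: "norm (vcnj z) = norm z" by (simp add: norm_vec_def)

lemma bounded_linear_vcnj: "bounded_linear vcnj"
 by (rule bounded_linear_intro[where K=1]) (auto simp: vec_eq_iff)

text \<open>The Leray projection acting on one mode: it removes the component along the wave vector,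
  that is the gradient part. At x = 0 nothing is subtracted and the map is the identity.\<close>

definition leray :: "real^3 \<Rightarrow> complex^3 \<Rightarrow> complex^3" where
 "leray x z = (\<chi> i. z $ i - of_real (x $ i) * (cdot x z / of_real ((norm x)^2)))"

lemma sum_square_vec: "(\<Sum>i\<in>UNIV. x $ i * x $ i) = (norm (x::real^3))^2"
 by (simp add: power2_norm_eq_inner inner_vec_def)

lemma cdot_leray: "cdot x (leray x z) = 0"
proof (cases "x = 0")
 case False
 define s where "s = cdot x z / of_real ((norm x)^2)"
 have "cdot x (leray x z) = cdot x z - (\<Sum>i\<in>UNIV. of_real (x $ i * x $ i)) * s"
  unfolding leray_def s_def[symmetric]
  by (simp add: cdot_def right_diff_distrib sum_subtractf sum_distrib_right mult.assoc)
 also have "(\<Sum>i\<in>UNIV. complex_of_real (x $ i * x $ i)) = of_real ((norm x)^2)"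
  by (simp only: of_real_sum[symmetric] sum_square_vec)
 finally show ?thesis using False by (simp add: s_def)
qed (simp add: cdot_def)

text \<open>Cauchy-Schwarz bounds the removed component by the norm of \<open>z\<close>, and the
  triangle inequality then gives 2. The sharp constant would be 1; only finiteness matters
  below.\<close>

lemma norm_leray: "norm (leray x z) \<le> 2 * norm z"
proof (cases "x = 0")
 case True then have "leray x z = z" by (simp add: leray_def vec_eq_iff) then show ?thesis by simp
next
 case False
 define s where "s = cdot x z / of_real ((norm x)^2)"
 have ns: "norm s \<le> norm z / norm x"
 proof -
  have "norm s = norm (cdot x z) / (norm x)^2" by (simp add: s_def norm_divide norm_power)
  also have "\<dots> \<le> (norm x * norm z) / (norm x)^2"
   using cdot_le[of x z] by (intro divide_right_mono) (auto simp: cdot_def)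
  finally show ?thesis using False by (simp add: power2_eq_square)
 qed
 have "leray x z = z - (\<chi> i. of_real (x $ i) * s)" by (simp add: leray_def s_def vec_eq_iff)
 then have "norm (leray x z) \<le> norm z + norm (\<chi> i. of_real (x $ i) * s)"
  by (metis norm_triangle_ineq4)
 also have "norm ((\<chi> i. of_real (x $ i) * s) :: complex^3) = norm x * norm s"
  by (simp add: norm_vec_def norm_mult L2_set_right_distrib mult.commute[of _ "norm s"] L2_set_def)
    (simp add: power_mult_distrib sum_distrib_left[symmetric] real_sqrt_mult)
 also have "norm x * norm s \<le> norm z" using ns False by (simp add: field_simps)
 finally show ?thesis by simp
qed

lemma leray_linear:
 "leray x (y + z) = leray x y + leray x z" "leray x (y - z) = leray x y - leray x z"
 "leray x (r *\<^sub>R z) = r *\<^sub>R leray x z" "leray x 0 = 0"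
 by (simp_all add: leray_def cdot_linear vec_eq_iff add_divide_distrib diff_divide_distrib algebra_simps)
   (simp add: scaleR_conv_of_real algebra_simps)?

lemma bounded_linear_leray: "bounded_linear (leray x)"
 by (rule bounded_linear_intro[where K=2])
   (use norm_leray[of x] in \<open>auto simp: leray_linear mult.commute\<close>)

lemma cdot_vcnj: "cdot (- x) (vcnj z) = - cnj (cdot x z)"
 by (simp add: cdot_def sum_negf)

lemma leray_vcnj: "leray (- x) (vcnj z) = vcnj (leray x z)"
 by (simp add: leray_def vec_eq_iff cdot_vcnj)

lemma leray_id: "cdot x z = 0 \<Longrightarrow> leray x z = z"
 by (simp add: leray_def vec_eq_iff)

lemma inner_complex_Re: "(z::complex) \<bullet> w = Re (z * cnj w)"
 by (simp add: inner_complex_def)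

lemma inner_complex_of_real: "(of_real r * z) \<bullet> w = r * (z \<bullet> (w::complex))" "z \<bullet> (of_real r * w) = r * (z \<bullet> (w::complex))"
 by (simp_all add: inner_complex_def algebra_simps)

text \<open>The removed part is parallel to \<open>x\<close> and hence orthogonal to a
  divergence-free amplitude. This lets the projection, and with it the pressure, drop out of the
  energy.\<close>

lemma leray_inner: "cdot x u = 0 \<Longrightarrow> leray x z \<bullet> u = z \<bullet> u"
proof -
 assume u: "cdot x u = 0"
 define s where "s = cdot x z / of_real ((norm x)^2)"
 have "leray x z \<bullet> u = z \<bullet> u - (\<Sum>i\<in>UNIV. (of_real (x $ i) * s) \<bullet> u $ i)"
  unfolding leray_def s_def[symmetric]
  by (simp add: inner_vec_def inner_diff_left sum_subtractf)
 also have "(\<Sum>i\<in>UNIV. (of_real (x $ i) * s) \<bullet> u $ i) = s \<bullet> cdot x u"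
  by (simp add: cdot_def inner_sum_right inner_complex_of_real)
 finally show ?thesis using u by simp
qed

text \<open>What the analysis on coefficients uses of the torus: wave vectors \<kappa> additive on a
  countable group, a spectral gap \<theta> that provides Poincare's inequality, and the summability
  of 1 / |k|^4. \<open>D\<close> stands for the deconvolution symbol, even and between 1 and
  \<open>dmax\<close>.\<close>

locale fourier_model =
 fixes \<kappa> :: "'k::{countable,ab_group_add} \<Rightarrow> real^3" and \<alpha> \<nu> T \<theta> dmax :: real and D :: "'k \<Rightarrow> real"
 assumes kappa_add: "\<kappa> (k + l) = \<kappa> k + \<kappa> l"
  and theta: "\<theta> > 0" "k \<noteq> 0 \<Longrightarrow> \<theta> \<le> (norm (\<kappa> k))^2"
  and summable4: "(%k. 1 / (norm (\<kappa> k)) ^ 4) summable_on UNIV"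
  and pos: "\<alpha> > 0" "\<nu> > 0" "T > 0"
  and D: "1 \<le> D k" "D k \<le> dmax" "D (- k) = D k"
begin

lemma kappa_0 [simp]: "\<kappa> 0 = 0" using kappa_add[of 0 0] by simp
lemma kappa_minus [simp]: "\<kappa> (- k) = - \<kappa> k" using kappa_add[of k "- k"] by (simp add: eq_neg_iff_add_eq_0 add.commute)
lemma kappa_diff: "\<kappa> (k - l) = \<kappa> k - \<kappa> l" using kappa_add[of k "- l"] by simp

lemma kappa_pos: "k \<noteq> 0 \<Longrightarrow> norm (\<kappa> k) > 0"
 using theta(1) theta(2)[of k] by (cases "\<kappa> k = 0") auto

definition lam :: "'k \<Rightarrow> real" where "lam k = (norm (\<kappa> k))^2"

lemma lam_0 [simp]: "lam 0 = 0" and lam_minus [simp]: "lam (- k) = lam k" and lam_nonneg [simp]: "lam k \<ge> 0"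
 by (simp_all add: lam_def)

lemma lam_pos: "k \<noteq> 0 \<Longrightarrow> lam k > 0" using kappa_pos by (simp add: lam_def)

lemma lam_ge: "k \<noteq> 0 \<Longrightarrow> \<theta> \<le> lam k" using theta by (simp add: lam_def)

definition gsym :: "'k \<Rightarrow> real" where "gsym k = 1 / (1 + \<alpha>^2 * lam k)"

lemma gsym_pos: "gsym k > 0" and gsym_le: "gsym k \<le> 1" and gsym_lam: "gsym k * lam k \<le> 1 / \<alpha>^2"
 and gsym_minus [simp]: "gsym (- k) = gsym k"
proof -
 have "1 + \<alpha>^2 * lam k > 0" by (intro add_pos_nonneg) auto
 then show "gsym k > 0" "gsym k \<le> 1" "gsym k * lam k \<le> 1 / \<alpha>^2"
  using pos by (auto simp: gsym_def field_simps)
qed (simp add: gsym_def)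

lemma dmax_pos: "dmax > 0" using D(1)[of 0] D(2)[of 0] by linarith
lemma D_pos: "D k > 0" using D(1)[of k] by linarith

definition h1w :: "('k \<Rightarrow> 'a::real_normed_vector) \<Rightarrow> 'k \<Rightarrow> 'a" where "h1w c = (%k. norm (\<kappa> k) *\<^sub>R c k)"
text \<open>The weight vanishes at the zero mode, so a zero mean has to be demanded separately for
  \<open>h1n\<close> to control every coefficient.\<close>

definition h1 :: "('k \<Rightarrow> 'a::real_normed_vector) \<Rightarrow> bool" where "h1 c \<longleftrightarrow> c 0 = 0 \<and> ell2 (h1w c)"
definition h1n :: "('k \<Rightarrow> 'a::real_normed_vector) \<Rightarrow> real" where "h1n c = ell2_norm (h1w c)"

lemma h1n_nonneg [simp]: "h1n c \<ge> 0" by (simp add: h1n_def)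

lemma h1n_square: "(h1n c)^2 = (\<Sum>\<^sub>\<infinity>k. lam k * (norm (c k))^2)"
 by (simp add: h1n_def ell2_norm_square h1w_def lam_def power_mult_distrib)

lemma h1_iff: "h1 c \<longleftrightarrow> c 0 = 0 \<and> (%k. lam k * (norm (c k))^2) summable_on UNIV"
 by (simp add: h1_def ell2_def h1w_def lam_def power_mult_distrib)

lemma h1_add: "h1 c \<Longrightarrow> h1 d \<Longrightarrow> h1 (%k. c k + d k)"
 and h1n_add: "h1 c \<Longrightarrow> h1 d \<Longrightarrow> h1n (%k. c k + d k) \<le> h1n c + h1n d"
 using ell2_add[of "h1w c" "h1w d"] by (auto simp: h1_def h1n_def h1w_def scaleR_add_right)

lemma h1_diff: "h1 c \<Longrightarrow> h1 d \<Longrightarrow> h1 (%k. c k - d k)"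
 and h1n_diff: "h1 c \<Longrightarrow> h1 d \<Longrightarrow> h1n (%k. c k - d k) \<le> h1n c + h1n d"
 using ell2_diff[of "h1w c" "h1w d"] by (auto simp: h1_def h1n_def h1w_def scaleR_diff_right)

lemma h1n_minus_commute: "h1n (%k. c k - d k) = h1n (%k. d k - c k)"
 using ell2_minus_commute[of "h1w c" "h1w d"] by (simp add: h1n_def h1w_def scaleR_diff_right)

lemma h1_scaleR: "h1 c \<Longrightarrow> h1 (%k. r *\<^sub>R c k)" and h1n_scaleR: "h1n (%k. r *\<^sub>R c k) = \<bar>r\<bar> * h1n c"
 using ell2_scaleR[where c="h1w c" and r=r] by (auto simp: h1_def h1n_def h1w_def scaleR_left_commute mult.commute)

lemma h1_mono:
 assumes "h1 d" "\<And>k. norm (c k) \<le> C * norm (d k)" "C \<ge> 0"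
 shows "h1 c" "h1n c \<le> C * h1n d"
proof -
 have *: "norm (h1w c k) \<le> norm (C *\<^sub>R h1w d k)" for k
  using mult_left_mono[OF assms(2)[of k], of "norm (\<kappa> k)"] assms(3) by (simp add: h1w_def mult_ac)
 have e: "ell2 (%k. C *\<^sub>R h1w d k)" using assms(1) by (auto simp: h1_def intro: ell2_scaleR)
 have "c 0 = 0" using assms(1) assms(2)[of 0] by (simp add: h1_def)
 then show "h1 c" using ell2_mono(1)[OF e *] by (simp add: h1_def)
 show "h1n c \<le> C * h1n d" using ell2_mono(2)[OF e *] assms(3) by (simp add: h1n_def ell2_scaleR(2))
qed

lemma h1_component: "h1 c \<Longrightarrow> norm (\<kappa> k) * norm (c k) \<le> h1n c"
 using ell2_component_le[of "h1w c" k] by (simp add: h1_def h1n_def h1w_def)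

text \<open>Poincare's inequality: the squared weight is at least \<theta> off the zero mode, and
  the zero mode is absent.\<close>

lemma h1_imp_ell2:
 assumes "h1 c" shows "ell2 c" "(ell2_norm c)^2 \<le> (h1n c)^2 / \<theta>"
proof -
 have s: "(%k. lam k * (norm (c k))^2 / \<theta>) summable_on UNIV"
  using assms unfolding h1_iff by (auto intro: summable_on_cmult_left simp: divide_inverse)
 have le: "(norm (c k))^2 \<le> lam k * (norm (c k))^2 / \<theta>" for k
 proof (cases "k = 0")
  case True then show ?thesis using assms by (simp add: h1_def)
 next
  case False then show ?thesis using lam_ge[OF False] theta(1) by (simp add: field_simps mult_right_mono)
 qed
 then show "ell2 c" using infsum_comparison(1)[OF s, of "%k. (norm (c k))^2"] by (simp add: ell2_def)
 have "(ell2_norm c)^2 \<le> (\<Sum>\<^sub>\<infinity>k. lam k * (norm (c k))^2 / \<theta>)"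
  using infsum_comparison(2)[OF s, of "%k. (norm (c k))^2"] le by (simp add: ell2_norm_square)
 then show "(ell2_norm c)^2 \<le> (h1n c)^2 / \<theta>"
  by (simp add: h1n_square divide_inverse infsum_cmult_left')
qed

section \<open>Convolutions and the bilinear term\<close>

definition S4 :: real where "S4 = (\<Sum>\<^sub>\<infinity>k. 1 / (norm (\<kappa> k)) ^ 4)"

lemma S4_nonneg: "S4 \<ge> 0" unfolding S4_def by (rule infsum_nonneg) simp

definition conv :: "('k \<Rightarrow> complex) \<Rightarrow> ('k \<Rightarrow> complex) \<Rightarrow> 'k \<Rightarrow> complex" where
 "conv a b k = (\<Sum>\<^sub>\<infinity>l. a l * b (k - l))"

text \<open>Cauchy--Schwarz against the weight \<open>1 / (\<bar>l\<bar> \<bar>k - l\<bar>)\<close>, which is square summable in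
 \<open>l\<close> uniformly in \<open>k\<close> because \<open>2 / (x y) \<le> 1 / x^2 + 1 / y^2\<close>.\<close>

lemma conv_pointwise:
 fixes a b :: "'k \<Rightarrow> complex"
 assumes a: "h1 a" and b: "h1 b"
 shows "(%l. norm (a l) * norm (b (k - l))) summable_on UNIV"
  "(%l. (norm (h1w a l) * norm (h1w b (k - l)))^2) summable_on UNIV"
  "(\<Sum>\<^sub>\<infinity>l. norm (a l) * norm (b (k - l)))^2 \<le> S4 * (\<Sum>\<^sub>\<infinity>l. (norm (h1w a l) * norm (h1w b (k - l)))^2)"
proof -
 define u where "u l = 1 / (norm (\<kappa> l) * norm (\<kappa> (k - l)))" for l
 define v where "v l = norm (h1w a l) * norm (h1w b (k - l))" for l
 have s1: "(%l. (1 / norm (\<kappa> l) ^ 4 + 1 / norm (\<kappa> (k - l)) ^ 4) / 2) summable_on UNIV"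
  unfolding divide_inverse[of _ 2]
  by (intro summable_on_cmult_left summable_on_add summable4)
    (use infsum_translate(2)[where f="%l. 1 / norm (\<kappa> l) ^ 4" and k=k] summable4 in simp)
 have ule: "(u l)^2 \<le> (1 / norm (\<kappa> l) ^ 4 + 1 / norm (\<kappa> (k - l)) ^ 4) / 2" for l
 proof -
  have "(u l)^2 = (1 / (norm (\<kappa> l))^2) * (1 / (norm (\<kappa> (k - l)))^2)"
   by (simp add: u_def power_mult_distrib power_divide)
  also have "\<dots> \<le> ((1 / (norm (\<kappa> l))^2)^2 + (1 / (norm (\<kappa> (k - l)))^2)^2) / 2"
   using sum_squares_bound[of "1 / (norm (\<kappa> l))^2" "1 / (norm (\<kappa> (k - l)))^2"] by simp
  also have "\<dots> = (1 / norm (\<kappa> l) ^ 4 + 1 / norm (\<kappa> (k - l)) ^ 4) / 2"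
   by (simp add: power_divide flip: power_mult)
  finally show ?thesis .
 qed
 have u: "ell2 u" "(ell2_norm u)^2 \<le> S4"
 proof -
  show "ell2 u" using infsum_comparison(1)[OF s1, of "%l. (u l)^2"] ule by (simp add: ell2_def)
  have "(ell2_norm u)^2 \<le> (\<Sum>\<^sub>\<infinity>l. (1 / norm (\<kappa> l) ^ 4 + 1 / norm (\<kappa> (k - l)) ^ 4) / 2)"
   using infsum_comparison(2)[OF s1, of "%l. (u l)^2"] ule by (simp add: ell2_norm_square)
  also have "\<dots> = (\<Sum>\<^sub>\<infinity>l. 1 / norm (\<kappa> l) ^ 4 + 1 / norm (\<kappa> (k - l)) ^ 4) / 2"
   unfolding divide_inverse[of _ 2] by (rule infsum_cmult_left')
  also have "(\<Sum>\<^sub>\<infinity>l. 1 / norm (\<kappa> l) ^ 4 + 1 / norm (\<kappa> (k - l)) ^ 4) = S4 + S4"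
   unfolding S4_def
   by (subst infsum_add)
     (use infsum_translate(1,2)[where f="%l. 1 / norm (\<kappa> l) ^ 4" and k=k] summable4 in simp_all)
  finally show "(ell2_norm u)^2 \<le> S4" by simp
 qed
 have bb: "norm (h1w b j) \<le> h1n b" for j
  using ell2_component_le[of "h1w b" j] b by (simp add: h1_def h1n_def)
 have v: "ell2 v"
 proof (rule ell2_mono(1))
  show "ell2 (%l. h1n b *\<^sub>R h1w a l)" using a by (auto simp: h1_def intro: ell2_scaleR)
  show "norm (v l) \<le> norm (h1n b *\<^sub>R h1w a l)" for l
   using mult_left_mono[OF bb[of "k - l"], of "norm (h1w a l)"] by (simp add: v_def abs_mult mult.commute)
 qed
 then show "(%l. (norm (h1w a l) * norm (h1w b (k - l)))^2) summable_on UNIV"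
  by (simp add: ell2_def v_def)
 \<comment> \<open>If l = 0 or l = k, both sides vanish because \<open>h1\<close> forces a 0 = b 0 =
   0; elsewhere the weights cancel.\<close>
 have eq: "norm (a l) * norm (b (k - l)) = norm (u l) * norm (v l)" for l
 proof (cases "l = 0 \<or> k - l = 0")
  case True
  have "a 0 = 0" "b 0 = 0" using a b by (auto simp: h1_def)
  with True show ?thesis by (auto simp: v_def h1w_def)
 next
  case False
  then have "norm (\<kappa> l) > 0" "norm (\<kappa> (k - l)) > 0" using kappa_pos by auto
  then show ?thesis by (simp add: u_def v_def h1w_def abs_mult field_simps)
 qed
 show "(%l. norm (a l) * norm (b (k - l))) summable_on UNIV"
  unfolding eq by (rule ell2_Cauchy_Schwarz(1)[OF u(1) v])
 have "(\<Sum>\<^sub>\<infinity>l. norm (a l) * norm (b (k - l)))^2 \<le> (ell2_norm u * ell2_norm v)^2"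
  unfolding eq by (intro power_mono ell2_Cauchy_Schwarz(2)[OF u(1) v] infsum_nonneg) auto
 also have "\<dots> \<le> S4 * (ell2_norm v)^2"
  unfolding power_mult_distrib by (intro mult_right_mono u) simp
 finally show "(\<Sum>\<^sub>\<infinity>l. norm (a l) * norm (b (k - l)))^2 \<le> S4 * (\<Sum>\<^sub>\<infinity>l. (norm (h1w a l) * norm (h1w b (k - l)))^2)"
  by (simp add: ell2_norm_square v_def)
qed

text \<open>Summing the pointwise bound over k and exchanging the sums, the inner sum of |b(k -
  l)|^2 with its weight is bounded by the square of \<open>h1n b\<close>, whatever l is. The
  statement keeps norms inside the series since it also majorizes the double sum of the energy
  cancellation.\<close>

lemma conv_norms_ell2:
 fixes a b :: "'k \<Rightarrow> complex"
 assumes a: "h1 a" and b: "h1 b"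
 shows "ell2 (%k. \<Sum>\<^sub>\<infinity>l. norm (a l) * norm (b (k - l)))"
  "ell2_norm (%k. \<Sum>\<^sub>\<infinity>l. norm (a l) * norm (b (k - l))) \<le> sqrt S4 * h1n a * h1n b"
proof -
 let ?c = "%k. \<Sum>\<^sub>\<infinity>l. norm (a l) * norm (b (k - l))"
 have "L2_set (%k. norm (?c k)) A \<le> sqrt S4 * h1n a * h1n b" if A: "finite A" for A
 proof -
  note cp = conv_pointwise[OF a b]
  have ea: "(%l. (norm (h1w a l))^2) summable_on UNIV" using a by (simp add: h1_def ell2_def)
  have "(\<Sum>k\<in>A. (norm (?c k))^2) \<le> (\<Sum>k\<in>A. S4 * (\<Sum>\<^sub>\<infinity>l. (norm (h1w a l) * norm (h1w b (k - l)))^2))"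
   by (intro sum_mono) (use cp(3) in simp)
  also have "\<dots> = S4 * (\<Sum>\<^sub>\<infinity>l. \<Sum>k\<in>A. (norm (h1w a l) * norm (h1w b (k - l)))^2)"
   unfolding sum_distrib_left[symmetric]
   by (subst infsum_finite_sum(2)[OF A]) (use cp(2) in auto)
  also have "\<dots> \<le> S4 * (\<Sum>\<^sub>\<infinity>l. (norm (h1w a l))^2 * (h1n b)^2)"
  proof (intro mult_left_mono infsum_mono S4_nonneg)
   show "(%l. \<Sum>k\<in>A. (norm (h1w a l) * norm (h1w b (k - l)))^2) summable_on UNIV"
    by (rule infsum_finite_sum(1)[OF A]) (use cp(2) in auto)
   show "(%l. (norm (h1w a l))^2 * (h1n b)^2) summable_on UNIV"
    by (rule summable_on_cmult_left[OF ea])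
   fix l
   have "(\<Sum>k\<in>A. (norm (h1w b (k - l)))^2) = (\<Sum>k\<in>(%k. k - l) ` A. (norm (h1w b k))^2)"
    by (subst sum.reindex) (auto simp: inj_on_def)
   also have "\<dots> \<le> (h1n b)^2"
    unfolding h1n_def by (rule ell2_finite_sum_le) (use b A in \<open>auto simp: h1_def\<close>)
   finally have "(\<Sum>k\<in>A. (norm (h1w b (k - l)))^2) \<le> (h1n b)^2" .
   then show "(\<Sum>k\<in>A. (norm (h1w a l) * norm (h1w b (k - l)))^2) \<le> (norm (h1w a l))^2 * (h1n b)^2"
    by (simp add: power_mult_distrib sum_distrib_left[symmetric] mult_left_mono)
  qed
  also have "\<dots> = S4 * ((h1n a)^2 * (h1n b)^2)"
   unfolding infsum_cmult_left' by (simp add: h1n_def ell2_norm_square)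
  also have "\<dots> = (sqrt S4 * h1n a * h1n b)^2"
   using S4_nonneg by (simp add: power_mult_distrib)
  finally show ?thesis
   unfolding L2_set_def by (intro real_le_lsqrt) (auto intro: sum_nonneg simp: S4_nonneg)
 qed
 from ell2_bounded[OF this] show "ell2 ?c" "ell2_norm ?c \<le> sqrt S4 * h1n a * h1n b" by auto
qed

lemma conv_summable:
 assumes "h1 a" "h1 b"
 shows "(%l. norm (a l * b (k - l))) summable_on UNIV" "(%l. a l * b (k - l)) summable_on UNIV"
  "norm (conv a b k) \<le> (\<Sum>\<^sub>\<infinity>l. norm (a l) * norm (b (k - l)))"
proof -
 show *: "(%l. norm (a l * b (k - l))) summable_on UNIV"
  using conv_pointwise(1)[OF assms, of k] by (simp add: norm_mult)
 then show "(%l. a l * b (k - l)) summable_on UNIV" by (rule abs_summable_summable)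
 show "norm (conv a b k) \<le> (\<Sum>\<^sub>\<infinity>l. norm (a l) * norm (b (k - l)))"
  unfolding conv_def using norm_infsum_bound[OF *] by (simp add: norm_mult)
qed

lemma conv_ell2:
 assumes "h1 a" "h1 b"
 shows "ell2 (conv a b)" "ell2_norm (conv a b) \<le> sqrt S4 * h1n a * h1n b"
proof -
 have nn: "(\<Sum>\<^sub>\<infinity>l. norm (a l) * norm (b (k - l))) \<ge> 0" for k by (intro infsum_nonneg) auto
 have le: "norm (conv a b k) \<le> norm (\<Sum>\<^sub>\<infinity>l. norm (a l) * norm (b (k - l)))" for k
  using conv_summable(3)[OF assms, of k] nn[of k] by simp
 note m = ell2_mono[OF conv_norms_ell2(1)[OF assms], of "conv a b", OF le]
 show "ell2 (conv a b)" by (rule m)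
 show "ell2_norm (conv a b) \<le> sqrt S4 * h1n a * h1n b" using m(2) conv_norms_ell2(2)[OF assms] by linarith
qed

lemma conv_diff:
 assumes "h1 a" "h1 a'" "h1 b"
 shows "conv (%k. a k - a' k) b k = conv a b k - conv a' b k"
  and "conv b (%k. a k - a' k) k = conv b a k - conv b a' k"
 unfolding conv_def using conv_summable(2) assms
 by (simp_all add: left_diff_distrib right_diff_distrib infsum_diff)

lemma conv_scaleR: "conv (%k. r *\<^sub>R a k) (%k. r' *\<^sub>R b k) k = (r * r') *\<^sub>R conv a b k"
 unfolding conv_def by (simp add: infsum_scaleR_right)

lemma conv_cnj:
 assumes "\<And>k. a (- k) = cnj (a k)" "\<And>k. b (- k) = cnj (b k)"
 shows "conv a b (- k) = cnj (conv a b k)"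
proof -
 have "conv a b (- k) = (\<Sum>\<^sub>\<infinity>l. a (- l) * b (- k - (- l)))"
  unfolding conv_def by (rule infsum_translate(5)[symmetric])
 also have "\<dots> = (\<Sum>\<^sub>\<infinity>l. cnj (a l * b (k - l)))"
  by (rule infsum_cong) (use assms(1) assms(2)[of "k - _"] in \<open>simp add: minus_diff_commute\<close>)
 also have "\<dots> = cnj (conv a b k)" unfolding conv_def by (rule infsum_cnj)
 finally show ?thesis .
qed

definition dec :: "('k \<Rightarrow> complex^3) \<Rightarrow> 3 \<Rightarrow> 'k \<Rightarrow> complex" where
 "dec c i k = D k *\<^sub>R c k $ i"

lemma dec_h1: "h1 c \<Longrightarrow> h1 (dec c i)" "h1 c \<Longrightarrow> h1n (dec c i) \<le> dmax * h1n c"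
proof -
 have le: "norm (dec c i k) \<le> dmax * norm (c k)" for k
 proof -
  have "norm (c k $ i) \<le> norm (c k)" by (rule Finite_Cartesian_Product.norm_nth_le)
  then show ?thesis using D(2)[of k] D_pos[of k] dmax_pos by (simp add: dec_def mult_mono)
 qed
 show "h1 c \<Longrightarrow> h1 (dec c i)" "h1 c \<Longrightarrow> h1n (dec c i) \<le> dmax * h1n c"
  using h1_mono[OF _ le] dmax_pos by auto
qed

lemma dec_linear: "dec (%k. c k - d k) i = (%k. dec c i k - dec d i k)" "dec (%k. r *\<^sub>R c k) i = (%k. r *\<^sub>R dec c i k)"
 by (auto simp: dec_def scaleR_diff_right)

definition tens :: "('k \<Rightarrow> complex^3) \<Rightarrow> ('k \<Rightarrow> complex^3) \<Rightarrow> 3 \<Rightarrow> 3 \<Rightarrow> 'k \<Rightarrow> complex" where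
 "tens c d i j = conv (dec c i) (dec d j)"

text \<open>The coefficients of the divergence of the filtered tensor product of the two deconvolved
  fields, before the Leray projection.\<close>

definition flux :: "('k \<Rightarrow> complex^3) \<Rightarrow> ('k \<Rightarrow> complex^3) \<Rightarrow> 'k \<Rightarrow> complex^3" where
 "flux c d k = (\<chi> i. of_real (gsym k) * (\<Sum>j\<in>UNIV. \<i> * of_real (\<kappa> k $ j) * tens c d i j k))"

text \<open>One convolution bound for each of the nine tensor components; the factor 1 / \<alpha>^2
  is the bound for \<open>gsym k * lam k\<close>.\<close>

definition Kf :: real where "Kf = (\<Sum>i\<in>(UNIV::3 set). \<Sum>j\<in>(UNIV::3 set). sqrt S4 * dmax * dmax) / \<alpha>^2"

lemma Kf_nonneg: "Kf \<ge> 0"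
 unfolding Kf_def using S4_nonneg dmax_pos by (intro divide_nonneg_nonneg sum_nonneg mult_nonneg_nonneg) auto

lemma tens_ell2:
 assumes "h1 c" "h1 d"
 shows "ell2 (tens c d i j)" "ell2_norm (tens c d i j) \<le> sqrt S4 * dmax * dmax * h1n c * h1n d"
proof -
 show "ell2 (tens c d i j)" unfolding tens_def by (intro conv_ell2 dec_h1 assms)
 have "ell2_norm (tens c d i j) \<le> sqrt S4 * h1n (dec c i) * h1n (dec d j)"
  unfolding tens_def by (intro conv_ell2 dec_h1 assms)
 also have "\<dots> \<le> sqrt S4 * (dmax * h1n c) * (dmax * h1n d)"
  using dmax_pos S4_nonneg by (intro mult_mono mult_nonneg_nonneg dec_h1 assms) auto
 finally show "ell2_norm (tens c d i j) \<le> sqrt S4 * dmax * dmax * h1n c * h1n d" by (simp add: mult_ac)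
qed

text \<open>One power of |k| comes from the divergence and one from the H_1 norm. Together they are
  \<open>lam k\<close>, which \<open>gsym k\<close> compensates up to 1 / \<alpha>^2, and square
  summability of the convolutions remains.\<close>

lemma flux_h1:
 assumes "h1 c" "h1 d"
 shows "h1 (flux c d)" "h1n (flux c d) \<le> Kf * h1n c * h1n d"
proof -
 define s where "s k = (\<Sum>i\<in>UNIV. \<Sum>j\<in>UNIV. norm (tens c d i j k))" for k
 have es: "ell2 s" unfolding s_def
  by (intro ell2_sum) (auto simp: ell2_norm_component tens_ell2[OF assms])
 have "ell2_norm s \<le> (\<Sum>i\<in>UNIV. ell2_norm (%k. \<Sum>j\<in>UNIV. norm (tens c d i j k)))"
  unfolding s_def by (intro ell2_sum) (auto simp: ell2_norm_component tens_ell2[OF assms] intro!: ell2_sum)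
 also have "\<dots> \<le> (\<Sum>i\<in>UNIV. \<Sum>j\<in>UNIV. ell2_norm (%k. norm (tens c d i j k)))"
  by (intro sum_mono ell2_sum) (auto simp: ell2_norm_component tens_ell2[OF assms])
 also have "\<dots> \<le> (\<Sum>i\<in>(UNIV::3 set). \<Sum>j\<in>(UNIV::3 set). sqrt S4 * dmax * dmax * h1n c * h1n d)"
  by (intro sum_mono) (simp add: ell2_norm_component tens_ell2[OF assms])
 also have "\<dots> = \<alpha>^2 * (Kf * h1n c * h1n d)"
  unfolding Kf_def using pos by (simp add: sum_distrib_right[symmetric])
 finally have ns: "ell2_norm s \<le> \<alpha>^2 * (Kf * h1n c * h1n d)" .
 have le: "norm (h1w (flux c d) k) \<le> norm ((1 / \<alpha>^2) *\<^sub>R s k)" for k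
 proof -
  have s0: "s k \<ge> 0" unfolding s_def by (intro sum_nonneg) auto
  have "norm (flux c d k) \<le> (\<Sum>i\<in>UNIV. norm (flux c d k $ i))" by (rule norm_vec_le_sum)
  also have "\<dots> \<le> (\<Sum>i\<in>UNIV. gsym k * (\<Sum>j\<in>UNIV. norm (\<kappa> k) * norm (tens c d i j k)))"
  proof (intro sum_mono)
   fix i
   have "norm (flux c d k $ i) = gsym k * norm (\<Sum>j\<in>UNIV. \<i> * of_real (\<kappa> k $ j) * tens c d i j k)"
    using gsym_pos[of k] by (simp add: flux_def norm_mult)
   also have "\<dots> \<le> gsym k * (\<Sum>j\<in>UNIV. norm (\<kappa> k) * norm (tens c d i j k))"
    using gsym_pos[of k]
    by (intro mult_left_mono order_trans[OF norm_sum] sum_mono)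
      (auto simp: norm_mult intro!: mult_right_mono component_le_norm_cart)
   finally show "norm (flux c d k $ i) \<le> gsym k * (\<Sum>j\<in>UNIV. norm (\<kappa> k) * norm (tens c d i j k))" .
  qed
  also have "\<dots> = gsym k * norm (\<kappa> k) * s k"
   by (simp add: s_def sum_distrib_left mult_ac)
  finally have "norm (\<kappa> k) * norm (flux c d k) \<le> norm (\<kappa> k) * (gsym k * norm (\<kappa> k) * s k)"
   by (rule mult_left_mono) simp
  also have "\<dots> = (gsym k * lam k) * s k" by (simp add: lam_def power2_eq_square)
  also have "\<dots> \<le> 1 / \<alpha>^2 * s k" by (intro mult_right_mono gsym_lam s0)
  finally show ?thesis using s0 by (simp add: h1w_def)
 qed
 have e2: "ell2 (%k. (1 / \<alpha>^2) *\<^sub>R s k)" by (rule ell2_scaleR(1)[OF es])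
 have z: "flux c d 0 = 0" by (simp add: flux_def vec_eq_iff)
 show "h1 (flux c d)" using ell2_mono(1)[OF e2 le] z by (simp add: h1_def)
 have "h1n (flux c d) \<le> 1 / \<alpha>^2 * ell2_norm s"
  using ell2_mono(2)[OF e2 le] unfolding h1n_def ell2_scaleR(2) by simp
 also have "\<dots> \<le> 1 / \<alpha>^2 * (\<alpha>^2 * (Kf * h1n c * h1n d))" by (intro mult_left_mono ns) simp
 finally show "h1n (flux c d) \<le> Kf * h1n c * h1n d" using pos by simp
qed

definition Bn :: "('k \<Rightarrow> complex^3) \<Rightarrow> ('k \<Rightarrow> complex^3) \<Rightarrow> 'k \<Rightarrow> complex^3" where
 "Bn c d k = leray (\<kappa> k) (flux c d k)"

lemma Bn_h1:
 assumes "h1 c" "h1 d"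
 shows "h1 (Bn c d)" "h1n (Bn c d) \<le> 2 * Kf * h1n c * h1n d"
proof -
 note m = h1_mono[OF flux_h1(1)[OF assms], of "Bn c d" 2]
 show "h1 (Bn c d)" using m(1) norm_leray by (simp add: Bn_def)
 have "h1n (Bn c d) \<le> 2 * h1n (flux c d)" using m(2) norm_leray by (simp add: Bn_def)
 then show "h1n (Bn c d) \<le> 2 * Kf * h1n c * h1n d" using flux_h1(2)[OF assms] by simp
qed

lemma flux_diff:
 assumes "h1 c" "h1 c'" "h1 d"
 shows "flux (%k. c k - c' k) d k = flux c d k - flux c' d k"
  "flux d (%k. c k - c' k) k = flux d c k - flux d c' k"
 by (simp_all add: flux_def tens_def dec_linear conv_diff dec_h1 assms vec_eq_iff
   right_diff_distrib sum_subtractf)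

lemma flux_scaleR: "flux (%k. r *\<^sub>R c k) (%k. r' *\<^sub>R d k) k = (r * r') *\<^sub>R flux c d k"
 by (simp add: flux_def tens_def dec_linear conv_scaleR vec_eq_iff scaleR_sum_right[symmetric])

lemma Bn_difference:
 assumes "h1 c" "h1 d"
 shows "Bn c c k - Bn d d k = Bn (%k. c k - d k) c k + Bn d (%k. c k - d k) k"
 by (simp add: Bn_def flux_diff assms leray_linear)

lemma Bn_scaleR: "Bn (%k. r *\<^sub>R c k) (%k. r' *\<^sub>R d k) k = (r * r') *\<^sub>R Bn c d k"
 by (simp add: Bn_def flux_scaleR leray_linear)

definition real_field :: "('k \<Rightarrow> complex^3) \<Rightarrow> bool" where
 "real_field c \<longleftrightarrow> c 0 = 0 \<and> (\<forall>k. c (- k) = vcnj (c k)) \<and> (\<forall>k. cdot (\<kappa> k) (c k) = 0)"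

lemma real_field_scaleR: "real_field c \<Longrightarrow> real_field (%k. r *\<^sub>R c k)"
 by (auto simp: real_field_def cdot_linear vec_eq_iff)

lemma flux_cnj:
 assumes "real_field c" "real_field d" shows "flux c d (- k) = vcnj (flux c d k)"
proof -
 have t: "tens c d i j (- k) = cnj (tens c d i j k)" for i j
  unfolding tens_def by (rule conv_cnj) (use assms in \<open>auto simp: dec_def real_field_def D\<close>)
 show ?thesis by (simp add: flux_def vec_eq_iff t sum_negf)
qed

lemma Bn_real_field:
 assumes "real_field c" "real_field d" shows "real_field (Bn c d)"
 unfolding real_field_def
proof (intro conjI allI)
 show "Bn c d 0 = 0" by (simp add: Bn_def flux_def leray_def cdot_def vec_eq_iff)
 show "Bn c d (- k) = vcnj (Bn c d k)" for k
  using flux_cnj[OF assms, of k] leray_vcnj[of "\<kappa> k" "flux c d k"] by (simp add: Bn_def)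
 show "cdot (\<kappa> k) (Bn c d k) = 0" for k by (simp add: Bn_def cdot_leray)
qed

text \<open>The energy weight. Division by \<open>gsym\<close> cancels the filter inside
  \<open>flux\<close>, and the factor \<open>D\<close> moves onto the second argument of the inner
  product, which thereby becomes the deconvolved field.\<close>

definition \<gamma> :: "'k \<Rightarrow> real" where "\<gamma> k = D k / gsym k"

lemma gamma_pos: "\<gamma> k > 0" using D_pos gsym_pos by (simp add: \<gamma>_def)

lemma gamma_ge: "\<alpha>^2 * lam k \<le> \<gamma> k"
proof -
 have "0 \<le> \<alpha>^2 * lam k" by simp
 then have "1 * (1 + \<alpha>^2 * lam k) \<le> D k * (1 + \<alpha>^2 * lam k)"
  by (intro mult_right_mono D) auto
 then show ?thesis by (simp add: \<gamma>_def gsym_def)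
qed

text \<open>Off the zero mode 1 <= \<open>lam k / \<theta>\<close>, so the summand 1 in 1 +
  \<alpha>^2 |k|^2 costs 1 / \<theta>. With \<open>gamma_ge\<close> the weighted energy is
  comparable to the square of the H_1 norm.\<close>

definition Kg :: real where "Kg = dmax * (1 / \<theta> + \<alpha>^2)"

lemma Kg_nonneg: "Kg \<ge> 0"
 unfolding Kg_def using dmax_pos theta(1) by (intro mult_nonneg_nonneg add_nonneg_nonneg) auto

lemma gamma_le: "k \<noteq> 0 \<Longrightarrow> \<gamma> k \<le> Kg * lam k"
proof -
 assume k: "k \<noteq> 0"
 have l: "1 \<le> lam k / \<theta>" using lam_ge[OF k] theta(1) by simp
 have "\<gamma> k = D k * (1 + \<alpha>^2 * lam k)" by (simp add: \<gamma>_def gsym_def)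
 also have "\<dots> \<le> dmax * (lam k / \<theta> + \<alpha>^2 * lam k)"
  using l dmax_pos D_pos[of k] D(2)[of k] by (intro mult_mono add_mono) (auto intro: add_nonneg_nonneg)
 finally show ?thesis by (simp add: Kg_def algebra_simps)
qed

lemma gamma_inner_summable:
 assumes c: "h1 c" and d: "h1 d"
 shows "(%k. \<bar>\<gamma> k * (c k \<bullet> d k)\<bar>) summable_on UNIV" "(\<Sum>\<^sub>\<infinity>k. \<bar>\<gamma> k * (c k \<bullet> d k)\<bar>) \<le> Kg * (h1n c * h1n d)"
proof -
 have e: "ell2 (h1w c)" "ell2 (h1w d)" using c d by (auto simp: h1_def)
 have s: "(%k. Kg * (norm (h1w c k) * norm (h1w d k))) summable_on UNIV"
  by (rule summable_on_cmult_right[OF ell2_Cauchy_Schwarz(1)[OF e]])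
 have le: "\<bar>\<gamma> k * (c k \<bullet> d k)\<bar> \<le> Kg * (norm (h1w c k) * norm (h1w d k))" for k
 proof (cases "k = 0")
  case True then show ?thesis using c by (simp add: h1_def h1w_def)
 next
  case False
  have "\<bar>\<gamma> k * (c k \<bullet> d k)\<bar> \<le> (Kg * lam k) * (norm (c k) * norm (d k))"
   unfolding abs_mult using gamma_pos[of k] gamma_le[OF False] Kg_nonneg
   by (intro mult_mono Cauchy_Schwarz_ineq2) auto
  also have "\<dots> = Kg * (norm (h1w c k) * norm (h1w d k))"
   by (simp add: h1w_def lam_def power2_eq_square)
  finally show ?thesis .
 qed
 show "(%k. \<bar>\<gamma> k * (c k \<bullet> d k)\<bar>) summable_on UNIV" by (rule infsum_comparison(3)[OF s le])
 have "(\<Sum>\<^sub>\<infinity>k. \<bar>\<gamma> k * (c k \<bullet> d k)\<bar>) \<le> (\<Sum>\<^sub>\<infinity>k. Kg * (norm (h1w c k) * norm (h1w d k)))"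
  by (rule infsum_mono[OF infsum_comparison(3)[OF s le] s le])
 also have "\<dots> = Kg * (\<Sum>\<^sub>\<infinity>k. norm (h1w c k) * norm (h1w d k))" by (rule infsum_cmult_right')
 also have "\<dots> \<le> Kg * (h1n c * h1n d)"
  unfolding h1n_def by (intro mult_left_mono ell2_Cauchy_Schwarz(2) e Kg_nonneg)
 finally show "(\<Sum>\<^sub>\<infinity>k. \<bar>\<gamma> k * (c k \<bullet> d k)\<bar>) \<le> Kg * (h1n c * h1n d)" .
qed

definition bdot :: "complex^3 \<Rightarrow> complex^3 \<Rightarrow> complex" where
 "bdot z w = (\<Sum>i\<in>UNIV. z $ i * w $ i)"

lemma norm_bdot_le: "norm (bdot z w) \<le> norm z * norm w"
proof -
 have "norm (bdot z w) \<le> (\<Sum>j\<in>UNIV. \<bar>norm (z $ j)\<bar> * \<bar>norm (w $ j)\<bar>)"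
  unfolding bdot_def by (rule order_trans[OF norm_sum]) (simp add: norm_mult)
 also have "\<dots> \<le> L2_set (%j. norm (z $ j)) UNIV * L2_set (%j. norm (w $ j)) UNIV"
  by (rule L2_set_mult_ineq)
 finally show ?thesis by (simp add: norm_vec_def)
qed

lemma bdot_commute: "bdot z w = bdot w z" by (simp add: bdot_def mult.commute)

lemma inner_bdot: "z \<bullet> w = Re (bdot z (vcnj w))"
 by (simp add: inner_vec_def bdot_def inner_complex_Re)

text \<open>With \<open>u = D c\<close> the sum is \<open>\<Sum> \<Sum> i (k \<cdot> u\<^bsub>k-l\<^esub>) (u\<^sub>l \<cdot> u\<^bsub>-k\<^esub>)\<close>; since \<open>k \<cdot> u\<^bsub>k-l\<^esub> = l \<cdot> u\<^bsub>k-l\<^esub>\<close>, the summand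
 changes sign under \<open>(k, l) \<mapsto> (- l, - k)\<close>.\<close>

lemma energy_cancellation:
 assumes c: "h1 c" and rf: "real_field c"
 shows "(\<Sum>\<^sub>\<infinity>k. \<gamma> k * (Bn c c k \<bullet> c k)) = 0"
proof -
 define u where "u k = D k *\<^sub>R c k" for k
 have u0: "u 0 = 0" and um: "u (- k) = vcnj (u k)" and ud: "cdot (\<kappa> k) (u k) = 0" for k
  using rf by (auto simp: real_field_def u_def vec_eq_iff cdot_linear D)
 have nu: "norm (u k) \<le> dmax * norm (c k)" for k
  using D(2)[of k] D_pos[of k] by (simp add: u_def mult_right_mono)
 have hu: "h1 u" using h1_mono(1)[OF c nu] dmax_pos by simp
 have hun: "h1 (%k. complex_of_real (norm (u k)))"
  using h1_mono(1)[OF hu, of "%k. complex_of_real (norm (u k))" 1] by simp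
 define f where "f k l = cdot (\<kappa> k) (u (k - l)) * bdot (u l) (u (- k))" for k l
 have un: "norm (u (- k)) = norm (u k)" for k by (simp add: um)
 define p where "p k = (\<Sum>\<^sub>\<infinity>l. norm (u l) * norm (u (k - l)))" for k
 have pe: "ell2 p" "\<And>k. (%l. norm (u l) * norm (u (k - l))) summable_on UNIV"
  using conv_norms_ell2(1)[OF hun hun] conv_pointwise(1)[OF hun hun] by (simp_all add: p_def[abs_def])
 have nf: "norm (f k l) \<le> norm (h1w u k) * (norm (u l) * norm (u (k - l)))" for k l
 proof -
  have "norm (f k l) \<le> (norm (\<kappa> k) * norm (u (k - l))) * (norm (u l) * norm (u (- k)))"
   unfolding f_def norm_mult using cdot_le[of "\<kappa> k" "u (k - l)"] norm_bdot_le
   by (intro mult_mono) (auto simp: cdot_def)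
  then show ?thesis by (simp add: un h1w_def mult_ac)
 qed
 have sf: "(%l. norm (f k l)) summable_on UNIV" for k
  by (rule summable_on_comparison_test[OF summable_on_cmult_right[OF pe(2)[of k], of "norm (h1w u k)"] nf]) simp
 have sf': "(\<Sum>\<^sub>\<infinity>l. norm (f k l)) \<le> norm (h1w u k) * norm (p k)" for k
 proof -
  have "(\<Sum>\<^sub>\<infinity>l. norm (f k l)) \<le> (\<Sum>\<^sub>\<infinity>l. norm (h1w u k) * (norm (u l) * norm (u (k - l))))"
   by (rule infsum_mono[OF sf summable_on_cmult_right[OF pe(2)] nf])
  also have "\<dots> = norm (h1w u k) * p k" by (simp only: infsum_cmult_right' p_def)
  also have "p k = norm (p k)" unfolding p_def by (simp add: infsum_nonneg)
  finally show ?thesis .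
 qed
 \<comment> \<open>For fixed k the inner sum is at most |\<open>h1w u k\<close>| times
   |\<open>p k\<close>|, a product of two square summable families. The resulting absolute
   summability over pairs is what permits the change of variables.\<close>
 have "(%k. \<Sum>\<^sub>\<infinity>l. norm (f k l)) summable_on UNIV"
  by (rule summable_on_comparison_test[OF ell2_Cauchy_Schwarz(1)[of "h1w u" p] sf'])
    (use hu pe in \<open>auto simp: h1_def intro!: infsum_nonneg\<close>)
 then have absum: "(%x. norm (case x of (k, l) \<Rightarrow> f k l)) summable_on (UNIV \<times> UNIV)"
  using Infinite_Sum.abs_summable_on_Sigma_iff[where f="%(k, l). f k l" and A=UNIV and B="%_. UNIV"] sf
  by (simp add: infsum_nonneg)
 then have fsum: "(%(k, l). f k l) summable_on (UNIV \<times> UNIV)" by (rule abs_summable_summable)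
 define tot where "tot = infsum (%(k, l). f k l) (UNIV \<times> UNIV)"
 have bij: "bij_betw (%(k, l). (- l, - k)) (UNIV \<times> UNIV) (UNIV \<times> UNIV :: ('k \<times> 'k) set)"
  by (rule bij_betwI[where g="%(k, l). (- l, - k)"]) auto
 have anti: "f (- l) (- k) = - f k l" for k l
 proof -
  have "cdot (\<kappa> k) (u (k - l)) - cdot (\<kappa> l) (u (k - l)) = cdot (\<kappa> (k - l)) (u (k - l))"
   by (simp add: kappa_diff cdot_linear)
  then have e: "cdot (\<kappa> k) (u (k - l)) = cdot (\<kappa> l) (u (k - l))" using ud by simp
  show ?thesis unfolding f_def e by (simp add: cdot_linear bdot_commute)
 qed
 have "tot = infsum (%x. (%(k, l). f k l) ((%(k, l). (- l, - k)) x)) (UNIV \<times> UNIV)"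
  unfolding tot_def by (rule infsum_reindex_bij_betw[OF bij, symmetric])
 also have "\<dots> = infsum (%x. - (case x of (k, l) \<Rightarrow> f k l)) (UNIV \<times> UNIV)"
  by (rule infsum_cong) (auto simp: anti)
 also have "\<dots> = - tot" unfolding tot_def by (rule infsum_uminus)
 finally have tot0: "tot = 0" by simp
 \<comment> \<open>The projection drops out since \<open>c k\<close> is divergence-free,
   \<open>gsym k\<close> cancels against the denominator of \<open>\<gamma> k\<close>, and the
   remaining \<open>D k\<close> turns \<open>c k\<close> into \<open>u k\<close>.\<close>
 have t1: "\<gamma> k * (Bn c c k \<bullet> c k) = Re (\<i> * (\<Sum>\<^sub>\<infinity>l. f k l))" for k
 proof -
  have tens: "tens c c i j k = (\<Sum>\<^sub>\<infinity>l. u l $ i * u (k - l) $ j)" for i j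
   by (simp add: tens_def conv_def dec_def u_def)
  have ts: "(%l. u l $ i * u (k - l) $ j) summable_on UNIV" for i j
   using conv_summable(2)[OF dec_h1(1)[OF c, of i] dec_h1(1)[OF c, of j], of k] by (simp add: dec_def u_def)
  have fe: "f k l = (\<Sum>i\<in>UNIV. \<Sum>j\<in>UNIV. (of_real (\<kappa> k $ j) * u (- k) $ i) * (u l $ i * u (k - l) $ j))" for l
   unfolding f_def cdot_def bdot_def sum_product
   by (subst sum.swap) (simp add: mult_ac)
  have "(\<Sum>\<^sub>\<infinity>l. f k l) = (\<Sum>i\<in>UNIV. \<Sum>j\<in>UNIV. (of_real (\<kappa> k $ j) * u (- k) $ i) * tens c c i j k)"
   unfolding fe tens
   by (subst infsum_finite_sum(2), simp, intro infsum_finite_sum(1) summable_on_cmult_right ts, simp,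
     intro sum.cong refl, subst infsum_finite_sum(2), simp, intro summable_on_cmult_right ts,
     intro sum.cong refl infsum_cmult_right')
  also have "\<dots> = (\<Sum>i\<in>UNIV. (\<Sum>j\<in>UNIV. of_real (\<kappa> k $ j) * tens c c i j k) * u (- k) $ i)"
   by (simp add: sum_distrib_left mult_ac)
  finally have "\<i> * (\<Sum>\<^sub>\<infinity>l. f k l) = (\<Sum>i\<in>UNIV. (\<Sum>j\<in>UNIV. \<i> * of_real (\<kappa> k $ j) * tens c c i j k) * u (- k) $ i)"
   by (simp add: sum_distrib_left mult_ac)
  also have "\<dots> = bdot (\<chi> i. \<Sum>j\<in>UNIV. \<i> * of_real (\<kappa> k $ j) * tens c c i j k) (vcnj (u k))"
   by (simp add: bdot_def um)
  finally have R: "Re (\<i> * (\<Sum>\<^sub>\<infinity>l. f k l)) = (\<chi> i. \<Sum>j\<in>UNIV. \<i> * of_real (\<kappa> k $ j) * tens c c i j k) \<bullet> u k"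
   by (simp only: inner_bdot)
  have "Bn c c k \<bullet> c k = flux c c k \<bullet> c k"
   unfolding Bn_def by (rule leray_inner) (use rf in \<open>simp add: real_field_def\<close>)
  also have "flux c c k = gsym k *\<^sub>R (\<chi> i. \<Sum>j\<in>UNIV. \<i> * of_real (\<kappa> k $ j) * tens c c i j k)"
   by (simp add: flux_def vec_eq_iff scaleR_conv_of_real[where 'a=complex])
  finally have "\<gamma> k * (Bn c c k \<bullet> c k) = (D k / gsym k) * (gsym k * ((\<chi> i. \<Sum>j\<in>UNIV. \<i> * of_real (\<kappa> k $ j) * tens c c i j k) \<bullet> c k))"
   by (simp add: \<gamma>_def)
  also have "\<dots> = (\<chi> i. \<Sum>j\<in>UNIV. \<i> * of_real (\<kappa> k $ j) * tens c c i j k) \<bullet> u k"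
   using gsym_pos[of k] by (simp add: u_def)
  finally show ?thesis using R by simp
 qed
 have "(\<Sum>\<^sub>\<infinity>k. \<Sum>\<^sub>\<infinity>l. f k l) = tot"
  unfolding tot_def using infsum_Sigma_banach[OF fsum] by simp
 moreover have "(%k. \<Sum>\<^sub>\<infinity>l. f k l) summable_on UNIV"
  using summable_on_Sigma_banach[OF fsum] by simp
 ultimately have "((%k. \<Sum>\<^sub>\<infinity>l. f k l) has_sum 0) UNIV" using tot0 by (simp add: has_sum_iff)
 from has_sum_Re[OF has_sum_cmult_right[OF this, of \<i>]]
 have "((%k. \<gamma> k * (Bn c c k \<bullet> c k)) has_sum 0) UNIV" unfolding t1 by simp
 then show ?thesis by (rule infsumI)
qed

end

section \<open>Gronwall iteration and measurability in time\<close>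

lemma AE_lebesgue_on_subset:
 assumes "AE s in Leb (T::real). P s" "t \<le> T"
 shows "AE s in Leb t. P s"
 using assms(1) by (subst (asm) AE_restrict_space_iff) (use assms(2) in \<open>auto simp: AE_restrict_space_iff elim!: eventually_mono\<close>)

lemma AE_in_lebesgue_onI: "(\<And>s. s \<in> S \<Longrightarrow> P s) \<Longrightarrow> AE s in lebesgue_on S. P s"
 by (rule AE_I2) simp

lemma integrable_lebesgue_on_bounded:
 fixes d :: "real \<Rightarrow> 'a::{banach,second_countable_topology}"
 assumes "d \<in> borel_measurable (lebesgue_on {a..b})" "\<And>t. t \<in> {a..b} \<Longrightarrow> norm (d t) \<le> B"
 shows "integrable (lebesgue_on {a..b}) d"
proof (rule bochner_integrable_bound[OF _ assms(1)])
 show "integrable (lebesgue_on {a..b}) (%t. B)" by (rule continuous_imp_integrable_real) simp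
 show "AE t in lebesgue_on {a..b}. norm (d t) \<le> norm B"
  by (rule AE_in_lebesgue_onI) (use assms(2) in force)
qed

text \<open>An exponential weight in time makes integration contractive: integrating exp(\<mu> t)
  divides by \<mu>, and \<mu> exceeds 4 C. No smallness of \<open>T\<close> is required. The same
  bound drives the Picard iteration and the Gronwall argument.\<close>

lemma integral_iterate_bound:
 fixes d :: "nat \<Rightarrow> real \<Rightarrow> real"
 assumes int: "\<And>n. integrable (Leb T) (d n)"
  and d0: "\<And>t. t \<in> {0..T} \<Longrightarrow> d 0 t \<le> M" and M: "M \<ge> 0" and C: "C \<ge> 0"
  and dS: "\<And>n t. t \<in> {0..T} \<Longrightarrow> d (Suc n) t \<le> C * (LINT s|Leb t. d n s)"
  and t: "t \<in> {0..T}"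
 shows "d n t \<le> M * (1/4) ^ n * exp ((4 * C + 1) * t)"
 using t
proof (induction n arbitrary: t)
 case 0
 have "M * 1 \<le> M * exp ((4 * C + 1) * t)" using 0 M C by (intro mult_left_mono) auto
 then show ?case using d0[OF 0] by simp
next
 case (Suc n)
 \<comment> \<open>The factor 4 produces the ratio 1/4; the summand 1 keeps \<mu> positive when C =
   0.\<close>
 define \<mu> where "\<mu> = 4 * C + 1"
 have mu: "\<mu> > 0" "C \<le> \<mu> / 4" using C by (auto simp: \<mu>_def)
 have ce: "continuous_on {0..t} (%s. M * (1/4) ^ n * exp (\<mu> * s))" by (intro continuous_intros)
 have hi: "((%s. M * (1/4) ^ n * exp (\<mu> * s)) has_integral M * (1/4) ^ n * exp (\<mu> * t) / \<mu> - M * (1/4) ^ n * exp (\<mu> * 0) / \<mu>) {0..t}"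
  by (rule fundamental_theorem_of_calculus)
    (use Suc.prems mu in \<open>auto intro!: derivative_eq_intros simp: has_real_derivative_iff_has_vector_derivative[symmetric]\<close>)
 have "(LINT s|Leb t. d n s) \<le> (LINT s|Leb t. M * (1/4) ^ n * exp (\<mu> * s))"
 proof (rule integral_mono)
  show "integrable (Leb t) (d n)"
   by (rule lebesgue_on_eq_integral(1)[OF int]) (use Suc.prems in auto)
  show "integrable (Leb t) (%s. M * (1/4) ^ n * exp (\<mu> * s))"
   by (rule continuous_imp_integrable_real[OF ce])
  show "d n s \<le> M * (1/4) ^ n * exp (\<mu> * s)" if "s \<in> space (Leb t)" for s
   using Suc.IH[of s] that Suc.prems by (simp add: \<mu>_def)
 qed
 also have "\<dots> = M * (1/4) ^ n * exp (\<mu> * t) / \<mu> - M * (1/4) ^ n * exp (\<mu> * 0) / \<mu>"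
  by (rule trans[OF lebesgue_integral_eq_integral[OF continuous_imp_integrable_real[OF ce]] integral_unique[OF hi]]) simp
 also have "\<dots> \<le> M * (1/4) ^ n * exp (\<mu> * t) / \<mu>" using M mu by simp
 finally have "d (Suc n) t \<le> C * (M * (1/4) ^ n * exp (\<mu> * t) / \<mu>)"
  using dS[OF Suc.prems, of n] C by (meson mult_left_mono order_trans)
 also have "\<dots> \<le> (\<mu> / 4) * (M * (1/4) ^ n * exp (\<mu> * t) / \<mu>)"
  using mu M by (intro mult_right_mono) auto
 also have "\<dots> = M * (1/4) ^ Suc n * exp (\<mu> * t)" using mu by simp
 finally show ?case by (simp add: \<mu>_def)
qed

text \<open>Gronwall's lemma: the iteration bound holds for the constant sequence \<open>d\<close>,
  so every bound M (1/4)^n exp(...) applies to it.\<close>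

lemma integral_inequality_zero:
 fixes d :: "real \<Rightarrow> real"
 assumes int: "integrable (Leb T) d"
  and dM: "\<And>t. t \<in> {0..T} \<Longrightarrow> d t \<le> M" and M: "M \<ge> 0" and C: "C \<ge> 0"
  and dS: "\<And>t. t \<in> {0..T} \<Longrightarrow> d t \<le> C * (LINT s|Leb t. d s)"
  and t: "t \<in> {0..T}"
 shows "d t \<le> 0"
proof (rule LIMSEQ_le_const)
 show "(%n. M * (1/4) ^ n * exp ((4 * C + 1) * t)) \<longlonglongrightarrow> 0"
  by (intro tendsto_mult_left_zero tendsto_mult_right_zero LIMSEQ_realpow_zero) auto
 show "\<exists>N. \<forall>n\<ge>N. d t \<le> M * (1/4) ^ n * exp ((4 * C + 1) * t)"
  using integral_iterate_bound[of T "%n. d" M C t, OF int dM M C dS t] by blast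
qed

lemma measurable_vec_lambda:
 fixes f :: "'n::finite \<Rightarrow> 'a \<Rightarrow> complex"
 assumes [measurable]: "\<And>i. f i \<in> borel_measurable M"
 shows "(%x. \<chi> i. f i x) \<in> borel_measurable M"
proof -
 have bl: "bounded_linear (axis i :: complex \<Rightarrow> complex^'n)" for i
 proof (rule bounded_linear_intro[where K=1])
  show "norm (axis i z :: complex^'n) \<le> norm z * 1" for z
   by (simp add: norm_vec_def L2_set_def axis_def if_distrib[of norm] if_distrib[of "%x. x^2"] cong: if_cong)
 qed (auto simp: axis_def vec_eq_iff)
 have [measurable]: "(axis i :: complex \<Rightarrow> complex^'n) \<in> borel_measurable borel" for i
  by (intro borel_measurable_continuous_onI linear_continuous_on bl)
 have "(\<chi> i. f i x) = (\<Sum>i\<in>UNIV. axis i (f i x))" for x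
  by (simp add: vec_eq_iff axis_def if_distrib cong: if_cong)
 then show ?thesis by simp
qed

lemma measurable_vec_nth:
 assumes [measurable]: "f \<in> borel_measurable M"
 shows "(%x. (f x :: complex^'n::finite) $ i) \<in> borel_measurable M"
proof -
 have [measurable]: "(%z :: complex^'n. z $ i) \<in> borel_measurable borel"
  by (intro borel_measurable_continuous_onI linear_continuous_on bounded_linear_vec_nth)
 show ?thesis by measurable
qed

lemma measurable_bounded_linear:
 fixes h :: "'b::euclidean_space \<Rightarrow> 'c::euclidean_space"
 assumes "bounded_linear h" "f \<in> borel_measurable M"
 shows "(%x. h (f x)) \<in> borel_measurable M"
 using measurable_compose[OF assms(2) borel_measurable_continuous_onI[OF linear_continuous_on[OF assms(1)]]]
 by simp

lemma measurable_ell2_norm: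
 fixes w :: "'k::countable \<Rightarrow> 'a \<Rightarrow> 'b::{banach,second_countable_topology}"
 assumes [measurable]: "\<And>k. w k \<in> borel_measurable M"
 shows "(%t. ell2_norm (slice w t)) \<in> borel_measurable M"
 unfolding ell2_norm_def by measurable

section \<open>Estimates across all modes, truncation, uniqueness for the coefficient system\<close>

context fourier_model
begin

text \<open>The estimate of each mode is multiplied by \<open>lam k\<close>, which cancels the 1 /
  \<open>lam k\<close> in front of the source, and then summed. The second conclusion bounds each
  mode by a summable family that does not depend on time; it later yields continuity in H_1. The
  third is H_2 regularity in mean square.\<close>

lemma evolution_estimate:
 fixes \<delta> \<eta> :: "'k \<Rightarrow> real \<Rightarrow> complex^3"
 assumes ev: "\<And>k. linear_evolution T (\<nu> * lam k) (\<eta> k) (\<delta> k)"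
  and d0: "\<And>t. t \<in> {0..T} \<Longrightarrow> \<delta> 0 t = 0" and i: "h1 (%k. \<delta> k 0)"
  and Hb: "AE s in Leb T. ell2 (%k. \<eta> k s) \<and> (ell2_norm (%k. \<eta> k s))^2 \<le> H s"
  and Hi: "integrable (Leb T) H"
 shows "(%k. lam k * (norm (\<delta> k 0))^2 + (LINT s|Leb T. (norm (\<eta> k s))^2) / \<nu>) summable_on UNIV"
  "t \<in> {0..T} \<Longrightarrow> lam k * (norm (\<delta> k t))^2 \<le> lam k * (norm (\<delta> k 0))^2 + (LINT s|Leb T. (norm (\<eta> k s))^2) / \<nu>"
  "(%k. (lam k)^2 * (LINT s|Leb T. (norm (\<delta> k s))^2)) summable_on UNIV"
  "t \<in> {0..T} \<Longrightarrow> h1 (%k. \<delta> k t)"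
  "t \<in> {0..T} \<Longrightarrow> (h1n (%k. \<delta> k t))^2 \<le> (h1n (%k. \<delta> k 0))^2 + (LINT s|Leb t. H s) / \<nu>"
proof -
 have em: "\<eta> k \<in> borel_measurable (Leb T)" for k
  using linear_evolutionD(1)[OF ev[of k]] by auto
 have dom: "AE s in Leb t. (%k. \<bar>(norm (\<eta> k s))^2\<bar>) summable_on UNIV \<and> (\<Sum>\<^sub>\<infinity>k. \<bar>(norm (\<eta> k s))^2\<bar>) \<le> H s"
  if t: "t \<in> {0..T}" for t
  by (rule AE_lebesgue_on_subset[where T=T]) (use Hb t in \<open>auto simp: ell2_def ell2_norm_square\<close>)
 have m2: "(%s. (norm (\<eta> k s))^2) \<in> borel_measurable (Leb t)" if t: "t \<in> {0..T}" for k t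
  using borel_measurable_lebesgue_on_subset[OF em[of k], of 0 t] t by auto
 have Ht: "integrable (Leb t) H" if t: "t \<in> {0..T}" for t
  using lebesgue_on_eq_integral(1)[OF Hi, of 0 t] t by auto
 note ii = infsum_integral_dominated[OF m2 dom Ht]
 have TT: "T \<in> {0..T}" using pos by simp
 have e2: "integrable (Leb T) (%s. (norm (\<eta> k s))^2)" for k by (rule ii(1)[OF TT TT TT])
 have n0: "0 \<le> (LINT s|Leb t. (norm (\<eta> k s))^2)" for k t
  by (intro bochner_integral_nonneg) auto
 have es: "(%k. (LINT s|Leb t. (norm (\<eta> k s))^2)) summable_on UNIV"
  "(\<Sum>\<^sub>\<infinity>k. LINT s|Leb t. (norm (\<eta> k s))^2) \<le> (LINT s|Leb t. H s)" if t: "t \<in> {0..T}" for t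
  using ii(3,4)[OF t t t] by simp_all
 have mono: "(LINT s|Leb t. (norm (\<eta> k s))^2) \<le> (LINT s|Leb T. (norm (\<eta> k s))^2)" if t: "t \<in> {0..T}" for k t
 proof -
  have "0 \<le> (LINT s|lebesgue_on {t..T}. (norm (\<eta> k s))^2)" by (intro bochner_integral_nonneg) auto
  moreover have "(LINT s|Leb T. (norm (\<eta> k s))^2) - (LINT s|Leb t. (norm (\<eta> k s))^2)
    = (LINT s|lebesgue_on {t..T}. (norm (\<eta> k s))^2)"
   by (rule lebesgue_on_integral_diff[OF e2]) (use t in auto)
  ultimately show ?thesis by linarith
 qed
 have est: "lam k * (norm (\<delta> k t))^2 + \<nu> * (lam k)^2 * (LINT s|Leb t. (norm (\<delta> k s))^2)
   \<le> lam k * (norm (\<delta> k 0))^2 + (LINT s|Leb t. (norm (\<eta> k s))^2) / \<nu>" if t: "t \<in> {0..T}" for k t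
 proof (cases "k = 0")
  case True
  then show ?thesis using n0 pos by simp
 next
  case False
  note lp = lam_pos[OF False]
  have "(norm (\<delta> k t))^2 + (\<nu> * lam k) * (LINT s|Leb t. (norm (\<delta> k s))^2)
    \<le> (norm (\<delta> k 0))^2 + (LINT s|Leb t. (norm (\<eta> k s))^2) / (\<nu> * lam k)"
   by (rule linear_evolution_estimate[OF ev t _ e2]) (use lp pos in simp)
  from mult_left_mono[OF this, of "lam k"] show ?thesis
   using lp pos by (simp add: distrib_left power2_eq_square mult_ac)
 qed
 have dn0: "0 \<le> (LINT s|Leb t. (norm (\<delta> k s))^2)" for k t
  by (intro bochner_integral_nonneg) auto
 have ism: "(%k. lam k * (norm (\<delta> k 0))^2) summable_on UNIV" using i by (simp add: h1_iff)
 have sm: "(%k. lam k * (norm (\<delta> k 0))^2 + (LINT s|Leb t. (norm (\<eta> k s))^2) / \<nu>) summable_on UNIV"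
  if t: "t \<in> {0..T}" for t
  unfolding divide_inverse by (intro summable_on_add ism summable_on_cmult_left es t)
 then show "(%k. lam k * (norm (\<delta> k 0))^2 + (LINT s|Leb T. (norm (\<eta> k s))^2) / \<nu>) summable_on UNIV"
  using TT by blast
 have le: "lam k * (norm (\<delta> k t))^2 \<le> lam k * (norm (\<delta> k 0))^2 + (LINT s|Leb t. (norm (\<eta> k s))^2) / \<nu>"
  if t: "t \<in> {0..T}" for k t
 proof -
  have "0 \<le> \<nu> * (lam k)^2 * (LINT s|Leb t. (norm (\<delta> k s))^2)"
   using pos by (intro mult_nonneg_nonneg dn0) auto
  then show ?thesis using est[OF t, of k] by linarith
 qed
 show "t \<in> {0..T} \<Longrightarrow> lam k * (norm (\<delta> k t))^2 \<le> lam k * (norm (\<delta> k 0))^2 + (LINT s|Leb T. (norm (\<eta> k s))^2) / \<nu>"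
  using le[of t k] divide_right_mono[OF mono[of t k], of \<nu>] pos by fastforce
 have nn: "0 \<le> lam k * (norm (\<delta> k t))^2" for k t by simp
 show "(%k. (lam k)^2 * (LINT s|Leb T. (norm (\<delta> k s))^2)) summable_on UNIV"
 proof (rule summable_on_comparison_test)
  show "(%k. (1 / \<nu>) * (lam k * (norm (\<delta> k 0))^2 + (LINT s|Leb T. (norm (\<eta> k s))^2) / \<nu>)) summable_on UNIV"
   by (rule summable_on_cmult_right[OF sm[OF TT]])
  fix k
  have "\<nu> * ((lam k)^2 * (LINT s|Leb T. (norm (\<delta> k s))^2)) \<le> lam k * (norm (\<delta> k 0))^2 + (LINT s|Leb T. (norm (\<eta> k s))^2) / \<nu>"
   using est[OF TT, of k] nn[of k T] unfolding mult.assoc by linarith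
  then show "(lam k)^2 * (LINT s|Leb T. (norm (\<delta> k s))^2) \<le> (1 / \<nu>) * (lam k * (norm (\<delta> k 0))^2 + (LINT s|Leb T. (norm (\<eta> k s))^2) / \<nu>)"
   using pos by (simp add: pos_le_divide_eq mult.commute)
  show "0 \<le> (lam k)^2 * (LINT s|Leb T. (norm (\<delta> k s))^2)"
   by (intro mult_nonneg_nonneg dn0) simp
 qed
 show "h1 (%k. \<delta> k t)" if t: "t \<in> {0..T}"
  unfolding h1_iff using d0[OF t] summable_on_comparison_test[OF sm[OF t] le[OF t] nn] by blast
 show "(h1n (%k. \<delta> k t))^2 \<le> (h1n (%k. \<delta> k 0))^2 + (LINT s|Leb t. H s) / \<nu>" if t: "t \<in> {0..T}"
 proof -
  have "(h1n (%k. \<delta> k t))^2 \<le> (\<Sum>\<^sub>\<infinity>k. lam k * (norm (\<delta> k 0))^2 + (LINT s|Leb t. (norm (\<eta> k s))^2) / \<nu>)"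
   unfolding h1n_square by (rule infsum_mono[OF summable_on_comparison_test[OF sm[OF t] le[OF t] nn] sm[OF t] le[OF t]])
  also have "\<dots> = (\<Sum>\<^sub>\<infinity>k. lam k * (norm (\<delta> k 0))^2) + (\<Sum>\<^sub>\<infinity>k. (LINT s|Leb t. (norm (\<eta> k s))^2) / \<nu>)"
   by (rule infsum_add[OF ism]) (unfold divide_inverse, rule summable_on_cmult_left[OF es(1)[OF t]])
  also have "(\<Sum>\<^sub>\<infinity>k. (LINT s|Leb t. (norm (\<eta> k s))^2) / \<nu>) = (\<Sum>\<^sub>\<infinity>k. (LINT s|Leb t. (norm (\<eta> k s))^2)) / \<nu>"
   unfolding divide_inverse by (rule infsum_cmult_left')
  also have "\<dots> \<le> (LINT s|Leb t. H s) / \<nu>"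
   by (rule divide_right_mono[OF es(2)[OF t]]) (use pos in simp)
  finally show ?thesis by (simp add: h1n_square)
 qed
qed

text \<open>The scaling factor of the radial retraction onto the ball of radius
  \<open>R\<close>.\<close>

definition cut :: "real \<Rightarrow> real \<Rightarrow> real" where "cut R x = (if x \<le> R then 1 else R / x)"

definition trunc :: "real \<Rightarrow> ('k \<Rightarrow> complex^3) \<Rightarrow> 'k \<Rightarrow> complex^3" where
 "trunc R c k = cut R (h1n c) *\<^sub>R c k"

lemma cut_bounds: "R > 0 \<Longrightarrow> 0 < cut R x \<and> cut R x \<le> 1" "R > 0 \<Longrightarrow> 0 \<le> x \<Longrightarrow> cut R x * x \<le> R"
 by (auto simp: cut_def)

text \<open>The factor \<open>y\<close> belongs to the inequality: in the difference of two
  truncations the change of \<open>cut\<close> multiplies a field of norm \<open>y\<close>. If both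
  norms exceed R, the left side is R / x times |y - x|, and R / x < 1.\<close>

lemma cut_lipschitz:
 assumes R: "R > 0" and "0 \<le> x" "0 \<le> y"
 shows "\<bar>cut R x - cut R y\<bar> * y \<le> \<bar>x - y\<bar>"
proof (cases "x \<le> R"; cases "y \<le> R")
 assume "x \<le> R" "\<not> y \<le> R"
 then have "\<bar>cut R x - cut R y\<bar> * y = (1 - R / y) * y" using R by (simp add: cut_def)
 also have "\<dots> = y - R" using \<open>\<not> y \<le> R\<close> R by (simp add: field_simps)
 finally show ?thesis using \<open>x \<le> R\<close> by linarith
next
 assume a: "\<not> x \<le> R" "y \<le> R"
 then have "\<bar>cut R x - cut R y\<bar> * y = (1 - R / x) * y" using R by (simp add: cut_def)
 also have "\<dots> \<le> (1 - R / x) * x" using a R by (intro mult_left_mono) auto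
 also have "\<dots> = x - R" using a R by (simp add: field_simps)
 finally show ?thesis using a by linarith
next
 assume a: "\<not> x \<le> R" "\<not> y \<le> R"
 then have p: "x > 0" "y > 0" using R by auto
 have "\<bar>cut R x - cut R y\<bar> * y = \<bar>(R / x - R / y) * y\<bar>" using a p by (simp add: cut_def abs_mult)
 also have "(R / x - R / y) * y = (R / x) * (y - x)" using p by (simp add: field_simps)
 also have "\<bar>(R / x) * (y - x)\<bar> \<le> 1 * \<bar>y - x\<bar>"
  unfolding abs_mult using a p R by (intro mult_right_mono) auto
 finally show ?thesis by simp
qed (simp add: cut_def)

lemma trunc_h1: "h1 c \<Longrightarrow> h1 (trunc R c)"
 unfolding trunc_def[abs_def] by (rule h1_scaleR)

lemma trunc_bound: "R > 0 \<Longrightarrow> h1n (trunc R c) \<le> R"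
 unfolding trunc_def[abs_def] h1n_scaleR using cut_bounds[of R "h1n c"] by simp

lemma h1n_triangle_abs:
 assumes "h1 c" "h1 d" shows "\<bar>h1n c - h1n d\<bar> \<le> h1n (%k. c k - d k)"
proof -
 have "h1n c \<le> h1n (%k. c k - d k) + h1n d"
  using h1n_add[OF h1_diff[OF assms] assms(2)] by simp
 moreover have "h1n d \<le> h1n (%k. d k - c k) + h1n c"
  using h1n_add[OF h1_diff[OF assms(2,1)] assms(1)] by simp
 ultimately show ?thesis using h1n_minus_commute[of c d] by linarith
qed

lemma trunc_lipschitz:
 assumes "h1 c" "h1 d" "R > 0"
 shows "h1n (%k. trunc R c k - trunc R d k) \<le> 2 * h1n (%k. c k - d k)"
proof -
 let ?s = "cut R (h1n c)" and ?t = "cut R (h1n d)"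
 \<comment> \<open>One unit of the Lipschitz constant 2 comes from the difference of the fields, the
   other from the difference of the scaling factors.\<close>
 have eq: "(%k. trunc R c k - trunc R d k) = (%k. ?s *\<^sub>R (c k - d k) + (?s - ?t) *\<^sub>R d k)"
  by (auto simp: trunc_def algebra_simps)
 have "h1n (%k. trunc R c k - trunc R d k) \<le> h1n (%k. ?s *\<^sub>R (c k - d k)) + h1n (%k. (?s - ?t) *\<^sub>R d k)"
  unfolding eq by (intro h1n_add h1_scaleR h1_diff assms)
 also have "\<dots> = \<bar>?s\<bar> * h1n (%k. c k - d k) + \<bar>?s - ?t\<bar> * h1n d" by (simp only: h1n_scaleR)
 also have "\<bar>?s\<bar> * h1n (%k. c k - d k) \<le> 1 * h1n (%k. c k - d k)"
  using cut_bounds(1)[OF assms(3), of "h1n c"] by (intro mult_right_mono) auto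
 also have "\<bar>?s - ?t\<bar> * h1n d \<le> \<bar>h1n c - h1n d\<bar>" by (rule cut_lipschitz[OF assms(3)]) auto
 also have "\<dots> \<le> h1n (%k. c k - d k)" by (rule h1n_triangle_abs[OF assms(1,2)])
 finally show ?thesis by simp
qed

definition Nl :: "real \<Rightarrow> ('k \<Rightarrow> complex^3) \<Rightarrow> 'k \<Rightarrow> complex^3" where
 "Nl R c = Bn (trunc R c) (trunc R c)"

lemma Nl_h1:
 assumes "h1 c" "R > 0"
 shows "h1 (Nl R c)" "h1n (Nl R c) \<le> 2 * Kf * R * R"
proof -
 show "h1 (Nl R c)" unfolding Nl_def by (intro Bn_h1 trunc_h1 assms)
 have "h1n (Nl R c) \<le> 2 * Kf * h1n (trunc R c) * h1n (trunc R c)"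
  unfolding Nl_def by (intro Bn_h1 trunc_h1 assms)
 also have "\<dots> \<le> 2 * Kf * R * R"
  using Kf_nonneg assms(2) by (intro mult_mono trunc_bound mult_nonneg_nonneg) auto
 finally show "h1n (Nl R c) \<le> 2 * Kf * R * R" .
qed

lemma Bn_lipschitz:
 assumes c: "h1 c" and d: "h1 d" and R: "h1n c \<le> R" "h1n d \<le> R"
 shows "h1 (%k. Bn c c k - Bn d d k)" "h1n (%k. Bn c c k - Bn d d k) \<le> 4 * Kf * R * h1n (%k. c k - d k)"
proof -
 let ?e = "%k. c k - d k"
 have e: "h1 ?e" by (rule h1_diff[OF c d])
 have eq: "(%k. Bn c c k - Bn d d k) = (%k. Bn ?e c k + Bn d ?e k)" by (rule ext) (rule Bn_difference[OF c d])
 show "h1 (%k. Bn c c k - Bn d d k)" by (intro h1_diff Bn_h1 c d)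
 have "h1n (%k. Bn c c k - Bn d d k) \<le> h1n (Bn ?e c) + h1n (Bn d ?e)"
  unfolding eq by (intro h1n_add Bn_h1 c d e)
 also have "\<dots> \<le> 2 * Kf * h1n ?e * h1n c + 2 * Kf * h1n d * h1n ?e"
  by (intro add_mono Bn_h1 c d e)
 also have "\<dots> \<le> 2 * Kf * h1n ?e * R + 2 * Kf * R * h1n ?e"
  using Kf_nonneg R by (intro add_mono mult_left_mono mult_right_mono) auto
 finally show "h1n (%k. Bn c c k - Bn d d k) \<le> 4 * Kf * R * h1n ?e" by (simp add: algebra_simps)
qed

lemma Nl_lipschitz:
 assumes c: "h1 c" and d: "h1 d" and R: "R > 0"
 shows "h1 (%k. Nl R c k - Nl R d k)" "h1n (%k. Nl R c k - Nl R d k) \<le> 8 * Kf * R * h1n (%k. c k - d k)"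
proof -
 note b = Bn_lipschitz[OF trunc_h1[OF c, of R] trunc_h1[OF d, of R] trunc_bound[OF R] trunc_bound[OF R]]
 show "h1 (%k. Nl R c k - Nl R d k)" unfolding Nl_def by (rule b)
 have "h1n (%k. Nl R c k - Nl R d k) \<le> 4 * Kf * R * h1n (%k. trunc R c k - trunc R d k)"
  unfolding Nl_def by (rule b)
 also have "\<dots> \<le> 4 * Kf * R * (2 * h1n (%k. c k - d k))"
  using Kf_nonneg R by (intro mult_left_mono trunc_lipschitz c d) auto
 finally show "h1n (%k. Nl R c k - Nl R d k) \<le> 8 * Kf * R * h1n (%k. c k - d k)" by simp
qed

text \<open>Truncation multiplies the nonlinear term by a scalar common to all modes, by
  bilinearity. Hence the energy cancellation survives truncation.\<close>

lemma Nl_eq: "Nl R c k = (cut R (h1n c) * cut R (h1n c)) *\<^sub>R Bn c c k"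
 unfolding Nl_def trunc_def[abs_def] by (rule Bn_scaleR)

lemma Nl_eq_Bn: "h1n c \<le> R \<Longrightarrow> Nl R c k = Bn c c k"
 by (simp add: Nl_eq cut_def)

lemma Nl_real_field: "real_field c \<Longrightarrow> real_field (Nl R c)"
 unfolding Nl_def trunc_def[abs_def] by (intro Bn_real_field real_field_scaleR)

lemma measurable_h1n:
 fixes w :: "'k \<Rightarrow> 'a \<Rightarrow> 'b::{banach,second_countable_topology}"
 assumes [measurable]: "\<And>k. w k \<in> borel_measurable M"
 shows "(%t. h1n (slice w t)) \<in> borel_measurable M"
 unfolding h1n_def h1w_def by (rule measurable_ell2_norm) measurable

lemma measurable_flux:
 fixes w v :: "'k \<Rightarrow> 'a \<Rightarrow> complex^3"
 assumes w: "\<And>k. w k \<in> borel_measurable M" and v: "\<And>k. v k \<in> borel_measurable M"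
  and h: "\<And>t. t \<in> space M \<Longrightarrow> h1 (slice w t)" "\<And>t. t \<in> space M \<Longrightarrow> h1 (slice v t)"
 shows "(%t. flux (slice w t) (slice v t) k) \<in> borel_measurable M"
proof -
 have [measurable]: "(%t. w k t $ i) \<in> borel_measurable M" "(%t. v k t $ i) \<in> borel_measurable M" for k i
  using w v by (auto intro: measurable_vec_nth)
 have [measurable]: "(%t. tens (slice w t) (slice v t) i j k) \<in> borel_measurable M" for i j
  unfolding tens_def conv_def
 proof (rule measurable_infsum_banach)
  show "(%t. dec (slice w t) i l * dec (slice v t) j (k - l)) \<in> borel_measurable M" for l
   unfolding dec_def by measurable
  show "(%l. dec (slice w t) i l * dec (slice v t) j (k - l)) summable_on UNIV" if "t \<in> space M" for t
   by (intro conv_summable dec_h1 h that)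
 qed
 show ?thesis unfolding flux_def by (rule measurable_vec_lambda) measurable
qed

lemma measurable_Bn:
 fixes w v :: "'k \<Rightarrow> 'a \<Rightarrow> complex^3"
 assumes w: "\<And>k. w k \<in> borel_measurable M" and v: "\<And>k. v k \<in> borel_measurable M"
  and h: "\<And>t. t \<in> space M \<Longrightarrow> h1 (slice w t)" "\<And>t. t \<in> space M \<Longrightarrow> h1 (slice v t)"
 shows "(%t. Bn (slice w t) (slice v t) k) \<in> borel_measurable M"
 unfolding Bn_def by (intro measurable_bounded_linear[OF bounded_linear_leray] measurable_flux assms)

lemma measurable_Nl:
 fixes w :: "'k \<Rightarrow> 'a \<Rightarrow> complex^3"
 assumes w: "\<And>k. w k \<in> borel_measurable M" and h: "\<And>t. t \<in> space M \<Longrightarrow> h1 (slice w t)"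
 shows "(%t. Nl R (slice w t) k) \<in> borel_measurable M"
proof -
 have [measurable]: "(%t. h1n (slice w t)) \<in> borel_measurable M" by (rule measurable_h1n[OF w])
 have [measurable]: "(%t. Bn (slice w t) (slice w t) k) \<in> borel_measurable M" by (rule measurable_Bn[OF w w h h])
 show ?thesis unfolding Nl_eq cut_def by measurable
qed

text \<open>In the difference of two solutions the force cancels and the source is a difference of
  nonlinear terms, Lipschitz in H_1 on the ball of radius \<open>R\<close>.
  \<open>evolution_estimate\<close> then gives an integral inequality for the squared H_1 distance,
  which starts at zero.\<close>

lemma evolution_unique:
 fixes w v :: "'k \<Rightarrow> real \<Rightarrow> complex^3"
 assumes w: "\<And>k. linear_evolution T (\<nu> * lam k) (%t. F k t - Bn (slice w t) (slice w t) k) (w k)"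
  and v: "\<And>k. linear_evolution T (\<nu> * lam k) (%t. F k t - Bn (slice v t) (slice v t) k) (v k)"
  and hw: "\<And>t. t \<in> {0..T} \<Longrightarrow> h1 (slice w t)" "\<And>t. t \<in> {0..T} \<Longrightarrow> h1n (slice w t) \<le> R"
  and hv: "\<And>t. t \<in> {0..T} \<Longrightarrow> h1 (slice v t)" "\<And>t. t \<in> {0..T} \<Longrightarrow> h1n (slice v t) \<le> R"
  and init: "\<And>k. w k 0 = v k 0" and t: "t \<in> {0..T}"
 shows "w k t = v k t"
proof -
 define \<delta> where "\<delta> k t = w k t - v k t" for k t
 define \<eta> where "\<eta> k t = (F k t - Bn (slice w t) (slice w t) k) - (F k t - Bn (slice v t) (slice v t) k)" for k t
 define d where "d t = (h1n (%k. \<delta> k t))^2" for t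
 \<comment> \<open>The squared Lipschitz constant of the nonlinear term in H_1, divided by \<theta>
   for the passage to H_0.\<close>
 define C where "C = (4 * Kf * R)^2 / \<theta>"
 have C0: "C \<ge> 0" using theta(1) by (simp add: C_def)
 have hd: "h1 (%k. \<delta> k t)" if "t \<in> {0..T}" for t unfolding \<delta>_def by (intro h1_diff hw hv that)
 have cw: "w k \<in> borel_measurable (Leb T)" "v k \<in> borel_measurable (Leb T)" for k
  using linear_evolutionD(2)[OF w[of k]] linear_evolutionD(2)[OF v[of k]] by (auto intro: continuous_borel_measurable_lebesgue_on)
 have dm: "d \<in> borel_measurable (Leb T)"
  unfolding d_def by (intro borel_measurable_power measurable_h1n) (use cw in \<open>simp add: \<delta>_def[abs_def]\<close>)
 have db: "d t \<le> (R + R)^2" if "t \<in> {0..T}" for t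
  unfolding d_def \<delta>_def using h1n_diff[OF hw(1)[OF that] hv(1)[OF that]] hw(2)[OF that] hv(2)[OF that]
  by (intro power_mono) auto
 have di: "integrable (Leb T) d"
  by (rule integrable_lebesgue_on_bounded[OF dm, where B="(R + R)^2"]) (use db in \<open>simp add: d_def\<close>)
 have "d t \<le> 0"
 proof (rule integral_inequality_zero[OF di db])
  fix t assume t: "t \<in> {0..T}"
  have "(h1n (%k. \<delta> k t))^2 \<le> (h1n (%k. \<delta> k 0))^2 + (LINT s|Leb t. C * d s) / \<nu>"
  proof (rule evolution_estimate(5)[where \<eta>=\<eta>])
   show "linear_evolution T (\<nu> * lam k) (\<eta> k) (\<delta> k)" for k
    unfolding \<eta>_def \<delta>_def by (rule linear_evolution_diff[OF w v])
   show "\<delta> 0 t = 0" if "t \<in> {0..T}" for t using hd[OF that] by (simp add: h1_def)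
   show "h1 (%k. \<delta> k 0)" using hd[of 0] pos by simp
   show "AE s in Leb T. ell2 (%k. \<eta> k s) \<and> (ell2_norm (%k. \<eta> k s))^2 \<le> C * d s"
   proof (rule AE_in_lebesgue_onI)
    fix s assume s: "s \<in> {0..T}"
    note b = Bn_lipschitz[OF hv(1)[OF s] hw(1)[OF s] hv(2)[OF s] hw(2)[OF s]]
    have eq: "(%k. \<eta> k s) = (%k. Bn (slice v s) (slice v s) k - Bn (slice w s) (slice w s) k)"
     by (auto simp: \<eta>_def)
    have "(ell2_norm (%k. \<eta> k s))^2 \<le> (h1n (%k. \<eta> k s))^2 / \<theta>"
     unfolding eq by (rule h1_imp_ell2[OF b(1)])
    also have "\<dots> \<le> (4 * Kf * R * h1n (%k. \<delta> k s))^2 / \<theta>"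
     using b(2) theta(1) unfolding eq h1n_minus_commute[of "%k. v k s"] \<delta>_def
     by (intro divide_right_mono power_mono) auto
    also have "\<dots> = C * d s" by (simp add: C_def d_def power_mult_distrib)
    finally show "ell2 (%k. \<eta> k s) \<and> (ell2_norm (%k. \<eta> k s))^2 \<le> C * d s"
     unfolding eq using h1_imp_ell2(1)[OF b(1)] by simp
   qed
  qed (use di t in auto)
  also have "h1n (%k. \<delta> k 0) = 0" using init by (simp add: \<delta>_def h1n_def h1w_def)
  finally show "d t \<le> C / \<nu> * (LINT s|Leb t. d s)" by (simp add: d_def)
 qed (use t C0 pos in auto)
 then have "h1n (%k. \<delta> k t) = 0" unfolding d_def by simp
 then have z: "norm (\<kappa> k) * norm (\<delta> k t) = 0"
  using h1_component[OF hd[OF t], of k] by (intro antisym) auto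
 show ?thesis
 proof (cases "k = 0")
  case True then show ?thesis using hd[OF t] by (simp add: h1_def \<delta>_def)
 next
  case False then show ?thesis using z kappa_pos[OF False] by (simp add: \<delta>_def)
 qed
qed

end

section \<open>Existence for the coefficient system\<close>

text \<open>The conditions on \<open>F\<close> hold at every time of the interval and not merely
  almost everywhere; on the torus this is arranged by changing the force on a null set.\<close>

locale forced_model = fourier_model +
 fixes w0 :: "'a \<Rightarrow> complex^3" and F :: "'a \<Rightarrow> real \<Rightarrow> complex^3"
 assumes w0: "h1 w0" "real_field w0"
  and F_measurable: "F k \<in> borel_measurable (Leb T)"
  and F_real_field: "t \<in> {0..T} \<Longrightarrow> real_field (slice F t)"
  and F_ell2: "t \<in> {0..T} \<Longrightarrow> ell2 (slice F t)"
  and F_integrable: "integrable (Leb T) (%t. (ell2_norm (slice F t))^2)"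
begin

text \<open>The class preserved by the iteration. Continuity is asked of each mode separately, which
  already gives measurability in time.\<close>

definition good :: "('a \<Rightarrow> real \<Rightarrow> complex^3) \<Rightarrow> bool" where
 "good w \<longleftrightarrow> (\<forall>k. continuous_on {0..T} (w k)) \<and> (\<forall>t\<in>{0..T}. h1 (slice w t) \<and> real_field (slice w t))"

lemma goodD:
 assumes "good w"
 shows "continuous_on {0..T} (w k)" "t \<in> {0..T} \<Longrightarrow> h1 (slice w t)" "t \<in> {0..T} \<Longrightarrow> real_field (slice w t)"
  "w k \<in> borel_measurable (Leb T)"
 using assms by (auto simp: good_def intro: continuous_borel_measurable_lebesgue_on)

definition source :: "real \<Rightarrow> ('a \<Rightarrow> real \<Rightarrow> complex^3) \<Rightarrow> 'a \<Rightarrow> real \<Rightarrow> complex^3" where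
 "source R w k t = F k t - Nl R (slice w t) k"

text \<open>Does not depend on the field: the truncated nonlinear term is bounded by 2 Kf R^2 in
  H_1, and both factors 2 come from (a + b)^2 <= 2 a^2 + 2 b^2.\<close>

definition source_bound :: "real \<Rightarrow> real \<Rightarrow> real" where
 "source_bound R t = 2 * (ell2_norm (slice F t))^2 + 2 * ((2 * Kf * R * R)^2 / \<theta>)"

lemma source_bound_integrable: "integrable (Leb T) (source_bound R)"
 unfolding source_bound_def by (intro bochner_integrable_add integrable_mult_right F_integrable) auto

lemma Nl_ell2:
 assumes "h1 c" "R > 0"
 shows "ell2 (Nl R c)" "(ell2_norm (Nl R c))^2 \<le> (2 * Kf * R * R)^2 / \<theta>"
proof -
 note n = Nl_h1[OF assms]
 show "ell2 (Nl R c)" by (rule h1_imp_ell2[OF n(1)])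
 have "(ell2_norm (Nl R c))^2 \<le> (h1n (Nl R c))^2 / \<theta>" by (rule h1_imp_ell2[OF n(1)])
 also have "\<dots> \<le> (2 * Kf * R * R)^2 / \<theta>"
  using theta(1) n(2) by (intro divide_right_mono power_mono) auto
 finally show "(ell2_norm (Nl R c))^2 \<le> (2 * Kf * R * R)^2 / \<theta>" .
qed

lemma source_ell2:
 assumes g: "good w" and t: "t \<in> {0..T}" and R: "R > 0"
 shows "ell2 (%k. source R w k t)" "(ell2_norm (%k. source R w k t))^2 \<le> source_bound R t"
proof -
 note n = Nl_ell2[OF goodD(2)[OF g t] R]
 show "ell2 (%k. source R w k t)" unfolding source_def by (rule ell2_diff[OF F_ell2[OF t] n(1)])
 have "ell2_norm (%k. source R w k t) \<le> ell2_norm (slice F t) + ell2_norm (Nl R (slice w t))"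
  unfolding source_def by (rule ell2_diff[OF F_ell2[OF t] n(1)])
 then have "(ell2_norm (%k. source R w k t))^2 \<le> (ell2_norm (slice F t) + ell2_norm (Nl R (slice w t)))^2"
  by (intro power_mono) auto
 also have "\<dots> \<le> 2 * (ell2_norm (slice F t))^2 + 2 * (ell2_norm (Nl R (slice w t)))^2"
  using sum_squares_bound[of "ell2_norm (slice F t)" "ell2_norm (Nl R (slice w t))"] by (simp add: power2_sum)
 also have "\<dots> \<le> source_bound R t" unfolding source_bound_def using n(2) by simp
 finally show "(ell2_norm (%k. source R w k t))^2 \<le> source_bound R t" .
qed

lemma source_measurable: "good w \<Longrightarrow> source R w k \<in> borel_measurable (Leb T)"
 unfolding source_def by (intro borel_measurable_diff F_measurable measurable_Nl) (auto intro: goodD)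

lemma source_integrable:
 assumes g: "good w" and R: "R > 0" shows "integrable (Leb T) (source R w k)"
proof (rule bochner_integrable_bound)
 show "integrable (Leb T) (%t. 1 + source_bound R t)"
  by (intro bochner_integrable_add source_bound_integrable) auto
 show "AE t in Leb T. norm (source R w k t) \<le> norm (1 + source_bound R t)"
 proof (rule AE_in_lebesgue_onI)
  fix t assume t: "t \<in> {0..T}"
  let ?x = "norm (source R w k t)"
  have "2 * ?x \<le> ?x^2 + 1" using sum_squares_bound[of ?x 1] by simp
  then have "?x \<le> 1 + ?x^2" using zero_le_power2[of ?x] by linarith
  also have "?x^2 \<le> (ell2_norm (%k. source R w k t))^2"
   by (intro power_mono ell2_component_le[OF source_ell2(1)[OF g t R]]) simp
  also have "\<dots> \<le> source_bound R t" by (rule source_ell2(2)[OF g t R])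
  finally show "?x \<le> norm (1 + source_bound R t)" by simp
 qed
qed (rule source_measurable[OF g])

text \<open>Zero mean and zero divergence are quantities solving the linear equation with zero data.
  For reality, the mode -k and the conjugate of the mode k solve the same equation with the same
  initial value.\<close>

lemma evolution_preserves_real_field:
 assumes ev: "\<And>k. linear_evolution T (\<nu> * lam k) (h k) (w k)" and init: "\<And>k. w k 0 = w0 k"
  and h: "\<And>t. t \<in> {0..T} \<Longrightarrow> real_field (slice h t)" and t: "t \<in> {0..T}"
 shows "real_field (slice w t)"
proof -
 have nn: "0 \<le> \<nu> * lam k" for k using pos by simp
 have cong: "linear_evolution T \<mu> h' y" if "linear_evolution T \<mu> h y" "\<And>t. t \<in> {0..T} \<Longrightarrow> h t = h' t"
  for \<mu> h h' and y :: "real \<Rightarrow> 'z::euclidean_space"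
 proof -
  note d = linear_evolutionD[OF that(1)]
  have "integrable (Leb T) h'"
   using d(1) bochner_integrable_cong[of "Leb T" "Leb T" h h'] that(2) by simp
  moreover have "y t = y 0 + (LINT s|Leb t. h' s - \<mu> *\<^sub>R y s)" if t: "t \<in> {0..T}" for t
  proof -
   have "(LINT s|Leb t. h s - \<mu> *\<^sub>R y s) = (LINT s|Leb t. h' s - \<mu> *\<^sub>R y s)"
    by (rule bochner_integral_cong) (use \<open>\<And>t. t \<in> {0..T} \<Longrightarrow> h t = h' t\<close> t in auto)
   then show ?thesis using d(3)[OF t] by (rule subst)
  qed
  ultimately show ?thesis using d(2) unfolding linear_evolution_def by blast
 qed
 have hk: "h 0 t = 0" "h (- k) t = vcnj (h k t)" "cdot (\<kappa> k) (h k t) = 0" if "t \<in> {0..T}" for t k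
  using h[OF that] by (auto simp: real_field_def)
 have w0k: "w0 0 = 0" "w0 (- k) = vcnj (w0 k)" "cdot (\<kappa> k) (w0 k) = 0" for k
  using w0(2) by (auto simp: real_field_def)
 have "w 0 t = 0"
  by (rule linear_evolution_zero[OF cong[OF ev[of 0] hk(1)] t nn]) (simp_all add: init w0k)
 moreover have "w (- k) t = vcnj (w k t)" for k
 proof (rule linear_evolution_unique[OF ev[of "- k"] _ t nn])
  have "linear_evolution T (\<nu> * lam k) (%s. vcnj (h k s)) (%s. vcnj (w k s))"
   by (rule linear_evolution_bounded_linear[OF ev bounded_linear_vcnj])
  from cong[OF this, of "h (- k)"] hk(2)
  show "linear_evolution T (\<nu> * lam (- k)) (h (- k)) (%s. vcnj (w k s))" by simp
 qed (simp add: init w0k)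
 moreover have "cdot (\<kappa> k) (w k t) = 0" for k
 proof (rule linear_evolution_zero[OF _ t nn])
  have "linear_evolution T (\<nu> * lam k) (%s. cdot (\<kappa> k) (h k s)) (%s. cdot (\<kappa> k) (w k s))"
   by (rule linear_evolution_bounded_linear[OF ev bounded_linear_cdot])
  from cong[OF this, of "%s. 0"] hk(3)
  show "linear_evolution T (\<nu> * lam k) (%s. 0) (%s. cdot (\<kappa> k) (w k s))" by simp
 qed (simp add: init w0k)
 ultimately show ?thesis by (simp add: real_field_def)
qed

lemma source_real_field: "good w \<Longrightarrow> t \<in> {0..T} \<Longrightarrow> real_field (%k. source R w k t)"
 using F_real_field[of t] Nl_real_field[OF goodD(3), of w t R]
 by (auto simp: source_def real_field_def cdot_linear vec_eq_iff)

lemma good_evolution: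
 assumes g: "good w" and R: "R > 0" and init: "\<And>k. w' k 0 = w0 k"
  and ev: "\<And>k. linear_evolution T (\<nu> * lam k) (source R w k) (w' k)"
 shows "good w'" and "t \<in> {0..T} \<Longrightarrow> (h1n (%k. w' k t))^2 \<le> (h1n w0)^2 + (LINT s|Leb t. source_bound R s) / \<nu>"
proof -
 have rf: "real_field (%k. w' k t)" if "t \<in> {0..T}" for t
  by (rule evolution_preserves_real_field[OF ev init source_real_field[OF g] that])
 have z: "w' 0 t = 0" if "t \<in> {0..T}" for t using rf[OF that] by (simp add: real_field_def)
 have i: "h1 (%k. w' k 0)" using w0(1) by (simp add: init)
 have b: "AE s in Leb T. ell2 (%k. source R w k s) \<and> (ell2_norm (%k. source R w k s))^2 \<le> source_bound R s"
  by (rule AE_in_lebesgue_onI) (use source_ell2[OF g _ R] in blast)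
 note e = evolution_estimate[OF ev z i b source_bound_integrable]
 show "good w'" unfolding good_def using rf e(4) linear_evolutionD(2)[OF ev] by blast
 show "t \<in> {0..T} \<Longrightarrow> (h1n (%k. w' k t))^2 \<le> (h1n w0)^2 + (LINT s|Leb t. source_bound R s) / \<nu>"
  using e(5)[of t] by (simp add: init)
qed

section \<open>Picard iteration for the truncated system\<close>

lemma picard_step_exists:
 assumes g: "good w" and R: "R > 0"
 shows "\<exists>w'. good w' \<and> (\<forall>k. w' k 0 = w0 k \<and> linear_evolution T (\<nu> * lam k) (source R w k) (w' k))"
proof -
 have "\<exists>y. linear_evolution T (\<nu> * lam k) (source R w k) y \<and> y 0 = w0 k" for k
  by (rule linear_evolution_exists[OF source_integrable[OF g R]]) (use pos in simp)
 then obtain w' where w': "\<And>k. linear_evolution T (\<nu> * lam k) (source R w k) (w' k)" "\<And>k. w' k 0 = w0 k"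
  by metis
 then show ?thesis using good_evolution(1)[OF g R w'(2,1)] by blast
qed

text \<open>With the nonlinear term frozen at the previous iterate the modes decouple into linear
  equations. The choice includes \<open>good\<close>, which makes the next source
  integrable.\<close>

primrec picard :: "real \<Rightarrow> nat \<Rightarrow> 'a \<Rightarrow> real \<Rightarrow> complex^3" where
 "picard R 0 = (%k t. w0 k)"
| "picard R (Suc n) = (SOME w'. good w' \<and> (\<forall>k. w' k 0 = w0 k \<and> linear_evolution T (\<nu> * lam k) (source R (picard R n) k) (w' k)))"

declare picard.simps(2) [simp del]

lemma picard_good: "R > 0 \<Longrightarrow> good (picard R n)"
proof (induction n)
 case 0 then show ?case using w0 by (simp add: good_def)
next
 case (Suc n)
 from someI_ex[OF picard_step_exists[OF Suc.IH[OF Suc.prems] Suc.prems]] show ?case by (simp add: picard.simps(2))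
qed

lemma picard_Suc:
 assumes R: "R > 0"
 shows "picard R (Suc n) k 0 = w0 k" "linear_evolution T (\<nu> * lam k) (source R (picard R n) k) (picard R (Suc n) k)"
 using someI_ex[OF picard_step_exists[OF picard_good[OF R, of n] R]] by (simp_all add: picard.simps(2))

lemma source_difference:
 assumes g: "good w" "good v" and t: "t \<in> {0..T}" and R: "R > 0"
 shows "ell2 (%k. source R w k t - source R v k t)"
  "(ell2_norm (%k. source R w k t - source R v k t))^2 \<le> (8 * Kf * R)^2 / \<theta> * (h1n (%k. w k t - v k t))^2"
proof -
 have eq: "(%k. source R w k t - source R v k t) = (%k. Nl R (slice v t) k - Nl R (slice w t) k)"
  by (auto simp: source_def)
 note l = Nl_lipschitz[OF goodD(2)[OF g(2) t] goodD(2)[OF g(1) t] R]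
 show "ell2 (%k. source R w k t - source R v k t)" unfolding eq by (rule h1_imp_ell2(1)[OF l(1)])
 have "(ell2_norm (%k. source R w k t - source R v k t))^2 \<le> (h1n (%k. Nl R (slice v t) k - Nl R (slice w t) k))^2 / \<theta>"
  unfolding eq by (rule h1_imp_ell2(2)[OF l(1)])
 also have "\<dots> \<le> (8 * Kf * R * h1n (%k. w k t - v k t))^2 / \<theta>"
  using l(2) theta(1) unfolding h1n_minus_commute[of "%k. v k t"]
  by (intro divide_right_mono power_mono) auto
 finally show "(ell2_norm (%k. source R w k t - source R v k t))^2 \<le> (8 * Kf * R)^2 / \<theta> * (h1n (%k. w k t - v k t))^2"
  by (simp add: power_mult_distrib)
qed

lemma h1n_difference_integrable:
 assumes g: "good w" "good v" and b: "\<And>t. t \<in> {0..T} \<Longrightarrow> (h1n (%k. w k t - v k t))^2 \<le> B"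
 shows "integrable (Leb T) (%t. (h1n (%k. w k t - v k t))^2)"
proof (rule integrable_lebesgue_on_bounded[where B=B])
 show "(%t. (h1n (%k. w k t - v k t))^2) \<in> borel_measurable (Leb T)"
  by (intro borel_measurable_power measurable_h1n borel_measurable_diff goodD g)
qed (use b in auto)

text \<open>The squared H_1 increments satisfy the hypothesis of
  \<open>integral_iterate_bound\<close>, by \<open>evolution_estimate\<close> and the Lipschitz
  bound for the source. Their ratio 1/4 becomes 1/2 after taking the root.\<close>

lemma picard_increment:
 assumes R: "R > 0"
 shows "\<exists>M\<ge>0. \<forall>n. \<forall>t\<in>{0..T}. h1n (%k. picard R (Suc n) k t - picard R n k t) \<le> M * (1/2) ^ n"
proof -
 define d where "d n t = (h1n (%k. picard R (Suc n) k t - picard R n k t))^2" for n t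
 define C where "C = (8 * Kf * R)^2 / \<theta>"
 have C: "C \<ge> 0" using theta(1) by (simp add: C_def)
 define I where "I = (LINT s|Leb T. source_bound R s)"
 have sb0: "source_bound R s \<ge> 0" for s unfolding source_bound_def using theta(1) by simp
 define M0 where "M0 = 2 * ((h1n w0)^2 + I / \<nu>) + 2 * (h1n w0)^2"
 have It: "(LINT s|Leb t. source_bound R s) \<le> I" if t: "t \<in> {0..T}" for t
 proof -
  have "0 \<le> (LINT s|lebesgue_on {t..T}. source_bound R s)" by (intro bochner_integral_nonneg sb0)
  moreover have "I - (LINT s|Leb t. source_bound R s) = (LINT s|lebesgue_on {t..T}. source_bound R s)"
   unfolding I_def by (rule lebesgue_on_integral_diff[OF source_bound_integrable]) (use t in auto)
  ultimately show ?thesis by linarith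
 qed
 have sq: "(a + b)^2 \<le> 2 * a^2 + 2 * b^2" for a b :: real
  using sum_squares_bound[of a b] by (simp add: power2_sum)
 \<comment> \<open>A bound uniform in n, available because \<open>source_bound\<close> is the same
   for all iterates.\<close>
 have bp: "(h1n (%k. picard R n k t))^2 \<le> (h1n w0)^2 + I / \<nu>" if t: "t \<in> {0..T}" for n t
 proof (cases n)
  case 0
  have "0 \<le> I" unfolding I_def by (intro bochner_integral_nonneg sb0)
  then show ?thesis using 0 pos by simp
 next
  case (Suc m)
  have "(h1n (%k. picard R (Suc m) k t))^2 \<le> (h1n w0)^2 + (LINT s|Leb t. source_bound R s) / \<nu>"
   by (rule good_evolution(2)[OF picard_good[OF R] R picard_Suc[OF R] t])
  then show ?thesis using divide_right_mono[OF It[OF t], of \<nu>] pos unfolding Suc by linarith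
 qed
 have db: "d n t \<le> 4 * ((h1n w0)^2 + I / \<nu>)" if t: "t \<in> {0..T}" for n t
 proof -
  have "d n t \<le> (h1n (%k. picard R (Suc n) k t) + h1n (%k. picard R n k t))^2"
   unfolding d_def by (intro power_mono h1n_diff goodD(2)[OF picard_good[OF R] t]) auto
  also have "\<dots> \<le> 2 * (h1n (%k. picard R (Suc n) k t))^2 + 2 * (h1n (%k. picard R n k t))^2" by (rule sq)
  also have "\<dots> \<le> 2 * ((h1n w0)^2 + I / \<nu>) + 2 * ((h1n w0)^2 + I / \<nu>)"
   by (intro add_mono mult_left_mono bp t) auto
  also have "\<dots> = 4 * ((h1n w0)^2 + I / \<nu>)" by simp
  finally show ?thesis .
 qed
 have di: "integrable (Leb T) (d n)" for n
  unfolding d_def by (rule h1n_difference_integrable[OF picard_good[OF R] picard_good[OF R]]) (use db in \<open>simp add: d_def\<close>)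
 have dS: "d (Suc n) t \<le> C / \<nu> * (LINT s|Leb t. d n s)" if t: "t \<in> {0..T}" for n t
 proof -
  let ?\<delta> = "%k t. picard R (Suc (Suc n)) k t - picard R (Suc n) k t"
  let ?\<eta> = "%k t. source R (picard R (Suc n)) k t - source R (picard R n) k t"
  have init: "?\<delta> k 0 = 0" for k using picard_Suc(1)[OF R] by simp
  have "(h1n (%k. ?\<delta> k t))^2 \<le> (h1n (%k. ?\<delta> k 0))^2 + (LINT s|Leb t. C * d n s) / \<nu>"
  proof (rule evolution_estimate(5)[where \<eta>="?\<eta>"])
   show "linear_evolution T (\<nu> * lam k) (?\<eta> k) (?\<delta> k)" for k
    by (rule linear_evolution_diff[OF picard_Suc(2)[OF R] picard_Suc(2)[OF R]])
   show "?\<delta> 0 t = 0" if "t \<in> {0..T}" for t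
    using h1_diff[OF goodD(2)[OF picard_good[OF R] that, of "Suc (Suc n)"] goodD(2)[OF picard_good[OF R] that, of "Suc n"]]
    by (simp add: h1_def)
   show "h1 (%k. ?\<delta> k 0)" unfolding init by (simp add: h1_def h1w_def)
   show "AE s in Leb T. ell2 (%k. ?\<eta> k s) \<and> (ell2_norm (%k. ?\<eta> k s))^2 \<le> C * d n s"
    unfolding C_def d_def
    by (rule AE_in_lebesgue_onI) (intro conjI source_difference picard_good R)
  qed (use di t in auto)
  also have "h1n (%k. ?\<delta> k 0) = 0" unfolding init by (simp add: h1n_def h1w_def)
  finally show ?thesis unfolding d_def by simp
 qed
 have h0: "0 \<le> 4 * ((h1n w0)^2 + I / \<nu>)"
 proof -
  have "0 \<le> (h1n w0)^2 + I / \<nu>"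
  proof -
   have "0 \<in> {0..T}" using pos by simp
   from bp[OF this, of 0] show ?thesis by (rule order_trans[OF zero_le_power2])
  qed
  then show ?thesis by simp
 qed
 \<comment> \<open>The iteration bound at the final time, so that the estimate of the increments is
   uniform on [0, T].\<close>
 define E where "E = 4 * ((h1n w0)^2 + I / \<nu>) * exp ((4 * (C / \<nu>) + 1) * T)"
 have E0: "E \<ge> 0" unfolding E_def using h0 by (intro mult_nonneg_nonneg) auto
 have "h1n (%k. picard R (Suc n) k t - picard R n k t) \<le> sqrt E * (1/2) ^ n" if t: "t \<in> {0..T}" for n t
 proof (rule power2_le_imp_le)
  have "d n t \<le> 4 * ((h1n w0)^2 + I / \<nu>) * (1/4) ^ n * exp ((4 * (C / \<nu>) + 1) * t)"
  proof (rule integral_iterate_bound[where T=T and d=d and C="C / \<nu>"])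
   show "0 \<le> C / \<nu>" using C pos by simp
  qed (fact di db h0 dS t)+
  also have "\<dots> \<le> 4 * ((h1n w0)^2 + I / \<nu>) * (1/4) ^ n * exp ((4 * (C / \<nu>) + 1) * T)"
  proof -
   have "0 \<le> 4 * (C / \<nu>) + 1" using C pos by (simp add: add_nonneg_nonneg)
   then have "(4 * (C / \<nu>) + 1) * t \<le> (4 * (C / \<nu>) + 1) * T" by (rule mult_left_mono[rotated]) (use t in simp)
   then show ?thesis using h0 by (intro mult_left_mono) auto
  qed
  also have "\<dots> = (sqrt E * (1/2) ^ n)^2"
  proof -
   have "((1/2::real) ^ n)^2 = ((1/2)^2) ^ n" by (simp only: power_mult[symmetric] mult.commute[of n 2])
   then have "((1/2::real) ^ n)^2 = (1/4) ^ n" by (simp only: power2_eq_square) simp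
   then show ?thesis using E0 by (simp add: power_mult_distrib E_def)
  qed
  finally show "(h1n (%k. picard R (Suc n) k t - picard R n k t))^2 \<le> (sqrt E * (1/2) ^ n)^2" by (simp only: d_def)
  show "0 \<le> sqrt E * (1/2) ^ n" using E0 by simp
 qed
 then show ?thesis using E0 by (intro exI[of _ "sqrt E"]) auto
qed

text \<open>The right-hand side is the exact partial geometric sum from n to m - 1; keeping the term
  in m is what closes the induction.\<close>

lemma picard_cauchy:
 assumes M: "\<And>n t. t \<in> {0..T} \<Longrightarrow> h1n (%k. picard R (Suc n) k t - picard R n k t) \<le> M * (1/2) ^ n"
  and R: "R > 0" and t: "t \<in> {0..T}" and "n \<le> m"
 shows "h1n (%k. picard R m k t - picard R n k t) \<le> M * (2 * (1/2) ^ n - 2 * (1/2) ^ m)"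
 using \<open>n \<le> m\<close>
proof (induction m rule: dec_induct)
 case base then show ?case by (simp add: h1n_def h1w_def)
next
 case (step m)
 note g = goodD(2)[OF picard_good[OF R] t]
 have "h1n (%k. (picard R (Suc m) k t - picard R m k t) + (picard R m k t - picard R n k t))
   \<le> h1n (%k. picard R (Suc m) k t - picard R m k t) + h1n (%k. picard R m k t - picard R n k t)"
  by (intro h1n_add h1_diff g)
 also have "\<dots> \<le> M * (1/2) ^ m + M * (2 * (1/2) ^ n - 2 * (1/2) ^ m)"
  by (intro add_mono M[OF t] step.IH)
 finally show ?case by (simp add: algebra_simps)
qed

text \<open>Each mode converges uniformly in time, and \<open>ell2_limit\<close> transfers the H_1
  estimates to the limit. The Lipschitz bound gives convergence of the sources, and dominated
  convergence passes to the limit in the integral equation.\<close>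

lemma truncated_solution_exists:
 assumes R: "R > 0"
 shows "\<exists>w. good w \<and> (\<forall>k. w k 0 = w0 k \<and> linear_evolution T (\<nu> * lam k) (source R w k) (w k))"
proof -
 obtain M where M: "M \<ge> 0" "\<And>n t. t \<in> {0..T} \<Longrightarrow> h1n (%k. picard R (Suc n) k t - picard R n k t) \<le> M * (1/2) ^ n"
 proof -
  from picard_increment[OF R] obtain M where "0 \<le> M"
   "\<forall>n. \<forall>t\<in>{0..T}. h1n (%k. picard R (Suc n) k t - picard R n k t) \<le> M * (1/2) ^ n" by blast
  then show thesis by (intro that) auto
 qed
 let ?w = "%n k t. picard R n k t"
 note g = picard_good[OF R] note gh = goodD(2)[OF picard_good[OF R]]
 have cau: "h1n (%k. ?w m k t - ?w n k t) \<le> 2 * M * (1/2) ^ n" if "t \<in> {0..T}" "n \<le> m" for n m t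
 proof -
  have "M * (2 * (1/2) ^ n - 2 * (1/2) ^ m) \<le> 2 * M * (1/2) ^ n" using M(1) by (simp add: algebra_simps)
  then show ?thesis using picard_cauchy[OF M(2) R that] by linarith
 qed
 have small: "\<exists>N. \<forall>n\<ge>N. C * (1/2::real) ^ n < e" if "e > 0" for C e
 proof -
  have "(%n. C * (1/2::real) ^ n) \<longlonglongrightarrow> 0" by (intro tendsto_mult_right_zero LIMSEQ_realpow_zero) auto
  then have "eventually (%n. C * (1/2::real) ^ n < e) sequentially" by (rule order_tendstoD) (rule that)
  then show ?thesis by (simp add: eventually_sequentially)
 qed
 \<comment> \<open>The constant depends on k, so uniformity is in time only. At k = 0 the quotient
   is 0 by division by zero, and so is the left side.\<close>
 have comp: "norm (?w m k t - ?w n k t) \<le> (2 * M / norm (\<kappa> k)) * (1/2) ^ n" if t: "t \<in> {0..T}" and nm: "n \<le> m" for k n m t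
 proof (cases "k = 0")
  case True
  then show ?thesis using gh[OF t, of m] gh[OF t, of n] by (simp add: h1_def)
 next
  case False
  have "norm (\<kappa> k) * norm (?w m k t - ?w n k t) \<le> 2 * M * (1/2) ^ n"
   using h1_component[OF h1_diff[OF gh[OF t, of m] gh[OF t, of n]], of k] cau[OF t nm] by simp
  then show ?thesis using kappa_pos[OF False] by (simp add: field_simps)
 qed
 have "\<exists>l. uniform_limit {0..T} (%n. ?w n k) l sequentially" for k
 proof -
  have "uniformly_Cauchy_on {0..T} (%n. ?w n k)"
  proof (rule uniformly_Cauchy_onI)
   fix e :: real assume e: "e > 0"
   obtain N where N: "\<And>n. n \<ge> N \<Longrightarrow> (2 * M / norm (\<kappa> k)) * (1/2::real) ^ n < e"
    using small[OF e] by blast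
   have "dist (?w m k t) (?w n k t) < e" if "t \<in> {0..T}" "m \<ge> N" "n \<ge> N" for m n t
   proof (cases "n \<le> m")
    case True then show ?thesis using comp[OF that(1) True, of k] N[OF that(3)] by (simp add: dist_norm)
   next
    case False
    then have "m \<le> n" by simp
    from comp[OF that(1) this, of k] N[OF that(2)] show ?thesis by (simp add: dist_norm norm_minus_commute)
   qed
   then show "\<exists>N. \<forall>x\<in>{0..T}. \<forall>m\<ge>N. \<forall>n\<ge>N. dist (?w m k x) (?w n k x) < e" by blast
  qed
  then show ?thesis using Cauchy_uniformly_convergent uniformly_convergent_on_def by blast
 qed
 then obtain w where w: "\<And>k. uniform_limit {0..T} (%n. ?w n k) (w k) sequentially" by metis
 have lim: "(%n. ?w n k t) \<longlonglongrightarrow> w k t" if "t \<in> {0..T}" for k t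
  by (rule tendsto_uniform_limitI[OF w that])
 have cw: "continuous_on {0..T} (w k)" for k
  by (rule uniform_limit_theorem[OF _ w]) (use goodD(1)[OF g] in auto)
 have dif: "h1 (%k. w k t - ?w n k t)" "h1n (%k. w k t - ?w n k t) \<le> 2 * M * (1/2) ^ n" if t: "t \<in> {0..T}" for t n
 proof -
  have l: "(%m. h1w (%k. ?w m k t - ?w n k t) k) \<longlonglongrightarrow> h1w (%k. w k t - ?w n k t) k" for k
   unfolding h1w_def by (intro tendsto_intros lim t)
  have e: "ell2 (h1w (%k. ?w m k t - ?w n k t))" for m
   using h1_diff[OF gh[OF t, of m] gh[OF t, of n]] by (simp add: h1_def)
  have b: "ell2_norm (h1w (%k. ?w m k t - ?w n k t)) \<le> 2 * M * (1/2) ^ n" if "m \<ge> n" for m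
   using cau[OF t that] by (simp add: h1n_def)
  note q = ell2_limit[OF l e b]
  have "?w m 0 t = 0" for m using gh[OF t, of m] by (simp add: h1_def)
  then have "(%m. ?w m 0 t) \<longlonglongrightarrow> 0" by simp
  then have "w 0 t = 0" by (rule LIMSEQ_unique[OF lim[OF t]])
  then show "h1 (%k. w k t - ?w n k t)" using q(1)[of n] gh[OF t, of n] by (simp add: h1_def)
  show "h1n (%k. w k t - ?w n k t) \<le> 2 * M * (1/2) ^ n" using q(2)[of n] by (simp add: h1n_def)
 qed
 have hw: "h1 (slice w t)" if t: "t \<in> {0..T}" for t
  using h1_add[OF dif(1)[OF t, of 0] gh[OF t, of 0]] by simp
 have rw: "real_field (slice w t)" if t: "t \<in> {0..T}" for t
 proof -
  have rn: "?w n (- k) t = vcnj (?w n k t)" "cdot (\<kappa> k) (?w n k t) = 0" for n k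
   using goodD(3)[OF g t, of n] by (auto simp: real_field_def)
  have "(%n. ?w n (- k) t) \<longlonglongrightarrow> vcnj (w k t)" for k
   unfolding rn by (rule bounded_linear.tendsto[OF bounded_linear_vcnj lim[OF t]])
  then have 1: "w (- k) t = vcnj (w k t)" for k using lim[OF t, of "- k"] LIMSEQ_unique by blast
  have "(%n. cdot (\<kappa> k) (?w n k t)) \<longlonglongrightarrow> cdot (\<kappa> k) (w k t)" for k
   by (rule bounded_linear.tendsto[OF bounded_linear_cdot lim[OF t]])
  then have 2: "cdot (\<kappa> k) (w k t) = 0" for k unfolding rn using LIMSEQ_unique tendsto_const by blast
  show ?thesis using 1 2 hw[OF t] by (simp add: real_field_def h1_def)
 qed
 have gw: "good w" unfolding good_def using cw hw rw by blast
 have init: "w k 0 = w0 k" for k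
 proof -
  have "?w n k 0 = w0 k" for n by (cases n) (use picard_Suc(1)[OF R] in auto)
  then have "(%n. ?w n k 0) \<longlonglongrightarrow> w0 k" by simp
  then show ?thesis by (rule LIMSEQ_unique[OF lim, rotated]) (use pos in simp)
 qed
 have slim: "norm (source R w k t - source R (picard R n) k t) \<le> sqrt ((8 * Kf * R)^2 / \<theta>) * (2 * M * (1/2) ^ n)"
  if t: "t \<in> {0..T}" for k n t
 proof -
  have "norm (source R w k t - source R (picard R n) k t) \<le> ell2_norm (%k. source R w k t - source R (picard R n) k t)"
   by (rule ell2_component_le[OF source_difference(1)[OF gw g t R]])
  also have "\<dots> \<le> sqrt ((8 * Kf * R)^2 / \<theta> * (h1n (%k. w k t - ?w n k t))^2)"
   by (rule real_le_rsqrt[OF source_difference(2)[OF gw g t R]])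
  also have "\<dots> = sqrt ((8 * Kf * R)^2 / \<theta>) * h1n (%k. w k t - ?w n k t)"
   by (simp only: real_sqrt_mult real_sqrt_abs abs_of_nonneg h1n_nonneg)
  also have "\<dots> \<le> sqrt ((8 * Kf * R)^2 / \<theta>) * (2 * M * (1/2) ^ n)"
   by (intro mult_left_mono dif t) (use theta(1) in simp)
  finally show ?thesis .
 qed
 have "w k t = w k 0 + (LINT s|Leb t. source R w k s - (\<nu> * lam k) *\<^sub>R w k s)" if t: "t \<in> {0..T}" for k t
 proof (rule LIMSEQ_unique)
  show "(%n. ?w (Suc n) k t) \<longlonglongrightarrow> w k t" by (rule LIMSEQ_Suc[OF lim[OF t]])
  let ?f = "%n s. source R (picard R n) k s - (\<nu> * lam k) *\<^sub>R ?w (Suc n) k s"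
  let ?l = "%s. source R w k s - (\<nu> * lam k) *\<^sub>R w k s"
  have if': "integrable (Leb t) (?f n)" for n
  proof -
   have "integrable (Leb T) (?f n)"
    by (intro bochner_integrable_diff integrable_scaleR_right source_integrable g R
      continuous_imp_integrable_real goodD(1)[OF g])
   then show ?thesis using lebesgue_on_eq_integral(1)[of T _ 0 t] t by auto
  qed
  have il: "integrable (Leb t) ?l"
  proof -
   have "integrable (Leb T) ?l"
    by (intro bochner_integrable_diff integrable_scaleR_right source_integrable gw R
      continuous_imp_integrable_real cw)
   then show ?thesis using lebesgue_on_eq_integral(1)[of T _ 0 t] t by auto
  qed
  \<comment> \<open>Bounds the integrand error uniformly in time: the first summand for the source,
    the second for the damping term. It tends to 0, and \<open>Q 0\<close> serves as the
    majorant.\<close>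
  define Q where "Q n = sqrt ((8 * Kf * R)^2 / \<theta>) * (2 * M * (1/2) ^ n) + \<nu> * lam k * ((2 * M / norm (\<kappa> k)) * (1/2) ^ n)" for n
  have wl: "norm (w k s - ?w n k s) \<le> (2 * M / norm (\<kappa> k)) * (1/2) ^ n" if s: "s \<in> {0..T}" for s n
  proof (rule LIMSEQ_le_const2)
   show "(%m. norm (?w m k s - ?w n k s)) \<longlonglongrightarrow> norm (w k s - ?w n k s)" by (intro tendsto_intros lim s)
   show "\<exists>N. \<forall>m\<ge>N. norm (?w m k s - ?w n k s) \<le> (2 * M / norm (\<kappa> k)) * (1/2) ^ n" using comp[OF s] by blast
  qed
  have bd: "norm (?f n s - ?l s) \<le> Q n" if s: "s \<in> {0..T}" for n s
  proof -
   have "?f n s - ?l s = (\<nu> * lam k) *\<^sub>R (w k s - ?w (Suc n) k s) - (source R w k s - source R (picard R n) k s)"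
    by (simp add: algebra_simps)
   then have n1: "norm (?f n s - ?l s) \<le> norm ((\<nu> * lam k) *\<^sub>R (w k s - ?w (Suc n) k s)) + norm (source R w k s - source R (picard R n) k s)"
    by (simp only: norm_triangle_ineq4)
   have n2: "norm ((\<nu> * lam k) *\<^sub>R (w k s - ?w (Suc n) k s)) = \<nu> * lam k * norm (w k s - ?w (Suc n) k s)"
    using pos by simp
   have n3: "\<nu> * lam k * norm (w k s - ?w (Suc n) k s) \<le> \<nu> * lam k * ((2 * M / norm (\<kappa> k)) * (1/2) ^ Suc n)"
    by (intro mult_left_mono wl s) (use pos in simp)
   have n4: "\<nu> * lam k * ((2 * M / norm (\<kappa> k)) * (1/2) ^ Suc n) \<le> \<nu> * lam k * ((2 * M / norm (\<kappa> k)) * (1/2) ^ n)"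
    using M(1) pos by (intro mult_left_mono) auto
   show ?thesis using n1 n2 n3 n4 slim[OF s, of k n] unfolding Q_def by linarith
  qed
  have "(%n. LINT s|Leb t. ?f n s) \<longlonglongrightarrow> (LINT s|Leb t. ?l s)"
  proof (rule integral_dominated_convergence[where w="%s. norm (?l s) + Q 0"])
   show "integrable (Leb t) (%s. norm (?l s) + Q 0)"
    by (intro bochner_integrable_add integrable_norm il) auto
   show "AE s in Leb t. (%n. ?f n s) \<longlonglongrightarrow> ?l s"
   proof (rule AE_in_lebesgue_onI)
    fix s assume "s \<in> {0..t}" then have s: "s \<in> {0..T}" using t by auto
    have Q0: "Q \<longlonglongrightarrow> 0" unfolding Q_def
     by (rule tendsto_add_zero; intro tendsto_mult_right_zero LIMSEQ_realpow_zero) auto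
    have "(%n. ?f n s - ?l s) \<longlonglongrightarrow> 0"
     by (rule Lim_null_comparison[OF _ Q0]) (use bd[OF s] in auto)
    then show "(%n. ?f n s) \<longlonglongrightarrow> ?l s" using Lim_null by blast
   qed
   show "AE s in Leb t. norm (?f n s) \<le> norm (?l s) + Q 0" for n
   proof (rule AE_in_lebesgue_onI)
    fix s assume "s \<in> {0..t}" then have s: "s \<in> {0..T}" using t by auto
    have "Q n \<le> Q 0" unfolding Q_def using M(1) pos theta(1)
     by (intro add_mono mult_left_mono) (auto simp: power_le_one)
    have "norm (?f n s) \<le> norm (?l s) + norm (?f n s - ?l s)" by (rule norm_triangle_sub)
    also have "\<dots> \<le> norm (?l s) + Q 0" using bd[OF s, of n] \<open>Q n \<le> Q 0\<close> by linarith
    finally show "norm (?f n s) \<le> norm (?l s) + Q 0" .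
   qed
  qed (use if' il in auto)
  then have "(%n. w0 k + (LINT s|Leb t. ?f n s)) \<longlonglongrightarrow> w0 k + (LINT s|Leb t. ?l s)"
   by (intro tendsto_intros)
  moreover have "?w (Suc n) k t = w0 k + (LINT s|Leb t. ?f n s)" for n
   using linear_evolutionD(3)[OF picard_Suc(2)[OF R] t] unfolding picard_Suc(1)[OF R] .
  ultimately show "(%n. ?w (Suc n) k t) \<longlonglongrightarrow> w k 0 + (LINT s|Leb t. ?l s)"
   unfolding init by (simp only:)
 qed
 then have "linear_evolution T (\<nu> * lam k) (source R w k) (w k)" for k
  unfolding linear_evolution_def using cw source_integrable[OF gw R] by blast
 then show ?thesis using gw init by blast
qed

section \<open>Energy bound independent of the truncation level\<close>

definition energy_bound :: real where
 "energy_bound = (\<Sum>\<^sub>\<infinity>k. \<gamma> k * (norm (w0 k))^2) + Kg / (2 * \<nu>) * (\<Sum>\<^sub>\<infinity>k. LINT s|Leb T. (norm (F k s))^2)"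

lemma F_square:
 shows "integrable (Leb T) (%s. (norm (F k s))^2)"
  "(%k. LINT s|Leb T. (norm (F k s))^2) summable_on UNIV"
proof -
 have m: "(%s. (norm (F k s))^2) \<in> borel_measurable (Leb T)" for k
  using F_measurable[of k] by measurable
 have d: "AE s in Leb T. (%k. \<bar>(norm (F k s))^2\<bar>) summable_on UNIV \<and>
   (\<Sum>\<^sub>\<infinity>k. \<bar>(norm (F k s))^2\<bar>) \<le> (ell2_norm (slice F s))^2"
  by (rule AE_in_lebesgue_onI) (use F_ell2 in \<open>auto simp: ell2_def ell2_norm_square\<close>)
 note i = infsum_integral_dominated[OF m d F_integrable]
 show "integrable (Leb T) (%s. (norm (F k s))^2)" by (rule i(1))
 show "(%k. LINT s|Leb T. (norm (F k s))^2) summable_on UNIV" using i(3) by simp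
qed

lemma F_integrable_component: "integrable (Leb T) (F k)"
proof (rule bochner_integrable_bound)
 show "integrable (Leb T) (%t. 1 + (norm (F k t))^2)"
  by (intro bochner_integrable_add F_square(1)) (rule continuous_imp_integrable_real, simp)
 show "AE t in Leb T. norm (F k t) \<le> norm (1 + (norm (F k t))^2)"
 proof (rule AE_in_lebesgue_onI)
  fix t
  have "2 * norm (F k t) \<le> (norm (F k t))^2 + 1" using sum_squares_bound[of "norm (F k t)" 1] by simp
  then have "norm (F k t) \<le> 1 + (norm (F k t))^2" using zero_le_power2[of "norm (F k t)"] by linarith
  then show "norm (F k t) \<le> norm (1 + (norm (F k t))^2)" by simp
 qed
qed (rule F_measurable)

text \<open>The energy identity of each mode is weighted by \<gamma> and summed. A single mode keeps
  its nonlinear contribution; only the sum over all modes cancels, so this term is carried until the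
  end. In the force term \<gamma> <= Kg |k|^2 cancels the 1 / |k|^2 of Young's inequality and leaves
  Kg / (2 \<nu>).\<close>

lemma truncated_energy:
 assumes R: "R > 0" and g: "good w" and init: "\<And>k. w k 0 = w0 k"
  and ev: "\<And>k. linear_evolution T (\<nu> * lam k) (source R w k) (w k)" and t: "t \<in> {0..T}"
 shows "\<alpha>^2 * (h1n (slice w t))^2 \<le> energy_bound"
proof -
 let ?I = "%f. LINT s|Leb t. f s"
 \<comment> \<open>This bound depends on \<open>R\<close>. It enters only the majorant that
   justifies exchanging sum and integral for the nonlinear term, not the final estimate.\<close>
 define B where "B = sqrt ((h1n w0)^2 + (LINT s|Leb T. source_bound R s) / \<nu>)"
 have sb0: "source_bound R s \<ge> 0" for s unfolding source_bound_def using theta(1) by simp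
 have wb: "h1n (slice w s) \<le> B" if s: "s \<in> {0..T}" for s
 proof -
  have "0 \<le> (LINT r|lebesgue_on {s..T}. source_bound R r)" by (intro bochner_integral_nonneg sb0)
  moreover have "(LINT r|Leb T. source_bound R r) - (LINT r|Leb s. source_bound R r) = (LINT r|lebesgue_on {s..T}. source_bound R r)"
   by (rule lebesgue_on_integral_diff[OF source_bound_integrable]) (use s in auto)
  ultimately have "(LINT r|Leb s. source_bound R r) \<le> (LINT r|Leb T. source_bound R r)" by linarith
  from divide_right_mono[OF this, of \<nu>] pos good_evolution(2)[OF g R init ev s]
  show ?thesis unfolding B_def by (intro real_le_rsqrt) linarith
 qed
 define n where "n k s = Nl R (slice w s) k" for k s
 have nm: "n k \<in> borel_measurable (Leb T)" for k
  unfolding n_def by (rule measurable_Nl) (auto intro: goodD[OF g])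
 have nw: "(\<Sum>\<^sub>\<infinity>k. \<gamma> k * (n k s \<bullet> w k s)) = 0" if s: "s \<in> {0..T}" for s
 proof -
  have "(\<Sum>\<^sub>\<infinity>k. \<gamma> k * (n k s \<bullet> w k s)) = (\<Sum>\<^sub>\<infinity>k. (cut R (h1n (slice w s)) * cut R (h1n (slice w s))) * (\<gamma> k * (Bn (slice w s) (slice w s) k \<bullet> w k s)))"
   by (simp add: n_def Nl_eq mult_ac)
  also have "\<dots> = 0"
   unfolding infsum_cmult_right' energy_cancellation[OF goodD(2)[OF g s] goodD(3)[OF g s]] by simp
  finally show ?thesis .
 qed
 have t0: "0 \<le> t" "t \<le> T" using t by auto
 have nwm: "(%s. \<gamma> k * (n k s \<bullet> w k s)) \<in> borel_measurable (Leb t)" for k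
  by (intro borel_measurable_lebesgue_on_subset[OF _ _ t0(2)] borel_measurable_times borel_measurable_inner nm goodD(4)[OF g]) auto
 have nwd: "AE s in Leb t. (%k. \<bar>\<gamma> k * (n k s \<bullet> w k s)\<bar>) summable_on UNIV \<and>
   (\<Sum>\<^sub>\<infinity>k. \<bar>\<gamma> k * (n k s \<bullet> w k s)\<bar>) \<le> Kg * ((2 * Kf * R * R) * B)"
 proof (rule AE_in_lebesgue_onI)
  fix s assume "s \<in> {0..t}" then have s: "s \<in> {0..T}" using t by auto
  note N = Nl_h1[OF goodD(2)[OF g s] R]
  note G = gamma_inner_summable[OF N(1) goodD(2)[OF g s]]
  have "Kg * (h1n (Nl R (slice w s)) * h1n (slice w s)) \<le> Kg * ((2 * Kf * R * R) * B)"
   using N(2) wb[OF s] Kg_nonneg Kf_nonneg R by (intro mult_left_mono mult_mono) auto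
  then show "(%k. \<bar>\<gamma> k * (n k s \<bullet> w k s)\<bar>) summable_on UNIV \<and>
   (\<Sum>\<^sub>\<infinity>k. \<bar>\<gamma> k * (n k s \<bullet> w k s)\<bar>) \<le> Kg * ((2 * Kf * R * R) * B)"
   using G unfolding n_def by linarith
 qed
 have ci: "integrable (Leb t) (%s. Kg * ((2 * Kf * R * R) * B))"
  by (rule continuous_imp_integrable_real) simp
 note X = infsum_integral_dominated[OF nwm nwd ci]
 have "(LINT s|Leb t. (\<Sum>\<^sub>\<infinity>k. \<gamma> k * (n k s \<bullet> w k s))) = (LINT s|Leb t. 0)"
  by (rule bochner_integral_cong) (use nw t in auto)
 then have X0: "((%k. ?I (%s. \<gamma> k * (n k s \<bullet> w k s))) has_sum 0) UNIV" using X(5) by simp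
 have F2: "integrable (Leb t) (%s. (norm (F k s))^2)" for k
  by (rule lebesgue_on_eq_integral(1)[OF F_square(1)]) (use t in auto)
 have pk: "\<gamma> k * (norm (w k t))^2 \<le> \<gamma> k * (norm (w0 k))^2 + Kg / (2 * \<nu>) * (LINT s|Leb T. (norm (F k s))^2)
   - 2 * ?I (%s. \<gamma> k * (n k s \<bullet> w k s))" for k
 proof (cases "k = 0")
  case True
  have "w 0 s = 0" if "s \<in> {0..T}" for s using goodD(2)[OF g that] by (simp add: h1_def)
  then have w0s: "w k s = 0" if "s \<in> {0..T}" for s using True that by simp
  have "?I (%s. \<gamma> k * (n k s \<bullet> w k s)) = ?I (%s. 0)"
   by (rule bochner_integral_cong) (use w0s t in auto)
  then have I0: "?I (%s. \<gamma> k * (n k s \<bullet> w k s)) = 0" by simp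
  have "w k t = 0" by (rule w0s[OF t])
  moreover have "0 \<le> Kg / (2 * \<nu>) * (LINT s|Leb T. (norm (F k s))^2)"
   using Kg_nonneg pos by (intro mult_nonneg_nonneg bochner_integral_nonneg) auto
  moreover have "0 \<le> \<gamma> k * (norm (w0 k))^2" using gamma_pos[of k] by simp
  ultimately show ?thesis unfolding I0 by simp
 next
  case False
  note lp = lam_pos[OF False]
  have cw: "continuous_on {0..t} (w k)" using goodD(1)[OF g, of k] t by (auto elim: continuous_on_subset)
  have iF: "integrable (Leb t) (F k)"
   by (rule lebesgue_on_eq_integral(1)[OF F_integrable_component]) (use t in auto)
  have iFw: "integrable (Leb t) (%s. F k s \<bullet> w k s)" by (rule integrable_inner_continuous[OF iF cw])
  have iww: "integrable (Leb t) (%s. (norm (w k s))^2)"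
   by (intro continuous_imp_integrable_real continuous_intros cw)
  have isw: "integrable (Leb t) (%s. source R w k s \<bullet> w k s)"
   by (rule integrable_inner_continuous[OF lebesgue_on_eq_integral(1)[OF source_integrable[OF g R]] cw]) (use t in auto)
  have inw: "integrable (Leb t) (%s. n k s \<bullet> w k s)"
   using bochner_integrable_diff[OF iFw isw] by (simp add: source_def n_def inner_diff_left)
  have e: "(norm (w k t))^2 + 2 * (\<nu> * lam k) * ?I (%s. (norm (w k s))^2) = (norm (w0 k))^2 + 2 * ?I (%s. source R w k s \<bullet> w k s)"
   using linear_evolution_energy[OF ev t, of k] by (simp add: init)
  have "?I (%s. source R w k s \<bullet> w k s) = ?I (%s. F k s \<bullet> w k s - n k s \<bullet> w k s)"
   by (simp add: source_def n_def inner_diff_left)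
  also have "\<dots> = ?I (%s. F k s \<bullet> w k s) - ?I (%s. n k s \<bullet> w k s)"
   by (rule bochner_integral_diff[OF iFw inw])
  finally have s: "?I (%s. source R w k s \<bullet> w k s) = ?I (%s. F k s \<bullet> w k s) - ?I (%s. n k s \<bullet> w k s)" .
  define \<mu> where "\<mu> = \<nu> * lam k"
  have mu: "\<mu> > 0" using lp pos by (simp add: \<mu>_def)
  have "2 * ?I (%s. F k s \<bullet> w k s) = ?I (%s. 2 * (F k s \<bullet> w k s))" by simp
  \<comment> \<open>Here Young's inequality spends the whole dissipation 2 \<mu>, as no regularity
    beyond H_1 is sought.\<close>
  also have "\<dots> \<le> ?I (%s. (norm (F k s))^2 / (2 * \<mu>) + 2 * \<mu> * (norm (w k s))^2)"
  proof (rule integral_mono)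
   fix s
   have "0 \<le> (norm (F k s - (2 * \<mu>) *\<^sub>R w k s))^2" by simp
   also have "\<dots> = (norm (F k s))^2 - 4 * \<mu> * (F k s \<bullet> w k s) + 4 * \<mu> * \<mu> * (norm (w k s))^2"
    unfolding power2_norm_eq_inner by (simp add: inner_diff_left inner_diff_right inner_commute algebra_simps)
   finally show "2 * (F k s \<bullet> w k s) \<le> (norm (F k s))^2 / (2 * \<mu>) + 2 * \<mu> * (norm (w k s))^2"
    using mu by (simp add: field_simps)
  qed (use iFw F2 iww in auto)
  also have "\<dots> = ?I (%s. (norm (F k s))^2) / (2 * \<mu>) + 2 * \<mu> * ?I (%s. (norm (w k s))^2)"
   using F2 iww by (subst bochner_integral_add) auto
  finally have c: "2 * ?I (%s. F k s \<bullet> w k s) \<le> ?I (%s. (norm (F k s))^2) / (2 * \<mu>) + 2 * \<mu> * ?I (%s. (norm (w k s))^2)" .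
  have arith: "x \<le> y + f - 2 * d" if "2 * a \<le> f + b" "x + b = y + 2 * (a - d)" for a b d f x y :: real
   using that by argo
  have a: "(norm (w k t))^2 \<le> (norm (w0 k))^2 + ?I (%s. (norm (F k s))^2) / (2 * \<mu>) - 2 * ?I (%s. n k s \<bullet> w k s)"
   by (rule arith[OF c e[unfolded s, folded \<mu>_def]])
  have "0 \<le> (LINT s|lebesgue_on {t..T}. (norm (F k s))^2)" by (intro bochner_integral_nonneg) simp
  moreover have "(LINT s|Leb T. (norm (F k s))^2) - ?I (%s. (norm (F k s))^2) = (LINT s|lebesgue_on {t..T}. (norm (F k s))^2)"
   by (rule lebesgue_on_integral_diff[OF F_square(1)]) (use t in auto)
  ultimately have IF: "?I (%s. (norm (F k s))^2) \<le> (LINT s|Leb T. (norm (F k s))^2)" by linarith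
  have IF0: "0 \<le> ?I (%s. (norm (F k s))^2)" by (intro bochner_integral_nonneg) simp
  have "\<gamma> k * (?I (%s. (norm (F k s))^2) / (2 * \<mu>)) \<le> (Kg * lam k) * (?I (%s. (norm (F k s))^2) / (2 * \<mu>))"
   using gamma_le[OF False] mu IF0 by (intro mult_right_mono) auto
  also have "\<dots> = Kg / (2 * \<nu>) * ?I (%s. (norm (F k s))^2)" using lp pos by (simp add: \<mu>_def field_simps)
  also have "\<dots> \<le> Kg / (2 * \<nu>) * (LINT s|Leb T. (norm (F k s))^2)"
   using Kg_nonneg pos by (intro mult_left_mono IF) auto
  finally have gF: "\<gamma> k * (?I (%s. (norm (F k s))^2) / (2 * \<mu>)) \<le> Kg / (2 * \<nu>) * (LINT s|Leb T. (norm (F k s))^2)" .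
  have "\<gamma> k * (norm (w k t))^2 \<le> \<gamma> k * ((norm (w0 k))^2 + ?I (%s. (norm (F k s))^2) / (2 * \<mu>) - 2 * ?I (%s. n k s \<bullet> w k s))"
   using gamma_pos[of k] by (intro mult_left_mono a) auto
  also have "\<dots> = \<gamma> k * (norm (w0 k))^2 + \<gamma> k * (?I (%s. (norm (F k s))^2) / (2 * \<mu>)) - 2 * (\<gamma> k * ?I (%s. n k s \<bullet> w k s))"
   by (simp only: right_diff_distrib distrib_left mult_ac)
  also have "\<gamma> k * ?I (%s. n k s \<bullet> w k s) = ?I (%s. \<gamma> k * (n k s \<bullet> w k s))" by simp
  finally show ?thesis using gF by linarith
 qed
 have sw0: "(%k. \<gamma> k * (norm (w0 k))^2) summable_on UNIV"
  using gamma_inner_summable(1)[OF w0(1) w0(1)] gamma_pos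
  by (simp add: power2_norm_eq_inner summable_on_abs_iff)
 have sF: "(%k. Kg / (2 * \<nu>) * (LINT s|Leb T. (norm (F k s))^2)) summable_on UNIV"
  by (rule summable_on_cmult_right[OF F_square(2)])
 have hsR: "((%k. \<gamma> k * (norm (w0 k))^2 + Kg / (2 * \<nu>) * (LINT s|Leb T. (norm (F k s))^2)
   + (- 2) * ?I (%s. \<gamma> k * (n k s \<bullet> w k s))) has_sum (energy_bound + (- 2) * 0)) UNIV"
  unfolding energy_bound_def infsum_cmult_right'[symmetric]
  by (intro has_sum_add has_sum_infsum sw0 sF has_sum_cmult_right X0)
 have swt: "(%k. \<gamma> k * (norm (w k t))^2) summable_on UNIV"
  using gamma_inner_summable(1)[OF goodD(2)[OF g t] goodD(2)[OF g t]] gamma_pos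
  by (simp add: power2_norm_eq_inner summable_on_abs_iff)
 have "\<alpha>^2 * (h1n (slice w t))^2 = (\<Sum>\<^sub>\<infinity>k. \<alpha>^2 * (lam k * (norm (w k t))^2))"
  unfolding h1n_square by (rule infsum_cmult_right'[symmetric])
 also have "\<dots> \<le> (\<Sum>\<^sub>\<infinity>k. \<gamma> k * (norm (w k t))^2)"
 proof (rule infsum_mono[OF _ swt])
  show "(%k. \<alpha>^2 * (lam k * (norm (w k t))^2)) summable_on UNIV"
   using goodD(2)[OF g t] by (intro summable_on_cmult_right) (simp add: h1_iff)
  show "\<alpha>^2 * (lam k * (norm (w k t))^2) \<le> \<gamma> k * (norm (w k t))^2" for k
   using mult_right_mono[OF gamma_ge[of k], of "(norm (w k t))^2"] by (simp add: mult.assoc)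
 qed
 also have "\<dots> \<le> energy_bound + (- 2) * 0"
  by (rule has_sum_mono[OF has_sum_infsum[OF swt] hsR]) (use pk in \<open>simp add: algebra_simps\<close>)
 finally show ?thesis by simp
qed

text \<open>The last two clauses are what the function spaces need later: a majorant uniform in time
  for continuity in H_1, and the mean square H_2 bound.\<close>

theorem coefficient_solution_exists:
 shows "\<exists>w. (\<forall>k. w k 0 = w0 k \<and> linear_evolution T (\<nu> * lam k) (%t. F k t - Bn (slice w t) (slice w t) k) (w k)) \<and>
  (\<forall>t\<in>{0..T}. h1 (slice w t) \<and> real_field (slice w t)) \<and>
  (\<exists>R. \<forall>t\<in>{0..T}. h1n (slice w t) \<le> R) \<and>
  (\<exists>m. m summable_on UNIV \<and> (\<forall>k. \<forall>t\<in>{0..T}. lam k * (norm (w k t))^2 \<le> m k)) \<and>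
  (%k. (lam k)^2 * (LINT s|Leb T. (norm (w k s))^2)) summable_on UNIV"
proof -
 \<comment> \<open>Chosen above the H_1 bound that the energy gives at any truncation level, so the
   truncation at this level is never active. The summand 1 makes \<open>R\<close> positive.\<close>
 define R where "R = sqrt (energy_bound / \<alpha>^2) + 1"
 have eb: "0 \<le> energy_bound"
  unfolding energy_bound_def using Kg_nonneg pos gamma_pos
  by (intro add_nonneg_nonneg mult_nonneg_nonneg infsum_nonneg bochner_integral_nonneg)
    (auto intro: less_imp_le)
 then have R: "R > 0" unfolding R_def by (intro add_nonneg_pos) auto
 obtain w where g: "good w" and init: "\<And>k. w k 0 = w0 k"
  and ev: "\<And>k. linear_evolution T (\<nu> * lam k) (source R w k) (w k)"
  using truncated_solution_exists[OF R] by blast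
 have wR: "h1n (slice w t) \<le> R" if t: "t \<in> {0..T}" for t
 proof -
  have "(h1n (slice w t))^2 \<le> energy_bound / \<alpha>^2"
   using truncated_energy[OF R g init ev t] pos by (simp add: field_simps)
  then have "h1n (slice w t) \<le> sqrt (energy_bound / \<alpha>^2)" by (rule real_le_rsqrt)
  then show ?thesis by (simp add: R_def)
 qed
 have src: "source R w k t = F k t - Bn (slice w t) (slice w t) k" if t: "t \<in> {0..T}" for k t
  unfolding source_def by (simp only: Nl_eq_Bn[OF wR[OF t]])
 have ev': "linear_evolution T (\<nu> * lam k) (%t. F k t - Bn (slice w t) (slice w t) k) (w k)" for k
  unfolding linear_evolution_def
 proof (intro conjI ballI)
  note d = linear_evolutionD[OF ev[of k]]
  show "integrable (Leb T) (%t. F k t - Bn (slice w t) (slice w t) k)"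
   using d(1) by (rule bochner_integrable_cong[THEN iffD1, rotated 2]) (use src in auto)
  show "continuous_on {0..T} (w k)" by (rule d(2))
  fix t assume t: "t \<in> {0..T}"
  have "(LINT s|Leb t. source R w k s - (\<nu> * lam k) *\<^sub>R w k s)
   = (LINT s|Leb t. (F k s - Bn (slice w s) (slice w s) k) - (\<nu> * lam k) *\<^sub>R w k s)"
   by (rule bochner_integral_cong) (use src t in auto)
  then show "w k t = w k 0 + (LINT s|Leb t. (F k s - Bn (slice w s) (slice w s) k) - (\<nu> * lam k) *\<^sub>R w k s)"
   using d(3)[OF t] by (rule subst)
 qed
 have z: "w 0 t = 0" if "t \<in> {0..T}" for t using goodD(2)[OF g that] by (simp add: h1_def)
 have i: "h1 (slice w 0)" using w0(1) by (simp add: init)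
 have b: "AE s in Leb T. ell2 (%k. source R w k s) \<and> (ell2_norm (%k. source R w k s))^2 \<le> source_bound R s"
  by (rule AE_in_lebesgue_onI) (use source_ell2[OF g _ R] in blast)
 note e = evolution_estimate[OF ev z i b source_bound_integrable]
 show ?thesis
 proof (intro exI[of _ w] conjI allI ballI)
  show "w k 0 = w0 k" for k by (rule init)
  show "linear_evolution T (\<nu> * lam k) (%t. F k t - Bn (slice w t) (slice w t) k) (w k)" for k by (rule ev')
  show "h1 (slice w t)" "real_field (slice w t)" if "t \<in> {0..T}" for t
   using goodD(2,3)[OF g that] by auto
  show "\<exists>R. \<forall>t\<in>{0..T}. h1n (slice w t) \<le> R" using wR by blast
  let ?m = "%k. lam k * (norm (w k 0))^2 + (LINT s|Leb T. (norm (source R w k s))^2) / \<nu>"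
  have "\<forall>k. \<forall>t\<in>{0..T}. lam k * (norm (w k t))^2 \<le> ?m k" using e(2) by blast
  with e(1) show "\<exists>m. m summable_on UNIV \<and> (\<forall>k. \<forall>t\<in>{0..T}. lam k * (norm (w k t))^2 \<le> m k)" by blast
  show "(%k. (lam k)^2 * (LINT s|Leb T. (norm (w k s))^2)) summable_on UNIV" by (rule e(3))
 qed
qed

end

section \<open>Fourier series on the torus\<close>

lemma AE_zero_if_sign_integrals_zero:
 fixes f :: "'a \<Rightarrow> real"
 assumes f: "integrable M f"
  and p: "(LINT x|M. indicator {x. f x > 0} x * f x) = 0"
  and n: "(LINT x|M. indicator {x. f x < 0} x * f x) = 0"
 shows "AE x in M. f x = 0"
proof -
 have [measurable]: "f \<in> borel_measurable M" using f by auto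
 have ip: "integrable M (%x. max (f x) 0)" "integrable M (%x. max (- f x) 0)" using f by auto
 have "indicator {x. f x > 0} x * f x = max (f x) 0" for x by (auto simp: indicator_def max_def)
 then have "AE x in M. max (f x) 0 = 0"
  using p ip by (simp add: integral_nonneg_eq_0_iff_AE)
 moreover have "indicator {x. f x < 0} x * f x = - max (- f x) 0" for x by (auto simp: indicator_def max_def)
 then have "AE x in M. max (- f x) 0 = 0"
  using n ip by (simp add: integral_nonneg_eq_0_iff_AE)
 ultimately show ?thesis by eventually_elim auto
qed

text \<open>The function is continuous off the nonnegative reals and vanishes on them, so it equals
  its product with the indicator of the complement.\<close>

lemma borel_measurable_Arg2pi [measurable]: "Arg2pi \<in> borel_measurable borel"
proof -
 have c: "continuous_on (- \<real>\<^sub>\<ge>\<^sub>0) Arg2pi"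
  by (intro continuous_at_imp_continuous_on ballI continuous_at_Arg2pi) auto
 have m: "- \<real>\<^sub>\<ge>\<^sub>0 \<in> sets (borel :: complex measure)" by (intro borel_open) (simp add: closed_nonneg_Reals_complex open_Compl)
 have "Arg2pi z = indicator (- \<real>\<^sub>\<ge>\<^sub>0) z *\<^sub>R Arg2pi z" for z
 proof (cases "z \<in> \<real>\<^sub>\<ge>\<^sub>0")
  case True
  then obtain r where "z = of_real r" "r \<ge> 0" by (auto elim: nonneg_Reals_cases)
  then show ?thesis by (simp add: Arg2pi_of_real)
 qed simp
 then show ?thesis using borel_measurable_continuous_on_indicator[OF m c] by (metis (no_types, lifting) measurable_cong)
qed

locale periodic_cell =
 fixes L :: real
 assumes L: "L > 0"
begin

definition cell :: "(real^3) set" where "cell = cbox 0 (\<chi> i. L)"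

definition wn :: "int^3 \<Rightarrow> real^3" where "wn m = (\<chi> i. 2 * pi / L * of_int (m $ i))"

lemma torus_cell: "torus L = lebesgue_on cell" by (simp add: torus_def cell_def)

lemma wn_add: "wn (k + l) = wn k + wn l" and wn_0 [simp]: "wn 0 = 0" and wn_minus [simp]: "wn (- k) = - wn k"
 by (simp_all add: wn_def vec_eq_iff distrib_left)

lemma wn_diff: "wn (k - l) = wn k - wn l" using wn_add[of k "- l"] by simp

lemma wn_inject: "wn k = wn l \<longleftrightarrow> k = l" using L by (simp add: wn_def vec_eq_iff)

lemma wavenumbers_eq: "wavenumbers L = range wn"
proof
 show "range wn \<subseteq> wavenumbers L" by (auto simp: wavenumbers_def wn_def)
 show "wavenumbers L \<subseteq> range wn"
 proof
  fix k assume "k \<in> wavenumbers L"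
  then obtain f where "\<And>i. k $ i = 2 * pi / L * of_int (f i)" unfolding wavenumbers_def by (auto, metis)
  then have "k = wn (\<chi> i. f i)" by (simp add: wn_def vec_eq_iff)
  then show "k \<in> range wn" by simp
 qed
qed

lemma wn_bij: "bij_betw wn UNIV (wavenumbers L)"
 unfolding wavenumbers_eq by (rule inj_on_imp_bij_betw) (auto simp: inj_on_def wn_inject)

lemma cell_measurable [simp, intro]: "cell \<in> sets lebesgue" "cell \<in> sets borel" "cell \<in> lmeasurable"
 by (simp_all add: cell_def)

lemma measure_cell: "measure lebesgue cell = L ^ 3"
proof -
 have "measure lebesgue cell = (\<Prod>b\<in>Basis. ((\<chi> i. L) - 0 :: real^3) \<bullet> b)"
  unfolding cell_def by (subst measure_completion, simp, subst measure_lborel_cbox)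
   (use L in \<open>auto simp: Basis_vec_def inner_axis\<close>)
 also have "\<dots> = (\<Prod>b\<in>(Basis::(real^3) set). L)" by (intro prod.cong) (auto simp: Basis_vec_def inner_axis)
 finally show ?thesis by simp
qed

lemma integral_torus_const [simp]: "(LINT x|torus L. c) = L ^ 3 *\<^sub>R (c :: 'b::{banach,second_countable_topology})"
proof -
 have "measure (lebesgue_on cell) cell = measure lebesgue cell" by (rule measure_restrict_space) auto
 then show ?thesis by (simp add: torus_cell measure_cell)
qed

lemma integrable_torus_continuous:
 fixes f :: "real^3 \<Rightarrow> 'b::euclidean_space"
 shows "continuous_on UNIV f \<Longrightarrow> integrable (torus L) f"
 unfolding torus_def by (rule continuous_imp_integrable) (auto elim: continuous_on_subset)

lemma measurable_torus_continuous:
 fixes f :: "real^3 \<Rightarrow> 'b::euclidean_space"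
 shows "continuous_on UNIV f \<Longrightarrow> f \<in> borel_measurable (torus L)"
 by (rule borel_measurable_integrable[OF integrable_torus_continuous])

lemma integrable_torus_mult_continuous:
 fixes f :: "real^3 \<Rightarrow> 'b::{real_normed_field,euclidean_space}" and u :: "real^3 \<Rightarrow> 'b"
 assumes u: "integrable (torus L) u" and f: "continuous_on UNIV f"
 shows "integrable (torus L) (%x. u x * f x)"
proof -
 have "compact (f ` cell)" unfolding cell_def
  by (intro compact_continuous_image continuous_on_subset[OF f]) auto
 then obtain B where B: "\<And>x. x \<in> cell \<Longrightarrow> norm (f x) \<le> B"
 proof -
  from \<open>compact (f ` cell)\<close> have "bounded (f ` cell)" by (rule compact_imp_bounded)
  then obtain B where "\<forall>y\<in>f ` cell. norm y \<le> B" unfolding bounded_iff by blast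
  then show thesis by (intro that[of B]) blast
 qed
 have [measurable]: "u \<in> borel_measurable (torus L)" "f \<in> borel_measurable (torus L)"
  using u measurable_torus_continuous[OF f] by auto
 show ?thesis
 proof (rule bochner_integrable_bound)
  show "integrable (torus L) (%x. norm (u x) * B)" using u by auto
  show "AE x in torus L. norm (u x * f x) \<le> norm (norm (u x) * B)"
   unfolding torus_cell
  proof (rule AE_I2)
   fix x assume "x \<in> space (lebesgue_on cell)"
   then have b: "norm (f x) \<le> B" by (intro B) simp
   have "norm (u x * f x) = norm (u x) * norm (f x)" by (rule norm_mult)
   also have "\<dots> \<le> norm (u x) * B" by (intro mult_left_mono b) simp
   finally show "norm (u x * f x) \<le> norm (norm (u x) * B)" by simp
  qed
 qed measurable
qed

lemma integral_cis_period:
 "(\<integral>t. indicator {0..L} t *\<^sub>R cis (2 * pi / L * of_int n * t) \<partial>lborel) = (if n = 0 then of_real L else 0)"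
proof (cases "n = 0")
 case True
 have "(\<integral>t. indicator {0..L} t *\<^sub>R (1::complex) \<partial>lborel) = of_real L"
  using L by (simp add: scaleR_conv_of_real)
 then show ?thesis using True by simp
next
 case False
 define a where "a = 2 * pi / L * of_int n"
 have a: "a \<noteq> 0" using False L by (simp add: a_def)
 have "(\<integral>t. indicator {0..L} t *\<^sub>R cis (a * t) \<partial>lborel)
   = cis (a * L) / (\<i> * of_real a) - cis (a * 0) / (\<i> * of_real a)"
 proof (rule integral_FTC_atLeastAtMost)
  show "0 \<le> L" using L by simp
  show "((%t. cis (a * t) / (\<i> * of_real a)) has_vector_derivative cis (a * t)) (at t within {0..L})" for t
  proof -
   have "((%t. exp ((\<i> * of_real a) * of_real t) / (\<i> * of_real a)) has_vector_derivative exp ((\<i> * of_real a) * of_real t)) (at t within {0..L})"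
   proof (rule has_vector_derivative_real_field)
    show "((%z. exp ((\<i> * of_real a) * z) / (\<i> * of_real a)) has_field_derivative exp ((\<i> * of_real a) * of_real t)) (at (of_real t))"
     using a by (auto intro!: derivative_eq_intros)
   qed
   then show ?thesis by (simp add: cis_conv_exp mult_ac)
  qed
  show "continuous_on {0..L} (%t. cis (a * t))" by (intro continuous_intros)
 qed
 also have "cis (a * L) = 1"
 proof -
  have "a * L = 2 * pi * of_int n" using L by (simp add: a_def)
  then show ?thesis by (simp add: complex_eq_iff cos_int_2pin sin_int_2pin)
 qed
 finally show ?thesis using False by (simp add: a_def)
qed

text \<open>The exponential and the indicator of the cell both factor over the coordinates, so the
  integral is a product of one-dimensional ones.\<close>

lemma integral_cis_torus: "(LINT x|torus L. cis (wn m \<bullet> x)) = (if m = 0 then of_real (L ^ 3) else 0)"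
proof -
 interpret product_sigma_finite "%_::real^3. lborel :: real measure" by standard
 let ?f = "%b::real^3. %t. indicator {0..L} t *\<^sub>R cis ((wn m \<bullet> b) * t)"
 have eq: "indicator cell x *\<^sub>R cis (wn m \<bullet> x) = (\<Prod>b\<in>Basis. ?f b (x \<bullet> b))" for x
 proof -
  have ind: "indicator cell x = (\<Prod>b\<in>Basis. indicator {0..L} (x \<bullet> b) :: real)"
  proof (cases "x \<in> cell")
   case True
   then have "\<And>b. b \<in> Basis \<Longrightarrow> x \<bullet> b \<in> {0..L}"
    unfolding cell_def mem_box by (auto simp: Basis_vec_def inner_axis)
   then show ?thesis using True by simp
  next
   case False
   have Lb: "((\<chi> i. L) :: real^3) \<bullet> b = L" if "b \<in> Basis" for b
    using that by (auto simp: Basis_vec_def inner_axis)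
   from False obtain b where b: "b \<in> Basis" "\<not> (0 \<bullet> b \<le> x \<bullet> b \<and> x \<bullet> b \<le> ((\<chi> i. L) :: real^3) \<bullet> b)"
    unfolding cell_def mem_box by blast
   then have "b \<in> Basis" "x \<bullet> b \<notin> {0..L}" using Lb[OF b(1)] by auto
   then show ?thesis using False by (auto intro!: prod_zero[symmetric] bexI[of _ b])
  qed
  have cis_sum: "cis (sum g A) = (\<Prod>b\<in>A. cis (g b))" if "finite A" for g and A :: "(real^3) set"
   using that by (induction A rule: finite_induct) (auto simp: cis_mult[symmetric])
  have "wn m \<bullet> x = (\<Sum>b\<in>Basis. (wn m \<bullet> b) * (x \<bullet> b))" by (rule euclidean_inner)
  then have "cis (wn m \<bullet> x) = (\<Prod>b\<in>Basis. cis ((wn m \<bullet> b) * (x \<bullet> b)))" by (simp add: cis_sum)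
  then show ?thesis unfolding ind by (simp add: scaleR_conv_of_real prod.distrib)
 qed
 have fb: "integral\<^sup>L lborel (?f (axis i 1)) = (if m $ i = 0 then of_real L else 0)" for i
  using integral_cis_period[of "m $ i"] by (simp add: wn_def inner_axis)
 have fi: "integrable lborel (?f b)" if "b \<in> Basis" for b
  by (rule borel_integrable_atLeastAtMost'[unfolded set_integrable_def]) (intro continuous_intros)
 have bm: "(%x. indicator cell x *\<^sub>R cis (wn m \<bullet> x)) \<in> borel_measurable lborel"
  by (intro borel_measurable_scaleR borel_measurable_indicator) 
    (auto intro!: borel_measurable_continuous_onI continuous_intros)
 have "(LINT x|torus L. cis (wn m \<bullet> x)) = (\<integral>x. indicator cell x *\<^sub>R cis (wn m \<bullet> x) \<partial>lebesgue)"
  unfolding torus_cell by (rule integral_restrict_space) simp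
 also have "\<dots> = (\<integral>x. indicator cell x *\<^sub>R cis (wn m \<bullet> x) \<partial>lborel)"
  by (rule integral_completion[OF bm])
 also have "\<dots> = (\<integral>x. (\<Prod>b\<in>Basis. ?f b (x \<bullet> b)) \<partial>lborel)" unfolding eq ..
 also have "\<dots> = (\<integral>f. (\<Prod>b\<in>Basis. ?f b ((\<Sum>b\<in>Basis. f b *\<^sub>R b) \<bullet> b)) \<partial>(\<Pi>\<^sub>M b\<in>(Basis::(real^3) set). lborel))"
  by (subst lborel_eq, rule integral_distr) (use bm[unfolded eq] in auto)
 also have "\<dots> = (\<integral>f. (\<Prod>b\<in>Basis. ?f b (f b)) \<partial>(\<Pi>\<^sub>M b\<in>(Basis::(real^3) set). lborel))"
  by (intro bochner_integral_cong prod.cong refl) simp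
 also have "\<dots> = (\<Prod>b\<in>Basis. integral\<^sup>L lborel (?f b))"
  by (rule product_integral_prod) (use fi in auto)
 also have "\<dots> = (if m = 0 then of_real (L ^ 3) else 0)"
 proof (cases "m = 0")
  case True
  have "(\<Prod>b\<in>Basis. integral\<^sup>L lborel (?f b)) = (\<Prod>b\<in>(Basis :: (real^3) set). of_real L)"
  proof (rule prod.cong[OF refl])
   fix b :: "real^3" assume "b \<in> Basis"
   then obtain i where "b = axis i 1" by (auto simp: Basis_vec_def)
   then show "integral\<^sup>L lborel (?f b) = of_real L" using fb[of i] True by simp
  qed
  then show ?thesis using True by simp
 next
  case False
  then obtain i where "m $ i \<noteq> 0" by (auto simp: vec_eq_iff)
  then have "integral\<^sup>L lborel (?f (axis i 1)) = 0" using fb[of i] by simp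
  moreover have "axis i 1 \<in> (Basis :: (real^3) set)" by (simp add: axis_in_Basis_iff)
  ultimately have "(\<Prod>b\<in>Basis. integral\<^sup>L lborel (?f b)) = 0" by (intro prod_zero) auto
  then show ?thesis using False by simp
 qed
 finally show ?thesis .
qed

section \<open>Completeness of the trigonometric system\<close>

inductive_set trig_poly :: "(real^3 \<Rightarrow> complex) set" where
 base: "(%x. c * cis (wn m \<bullet> x)) \<in> trig_poly"
| add: "f \<in> trig_poly \<Longrightarrow> g \<in> trig_poly \<Longrightarrow> (%x. f x + g x) \<in> trig_poly"

lemma trig_poly_mult_base: "f \<in> trig_poly \<Longrightarrow> (%x. f x * (d * cis (wn n \<bullet> x))) \<in> trig_poly"
proof (induction rule: trig_poly.induct)
 case (base c m)
 have "(%x. c * cis (wn m \<bullet> x) * (d * cis (wn n \<bullet> x))) = (%x. (c * d) * cis (wn (m + n) \<bullet> x))"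
  by (auto simp: wn_add inner_add_left cis_mult[symmetric] mult_ac)
 then show ?case using trig_poly.base[of "c * d" "m + n"] by simp
qed (auto simp: distrib_right intro: trig_poly.add)

lemma trig_poly_mult: "g \<in> trig_poly \<Longrightarrow> f \<in> trig_poly \<Longrightarrow> (%x. f x * g x) \<in> trig_poly"
 by (induction rule: trig_poly.induct) (auto simp: distrib_left intro: trig_poly.add trig_poly_mult_base)

lemma trig_poly_const: "(%x. c) \<in> trig_poly"
 using trig_poly.base[of c 0] by simp

lemma trig_poly_sum: "finite A \<Longrightarrow> (\<And>i. i \<in> A \<Longrightarrow> f i \<in> trig_poly) \<Longrightarrow> (%x. \<Sum>i\<in>A. f i x) \<in> trig_poly"
 by (induction A rule: finite_induct) (auto intro: trig_poly.add trig_poly_const)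

lemma trig_poly_continuous: "f \<in> trig_poly \<Longrightarrow> continuous_on UNIV f"
 by (induction rule: trig_poly.induct) (auto intro!: continuous_intros)

text \<open>The torus as a product of three unit circles in complex space. Polynomials in the real
  and imaginary parts become trigonometric polynomials, so Stone-Weierstrass can be applied on a
  ball containing the image.\<close>

definition torus_emb :: "real^3 \<Rightarrow> complex^3" where
 "torus_emb x = (\<chi> j. cis (2 * pi / L * x $ j))"

lemma torus_emb_continuous: "continuous_on UNIV torus_emb"
 unfolding torus_emb_def by (intro continuous_on_vec_lambda continuous_intros)

lemma torus_emb_bounded: "torus_emb x \<in> cball 0 3"
proof -
 have "norm (torus_emb x) \<le> (\<Sum>i\<in>UNIV. norm (torus_emb x $ i))" by (rule norm_vec_le_sum)
 then show ?thesis by (simp add: torus_emb_def)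
qed

lemma trig_poly_linear_emb:
 assumes f: "bounded_linear f"
 shows "(%x. complex_of_real (f (torus_emb x))) \<in> trig_poly"
proof -
 interpret f: bounded_linear f by fact
 have z: "z = (\<Sum>j\<in>UNIV. Re (z $ j) *\<^sub>R axis j 1 + Im (z $ j) *\<^sub>R axis j \<i>)" for z :: "complex^3"
  by (simp add: vec_eq_iff axis_def complex_eq_iff if_distrib if_distribR sum.distrib cong: if_cong)
 have e: "complex_of_real (f (torus_emb x)) = (\<Sum>j\<in>UNIV. (of_real (f (axis j 1)) / 2 - of_real (f (axis j \<i>)) * \<i> / 2) * cis (wn (axis j 1) \<bullet> x)
   + (of_real (f (axis j 1)) / 2 + of_real (f (axis j \<i>)) * \<i> / 2) * cis (wn (- axis j 1) \<bullet> x))" for x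
 proof -
  have w: "wn (axis j 1) \<bullet> x = 2 * pi / L * x $ j" for j
  proof -
   have "wn (axis j 1) = axis j (2 * pi / L)" by (simp add: wn_def axis_def vec_eq_iff)
   then show ?thesis by (simp add: inner_axis')
  qed
  have "f (torus_emb x) = (\<Sum>j\<in>UNIV. cos (2 * pi / L * x $ j) * f (axis j 1) + sin (2 * pi / L * x $ j) * f (axis j \<i>))"
   by (subst z[of "torus_emb x"]) (simp add: f.sum f.add f.scaleR torus_emb_def)
  then show ?thesis
   by (simp add: w inner_minus_left complex_eq_iff sum.distrib algebra_simps)
 qed
 show ?thesis unfolding e by (intro trig_poly_sum trig_poly.add trig_poly.base) simp
qed

lemma trig_poly_polynomial_emb:
 "real_polynomial_function p \<Longrightarrow> (%x. complex_of_real (p (torus_emb x))) \<in> trig_poly"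
 by (induction rule: real_polynomial_function.induct)
   (auto intro: trig_poly_linear_emb trig_poly_const trig_poly.add trig_poly_mult)

context
 fixes u :: "real^3 \<Rightarrow> real"
 assumes u: "integrable (torus L) u"
  and orth: "\<And>m. (LINT x|torus L. complex_of_real (u x) * cis (wn m \<bullet> x)) = 0"
begin

lemma u_complex: "integrable (torus L) (%x. complex_of_real (u x))" using u by simp

lemma orth_trig_poly: "f \<in> trig_poly \<Longrightarrow> (LINT x|torus L. complex_of_real (u x) * f x) = 0"
proof (induction rule: trig_poly.induct)
 case (base c m)
 have "(LINT x|torus L. complex_of_real (u x) * (c * cis (wn m \<bullet> x))) = (LINT x|torus L. c * (complex_of_real (u x) * cis (wn m \<bullet> x)))"
  by (simp add: mult_ac)
 then show ?case using orth[of m] by simp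
next
 case (add f g)
 have "(LINT x|torus L. complex_of_real (u x) * f x + complex_of_real (u x) * g x)
   = (LINT x|torus L. complex_of_real (u x) * f x) + (LINT x|torus L. complex_of_real (u x) * g x)"
  by (intro bochner_integral_add integrable_torus_mult_continuous u_complex trig_poly_continuous add.hyps)
 then show ?case using add.IH by (simp add: distrib_left)
qed

text \<open>Stone-Weierstrass on the ball of radius 3, which contains the embedded torus, replaces
  \<phi> by a polynomial at cost e / (I + 1) times the L^1 norm \<open>I\<close> of
  \<open>u\<close>.\<close>

lemma orth_continuous:
 assumes \<phi>: "continuous_on UNIV (\<phi> :: complex^3 \<Rightarrow> real)"
 shows "(LINT x|torus L. u x * \<phi> (torus_emb x)) = 0"
proof -
 have c: "continuous_on UNIV (%x. \<phi> (torus_emb x))"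
  by (rule continuous_on_compose2[OF \<phi> torus_emb_continuous]) auto
 define I where "I = (LINT x|torus L. \<bar>u x\<bar>)"
 have "\<bar>LINT x|torus L. u x * \<phi> (torus_emb x)\<bar> \<le> 0 + e" if e: "e > 0" for e
 proof -
  have I0: "I \<ge> 0" unfolding I_def by (intro bochner_integral_nonneg) auto
  obtain p where p: "real_polynomial_function p" "\<And>z. z \<in> cball 0 3 \<Longrightarrow> \<bar>\<phi> z - p z\<bar> < e / (I + 1)"
   by (rule Stone_Weierstrass_real_polynomial_function[of "cball 0 3" \<phi> "e / (I + 1)"])
     (use \<phi> e I0 in \<open>auto elim: continuous_on_subset\<close>)
  have cp: "continuous_on UNIV (%x. p (torus_emb x))"
   by (rule continuous_on_compose2[OF _ torus_emb_continuous, of UNIV])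
     (use p(1) continuous_on_polymonial_function real_polynomial_function_eq in auto)
  have "complex_of_real (LINT x|torus L. u x * p (torus_emb x)) = (LINT x|torus L. complex_of_real (u x * p (torus_emb x)))"
   by (rule integral_complex_of_real[symmetric])
  also have "\<dots> = 0" using orth_trig_poly[OF trig_poly_polynomial_emb[OF p(1)]] by simp
  finally have pz: "(LINT x|torus L. u x * p (torus_emb x)) = 0" by simp
  have "\<bar>LINT x|torus L. u x * \<phi> (torus_emb x)\<bar> = \<bar>(LINT x|torus L. u x * \<phi> (torus_emb x)) - (LINT x|torus L. u x * p (torus_emb x))\<bar>"
   by (simp add: pz)
  also have "\<dots> = \<bar>LINT x|torus L. u x * \<phi> (torus_emb x) - u x * p (torus_emb x)\<bar>"
   by (subst bochner_integral_diff) (auto intro!: integrable_torus_mult_continuous u c cp)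
  also have "\<dots> \<le> (LINT x|torus L. \<bar>u x * \<phi> (torus_emb x) - u x * p (torus_emb x)\<bar>)"
   by (rule integral_abs_bound)
  also have "\<dots> \<le> (LINT x|torus L. e / (I + 1) * \<bar>u x\<bar>)"
  proof (rule integral_mono)
   show "integrable (torus L) (%x. \<bar>u x * \<phi> (torus_emb x) - u x * p (torus_emb x)\<bar>)"
    by (intro integrable_abs bochner_integrable_diff integrable_torus_mult_continuous u c cp)
   show "\<bar>u x * \<phi> (torus_emb x) - u x * p (torus_emb x)\<bar> \<le> e / (I + 1) * \<bar>u x\<bar>" for x
    using mult_right_mono[OF less_imp_le[OF p(2)[OF torus_emb_bounded[of x]]], of "\<bar>u x\<bar>"]
    by (simp add: abs_mult[symmetric] algebra_simps)
  qed (use u in auto)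
  also have "\<dots> = e * (I / (I + 1))" by (simp add: I_def)
  also have "\<dots> \<le> e * 1" using e I0 by (intro mult_left_mono) auto
  finally show ?thesis by simp
 qed
 then have "\<bar>LINT x|torus L. u x * \<phi> (torus_emb x)\<bar> \<le> 0" by (rule field_le_epsilon)
 then show ?thesis by simp
qed

lemma measurable_emb: "torus_emb \<in> borel_measurable (torus L)"
 by (rule measurable_torus_continuous[OF torus_emb_continuous])

lemma orth_indicator_integrable:
 assumes "B \<in> sets borel" shows "integrable (torus L) (%x. u x * indicator B (torus_emb x))"
proof (rule bochner_integrable_bound[OF u])
 show "(%x. u x * indicator B (torus_emb x)) \<in> borel_measurable (torus L)"
  using u measurable_emb assms by measurable
qed (auto simp: indicator_def)

text \<open>The indicator of an open set is the pointwise limit of min(1, n dist(z, complement)).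
  The whole space is separate because \<open>infdist\<close> to the empty set is 0.\<close>

lemma orth_open:
 assumes U: "open U" shows "(LINT x|torus L. u x * indicator U (torus_emb x)) = 0"
proof (cases "U = UNIV")
 case True
 then show ?thesis using orth_continuous[of "%_. 1"] by simp
next
 case False
 define \<phi> where "\<phi> n z = min 1 (real n * infdist z (- U))" for n and z :: "complex^3"
 have c: "continuous_on UNIV (\<phi> n)" for n unfolding \<phi>_def by (intro continuous_intros)
 have lim: "(%n. \<phi> n z) \<longlonglongrightarrow> indicator U z" for z
 proof (cases "z \<in> U")
  case True
  then have p: "infdist z (- U) > 0"
   using infdist_pos_not_in_closed[of "- U" z] U False by auto
  obtain N :: nat where N: "1 / infdist z (- U) < real N" using reals_Archimedean2 by blast
  have "\<phi> n z = 1" if "n \<ge> N" for n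
  proof -
   have "1 / infdist z (- U) \<le> real n" using N that by simp
   then have "1 \<le> real n * infdist z (- U)" using p by (simp add: field_simps)
   then show ?thesis by (simp add: \<phi>_def)
  qed
  then have "eventually (%n. \<phi> n z = 1) sequentially" unfolding eventually_sequentially by blast
  then show ?thesis using True by (simp add: tendsto_eventually)
 next
  case False
  then show ?thesis by (simp add: \<phi>_def)
 qed
 have "(%n. LINT x|torus L. u x * \<phi> n (torus_emb x)) \<longlonglongrightarrow> (LINT x|torus L. u x * indicator U (torus_emb x))"
 proof (rule integral_dominated_convergence[where w="%x. \<bar>u x\<bar>"])
  show "(%x. u x * indicator U (torus_emb x)) \<in> borel_measurable (torus L)"
   using orth_indicator_integrable[of U] U by auto
  show "(%x. u x * \<phi> n (torus_emb x)) \<in> borel_measurable (torus L)" for n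
   using integrable_torus_mult_continuous[OF u continuous_on_compose2[OF c torus_emb_continuous]] by auto
  show "AE x in torus L. (%n. u x * \<phi> n (torus_emb x)) \<longlonglongrightarrow> u x * indicator U (torus_emb x)"
   by (intro AE_I2 tendsto_intros lim)
  show "AE x in torus L. norm (u x * \<phi> n (torus_emb x)) \<le> \<bar>u x\<bar>" for n
   by (intro AE_I2) (auto simp: \<phi>_def abs_mult infdist_nonneg intro!: mult_left_le)
 qed (use u in auto)
 then have "(%n. 0) \<longlonglongrightarrow> (LINT x|torus L. u x * indicator U (torus_emb x))"
  unfolding orth_continuous[OF c] .
 then show ?thesis by (simp add: LIMSEQ_const_iff)
qed

text \<open>Open sets are stable under intersection and generate the Borel sets, and the sets for
  which the integral vanishes are closed under complements and disjoint unions.\<close>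

lemma orth_borel:
 assumes B: "B \<in> sets borel" shows "(LINT x|torus L. u x * indicator B (torus_emb x)) = 0"
proof -
 have cl: "{S :: (complex^3) set. open S} \<subseteq> Pow UNIV" by simp
 have bs: "sigma_sets UNIV {S :: (complex^3) set. open S} = sets borel"
  by (rule sets_borel[symmetric])
 have ist: "Int_stable {S :: (complex^3) set. open S}" by (auto simp: Int_stable_def)
 from B[folded bs] show ?thesis
 proof (induction rule: sigma_sets_induct_disjoint[OF ist cl, consumes 1, case_names basic empty compl union])
  case (compl A)
  then have A: "A \<in> sets borel" using bs by simp
  have "(LINT x|torus L. u x * indicator (UNIV - A) (torus_emb x)) = (LINT x|torus L. u x * indicator UNIV (torus_emb x) - u x * indicator A (torus_emb x))"
   by (intro bochner_integral_cong) (auto simp: indicator_def)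
  also have "\<dots> = (LINT x|torus L. u x * indicator UNIV (torus_emb x)) - (LINT x|torus L. u x * indicator A (torus_emb x))"
   by (intro bochner_integral_diff orth_indicator_integrable A) auto
  finally show ?case using compl orth_open[of UNIV] by simp
 next
  case (union A)
  then have A: "A i \<in> sets borel" for i using bs by auto
  have ind: "indicator (\<Union>i<n. A i) z = (\<Sum>i<n. indicator (A i) z :: real)" for n z
   by (rule indicator_UN_disjoint) (use union(1) in \<open>auto simp: disjoint_family_on_def\<close>)
  have part: "(LINT x|torus L. u x * indicator (\<Union>i<n. A i) (torus_emb x)) = 0" for n
   unfolding ind sum_distrib_left
   by (subst bochner_integral_sum) (use orth_indicator_integrable[OF A] union in auto)
  have "(%n. LINT x|torus L. u x * indicator (\<Union>i<n. A i) (torus_emb x)) \<longlonglongrightarrow> (LINT x|torus L. u x * indicator (\<Union>i. A i) (torus_emb x))"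
  proof (rule integral_dominated_convergence[where w="%x. \<bar>u x\<bar>"])
   show "(%x. u x * indicator (\<Union>i. A i) (torus_emb x)) \<in> borel_measurable (torus L)"
    using orth_indicator_integrable[of "\<Union>i. A i"] A by auto
   show "(%x. u x * indicator (\<Union>i<n. A i) (torus_emb x)) \<in> borel_measurable (torus L)" for n
    using orth_indicator_integrable[of "\<Union>i<n. A i"] A by auto
   show "AE x in torus L. (%n. u x * indicator (\<Union>i<n. A i) (torus_emb x)) \<longlonglongrightarrow> u x * indicator (\<Union>i. A i) (torus_emb x)"
    by (intro AE_I2 tendsto_intros LIMSEQ_indicator_UN)
  qed (use u in \<open>auto simp: indicator_def\<close>)
  then show ?case unfolding part by (simp add: LIMSEQ_const_iff)
 qed (auto intro: orth_open)
qed

text \<open>Off the faces x_j = L, a null set, the embedding has the measurable inverse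
  \<open>r\<close>. A Borel set in the cell is thus almost everywhere a preimage under the
  embedding, and the sign sets of \<open>u\<close> become admissible.\<close>

lemma orth_imp_AE_zero: "AE x in torus L. u x = 0"
proof -
 define r where "r z = (\<chi> j. Arg2pi (z $ j) * (L / (2 * pi)))" for z :: "complex^3"
 have r [measurable]: "r \<in> borel_measurable borel"
 proof -
  have "(%z::complex^3. z $ j) \<in> borel_measurable borel" for j
   by (intro borel_measurable_continuous_onI linear_continuous_on bounded_linear_vec_nth)
  then have [measurable]: "(%z::complex^3. Arg2pi (z $ j) * (L / (2 * pi))) \<in> borel_measurable borel" for j by measurable
  have e: "r z = (\<Sum>j\<in>UNIV. (Arg2pi (z $ j) * (L / (2 * pi))) *\<^sub>R axis j 1)" for z
   by (simp add: r_def vec_eq_iff axis_def if_distrib cong: if_cong)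
  show ?thesis unfolding e by measurable
 qed
 have re: "r (torus_emb x) = x" if "x \<in> cell" "\<And>j. x $ j \<noteq> L" for x
 proof -
  have "Arg2pi (torus_emb x $ j) = 2 * pi / L * x $ j" for j
  proof (rule Arg2pi_unique[where r=1])
   have "0 \<le> x $ j" "x $ j \<le> L" using that(1) by (auto simp: cell_def mem_box_cart)
   then have "x $ j < L" using that(2)[of j] by simp
   then show "2 * pi / L * x $ j < 2 * pi" "0 \<le> 2 * pi / L * x $ j" using L \<open>0 \<le> x $ j\<close> by (auto simp: field_simps)
  qed (simp_all add: torus_emb_def cis_conv_exp)
  then show ?thesis using L by (simp add: r_def vec_eq_iff)
 qed
 have neg: "negligible {x :: real^3. x $ j = L}" for j
  using negligible_standard_hyperplane[of "axis j (1::real)" L] by (simp add: axis_in_Basis_iff inner_axis)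
 have "negligible (\<Union>j\<in>UNIV. {x :: real^3. x $ j = L})" by (intro negligible_Union) (auto intro: neg)
 then have "AE x in lebesgue. x \<notin> (\<Union>j\<in>UNIV. {x :: real^3. x $ j = L})"
  unfolding negligible_iff_null_sets by (rule AE_not_in)
 then have AEr: "AE x in torus L. r (torus_emb x) = x"
  unfolding torus_cell by (subst AE_restrict_space_iff) (auto elim!: eventually_mono intro: re)
 \<comment> \<open>\<open>u\<close> is Lebesgue measurable only, while preimages under
   \<open>r\<close> are controlled for Borel sets; hence a Borel representative
   \<open>g\<close>.\<close>
 have um: "(%x. indicator cell x *\<^sub>R u x) \<in> borel_measurable lebesgue"
  using u by (subst borel_measurable_restrict_space_iff[symmetric]) (auto simp: torus_cell)
 then obtain g where g: "g \<in> borel_measurable lborel" "AE x in lborel. indicator cell x *\<^sub>R u x = g x"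
  using completion_ex_borel_measurable_real by blast
 from AE_completion[OF g(2)] have ug: "AE x in torus L. u x = g x"
  unfolding torus_cell by (subst AE_restrict_space_iff) (auto elim!: eventually_mono)
 have gi: "integrable (torus L) g"
 proof (rule integrable_cong_AE_imp[OF u _ ug])
  have "g \<in> borel_measurable lebesgue" using g(1) by (rule measurable_completion)
  then show "g \<in> borel_measurable (torus L)" unfolding torus_cell by (rule measurable_restrict_space1)
 qed
 have z: "(LINT x|torus L. indicator A x * g x) = 0" if A: "A \<in> sets borel" for A
 proof -
  have B: "r -` A \<in> sets borel" using measurable_sets[OF r A] by simp
  have [measurable]: "(%x. indicator A x :: real) \<in> borel_measurable (torus L)"
   unfolding torus_cell by (intro measurable_restrict_space1 measurable_completion) (use A in simp)
  have "(LINT x|torus L. indicator A x * g x) = (LINT x|torus L. u x * indicator (r -` A) (torus_emb x))"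
  proof (rule integral_cong_AE)
   show "(%x. indicator A x * g x) \<in> borel_measurable (torus L)" using gi by measurable
   show "(%x. u x * indicator (r -` A) (torus_emb x)) \<in> borel_measurable (torus L)"
    using orth_indicator_integrable[OF B] by auto
   show "AE x in torus L. indicator A x * g x = u x * indicator (r -` A) (torus_emb x)"
    using ug AEr by eventually_elim (simp add: indicator_def)
  qed
  then show ?thesis using orth_borel[OF B] by simp
 qed
 have "AE x in torus L. g x = 0"
  by (rule AE_zero_if_sign_integrals_zero[OF gi]; rule z) (use g(1) in measurable)
 then show ?thesis using ug by eventually_elim simp
qed

end

end

text \<open>Fatou's lemma in the form that also delivers integrability of the limit; the bound may
  hold from some index on.\<close>

lemma integrable_fatou:
 fixes g :: "nat \<Rightarrow> 'a \<Rightarrow> real"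
 assumes g: "\<And>i. integrable M (g i)" "\<And>i x. 0 \<le> g i x"
  and C: "\<And>i. i \<ge> N \<Longrightarrow> (LINT x|M. g i x) \<le> C"
  and lim: "AE x in M. (slice g x) \<longlonglongrightarrow> h x" and h: "h \<in> borel_measurable M"
 shows "integrable M h" "(LINT x|M. h x) \<le> C"
proof -
 have C0: "0 \<le> C" using C[of N] g(2) by (meson bochner_integral_nonneg order_trans order_refl)
 have h0: "AE x in M. 0 \<le> h x" using lim by eventually_elim (rule LIMSEQ_le_const, auto simp: g(2))
 have "(\<integral>\<^sup>+x. ennreal (h x) \<partial>M) = (\<integral>\<^sup>+x. liminf (%i. ennreal (g i x)) \<partial>M)"
  by (rule nn_integral_cong_AE, use lim in eventually_elim)
    (rule lim_imp_Liminf[symmetric], auto intro!: tendsto_ennrealI)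
 also have "\<dots> \<le> liminf (%i. \<integral>\<^sup>+x. ennreal (g i x) \<partial>M)"
  by (rule nn_integral_liminf) (use g(1) in auto)
 also have "\<dots> \<le> ennreal C"
 proof (rule Liminf_le)
  show "\<forall>\<^sub>F i in sequentially. (\<integral>\<^sup>+x. ennreal (g i x) \<partial>M) \<le> ennreal C"
   using eventually_ge_at_top[of N]
  proof eventually_elim
   case (elim i)
   have "(\<integral>\<^sup>+x. ennreal (g i x) \<partial>M) = ennreal (LINT x|M. g i x)"
    by (rule nn_integral_eq_integral[OF g(1)]) (use g(2) in auto)
   then show ?case using C[OF elim] by (simp add: ennreal_leI)
  qed
 qed simp
 finally have le: "(\<integral>\<^sup>+x. ennreal (h x) \<partial>M) \<le> ennreal C" .
 show i: "integrable M h"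
  by (rule integrableI_nonneg[OF h h0]) (rule order.strict_trans1[OF le], simp)
 have "ennreal (LINT x|M. h x) \<le> ennreal C" using le by (simp add: nn_integral_eq_integral[OF i h0])
 then show "(LINT x|M. h x) \<le> C" using C0 by (simp add: ennreal_le_iff)
qed

lemma square_sum_le: "(a + b)^2 \<le> 2 * a^2 + 2 * (b::real)^2"
 using sum_squares_bound[of a b] by (simp add: power2_sum)

section \<open>Fourier coefficients: Bessel, Riesz-Fischer, Parseval, products\<close>

context periodic_cell
begin

lemma periodic_cis: "cis (wn m \<bullet> (x + L *\<^sub>R axis i 1)) = cis (wn m \<bullet> x)"
proof -
 have "wn m \<bullet> (x + L *\<^sub>R axis i 1) = wn m \<bullet> x + 2 * pi * of_int (m $ i)"
  using L by (simp add: inner_add_right inner_axis wn_def)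
 moreover have "cis (2 * pi * of_int (m $ i)) = 1" by (simp add: complex_eq_iff cos_int_2pin sin_int_2pin)
 ultimately show ?thesis by (simp add: cis_mult[symmetric])
qed

lemma measure_space_torus [simp]: "measure (torus L) (space (torus L)) = L ^ 3"
 using integral_torus_const[of "1::real"] by simp

lemma L2_torusD:
 assumes "u \<in> L2_torus L"
 shows "periodic L u" "u \<in> borel_measurable (torus L)" "integrable (torus L) (%x. (norm (u x))^2)"
 using assms by (auto simp: L2_torus_def)

lemma const_integrable_torus [simp]: "integrable (torus L) (%x. c :: 'b::euclidean_space)"
 by (rule integrable_torus_continuous) simp

lemma L2_torus_integrable:
 assumes u: "u \<in> L2_torus L" shows "integrable (torus L) u"
proof (rule bochner_integrable_bound)
 show "integrable (torus L) (%x. 1 + (norm (u x))^2)"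
  by (intro bochner_integrable_add L2_torusD(3)[OF u]) simp
 show "AE x in torus L. norm (u x) \<le> norm (1 + (norm (u x))^2)"
 proof (rule AE_I2)
  fix x
  have "2 * norm (u x) \<le> (norm (u x))^2 + 1" using sum_squares_bound[of "norm (u x)" 1] by simp
  then have "norm (u x) \<le> 1 + (norm (u x))^2" using zero_le_power2[of "norm (u x)"] by linarith
  then show "norm (u x) \<le> norm (1 + (norm (u x))^2)" by simp
 qed
qed (rule L2_torusD(2)[OF u])

lemma L2_torus_dominated:
 fixes u :: "real^3 \<Rightarrow> 'b::euclidean_space"
 assumes "periodic L u" "u \<in> borel_measurable (torus L)" "integrable (torus L) f"
  "\<And>x. (norm (u x))^2 \<le> f x"
 shows "u \<in> L2_torus L"
proof -
 have "integrable (torus L) (%x. (norm (u x))^2)"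
  by (rule bochner_integrable_bound[OF assms(3)])
    (use assms(2,4) in \<open>auto intro!: AE_I2 order_trans[OF assms(4) abs_ge_self]\<close>)
 then show ?thesis using assms by (simp add: L2_torus_def)
qed

lemma L2_torus_inner_integrable:
 fixes u v :: "real^3 \<Rightarrow> 'b::euclidean_space"
 assumes u: "u \<in> L2_torus L" and v: "v \<in> L2_torus L"
 shows "integrable (torus L) (%x. u x \<bullet> v x)"
proof (rule bochner_integrable_bound)
 show "integrable (torus L) (%x. (norm (u x))^2 + (norm (v x))^2)"
  by (intro bochner_integrable_add L2_torusD(3) u v)
 show "(%x. u x \<bullet> v x) \<in> borel_measurable (torus L)"
  by (intro borel_measurable_inner L2_torusD(2) u v)
 show "AE x in torus L. norm (u x \<bullet> v x) \<le> norm ((norm (u x))^2 + (norm (v x))^2)"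
 proof (rule AE_I2)
  fix x
  have "\<bar>u x \<bullet> v x\<bar> \<le> norm (u x) * norm (v x)" by (rule Cauchy_Schwarz_ineq2)
  moreover have "2 * norm (u x) * norm (v x) \<le> (norm (u x))^2 + (norm (v x))^2" by (rule sum_squares_bound)
  moreover have "0 \<le> norm (u x) * norm (v x)" by simp
  ultimately show "norm (u x \<bullet> v x) \<le> norm ((norm (u x))^2 + (norm (v x))^2)" by simp
 qed
qed

lemma L2_torus_mult_integrable:
 fixes u v :: "real^3 \<Rightarrow> real"
 shows "u \<in> L2_torus L \<Longrightarrow> v \<in> L2_torus L \<Longrightarrow> integrable (torus L) (%x. u x * v x)"
 using L2_torus_inner_integrable[of u v] by simp

lemma L2_torus_add:
 fixes u v :: "real^3 \<Rightarrow> 'b::euclidean_space"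
 assumes u: "u \<in> L2_torus L" and v: "v \<in> L2_torus L"
 shows "(%x. u x + v x) \<in> L2_torus L"
proof (rule L2_torus_dominated)
 show "periodic L (%x. u x + v x)" using L2_torusD(1)[OF u] L2_torusD(1)[OF v] by (simp add: periodic_def)
 show "(%x. u x + v x) \<in> borel_measurable (torus L)" using L2_torusD(2)[OF u] L2_torusD(2)[OF v] by measurable
 show "integrable (torus L) (%x. 2 * (norm (u x))^2 + 2 * (norm (v x))^2)"
  by (intro bochner_integrable_add integrable_mult_right L2_torusD(3) u v)
 show "(norm (u x + v x))^2 \<le> 2 * (norm (u x))^2 + 2 * (norm (v x))^2" for x
  by (rule order_trans[OF power_mono[OF norm_triangle_ineq] square_sum_le]) simp
qed

lemma L2_torus_scaleR:
 fixes u :: "real^3 \<Rightarrow> 'b::euclidean_space"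
 assumes u: "u \<in> L2_torus L" shows "(%x. r *\<^sub>R u x) \<in> L2_torus L"
proof (rule L2_torus_dominated)
 show "periodic L (%x. r *\<^sub>R u x)" using L2_torusD(1)[OF u] by (simp add: periodic_def)
 show "(%x. r *\<^sub>R u x) \<in> borel_measurable (torus L)" using L2_torusD(2)[OF u] by measurable
 show "integrable (torus L) (%x. r^2 * (norm (u x))^2)"
  by (intro integrable_mult_right L2_torusD(3) u)
qed (simp add: power_mult_distrib)

lemma L2_torus_diff:
 fixes u v :: "real^3 \<Rightarrow> 'b::euclidean_space"
 assumes u: "u \<in> L2_torus L" and v: "v \<in> L2_torus L"
 shows "(%x. u x - v x) \<in> L2_torus L"
 using L2_torus_add[OF u L2_torus_scaleR[OF v, of "-1"]] by simp

lemma L2_torus_continuous: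
 fixes u :: "real^3 \<Rightarrow> 'b::euclidean_space"
 assumes "continuous_on UNIV u" "periodic L u" shows "u \<in> L2_torus L"
 using assms by (auto simp: L2_torus_def intro!: measurable_torus_continuous integrable_torus_continuous continuous_intros)

text \<open>Indexed by integer vectors, a countable group, instead of by wave vectors; this is the
  index type for \<open>fourier_model\<close>.\<close>

definition coef :: "(real^3 \<Rightarrow> real) \<Rightarrow> int^3 \<Rightarrow> complex" where "coef u m = fourier L u (wn m)"

lemma coef_eq: "coef u m = (LINT x|torus L. complex_of_real (u x) * cis (- (wn m \<bullet> x))) / of_real (L ^ 3)"
 by (simp add: coef_def fourier_def)

lemma cis_integrable:
 fixes u :: "real^3 \<Rightarrow> real"
 shows "integrable (torus L) u \<Longrightarrow> integrable (torus L) (%x. complex_of_real (u x) * cis (a * (wn m \<bullet> x)))"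
 by (intro integrable_torus_mult_continuous) (auto intro!: continuous_intros)

lemma cis_integrable_minus:
 fixes u :: "real^3 \<Rightarrow> real"
 shows "integrable (torus L) u \<Longrightarrow> integrable (torus L) (%x. complex_of_real (u x) * cis (- (wn m \<bullet> x)))"
 using cis_integrable[of u "-1" m] by simp

lemma coef_linear:
 assumes u: "integrable (torus L) u" and v: "integrable (torus L) v"
 shows "coef (%x. u x + v x) m = coef u m + coef v m" "coef (%x. u x - v x) m = coef u m - coef v m"
  "coef (%x. r * u x) m = of_real r * coef u m"
proof -
 note i = cis_integrable_minus[OF u, of m] cis_integrable_minus[OF v, of m]
 show "coef (%x. u x + v x) m = coef u m + coef v m"
  unfolding coef_eq using i by (simp add: distrib_right add_divide_distrib)
 show "coef (%x. u x - v x) m = coef u m - coef v m"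
  unfolding coef_eq using i by (simp add: left_diff_distrib diff_divide_distrib)
 show "coef (%x. r * u x) m = of_real r * coef u m"
  unfolding coef_eq by (simp add: mult.assoc)
qed

lemma coef_minus: "coef u (- m) = cnj (coef u m)"
proof -
 have "(LINT x|torus L. complex_of_real (u x) * cis (- (wn (- m) \<bullet> x))) = (LINT x|torus L. cnj (complex_of_real (u x) * cis (- (wn m \<bullet> x))))"
  by (simp add: cis_cnj)
 also have "\<dots> = cnj (LINT x|torus L. complex_of_real (u x) * cis (- (wn m \<bullet> x)))" by (rule bochner_integral_cnj)
 finally show ?thesis by (simp add: coef_eq)
qed

text \<open>Real parts make the sum real for any index set and any coefficients; it is the usual
  partial Fourier sum when the set is symmetric and the coefficients are Hermitian.\<close>

definition synth :: "(int^3) set \<Rightarrow> (int^3 \<Rightarrow> complex) \<Rightarrow> real^3 \<Rightarrow> real" where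
 "synth A c x = (\<Sum>m\<in>A. Re (c m * cis (wn m \<bullet> x)))"

lemma synth_continuous: "continuous_on UNIV (synth A c)"
 unfolding synth_def by (intro continuous_intros)

lemma synth_L2: "synth A c \<in> L2_torus L"
 by (rule L2_torus_continuous[OF synth_continuous]) (simp only: periodic_def synth_def periodic_cis, simp)

lemma integral_mult_synth:
 assumes u: "integrable (torus L) u"
 shows "(LINT x|torus L. u x * synth A c x) = L ^ 3 * (\<Sum>m\<in>A. c m \<bullet> coef u m)"
proof -
 have i: "integrable (torus L) (%x. complex_of_real (u x) * cis (wn m \<bullet> x))" for m
  using cis_integrable[OF u, of 1] by simp
 have ir: "integrable (torus L) (%x. Re (c m * (complex_of_real (u x) * cis (wn m \<bullet> x))))" for m
  using i by (intro integrable_Re integrable_mult_right)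
 have p: "(LINT x|torus L. Re (c m * (complex_of_real (u x) * cis (wn m \<bullet> x)))) = L ^ 3 * (c m \<bullet> coef u m)" for m
 proof -
  have "(LINT x|torus L. complex_of_real (u x) * cis (wn m \<bullet> x)) = of_real (L ^ 3) * coef u (- m)"
   using L by (simp add: coef_eq)
  then have e: "(LINT x|torus L. complex_of_real (u x) * cis (wn m \<bullet> x)) = of_real (L ^ 3) * cnj (coef u m)"
   by (simp only: coef_minus)
  have "(LINT x|torus L. Re (c m * (complex_of_real (u x) * cis (wn m \<bullet> x)))) = Re (LINT x|torus L. c m * (complex_of_real (u x) * cis (wn m \<bullet> x)))"
   using i by (intro integral_Re integrable_mult_right)
  also have "\<dots> = Re (c m * (of_real (L ^ 3) * cnj (coef u m)))" by (simp only: integral_mult_right_zero e)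
  also have "\<dots> = L ^ 3 * (c m \<bullet> coef u m)" by (simp add: inner_complex_def algebra_simps)
  finally show ?thesis .
 qed
 have "(LINT x|torus L. u x * synth A c x) = (LINT x|torus L. (\<Sum>m\<in>A. Re (c m * (complex_of_real (u x) * cis (wn m \<bullet> x)))))"
  by (simp add: synth_def sum_distrib_left algebra_simps)
 also have "\<dots> = (\<Sum>m\<in>A. L ^ 3 * (c m \<bullet> coef u m))"
  by (subst bochner_integral_sum) (use ir p in auto)
 finally show ?thesis by (simp add: sum_distrib_left)
qed

definition hermitian :: "(int^3 \<Rightarrow> complex) \<Rightarrow> bool" where "hermitian c \<longleftrightarrow> (\<forall>m. c (- m) = cnj (c m))"

definition symmetric_set :: "(int^3) set \<Rightarrow> bool" where "symmetric_set A \<longleftrightarrow> finite A \<and> (\<forall>m. - m \<in> A \<longleftrightarrow> m \<in> A)"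

lemma hermitian_coef [simp]: "hermitian (coef u)" by (simp add: hermitian_def coef_minus)

text \<open>Each real part splits into halves at the frequencies m and -m. Over a symmetric set with
  Hermitian coefficients the two halves at \<open>l\<close> recombine.\<close>

lemma coef_synth:
 assumes A: "symmetric_set A" and c: "hermitian c"
 shows "coef (synth A c) l = (if l \<in> A then c l else 0)"
proof -
 have fin: "finite A" and sy: "- l \<in> A \<longleftrightarrow> l \<in> A" using A by (auto simp: symmetric_set_def)
 have ic: "integrable (torus L) (%x. cis (wn m \<bullet> x))" for m
  by (intro integrable_torus_continuous continuous_intros)
 have e: "complex_of_real (Re (c m * cis (wn m \<bullet> x))) * cis (- (wn l \<bullet> x))
   = (c m / 2) * cis (wn (m - l) \<bullet> x) + (cnj (c m) / 2) * cis (wn (- m - l) \<bullet> x)" for m x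
 proof -
  have "complex_of_real (Re (c m * cis (wn m \<bullet> x))) = (c m / 2) * cis (wn m \<bullet> x) + (cnj (c m) / 2) * cis (- (wn m \<bullet> x))"
   by (rule complex_eqI) (simp_all add: add_divide_distrib diff_divide_distrib)
  then show ?thesis
   by (simp add: wn_diff inner_diff_left distrib_right cis_mult mult.assoc)
 qed
 have p: "(LINT x|torus L. (c m / 2) * cis (wn (m - l) \<bullet> x) + (cnj (c m) / 2) * cis (wn (- m - l) \<bullet> x))
   = of_real (L ^ 3) * ((if m = l then c m / 2 else 0) + (if m = - l then cnj (c m) / 2 else 0))" for m
 proof -
  have "- m - l = 0 \<longleftrightarrow> - m = l" by (rule right_minus_eq)
  also have "\<dots> \<longleftrightarrow> - l = m" by (rule minus_equation_iff)
  finally have ml: "- m - l = 0 \<longleftrightarrow> m = - l" by (simp only: eq_commute)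
  have ifs: "a * (if P then X else 0) + b * (if Q then X else 0) = X * ((if P then a else 0) + (if Q then b else 0))"
   for a b X :: complex and P Q by (simp add: distrib_left mult.commute)
  have "(LINT x|torus L. (c m / 2) * cis (wn (m - l) \<bullet> x) + (cnj (c m) / 2) * cis (wn (- m - l) \<bullet> x))
   = (c m / 2) * (LINT x|torus L. cis (wn (m - l) \<bullet> x)) + (cnj (c m) / 2) * (LINT x|torus L. cis (wn (- m - l) \<bullet> x))"
   by (subst bochner_integral_add) (use ic in \<open>auto intro!: integrable_mult_right\<close>)
  then show ?thesis unfolding integral_cis_torus unfolding ml unfolding right_minus_eq ifs .
 qed
 have "(LINT x|torus L. complex_of_real (synth A c x) * cis (- (wn l \<bullet> x)))
   = (LINT x|torus L. (\<Sum>m\<in>A. (c m / 2) * cis (wn (m - l) \<bullet> x) + (cnj (c m) / 2) * cis (wn (- m - l) \<bullet> x)))"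
  by (simp only: synth_def of_real_sum sum_distrib_right e)
 also have "\<dots> = (\<Sum>m\<in>A. of_real (L ^ 3) * ((if m = l then c m / 2 else 0) + (if m = - l then cnj (c m) / 2 else 0)))"
  unfolding p[symmetric]
  by (rule bochner_integral_sum) (use ic in auto)
 also have "\<dots> = of_real (L ^ 3) * ((if l \<in> A then c l / 2 else 0) + (if l \<in> A then cnj (c (- l)) / 2 else 0))"
  using fin by (simp add: sum_distrib_left[symmetric] sum.distrib sy)
 also have "\<dots> = of_real (L ^ 3) * (if l \<in> A then c l else 0)"
  using c by (simp add: hermitian_def)
 finally show ?thesis using L by (simp add: coef_eq)
qed

lemma integral_synth_square:
 assumes A: "symmetric_set A" and c: "hermitian c"
 shows "(LINT x|torus L. (synth A c x)^2) = L ^ 3 * (\<Sum>m\<in>A. (norm (c m))^2)"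
 using integral_mult_synth[OF L2_torus_integrable[OF synth_L2], of A c A c]
 by (simp add: coef_synth[OF A c] power2_eq_square power2_norm_eq_inner[unfolded power2_eq_square] cong: sum.cong)

lemma bessel_finite:
 assumes u: "u \<in> L2_torus L" and A: "symmetric_set A"
 shows "(LINT x|torus L. (u x - synth A (coef u) x)^2) = (LINT x|torus L. (u x)^2) - L ^ 3 * (\<Sum>m\<in>A. (norm (coef u m))^2)"
proof -
 have iu: "integrable (torus L) (%x. (u x)^2)" using L2_torusD(3)[OF u] by simp
 have is2: "integrable (torus L) (%x. (synth A (coef u) x)^2)" using L2_torusD(3)[OF synth_L2] by simp
 have ius: "integrable (torus L) (%x. u x * synth A (coef u) x)" by (rule L2_torus_mult_integrable[OF u synth_L2])
 have "(LINT x|torus L. (u x - synth A (coef u) x)^2) = (LINT x|torus L. ((u x)^2 - 2 * (u x * synth A (coef u) x)) + (synth A (coef u) x)^2)"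
  by (simp add: power2_diff algebra_simps)
 also have "\<dots> = ((LINT x|torus L. (u x)^2) - 2 * (LINT x|torus L. u x * synth A (coef u) x)) + (LINT x|torus L. (synth A (coef u) x)^2)"
  using iu is2 ius by simp
 also have "(LINT x|torus L. u x * synth A (coef u) x) = L ^ 3 * (\<Sum>m\<in>A. (norm (coef u m))^2)"
  using integral_mult_synth[OF L2_torus_integrable[OF u], of A "coef u"] by (simp add: power2_norm_eq_inner)
 also have "(LINT x|torus L. (synth A (coef u) x)^2) = L ^ 3 * (\<Sum>m\<in>A. (norm (coef u m))^2)"
  by (rule integral_synth_square[OF A hermitian_coef])
 finally show ?thesis by simp
qed

definition sym_initial :: "nat \<Rightarrow> (int^3) set" where "sym_initial n = initial n \<union> uminus ` initial n"

lemma symmetric_sym_initial: "symmetric_set (sym_initial n)"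
proof -
 have "- m \<in> sym_initial n \<longleftrightarrow> m \<in> sym_initial n" for m :: "int^3"
  unfolding sym_initial_def by (auto intro: image_eqI[of _ _ "- m"] image_eqI[of _ _ m])
 then show ?thesis by (simp add: symmetric_set_def sym_initial_def)
qed

lemma sym_initial_mono: "n \<le> n' \<Longrightarrow> sym_initial n \<subseteq> sym_initial n'"
 unfolding sym_initial_def initial_def by fastforce

lemma finite_subset_sym_initial: "finite A \<Longrightarrow> \<exists>n. A \<subseteq> sym_initial n"
proof -
 assume "finite A"
 then obtain m where m: "\<forall>i\<in>to_nat ` A. i < m" using finite_nat_set_iff_bounded[of "to_nat ` A"] by auto
 then have "A \<subseteq> sym_initial m" by (auto simp: initial_def sym_initial_def)
 then show ?thesis by blast
qed

lemma finite_sym_initial [simp]: "finite (sym_initial n)" by (simp add: sym_initial_def)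

lemma bessel:
 assumes u: "u \<in> L2_torus L"
 shows "ell2 (coef u)" "L ^ 3 * (ell2_norm (coef u))^2 \<le> (LINT x|torus L. (u x)^2)"
proof -
 have L3: "L ^ 3 > 0" using L by simp
 have "(\<Sum>m\<in>A. (norm (coef u m))^2) \<le> (LINT x|torus L. (u x)^2) / L ^ 3" if A: "finite A" for A
 proof -
  obtain n where n: "A \<subseteq> sym_initial n" using finite_subset_sym_initial[OF A] by blast
  have "0 \<le> (LINT x|torus L. (u x - synth (sym_initial n) (coef u) x)^2)" by (intro bochner_integral_nonneg) simp
  then have "L ^ 3 * (\<Sum>m\<in>sym_initial n. (norm (coef u m))^2) \<le> (LINT x|torus L. (u x)^2)"
   using bessel_finite[OF u symmetric_sym_initial, of n] by linarith
  moreover have "(\<Sum>m\<in>A. (norm (coef u m))^2) \<le> (\<Sum>m\<in>sym_initial n. (norm (coef u m))^2)"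
   by (intro sum_mono2 n) auto
  then have "L ^ 3 * (\<Sum>m\<in>A. (norm (coef u m))^2) \<le> L ^ 3 * (\<Sum>m\<in>sym_initial n. (norm (coef u m))^2)"
   by (rule mult_left_mono) (use L3 in simp)
  ultimately have "L ^ 3 * (\<Sum>m\<in>A. (norm (coef u m))^2) \<le> (LINT x|torus L. (u x)^2)" by linarith
  then show ?thesis unfolding pos_le_divide_eq[OF L3] by (simp only: mult.commute)
 qed
 from summable_on_nonneg_if_bounded[OF _ this]
 have "(%m. (norm (coef u m))^2) summable_on UNIV" "(ell2_norm (coef u))^2 \<le> (LINT x|torus L. (u x)^2) / L ^ 3"
  by (auto simp: ell2_norm_square)
 then show "ell2 (coef u)" "L ^ 3 * (ell2_norm (coef u))^2 \<le> (LINT x|torus L. (u x)^2)"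
  using L3 by (auto simp: ell2_def pos_le_divide_eq mult.commute)
qed

lemma coef_inject:
 assumes u: "integrable (torus L) u" and v: "integrable (torus L) v" and e: "\<And>m. coef u m = coef v m"
 shows "AE x in torus L. u x = v x"
proof -
 have i: "integrable (torus L) (%x. u x - v x)" using u v by simp
 have "(LINT x|torus L. complex_of_real (u x - v x) * cis (wn m \<bullet> x)) = 0" for m
 proof -
  have "coef (%x. u x - v x) (- m) = 0" using coef_linear(2)[OF u v] e by simp
  then show ?thesis using L by (simp add: coef_eq)
 qed
 from orth_imp_AE_zero[OF i this] show ?thesis by eventually_elim simp
qed

lemma synth_diff: "finite B \<Longrightarrow> A \<subseteq> B \<Longrightarrow> synth B c x - synth A c x = synth (B - A) c x"
 unfolding synth_def by (simp add: sum_diff)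

text \<open>A rapidly converging sequence of partial sums converges almost everywhere, and Fatou's
  lemma gives the mean square error. The approximation clause is included because Parseval's
  identity is derived from it.\<close>

lemma riesz_fischer:
 assumes c: "hermitian c" "ell2 c"
 shows "\<exists>U\<in>L2_torus L. (\<forall>m. coef U m = c m) \<and>
  (\<forall>e>0. \<exists>A. symmetric_set A \<and> (LINT x|torus L. (U x - synth A c x)^2) \<le> e)"
proof -
 have L3: "L ^ 3 > 0" using L by simp
 have sm: "(%m. (norm (c m))^2) summable_on UNIV" using c(2) by (simp add: ell2_def)
 have "\<exists>n. \<forall>B. finite B \<longrightarrow> B \<inter> sym_initial n = {} \<longrightarrow> (\<Sum>m\<in>B. (norm (c m))^2) \<le> e" if e: "e > 0" for e
 proof -
  obtain F where F: "finite F" "dist (\<Sum>m\<in>F. (norm (c m))^2) (\<Sum>\<^sub>\<infinity>m. (norm (c m))^2) \<le> e"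
   using has_sum_finite_approximation[OF has_sum_infsum[OF sm] e] by blast
  obtain n where n: "F \<subseteq> sym_initial n" using finite_subset_sym_initial[OF F(1)] by blast
  have "(\<Sum>m\<in>B. (norm (c m))^2) \<le> e" if B: "finite B" "B \<inter> sym_initial n = {}" for B
  proof -
   have "(\<Sum>m\<in>F. (norm (c m))^2) + (\<Sum>m\<in>B. (norm (c m))^2) = (\<Sum>m\<in>F \<union> B. (norm (c m))^2)"
    by (rule sum.union_disjoint[symmetric]) (use F B n in auto)
   also have "\<dots> \<le> (\<Sum>\<^sub>\<infinity>m. (norm (c m))^2)"
    by (rule finite_sum_le_infsum[OF sm]) (use F B in auto)
   finally show ?thesis using F(2) unfolding dist_real_def by linarith
  qed
  then show ?thesis by blast
 qed
 then obtain n0 where n0: "\<And>e B. e > 0 \<Longrightarrow> finite B \<Longrightarrow> B \<inter> sym_initial (n0 e) = {} \<Longrightarrow> (\<Sum>m\<in>B. (norm (c m))^2) \<le> e"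
  by metis
 \<comment> \<open>Cumulative sums make the index sets increase while still leaving tails of mass at
   most (1/4)^j.\<close>
 define N where "N j = (\<Sum>i\<le>j. n0 ((1/4::real) ^ i))" for j :: nat
 have Nm: "N j \<le> N i" if "j \<le> i" for i j unfolding N_def by (rule sum_mono2) (use that in auto)
 have Nn: "n0 ((1/4::real) ^ j) \<le> N j" for j unfolding N_def by (rule member_le_sum) auto
 define A where "A j = sym_initial (N j)" for j
 have As: "symmetric_set (A j)" for j by (simp add: A_def symmetric_sym_initial)
 have Am: "A j \<subseteq> A i" if "j \<le> i" for i j unfolding A_def by (intro sym_initial_mono Nm that)
 have Af: "finite (A j)" for j using As[of j] by (simp add: symmetric_set_def)
 have Ds: "symmetric_set (A i - A j)" for i j using As by (simp add: symmetric_set_def)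
 have tail: "(\<Sum>m\<in>A i - A j. (norm (c m))^2) \<le> (1/4) ^ j" for i j
 proof (rule n0)
  show "(A i - A j) \<inter> sym_initial (n0 ((1/4) ^ j)) = {}"
   using sym_initial_mono[OF Nn[of j]] by (auto simp: A_def)
 qed (use Af in auto)
 define f where "f j = synth (A j) c" for j
 have f2: "f j \<in> L2_torus L" for j by (simp add: f_def synth_L2)
 have fd: "(LINT x|torus L. (f i x - f j x)^2) \<le> L ^ 3 * (1/4) ^ j" if "j \<le> i" for i j
 proof -
  have "f i x - f j x = synth (A i - A j) c x" for x unfolding f_def by (rule synth_diff[OF Af Am[OF that]])
  then have "(LINT x|torus L. (f i x - f j x)^2) = L ^ 3 * (\<Sum>m\<in>A i - A j. (norm (c m))^2)"
   using integral_synth_square[OF Ds c(1)] by simp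
  also have "\<dots> \<le> L ^ 3 * (1/4) ^ j" using L3 by (intro mult_left_mono tail) auto
  finally show ?thesis .
 qed
 have fi: "integrable (torus L) (%x. f (Suc j) x - f j x)" for j
  by (intro bochner_integrable_diff L2_torus_integrable f2)
 have fi2: "integrable (torus L) (%x. (f i x - f j x)^2)" for i j
  using L2_torusD(3)[OF L2_torus_diff[OF f2 f2]] by simp
 have fa: "(LINT x|torus L. \<bar>f (Suc j) x - f j x\<bar>) \<le> L ^ 3 * (1/2) ^ j" for j
 proof -
  \<comment> \<open>Young's inequality with weight 2^j turns the mean square bound L^3 (1/4)^j into
    a summable bound in L^1.\<close>
  have "(LINT x|torus L. \<bar>f (Suc j) x - f j x\<bar>) \<le> (LINT x|torus L. (1/2) ^ j / 2 + 2 ^ j / 2 * (f (Suc j) x - f j x)^2)"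
  proof (rule integral_mono)
   fix x
   let ?g = "\<bar>f (Suc j) x - f j x\<bar>"
   have "2 * 1 * (2 ^ j * ?g) \<le> 1^2 + (2 ^ j * ?g)^2" by (rule sum_squares_bound)
   also have "\<dots> = 2 ^ j * ((1/2) ^ j + 2 ^ j * ?g^2)"
    by (simp add: power_mult_distrib power2_eq_square algebra_simps power_divide)
   finally have "2 ^ j * (2 * ?g) \<le> 2 ^ j * ((1/2) ^ j + 2 ^ j * ?g^2)" by (simp add: mult_ac)
   then have "2 * ?g \<le> (1/2) ^ j + 2 ^ j * ?g^2" by (rule mult_left_le_imp_le) simp
   then show "?g \<le> (1/2) ^ j / 2 + 2 ^ j / 2 * (f (Suc j) x - f j x)^2" by simp
  qed (use fi fi2 in auto)
  also have "\<dots> = (1/2) ^ j / 2 * L ^ 3 + 2 ^ j / 2 * (LINT x|torus L. (f (Suc j) x - f j x)^2)"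
   using fi2 by simp
  also have "\<dots> \<le> (1/2) ^ j / 2 * L ^ 3 + 2 ^ j / 2 * (L ^ 3 * (1/4) ^ j)"
   by (intro add_left_mono mult_left_mono fd) auto
  also have "2 ^ j / 2 * (L ^ 3 * (1/4) ^ j) = (1/2) ^ j / 2 * L ^ 3"
  proof -
   have "(2::real) ^ j * (1/4) ^ j = (1/2) ^ j" by (simp add: power_mult_distrib[symmetric])
   then show ?thesis by (simp add: mult_ac)
  qed
  finally show ?thesis by simp
 qed
 have "(%j. LINT x|torus L. \<bar>f (Suc j) x - f j x\<bar>) summable_on UNIV"
 proof (rule summable_on_comparison_test[OF _ fa])
  have "summable (%j. L ^ 3 * (1/2::real) ^ j)" by (intro summable_mult summable_geometric) simp
  then show "(%j. L ^ 3 * (1/2) ^ j) summable_on (UNIV::nat set)"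
   using L3 by (subst summable_on_UNIV_nonneg_real_iff) auto
 qed (auto intro!: bochner_integral_nonneg)
 from infsum_integral_summable(1)[OF fi this]
 have ae: "AE x in torus L. (%j. \<bar>f (Suc j) x - f j x\<bar>) summable_on UNIV" .
 \<comment> \<open>An explicit limit with default 0 is measurable and periodic at every point, as
   membership in \<open>L2_torus\<close> demands.\<close>
 define U where "U x = (if Cauchy (slice f x) then lim (slice f x) else 0)" for x
 have lim: "AE x in torus L. (slice f x) \<longlonglongrightarrow> U x"
  using ae
 proof eventually_elim
  case (elim x)
  then have "(%j. f (Suc j) x - f j x) summable_on UNIV" by (simp add: summable_on_abs_iff)
  then have "summable (%j. f (Suc j) x - f j x)" by (rule summable_on_imp_summable)
  then have "(%n. \<Sum>j<n. f (Suc j) x - f j x) \<longlonglongrightarrow> (\<Sum>j. f (Suc j) x - f j x)" by (rule summable_LIMSEQ)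
  then have "(%n. f n x - f 0 x) \<longlonglongrightarrow> (\<Sum>j. f (Suc j) x - f j x)"
   using sum_lessThan_telescope[of "%j. f j x"] by simp
  then have "(%n. (f n x - f 0 x) + f 0 x) \<longlonglongrightarrow> (\<Sum>j. f (Suc j) x - f j x) + f 0 x" by (intro tendsto_intros)
  then have "(slice f x) \<longlonglongrightarrow> (\<Sum>j. f (Suc j) x - f j x) + f 0 x" by simp
  moreover from this have "Cauchy (slice f x)" by (rule LIMSEQ_imp_Cauchy)
  ultimately show ?case by (simp add: U_def limI)
 qed
 have Um [measurable]: "U \<in> borel_measurable (torus L)"
 proof -
  have [measurable]: "f j \<in> borel_measurable (torus L)" for j by (rule L2_torusD(2)[OF f2])
  have [measurable]: "Measurable.pred (torus L) (%x. Cauchy (slice f x))"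
   unfolding pred_def by (rule sets_Collect_Cauchy) measurable
  show ?thesis unfolding U_def by measurable
 qed
 have Ud: "integrable (torus L) (%x. (U x - f j x)^2)" "(LINT x|torus L. (U x - f j x)^2) \<le> L ^ 3 * (1/4) ^ j" for j
 proof -
  have l: "AE x in torus L. (%i. (f i x - f j x)^2) \<longlonglongrightarrow> (U x - f j x)^2"
   using lim by eventually_elim (intro tendsto_intros)
  have m: "(%x. (U x - f j x)^2) \<in> borel_measurable (torus L)"
   using L2_torusD(2)[OF f2[of j]] by measurable
  show "integrable (torus L) (%x. (U x - f j x)^2)" "(LINT x|torus L. (U x - f j x)^2) \<le> L ^ 3 * (1/4) ^ j"
   using integrable_fatou[of "torus L" "%i x. (f i x - f j x)^2" j, OF fi2 _ fd l m] by auto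
 qed
 have per: "periodic L U"
  using L2_torusD(1)[OF f2] by (simp add: U_def periodic_def)
 have UL: "U \<in> L2_torus L"
 proof (rule L2_torus_dominated[OF per Um])
  show "integrable (torus L) (%x. 2 * (U x - f 0 x)^2 + 2 * (f 0 x)^2)"
   using Ud(1)[of 0] L2_torusD(3)[OF f2[of 0]] by simp
  show "(norm (U x))^2 \<le> 2 * (U x - f 0 x)^2 + 2 * (f 0 x)^2" for x
   using square_sum_le[of "U x - f 0 x" "f 0 x"] by simp
 qed
 have "coef U m = c m" for m
 proof -
  have b: "(norm (coef U m - coef (f j) m))^2 \<le> (1/4) ^ j" for j
  proof -
   have d: "(%x. U x - f j x) \<in> L2_torus L" by (rule L2_torus_diff[OF UL f2])
   have e: "coef (%x. U x - f j x) m = coef U m - coef (f j) m"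
    by (rule coef_linear(2)) (intro L2_torus_integrable UL f2)+
   have "(norm (coef U m - coef (f j) m))^2 \<le> (ell2_norm (coef (%x. U x - f j x)))^2"
    unfolding e[symmetric] by (intro power_mono ell2_component_le bessel d) simp
   moreover have "L ^ 3 * (ell2_norm (coef (%x. U x - f j x)))^2 \<le> L ^ 3 * (1/4) ^ j"
    using bessel(2)[OF d] Ud(2)[of j] by linarith
   then have "(ell2_norm (coef (%x. U x - f j x)))^2 \<le> (1/4) ^ j" using L3 by simp
   ultimately show ?thesis by linarith
  qed
  have "eventually (%j. (norm (coef U m - c m))^2 \<le> (1/4) ^ j) sequentially" if ex: "\<exists>j. m \<in> A j"
  proof -
   obtain j0 where "m \<in> A j0" using ex by blast
   then have "m \<in> A j" if "j \<ge> j0" for j using Am[OF that] by blast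
   then have "coef (f j) m = c m" if "j \<ge> j0" for j
    using that by (simp add: f_def coef_synth[OF As c(1)])
   then show ?thesis using b unfolding eventually_sequentially by metis
  qed
  \<comment> \<open>A mode that no \<open>A j\<close> contains lies in every tail, so its
    coefficient is below every (1/4)^j.\<close>
  moreover have "c m = 0 \<and> (\<forall>j. coef (f j) m = 0)" if "\<not> (\<exists>j. m \<in> A j)"
  proof -
   have "(norm (c m))^2 \<le> (1/4) ^ j" for j
   proof -
    have "(\<Sum>m\<in>{m}. (norm (c m))^2) \<le> (1/4) ^ j"
     by (rule n0) (use that sym_initial_mono[OF Nn[of j]] in \<open>auto simp: A_def\<close>)
    then show ?thesis by simp
   qed
   then have "(norm (c m))^2 \<le> 0" by (intro LIMSEQ_le_const[OF LIMSEQ_realpow_zero[of "1/4"]]) auto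
   then show ?thesis using that by (simp add: f_def coef_synth[OF As c(1)])
  qed
  ultimately have "eventually (%j. (norm (coef U m - c m))^2 \<le> (1/4) ^ j) sequentially"
   using b by (cases "\<exists>j. m \<in> A j") (auto intro: always_eventually)
  then have "(norm (coef U m - c m))^2 \<le> 0"
   by (rule tendsto_lowerbound[OF LIMSEQ_realpow_zero[of "1/4"], rotated 2]) auto
  then show ?thesis by simp
 qed
 moreover have "\<exists>A. symmetric_set A \<and> (LINT x|torus L. (U x - synth A c x)^2) \<le> e" if e: "e > 0" for e
 proof -
  have "(%j. L ^ 3 * (1/4::real) ^ j) \<longlonglongrightarrow> 0" by (intro tendsto_mult_right_zero LIMSEQ_realpow_zero) auto
  then have "eventually (%j. L ^ 3 * (1/4::real) ^ j < e) sequentially" by (rule order_tendstoD) (rule e)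
  then obtain j where "L ^ 3 * (1/4::real) ^ j < e" by (auto simp: eventually_sequentially)
  then show ?thesis using Ud(2)[of j] As[of j] by (intro exI[of _ "A j"]) (simp add: f_def)
 qed
 ultimately show ?thesis using UL by blast
qed

text \<open>Bessel gives one inequality. For the other, the field rebuilt from the coefficients
  agrees with \<open>u\<close> almost everywhere by completeness, so finite sums approximate
  \<open>u\<close> in mean square.\<close>

lemma parseval_norm:
 assumes u: "u \<in> L2_torus L"
 shows "(LINT x|torus L. (u x)^2) = L ^ 3 * (ell2_norm (coef u))^2"
proof (rule antisym[OF _ bessel(2)[OF u]])
 obtain U where U: "U \<in> L2_torus L" "\<And>m. coef U m = coef u m"
  "\<And>e. e > 0 \<Longrightarrow> \<exists>A. symmetric_set A \<and> (LINT x|torus L. (U x - synth A (coef u) x)^2) \<le> e"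
  using riesz_fischer[OF hermitian_coef bessel(1)[OF u]] by blast
 have ae: "AE x in torus L. U x = u x"
  by (rule coef_inject) (use U u L2_torus_integrable in auto)
 show "(LINT x|torus L. (u x)^2) \<le> L ^ 3 * (ell2_norm (coef u))^2"
 proof (rule field_le_epsilon)
  fix e :: real assume "e > 0"
  then obtain A where A: "symmetric_set A" "(LINT x|torus L. (U x - synth A (coef u) x)^2) \<le> e" using U(3) by blast
  have "(LINT x|torus L. (U x - synth A (coef u) x)^2) = (LINT x|torus L. (u x - synth A (coef u) x)^2)"
   by (rule integral_cong_AE)
     (use ae L2_torusD(2)[OF L2_torus_diff[OF U(1) synth_L2]] L2_torusD(2)[OF L2_torus_diff[OF u synth_L2]] in
      \<open>auto elim!: eventually_mono\<close>)
  then have "(LINT x|torus L. (u x)^2) \<le> L ^ 3 * (\<Sum>m\<in>A. (norm (coef u m))^2) + e"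
   using A(2) bessel_finite[OF u A(1)] by linarith
  moreover have "L ^ 3 * (\<Sum>m\<in>A. (norm (coef u m))^2) \<le> L ^ 3 * (ell2_norm (coef u))^2"
   using A(1) L by (intro mult_left_mono ell2_finite_sum_le bessel u) (auto simp: symmetric_set_def)
  ultimately show "(LINT x|torus L. (u x)^2) \<le> L ^ 3 * (ell2_norm (coef u))^2 + e" by linarith
 qed
qed

text \<open>Polarization of \<open>parseval_norm\<close>.\<close>

lemma parseval:
 assumes u: "u \<in> L2_torus L" and v: "v \<in> L2_torus L"
 shows "((%m. coef u m \<bullet> coef v m) has_sum ((LINT x|torus L. u x * v x) / L ^ 3)) UNIV"
proof -
 have L3: "L ^ 3 > 0" using L by simp
 have cl: "coef (%x. u x + v x) m = coef u m + coef v m" "coef (%x. u x - v x) m = coef u m - coef v m" for m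
  by (rule coef_linear; intro L2_torus_integrable u v)+
 have p: "((%m. (norm (coef u m + coef v m))^2) has_sum ((LINT x|torus L. (u x + v x)^2) / L ^ 3)) UNIV"
  using parseval_norm[OF L2_torus_add[OF u v]] bessel(1)[OF L2_torus_add[OF u v]] L3
  by (simp add: ell2_norm_square ell2_def cl has_sum_iff)
 have q: "((%m. (norm (coef u m - coef v m))^2) has_sum ((LINT x|torus L. (u x - v x)^2) / L ^ 3)) UNIV"
  using parseval_norm[OF L2_torus_diff[OF u v]] bessel(1)[OF L2_torus_diff[OF u v]] L3
  by (simp add: ell2_norm_square ell2_def cl has_sum_iff)
 have pi: "integrable (torus L) (%x. (u x + v x)^2)" "integrable (torus L) (%x. (u x - v x)^2)"
  using L2_torusD(3)[OF L2_torus_add[OF u v]] L2_torusD(3)[OF L2_torus_diff[OF u v]] by simp_all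
 have "(LINT x|torus L. u x * v x) = (LINT x|torus L. (1/4) * ((u x + v x)^2 - (u x - v x)\<^sup>2))"
  by (intro bochner_integral_cong refl) (simp add: power2_eq_square algebra_simps)
 also have "\<dots> = (1/4) * ((LINT x|torus L. (u x + v x)^2) - (LINT x|torus L. (u x - v x)^2))" using pi by simp
 finally have e: "(LINT x|torus L. u x * v x) / L ^ 3 = (1/4) * ((LINT x|torus L. (u x + v x)^2) / L ^ 3 + - ((LINT x|torus L. (u x - v x)^2) / L ^ 3))"
  by (simp add: diff_divide_distrib)
 have s: "coef u m \<bullet> coef v m = (1/4) * ((norm (coef u m + coef v m))^2 + - (norm (coef u m - coef v m))\<^sup>2)" for m
  unfolding power2_norm_eq_inner by (simp add: inner_add_left inner_add_right inner_diff_left inner_diff_right inner_commute)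
 show ?thesis unfolding e s by (intro has_sum_cmult_right has_sum_add p has_sum_uminusI q)
qed

text \<open>The real part of the sum is Parseval's identity; its imaginary part vanishes since l to
  -l conjugates the terms.\<close>

lemma bilinear_parseval:
 assumes u: "u \<in> L2_torus L" and v: "v \<in> L2_torus L"
 shows "((%l. coef u l * coef v (- l)) has_sum (of_real ((LINT x|torus L. u x * v x) / L ^ 3))) UNIV"
proof -
 let ?f = "%l. coef u l * coef v (- l)"
 have "(%l. norm (?f l)) summable_on UNIV"
  using ell2_Cauchy_Schwarz(1)[OF bessel(1)[OF u] bessel(1)[OF v]] by (simp add: norm_mult coef_minus)
 then have s: "?f summable_on UNIV" by (rule abs_summable_summable)
 have "(\<Sum>\<^sub>\<infinity>l. ?f l) = (\<Sum>\<^sub>\<infinity>l. ?f (- l))" by (rule infsum_translate(5)[symmetric])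
 also have "\<dots> = (\<Sum>\<^sub>\<infinity>l. cnj (?f l))" by (simp add: coef_minus)
 also have "\<dots> = cnj (\<Sum>\<^sub>\<infinity>l. ?f l)" by (rule infsum_cnj)
 finally have im: "Im (\<Sum>\<^sub>\<infinity>l. ?f l) = 0" by (simp add: complex_eq_iff)
 have "Re (\<Sum>\<^sub>\<infinity>l. ?f l) = (\<Sum>\<^sub>\<infinity>l. Re (?f l))" by (rule infsum_Re[OF s, symmetric])
 also have "\<dots> = (\<Sum>\<^sub>\<infinity>l. coef u l \<bullet> coef v l)" by (simp add: inner_complex_Re coef_minus)
 also have "\<dots> = (LINT x|torus L. u x * v x) / L ^ 3" by (rule infsumI[OF parseval[OF u v]])
 finally have "(\<Sum>\<^sub>\<infinity>l. ?f l) = of_real ((LINT x|torus L. u x * v x) / L ^ 3)" using im by (simp add: complex_eq_iff)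
 then show ?thesis using s by (simp add: has_sum_iff)
qed

lemma L2_torus_mult_bounded:
 fixes v :: "real^3 \<Rightarrow> real"
 assumes v: "v \<in> L2_torus L" and c: "continuous_on UNIV c" "periodic L c" "\<And>x. \<bar>c x\<bar> \<le> 1"
 shows "(%x. v x * c x) \<in> L2_torus L"
proof (rule L2_torus_dominated)
 show "periodic L (%x. v x * c x)" using L2_torusD(1)[OF v] c(2) by (simp add: periodic_def)
 show "(%x. v x * c x) \<in> borel_measurable (torus L)"
  using L2_torusD(2)[OF v] measurable_torus_continuous[OF c(1)] by measurable
 show "integrable (torus L) (%x. (norm (v x))^2)" by (rule L2_torusD(3)[OF v])
 show "(norm (v x * c x))^2 \<le> (norm (v x))^2" for x
  using mult_left_mono[OF c(3)[of x], of "\<bar>v x\<bar>"] by (intro power_mono) (auto simp: abs_mult)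
qed

text \<open>The product is merely integrable, so Parseval does not apply to it. Instead the
  exponential is absorbed into \<open>v\<close>, as a cosine and a sine part that are real and
  square integrable, and \<open>u\<close> is paired with each.\<close>

lemma coef_product:
 assumes u: "u \<in> L2_torus L" and v: "v \<in> L2_torus L"
 shows "coef (%x. u x * v x) k = (\<Sum>\<^sub>\<infinity>l. coef u l * coef v (k - l))"
proof -
 have per: "periodic L (%x. cos (wn k \<bullet> x))" "periodic L (%x. sin (wn k \<bullet> x))"
  using periodic_cis[of k] by (auto simp: periodic_def complex_eq_iff)
 define vc where "vc x = v x * cos (wn k \<bullet> x)" for x
 define vs where "vs x = v x * sin (wn k \<bullet> x)" for x
 have vc: "vc \<in> L2_torus L" and vs: "vs \<in> L2_torus L"
  unfolding vc_def vs_def by (rule L2_torus_mult_bounded[OF v _ per(1)] L2_torus_mult_bounded[OF v _ per(2)]; auto intro!: continuous_intros)+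
 have iv: "integrable (torus L) v" by (rule L2_torus_integrable[OF v])
 have cv: "coef vc (- l) - \<i> * coef vs (- l) = coef v (k - l)" for l
 proof -
  have i: "integrable (torus L) (%x. complex_of_real (vc x) * cis (- (wn (- l) \<bullet> x)))"
   "integrable (torus L) (%x. complex_of_real (vs x) * cis (- (wn (- l) \<bullet> x)))"
   by (intro cis_integrable_minus L2_torus_integrable vc vs)+
  have e: "complex_of_real (v x) * cis (- (wn (k - l) \<bullet> x)) = complex_of_real (vc x) * cis (- (wn (- l) \<bullet> x)) - \<i> * (complex_of_real (vs x) * cis (- (wn (- l) \<bullet> x)))" for x
  proof -
   have "cis (- (wn (k - l) \<bullet> x)) = cis (- (wn k \<bullet> x)) * cis (- (wn (- l) \<bullet> x))"
    by (simp add: cis_mult wn_diff inner_diff_left)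
   moreover have "cis (- (wn k \<bullet> x)) = of_real (cos (wn k \<bullet> x)) - \<i> * of_real (sin (wn k \<bullet> x))"
    by (simp add: complex_eq_iff)
   ultimately have e': "cis (- (wn (k - l) \<bullet> x)) = (of_real (cos (wn k \<bullet> x)) - \<i> * of_real (sin (wn k \<bullet> x))) * cis (- (wn (- l) \<bullet> x))"
    by (simp only:)
   show ?thesis unfolding e' vc_def vs_def of_real_mult by (simp only: left_diff_distrib right_diff_distrib mult_ac)
  qed
  show ?thesis unfolding coef_eq e using i by (simp add: diff_divide_distrib)
 qed
 have "((%l. coef u l * coef vc (- l) + (- \<i>) * (coef u l * coef vs (- l))) has_sum
   (of_real ((LINT x|torus L. u x * vc x) / L ^ 3) + (- \<i>) * of_real ((LINT x|torus L. u x * vs x) / L ^ 3))) UNIV"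
  by (intro has_sum_add has_sum_cmult_right bilinear_parseval u vc vs)
 moreover have "coef u l * coef vc (- l) + (- \<i>) * (coef u l * coef vs (- l)) = coef u l * coef v (k - l)" for l
  by (simp add: cv[symmetric] algebra_simps)
 moreover have "of_real ((LINT x|torus L. u x * vc x) / L ^ 3) + (- \<i>) * of_real ((LINT x|torus L. u x * vs x) / L ^ 3) = coef (%x. u x * v x) k"
 proof -
  have i: "integrable (torus L) (%x. complex_of_real (u x * vc x))" "integrable (torus L) (%x. complex_of_real (u x * vs x))"
   by (intro integrable_of_real L2_torus_mult_integrable u vc vs)+
  have e: "complex_of_real (u x * v x) * cis (- (wn k \<bullet> x)) = complex_of_real (u x * vc x) - \<i> * complex_of_real (u x * vs x)" for x
   by (simp add: complex_eq_iff vc_def vs_def)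
  have "(LINT x|torus L. complex_of_real (u x * v x) * cis (- (wn k \<bullet> x)))
    = (LINT x|torus L. complex_of_real (u x * vc x)) - \<i> * (LINT x|torus L. complex_of_real (u x * vs x))"
   unfolding e using i by (subst bochner_integral_diff) auto
  then show ?thesis unfolding coef_eq integral_complex_of_real by (simp add: diff_divide_distrib)
 qed
 ultimately show ?thesis by (simp add: infsumI)
qed

text \<open>Riesz-Fischer provides the witness that the choice in \<open>of_fourier\<close>
  needs.\<close>

lemma of_fourier_spec:
 assumes h: "\<And>m. c (wn (- m)) = cnj (c (wn m))" and e: "ell2 (%m. c (wn m))"
 shows "of_fourier L c \<in> L2_torus L" "coef (of_fourier L c) m = c (wn m)"
proof -
 have "hermitian (%m. c (wn m))" unfolding hermitian_def using h by blast
 from riesz_fischer[OF this e] obtain U where "U \<in> L2_torus L" "\<And>m. coef U m = c (wn m)" by blast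
 then have "\<exists>u. u \<in> L2_torus L \<and> (\<forall>k\<in>wavenumbers L. fourier L u k = c k)"
  unfolding wavenumbers_eq coef_def by blast
 from someI_ex[OF this] show "of_fourier L c \<in> L2_torus L" "coef (of_fourier L c) m = c (wn m)"
  unfolding of_fourier_def wavenumbers_eq coef_def by auto
qed

lemma multiplier_spec:
 assumes s: "\<And>m. s (wn (- m)) = cnj (s (wn m))" and e: "ell2 (%m. s (wn m) * coef u m)"
 shows "multiplier L s u \<in> L2_torus L" "coef (multiplier L s u) m = s (wn m) * coef u m"
proof -
 have h: "s (wn (- m)) * fourier L u (wn (- m)) = cnj (s (wn m) * fourier L u (wn m))" for m
  using coef_minus[of u m] s[of m] by (simp add: coef_def)
 have e': "ell2 (%m. s (wn m) * fourier L u (wn m))" using e by (simp add: coef_def)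
 show "multiplier L s u \<in> L2_torus L" "coef (multiplier L s u) m = s (wn m) * coef u m"
  unfolding multiplier_def using of_fourier_spec[of "%k. s k * fourier L u k", OF h e'] by (auto simp: coef_def)
qed

end

section \<open>Square integrable functions of time\<close>

text \<open>Rests on completeness of Lebesgue measure. Through it, functions known only almost
  everywhere become measurable.\<close>

lemma borel_measurable_AE_lebesgue_on:
 fixes f g :: "'a::euclidean_space \<Rightarrow> 'b::euclidean_space"
 assumes f: "f \<in> borel_measurable (lebesgue_on S)" and ae: "AE x in lebesgue_on S. f x = g x" and S: "S \<in> sets lebesgue"
 shows "g \<in> borel_measurable (lebesgue_on S)"
proof -
 have S': "S \<inter> space lebesgue \<in> sets lebesgue" using S by simp
 have "(%x. indicator S x *\<^sub>R f x) \<in> borel_measurable lebesgue"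
  using f borel_measurable_restrict_space_iff[OF S', of f] by (simp add: mult.commute)
 moreover have "AE x in lebesgue. indicator S x *\<^sub>R f x = indicator S x *\<^sub>R g x"
  using ae by (subst (asm) AE_restrict_space_iff) (use S in \<open>auto elim!: eventually_mono simp: indicator_def\<close>)
 ultimately have "(%x. indicator S x *\<^sub>R g x) \<in> borel_measurable lebesgue" by (rule borel_measurable_AE)
 then show ?thesis using borel_measurable_restrict_space_iff[OF S', of g] by (simp add: mult.commute)
qed

text \<open>A functional that is Lipschitz on \<open>V\<close> maps the approximating simple
  functions to convergent ones. With \<open>l\<close> a Fourier coefficient, strong measurability of
  a field gives measurability of each mode.\<close>

lemma L2_time_functional_measurable:
 fixes l :: "('a \<Rightarrow> 'b::ab_group_add) \<Rightarrow> 'c::euclidean_space"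
 assumes u: "u \<in> L2_time T V nrm"
  and l: "\<And>a b. a \<in> V \<Longrightarrow> b \<in> V \<Longrightarrow> norm (l a - l b) \<le> C * nrm (%x. a x - b x)"
 shows "(%t. l (u t)) \<in> borel_measurable (Leb T)"
proof -
 from u obtain s where V: "AE t in Leb T. u t \<in> V"
  and s: "\<And>n::nat. simple_function (Leb T) (s n)" "\<And>n t. t \<in> {0..T} \<Longrightarrow> s n t \<in> V"
  and lim: "AE t in Leb T. (%n. nrm (%x. s n t x - u t x)) \<longlonglongrightarrow> 0"
  unfolding L2_time_def by blast
 have sm: "(%t. l (s n t)) \<in> borel_measurable (Leb T)" for n
  by (rule borel_measurable_simple_function) (rule simple_function_compose1[OF s(1)])
 define h where "h t = lim (%n. l (s n t))" for t
 have h: "h \<in> borel_measurable (Leb T)"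
  unfolding h_def by (rule borel_measurable_lim_metric[OF sm])
 have sp: "AE t in Leb T. t \<in> {0..T}" by (rule AE_in_lebesgue_onI)
 have "AE t in Leb T. h t = l (u t)"
  using V lim sp
 proof eventually_elim
  case (elim t)
  have "(%n. C * nrm (%x. s n t x - u t x)) \<longlonglongrightarrow> 0" by (rule tendsto_mult_right_zero[OF elim(2)])
  then have "(%n. l (s n t) - l (u t)) \<longlonglongrightarrow> 0"
   by (rule Lim_null_comparison[rotated]) (use l[OF s(2)[OF elim(3)] elim(1)] in auto)
  then have "(%n. l (s n t)) \<longlonglongrightarrow> l (u t)" by (rule Lim_null[THEN iffD2])
  then show ?case unfolding h_def by (rule limI)
 qed
 then show ?thesis by (rule borel_measurable_AE_lebesgue_on[OF h]) simp
qed

lemma simple_function_restrict_family: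
 fixes S :: "'k \<Rightarrow> 'a \<Rightarrow> 'c::zero"
 assumes "finite I" "\<And>k. k \<in> I \<Longrightarrow> simple_function M (S k)"
 shows "simple_function M (%t k. if k \<in> I then S k t else 0)"
 using assms
proof (induction I rule: finite_induct)
 case (insert j I)
 have "(%t k. if k \<in> insert j I then S k t else 0) = (%t. (%k. if k \<in> I then S k t else 0)(j := S j t))"
  by (auto simp: fun_eq_iff)
 moreover have "simple_function M (%t. (%k. if k \<in> I then S k t else 0)(j := S j t))"
  by (rule simple_function_compose2[of M "%t k. if k \<in> I then S k t else 0" "S j" "%f y. f(j := y)"])
    (use insert in auto)
 ultimately show ?case by simp
qed simp

text \<open>\<open>Adm\<close> collects the linear constraints on coefficients, \<open>q\<close> is
  the weight of the norm, and \<open>Q\<close> projects arbitrary coefficients to admissible ones;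
  its error at k may involve the index \<open>J k\<close>, which will be -k. Simple functions arise
  by approximating finitely many modes and projecting, since truncation alone breaks the
  constraints.\<close>

lemma L2_time_from_coefficients:
 fixes c :: "'k::countable \<Rightarrow> real \<Rightarrow> 'c::euclidean_space" and syn :: "('k \<Rightarrow> 'c) \<Rightarrow> 'a \<Rightarrow> 'b::ab_group_add"
 assumes meas: "\<And>k. c k \<in> borel_measurable (Leb T)"
  and adm: "AE t in Leb T. Adm (slice c t) \<and> ell2 (%k. q k *\<^sub>R c k t)"
  and int: "integrable (Leb T) (%t. (ell2_norm (%k. q k *\<^sub>R c k t))^2)"
  and synV: "\<And>a. Adm a \<Longrightarrow> ell2 (%k. q k *\<^sub>R a k) \<Longrightarrow> syn a \<in> V"
  and nrmd: "\<And>a b. Adm a \<Longrightarrow> ell2 (%k. q k *\<^sub>R a k) \<Longrightarrow> Adm b \<Longrightarrow> ell2 (%k. q k *\<^sub>R b k) \<Longrightarrow>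
    nrm (%x. syn a x - syn b x) = ell2_norm (%k. q k *\<^sub>R (a k - b k))"
  and nrm: "\<And>a. Adm a \<Longrightarrow> ell2 (%k. q k *\<^sub>R a k) \<Longrightarrow> nrm (syn a) = ell2_norm (%k. q k *\<^sub>R a k)"
  and Q: "\<And>a. Adm (Q a)" "\<And>a b k. Adm b \<Longrightarrow> norm (Q a k - b k) \<le> K * (norm (a k - b k) + norm (a (J k) - b (J k)))"
  and Adm0: "Adm (%k. 0)" and K: "K \<ge> 0"
  and J: "\<And>k. J (J k) = k" "\<And>k. q (J k) = q k"
 shows "(%t. syn (slice c t)) \<in> L2_time T V nrm"
proof -
 have "\<exists>S. (\<forall>i. simple_function (Leb T) (S i)) \<and> (\<forall>t\<in>{0..T}. (slice S t) \<longlonglongrightarrow> c k t) \<and>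
   (\<forall>i. \<forall>t\<in>{0..T}. norm (S i t) \<le> 2 * norm (c k t))" for k
  using borel_measurable_implies_sequence_metric[OF meas[of k], of 0] by simp
 then have "\<forall>k. \<exists>S. (\<forall>i. simple_function (Leb T) (S i)) \<and> (\<forall>t\<in>{0..T}. (slice S t) \<longlonglongrightarrow> c k t) \<and>
   (\<forall>i. \<forall>t\<in>{0..T}. norm (S i t) \<le> 2 * norm (c k t))" by blast
 from choice[OF this] obtain S where S: "\<And>k i. simple_function (Leb T) (S k i)"
  "\<And>k t. t \<in> {0..T} \<Longrightarrow> (%i. S k i t) \<longlonglongrightarrow> c k t" "\<And>k i t. t \<in> {0..T} \<Longrightarrow> norm (S k i t) \<le> 2 * norm (c k t)"
  by blast
 define a where "a n t k = (if k \<in> initial n then S k n t else 0)" for n t k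
 have as: "simple_function (Leb T) (a n)" for n
  unfolding a_def by (rule simple_function_restrict_family) (auto intro: S)
 have bJ: "bij_betw J UNIV UNIV" by (rule bij_betwI[where g=J]) (auto simp: J)
 \<comment> \<open>The bound on \<open>Q\<close>, compared with the zero family, keeps the support
   within \<open>initial n\<close> and its image under \<open>J\<close>, hence finite.\<close>
 have fin: "ell2 (%k. q k *\<^sub>R Q (a n t) k)" for n t
 proof -
  have "Q (a n t) k = 0" if "k \<notin> initial n \<union> J ` initial n" for k
  proof -
   have "J k \<notin> initial n" using that J(1)[of k] by (metis UnI2 imageI)
   then have "norm (Q (a n t) k - 0) \<le> K * (norm (0 - 0 :: 'c) + norm (0 - 0 :: 'c))"
    using Q(2)[OF Adm0, of "a n t" k] that by (simp add: a_def)
   then show ?thesis by simp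
  qed
  then have "{k. (norm (q k *\<^sub>R Q (a n t) k))^2 \<noteq> 0} \<subseteq> initial n \<union> J ` initial n" by auto
  then have "finite {k. (norm (q k *\<^sub>R Q (a n t) k))^2 \<noteq> 0}" by (rule finite_subset) auto
  then show ?thesis unfolding ell2_def by (intro finite_nonzero_values_imp_summable_on) simp
 qed
 have ss: "simple_function (Leb T) (%t. syn (Q (a n t)))" for n
  by (rule simple_function_compose1[OF as])
 have sV: "syn (Q (a n t)) \<in> V" for n t by (rule synV[OF Q(1) fin])
 have sp: "AE t in Leb T. t \<in> {0..T}" by (rule AE_in_lebesgue_onI)
 have conv: "AE t in Leb T. (%n. nrm (%x. syn (Q (a n t)) x - syn (slice c t) x)) \<longlonglongrightarrow> 0"
  using adm sp
 proof eventually_elim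
  case (elim t)
  then have A: "Adm (slice c t)" and e: "ell2 (%k. q k *\<^sub>R c k t)" and t: "t \<in> {0..T}" by auto
  have nn: "nrm (%x. syn (Q (a n t)) x - syn (slice c t) x) = sqrt (\<Sum>\<^sub>\<infinity>k. (norm (q k *\<^sub>R (Q (a n t) k - c k t)))^2)" for n
   using nrmd[OF Q(1) fin A e] by (simp add: ell2_norm_def)
  have er: "(%n. a n t k - c k t) \<longlonglongrightarrow> 0" for k
  proof -
   have "eventually (%n. a n t k = S k n t) sequentially"
    using eventually_gt_at_top[of "to_nat k"] by eventually_elim (simp add: a_def initial_def)
   then have "(%n. a n t k) \<longlonglongrightarrow> c k t"
    by (rule Lim_transform_eventually[OF S(2)[OF t] eventually_mono]) simp
   then show ?thesis by (rule Lim_null[THEN iffD1])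
  qed
  have eb: "norm (a n t k - c k t) \<le> 3 * norm (c k t)" for n k
  proof -
   have "norm (a n t k) \<le> 2 * norm (c k t)" using S(3)[OF t, of k n] by (simp add: a_def)
   then show ?thesis using norm_triangle_ineq4[of "a n t k" "c k t"] by linarith
  qed
  have "(%n. \<Sum>\<^sub>\<infinity>k. (norm (q k *\<^sub>R (Q (a n t) k - c k t)))^2) \<longlonglongrightarrow> (\<Sum>\<^sub>\<infinity>k::'k. 0)"
  proof (rule infsum_tannery)
   fix k
   have "(%n. K * (norm (a n t k - c k t) + norm (a n t (J k) - c (J k) t))) \<longlonglongrightarrow> K * (0 + 0)"
    by (intro tendsto_intros tendsto_norm_zero er)
   then have "(%n. K * (norm (a n t k - c k t) + norm (a n t (J k) - c (J k) t))) \<longlonglongrightarrow> 0" by simp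
   then have "(%n. Q (a n t) k - c k t) \<longlonglongrightarrow> 0"
    by (rule Lim_null_comparison[rotated]) (use Q(2)[OF A] in auto)
   then have "(%n. (norm (q k *\<^sub>R (Q (a n t) k - c k t)))^2) \<longlonglongrightarrow> (norm (q k *\<^sub>R (0::'c)))^2" by (intro tendsto_intros)
   then show "(%n. (norm (q k *\<^sub>R (Q (a n t) k - c k t)))^2) \<longlonglongrightarrow> 0" by simp
  next
   \<comment> \<open>The approximation error of a mode is at most 3 times the mode. Squaring gives
     9, and splitting the square of a sum gives another 2.\<close>
   let ?B = "%k. (18 * K^2) * ((norm (q k *\<^sub>R c k t))^2 + (norm (q (J k) *\<^sub>R c (J k) t))^2)"
   have "(norm (q k *\<^sub>R (Q (a n t) k - c k t)))^2 \<le> ?B k" for n k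
   proof -
    have "norm (Q (a n t) k - c k t) \<le> K * (3 * norm (c k t) + 3 * norm (c (J k) t))"
     by (rule order_trans[OF Q(2)[OF A]]) (intro mult_left_mono add_mono eb K)
    then have "norm (q k *\<^sub>R (Q (a n t) k - c k t)) \<le> \<bar>q k\<bar> * (K * (3 * norm (c k t) + 3 * norm (c (J k) t)))"
     unfolding norm_scaleR by (intro mult_left_mono) auto
    also have "\<dots> = 3 * K * (norm (q k *\<^sub>R c k t) + norm (q (J k) *\<^sub>R c (J k) t))"
     by (simp add: J algebra_simps)
    finally have "(norm (q k *\<^sub>R (Q (a n t) k - c k t)))^2 \<le> (3 * K * (norm (q k *\<^sub>R c k t) + norm (q (J k) *\<^sub>R c (J k) t)))^2"
     by (intro power_mono) auto
    also have "\<dots> = 9 * K^2 * (norm (q k *\<^sub>R c k t) + norm (q (J k) *\<^sub>R c (J k) t))^2"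
     by (simp add: power_mult_distrib)
    also have "\<dots> \<le> 9 * K^2 * (2 * (norm (q k *\<^sub>R c k t))^2 + 2 * (norm (q (J k) *\<^sub>R c (J k) t))^2)"
     by (intro mult_left_mono square_sum_le) simp
    finally show ?thesis by (simp add: algebra_simps)
   qed
   then show "eventually (%n. \<forall>k. \<bar>(norm (q k *\<^sub>R (Q (a n t) k - c k t)))^2\<bar> \<le> ?B k) sequentially" by simp
   have "(%k. (norm (q (J k) *\<^sub>R c (J k) t))^2) summable_on UNIV"
    using e summable_on_reindex_bij_betw[OF bJ, of "%k. (norm (q k *\<^sub>R c k t))^2"] by (simp add: ell2_def)
   then show "?B summable_on UNIV"
    using e by (intro summable_on_cmult_right summable_on_add) (simp_all add: ell2_def)
  qed simp
  then have "(%n. sqrt (\<Sum>\<^sub>\<infinity>k. (norm (q k *\<^sub>R (Q (a n t) k - c k t)))^2)) \<longlonglongrightarrow> sqrt (\<Sum>\<^sub>\<infinity>k::'k. 0)"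
   by (rule tendsto_real_sqrt)
  then show ?case unfolding nn by simp
 qed
 have V: "AE t in Leb T. syn (slice c t) \<in> V" using adm by eventually_elim (use synV in blast)
 have eqn: "AE t in Leb T. (ell2_norm (%k. q k *\<^sub>R c k t))^2 = (nrm (syn (slice c t)))^2"
  using adm by eventually_elim (simp add: nrm)
 have m: "(%t. (ell2_norm (%k. q k *\<^sub>R c k t))^2) \<in> borel_measurable (Leb T)" using int by auto
 have "integrable (Leb T) (%t. (nrm (syn (slice c t)))^2)"
  by (rule integrable_cong_AE_imp[OF int borel_measurable_AE_lebesgue_on[OF m eqn]])
    (use eqn in \<open>auto elim!: eventually_mono\<close>)
 then show ?thesis
  unfolding L2_time_def
  by (intro CollectI conjI exI[of _ "%n. %t. syn (Q (a n t))"] allI ballI) (rule V ss sV conv)+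
qed

text \<open>Provides the test fields for the weak form: a fixed spatial field switched on during a
  measurable set of times.\<close>

lemma L2_time_indicator:
 fixes v :: "'a \<Rightarrow> 'b::ab_group_add"
 assumes v: "v \<in> V" and z: "(%x. 0) \<in> V" and n0: "nrm (%x. 0) = 0" and A: "A \<in> sets (Leb T)"
 shows "(%t. if t \<in> A then v else (%x. 0)) \<in> L2_time T V nrm"
proof -
 have sA: "simple_function (Leb T) (%t. if t \<in> A then v else (%x. 0))"
  by (rule simple_function_If_set) (use A sets.sets_into_space[OF A] in \<open>auto simp: Int_absorb2\<close>)
 have "(%t. (nrm (if t \<in> A then v else (%x. 0)))^2) = (%t. indicator A t * (nrm v)^2)"
  by (auto simp: n0 indicator_def)
 moreover have "integrable (Leb T) (%t. indicator A t * (nrm v)^2 :: real)"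
  by (rule integrable_lebesgue_on_bounded[where B="(nrm v)^2"]) (use A in \<open>auto simp: indicator_def\<close>)
 ultimately show ?thesis
  unfolding L2_time_def
 proof (intro CollectI conjI exI[of _ "%n. %t. if t \<in> A then v else (%x. 0)"] allI ballI)
  show "AE t in Leb T. (%n. nrm (%x. (if t \<in> A then v else (%x. 0)) x - (if t \<in> A then v else (%x. 0)) x)) \<longlonglongrightarrow> 0"
   by (simp add: n0)
 qed (simp_all add: v z sA)
qed

section \<open>Summability of 1 / |k|^4 over the lattice in dimension three\<close>

lemma summable_int_powr: "(%n::int. (1 + (of_int n)^2 :: real) powr (- 2/3)) summable_on UNIV"
proof -
 let ?f = "%n::int. (1 + (of_int n)^2 :: real) powr (- 2/3)"
 have le: "?f n \<le> (real_of_int n) powr (- 4/3)" if "n > 0" for n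
 proof -
  have "((real_of_int n)^2) powr (- 2/3) = (real_of_int n) powr (- 4/3)"
  proof -
   have "(real_of_int n)^2 = (real_of_int n) powr 2" using that by simp
   then show ?thesis by (simp only: powr_powr) simp
  qed
  moreover have "?f n \<le> ((real_of_int n)^2) powr (- 2/3)"
  proof (rule powr_mono2')
   show "0 < (real_of_int n)^2" using that by simp
  qed simp_all
  ultimately show ?thesis by simp
 qed
 have "summable (%i. real i powr (- 4/3))" by (subst summable_real_powr_iff) simp
 then have "summable (%i. real (Suc i) powr (- 4/3))" by (subst summable_Suc_iff)
 then have s: "(%i. real (Suc i) powr (- 4/3)) summable_on (UNIV :: nat set)"
  by (subst summable_on_UNIV_nonneg_real_iff) auto
 have "(%i::nat. ?f (int (Suc i))) summable_on UNIV"
 proof (rule summable_on_comparison_test[OF s])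
  fix i :: nat
  show "?f (int (Suc i)) \<le> real (Suc i) powr (- 4/3)" using le[of "int (Suc i)"] by simp
 qed simp
 moreover have bij: "bij_betw (%i. int (Suc i)) UNIV {n. n > 0}"
  by (rule bij_betwI[where g="%n. nat (n - 1)"]) auto
 ultimately have p: "?f summable_on {n. n > 0}" using summable_on_reindex_bij_betw[OF bij, of ?f] by simp
 have bij2: "bij_betw uminus {n::int. n > 0} {n. n < 0}" by (rule bij_betwI[where g=uminus]) auto
 have m: "?f summable_on {n. n < 0}" using p summable_on_reindex_bij_betw[OF bij2, of ?f] by simp
 have "?f summable_on ({n. n > 0} \<union> ({n. n < 0} \<union> {0}))"
  by (intro summable_on_Un_disjoint p m) (simp_all add: disjoint_iff)
 moreover have "{n::int. n > 0} \<union> ({n. n < 0} \<union> {0}) = UNIV" by auto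
 ultimately show ?thesis by simp
qed

text \<open>For m nonzero, 1 + m_i^2 <= 2 |m|^2, so the product of the three factors (1 +
  m_i^2)^(-2/3) is at least 1 / (4 |m|^4). The exponent 2/3 splits the power evenly, and each
  one-dimensional series decays like |n|^(-4/3).\<close>

lemma summable_int3_fourth_power:
 "(%m::int^3. 1 / (norm (\<chi> i. real_of_int (m $ i))) ^ 4) summable_on UNIV"
proof -
 define f where "f n = (1 + (of_int n)^2 :: real) powr (- 2/3)" for n :: int
 have f0: "f n > 0" for n
 proof -
  have "1 + (real_of_int n)^2 > 0" by (intro add_pos_nonneg) auto
  then show ?thesis unfolding f_def by simp
 qed
 define S where "S = (\<Sum>\<^sub>\<infinity>n. f n)"
 have fs: "f summable_on UNIV" unfolding f_def by (rule summable_int_powr)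
 have S0: "S \<ge> 0" unfolding S_def using f0 by (intro infsum_nonneg) (auto intro: less_imp_le)
 have fin_vec: "finite {m::int^3. \<forall>i. m $ i \<in> X}" if X: "finite X" for X
 proof -
  have "inj_on (%m::int^3. (m $ 1, m $ 2, m $ 3)) {m. \<forall>i. m $ i \<in> X}"
   by (auto simp: inj_on_def vec_eq_iff forall_3)
  moreover have "finite ((%m::int^3. (m $ 1, m $ 2, m $ 3)) ` {m. \<forall>i. m $ i \<in> X})"
   by (rule finite_subset[of _ "X \<times> X \<times> X"]) (use X in auto)
  ultimately show ?thesis by (rule finite_imageD[rotated])
 qed
 have psum: "(\<Sum>m\<in>{m::int^3. \<forall>i. m $ i \<in> X}. \<Prod>i\<in>UNIV. f (m $ i)) = (\<Sum>n\<in>X. f n) ^ 3" if X: "finite X" for X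
 proof -
  have p3: "(\<Prod>i\<in>UNIV. g i) = g 1 * (g 2 * g 3)" for g :: "3 \<Rightarrow> real" unfolding UNIV_3 by simp
  have b: "bij_betw (%(a, b, c). vector [a, b, c] :: int^3) (X \<times> X \<times> X) {m. \<forall>i. m $ i \<in> X}"
   by (rule bij_betwI[where g="%m. (m $ 1, m $ 2, m $ 3)"]) (auto simp: forall_3 vec_eq_iff vector_3)
  have "(\<Sum>m\<in>{m::int^3. \<forall>i. m $ i \<in> X}. \<Prod>i\<in>UNIV. f (m $ i)) = (\<Sum>x\<in>X \<times> X \<times> X. (case x of (a, b, c) \<Rightarrow> f a * (f b * f c)))"
   unfolding sum.reindex_bij_betw[OF b, symmetric] by (simp only: split_def p3 vector_3)
  also have "\<dots> = (\<Sum>n\<in>X. f n) * ((\<Sum>n\<in>X. f n) * (\<Sum>n\<in>X. f n))"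
   by (simp add: sum_product sum.cartesian_product split_def)
  finally show ?thesis by (simp add: power3_eq_cube mult.assoc)
 qed
 have ps: "(%m::int^3. \<Prod>i\<in>UNIV. f (m $ i)) summable_on UNIV"
 proof (rule summable_on_nonneg_if_bounded(1))
  fix A :: "(int^3) set" assume A: "finite A"
  define X where "X = (\<Union>i. (%m. m $ i) ` A)"
  have X: "finite X" unfolding X_def using A by auto
  have "(\<Sum>m\<in>A. \<Prod>i\<in>UNIV. f (m $ i)) \<le> (\<Sum>m\<in>{m::int^3. \<forall>i. m $ i \<in> X}. \<Prod>i\<in>UNIV. f (m $ i))"
  proof (rule Groups_Big.sum_mono2)
   show "finite {m::int^3. \<forall>i. m $ i \<in> X}" by (rule fin_vec[OF X])
   show "A \<subseteq> {m. \<forall>i. m $ i \<in> X}" by (auto simp: X_def)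
  qed (simp add: prod_nonneg less_imp_le f0)
  also have "\<dots> = (\<Sum>n\<in>X. f n) ^ 3" by (rule psum[OF X])
  also have "\<dots> \<le> S ^ 3"
  proof (rule power_mono)
   show "(\<Sum>n\<in>X. f n) \<le> S"
    unfolding S_def by (rule finite_sum_le_infsum[OF fs X]) (simp_all add: less_imp_le f0)
  qed (simp add: sum_nonneg less_imp_le f0)
  finally show "(\<Sum>m\<in>A. \<Prod>i\<in>UNIV. f (m $ i)) \<le> S ^ 3" .
 qed (simp add: prod_nonneg less_imp_le f0)
 show ?thesis
 proof (rule summable_on_comparison_test[OF summable_on_cmult_right[OF ps, of 4]])
  fix m :: "int^3"
  let ?r = "%i. real_of_int (m $ i)"
  define n2 where "n2 = (norm (\<chi> i. ?r i))^2"
  have n2: "n2 = (\<Sum>i\<in>UNIV. (?r i)^2)" by (simp add: n2_def norm_vec_def L2_set_def sum_nonneg)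
  show "1 / (norm (\<chi> i. ?r i)) ^ 4 \<le> 4 * (\<Prod>i\<in>UNIV. f (m $ i))"
  proof (cases "m = 0")
   case True
   have "(\<chi> i. ?r i) = 0" using True by (simp add: vec_eq_iff)
   then show ?thesis by (simp add: prod_nonneg less_imp_le f0)
  next
   case False
   then obtain j where "m $ j \<noteq> 0" by (auto simp: vec_eq_iff)
   then have "1 \<le> \<bar>m $ j\<bar>" by simp
   then have "1 \<le> \<bar>?r j\<bar>" by (metis of_int_1_le_iff of_int_abs)
   then have "1 \<le> (?r j)^2" by (metis one_le_power power2_abs)
   also have "(?r j)^2 \<le> n2" unfolding n2 by (rule member_le_sum) auto
   finally have one: "1 \<le> n2" .
   have le: "1 + (?r i)^2 \<le> 2 * n2" for i
    using one member_le_sum[of i UNIV "%i. (?r i)^2"] unfolding n2 by simp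
   have pos1: "0 < 1 + (?r i)^2" for i by (intro add_pos_nonneg) auto
   have "(1 / n2) powr (2/3) \<le> 2 powr (2/3) * f (m $ i)" for i
   proof -
    have "(2 * n2) powr (- 2/3) \<le> f (m $ i)"
     unfolding f_def by (rule powr_mono2') (use le[of i] pos1[of i] in auto)
    then have "2 powr (2/3) * (2 * n2) powr (- 2/3) \<le> 2 powr (2/3) * f (m $ i)" by (intro mult_left_mono) auto
    moreover have "2 powr (2/3) * (2 * n2) powr (- 2/3) = (1 / n2) powr (2/3)"
     using one by (simp add: powr_mult powr_divide powr_minus_divide field_simps)
    ultimately show ?thesis by (simp only:)
   qed
   then have "(\<Prod>i\<in>(UNIV::3 set). (1 / n2) powr (2/3 :: real)) \<le> (\<Prod>i\<in>UNIV. 2 powr (2/3) * f (m $ i))"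
    by (intro prod_mono) auto
   also have "\<dots> = (2 powr (2/3)) ^ 3 * (\<Prod>i\<in>UNIV. f (m $ i))" by (simp add: prod.distrib)
   also have "(2 powr (2/3 :: real)) ^ 3 = 4" by (simp add: powr_power)
   also have "(\<Prod>i\<in>(UNIV::3 set). (1 / n2) powr (2/3)) = (1 / n2)^2"
    using one by (simp add: powr_power)
   finally have "(1 / n2)^2 \<le> 4 * (\<Prod>i\<in>UNIV. f (m $ i))" .
   then show ?thesis by (simp add: n2_def power_divide power_mult[symmetric])
  qed
 qed simp
qed

section \<open>Function spaces in terms of coefficients\<close>

locale torus_model = periodic_cell +
 fixes \<alpha> \<nu> T :: real and N :: nat
 assumes params: "\<alpha> > 0" "\<nu> > 0" "T > 0"

context periodic_cell
begin

lemma wn_scaled: "wn m = (2 * pi / L) *\<^sub>R (\<chi> i. real_of_int (m $ i))"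
 by (simp add: wn_def vec_eq_iff)

lemma norm_wn: "norm (wn m) = 2 * pi / L * norm (\<chi> i. real_of_int (m $ i))"
 using L by (simp add: wn_scaled)

lemma norm_wn_ge: assumes "m \<noteq> 0" shows "2 * pi / L \<le> norm (wn m)"
proof -
 obtain j where "m $ j \<noteq> 0" using assms by (auto simp: vec_eq_iff)
 then have "1 \<le> \<bar>m $ j\<bar>" by simp
 then have "1 \<le> \<bar>real_of_int (m $ j)\<bar>" by (metis of_int_1_le_iff of_int_abs)
 also have "\<dots> \<le> norm (\<chi> i. real_of_int (m $ i))"
  using component_le_norm_cart[of "\<chi> i. real_of_int (m $ i)" j] by simp
 finally have "2 * pi / L * 1 \<le> 2 * pi / L * norm (\<chi> i. real_of_int (m $ i))"
  using L by (intro mult_left_mono) auto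
 then show ?thesis by (simp add: norm_wn)
qed

lemma norm_wn_pos: "m \<noteq> 0 \<Longrightarrow> norm (wn m) > 0"
 using norm_wn_ge[of m] L divide_pos_pos[of "2 * pi" L] pi_gt_zero by linarith

lemma wn_summable4: "(%m. 1 / (norm (wn m)) ^ 4) summable_on UNIV"
proof -
 have "(%m. 1 / (norm (wn m)) ^ 4) = (%m. (1 / (2 * pi / L) ^ 4) * (1 / (norm (\<chi> i. real_of_int (m $ i))) ^ 4))"
  by (simp add: norm_wn power_mult_distrib power_divide)
 then show ?thesis by (simp only: summable_on_cmult_right[OF summable_int3_fourth_power])
qed

end

text \<open>A sum of N + 1 powers of a number in [0, 1], of which the zeroth is 1.\<close>

lemma deconv_symbol_bounds:
 "1 \<le> deconv_symbol \<alpha> N k" "deconv_symbol \<alpha> N k \<le> real N + 1" "deconv_symbol \<alpha> N (- k) = deconv_symbol \<alpha> N k"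
proof -
 define r where "r = \<alpha>^2 * (norm k)^2 / (1 + \<alpha>^2 * (norm k)^2)"
 have p: "1 + \<alpha>^2 * (norm k)^2 > 0" by (intro add_pos_nonneg) auto
 have r: "0 \<le> r" "r \<le> 1" using p by (auto simp: r_def divide_le_eq)
 have e: "deconv_symbol \<alpha> N k = (\<Sum>n=0..N. r ^ n)" by (simp add: deconv_symbol_def r_def)
 have "r ^ 0 \<le> (\<Sum>n=0..N. r ^ n)" by (rule member_le_sum) (use r in auto)
 then show "1 \<le> deconv_symbol \<alpha> N k" by (simp add: e)
 have "(\<Sum>n=0..N. r ^ n) \<le> (\<Sum>n=0..N. 1)" by (intro sum_mono power_le_one r)
 then show "deconv_symbol \<alpha> N k \<le> real N + 1" by (simp add: e)
 show "deconv_symbol \<alpha> N (- k) = deconv_symbol \<alpha> N k" by (simp add: deconv_symbol_def)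
qed

text \<open>The spectral gap is the square of the smallest nonzero wave number, 2 \<pi> / L.\<close>

sublocale torus_model \<subseteq> fourier_model wn \<alpha> \<nu> T "(2 * pi / L)^2" "real N + 1" "%m. deconv_symbol \<alpha> N (wn m)"
proof
 show "(2 * pi / L)^2 \<le> (norm (wn k))^2" if "k \<noteq> 0" for k
  using norm_wn_ge[OF that] L by (intro power_mono) auto
qed (use params L deconv_symbol_bounds wn_summable4 in \<open>simp_all add: wn_add\<close>)

context periodic_cell
begin

definition vcoef :: "(real^3 \<Rightarrow> real^3) \<Rightarrow> int^3 \<Rightarrow> complex^3" where "vcoef u m = vfourier L u (wn m)"

lemma vcoef_nth [simp]: "vcoef u m $ j = coef (%x. u x $ j) m"
 by (simp add: vcoef_def vfourier_def coef_def)

lemma L2_torus_nth: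
 fixes u :: "real^3 \<Rightarrow> real^3"
 assumes u: "u \<in> L2_torus L" shows "(%x. u x $ j) \<in> L2_torus L"
proof (rule L2_torus_dominated[OF _ _ L2_torusD(3)[OF u]])
 show "periodic L (%x. u x $ j)" using L2_torusD(1)[OF u] by (simp add: periodic_def)
 show "(%x. u x $ j) \<in> borel_measurable (torus L)"
  by (rule measurable_bounded_linear[OF bounded_linear_vec_nth L2_torusD(2)[OF u]])
 show "(norm (u x $ j))^2 \<le> (norm (u x))^2" for x
  by (intro power_mono Finite_Cartesian_Product.norm_nth_le) simp
qed

lemma L2_torus_vec:
 fixes u :: "real^3 \<Rightarrow> real^3"
 assumes u: "\<And>j. (%x. u x $ j) \<in> L2_torus L" shows "u \<in> L2_torus L"
proof (rule L2_torus_dominated)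
 show "periodic L u" using L2_torusD(1)[OF u] by (simp add: periodic_def vec_eq_iff)
 show "u \<in> borel_measurable (torus L)"
  using L2_torusD(2)[OF u] by (subst borel_measurable_euclidean_space) (auto simp: Basis_vec_def inner_axis)
 show "integrable (torus L) (%x. \<Sum>j\<in>UNIV. (norm (u x $ j))^2)"
  by (intro bochner_integrable_sum L2_torusD(3) u)
 show "(norm (u x))^2 \<le> (\<Sum>j\<in>UNIV. (norm (u x $ j))^2)" for x
  by (simp add: norm_vec_def L2_set_def sum_nonneg)
qed

lemma norm_square_components: "(norm (z :: complex^3))^2 = (\<Sum>j\<in>UNIV. (norm (z $ j))^2)"
 by (simp add: norm_vec_def L2_set_def sum_nonneg)

lemma ell2_components:
 fixes c :: "'k \<Rightarrow> complex^3"
 assumes "\<And>j. ell2 (%m. c m $ j)"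
 shows "ell2 c" "(ell2_norm c)^2 = (\<Sum>j\<in>UNIV. (ell2_norm (%m. c m $ j))^2)"
proof -
 note s = infsum_finite_sum[of UNIV "%j m. (norm (c m $ j))^2" UNIV]
 show "ell2 c" unfolding ell2_def norm_square_components
  by (rule s) (use assms in \<open>auto simp: ell2_def\<close>)
 show "(ell2_norm c)^2 = (\<Sum>j\<in>UNIV. (ell2_norm (%m. c m $ j))^2)"
  unfolding ell2_norm_square norm_square_components by (rule s) (use assms in \<open>auto simp: ell2_def\<close>)
qed

lemma ell2_component: "ell2 c \<Longrightarrow> ell2 (%m. (c m :: complex^3) $ j)"
 by (erule ell2_mono(1)) (rule Finite_Cartesian_Product.norm_nth_le)

lemma ell2_vcoef: "u \<in> L2_torus L \<Longrightarrow> ell2 (vcoef u)"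
 by (rule ell2_components(1)) (simp add: bessel(1)[OF L2_torus_nth])

lemma vcoef_minus: "vcoef u (- m) = vcnj (vcoef u m)"
 by (simp add: vec_eq_iff coef_minus)

lemma vcoef_diff:
 assumes "u \<in> L2_torus L" "v \<in> L2_torus L"
 shows "vcoef (%x. u x - v x) m = vcoef u m - vcoef v m"
 by (simp add: vec_eq_iff coef_linear[OF L2_torus_integrable[OF L2_torus_nth] L2_torus_integrable[OF L2_torus_nth]] assms)

lemma vcoef_zero [simp]: "vcoef (%x. 0) m = 0"
 by (simp add: vec_eq_iff coef_eq)

lemma vcoef_inject:
 assumes u: "u \<in> L2_torus L" and v: "v \<in> L2_torus L" and e: "\<And>m. vcoef u m = vcoef v m"
 shows "AE x in torus L. u x = v x"
proof -
 have "AE x in torus L. u x $ j = v x $ j" for j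
 proof (rule coef_inject)
  show "coef (%x. u x $ j) m = coef (%x. v x $ j) m" for m
   using e[of m] by (metis vcoef_nth)
 qed (intro L2_torus_integrable L2_torus_nth u v)+
 then have "AE x in torus L. \<forall>j\<in>UNIV. u x $ j = v x $ j" by (subst AE_finite_all) auto
 then show ?thesis by eventually_elim (simp add: vec_eq_iff)
qed

lemma vparseval:
 assumes u: "u \<in> L2_torus L" and v: "v \<in> L2_torus L"
 shows "((%m. vcoef u m \<bullet> vcoef v m) has_sum ((LINT x|torus L. u x \<bullet> v x) / L ^ 3)) UNIV"
proof -
 have "((%m. \<Sum>j\<in>UNIV. coef (%x. u x $ j) m \<bullet> coef (%x. v x $ j) m) has_sum
   (\<Sum>j\<in>UNIV. (LINT x|torus L. u x $ j * v x $ j) / L ^ 3)) UNIV"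
 proof -
  note p = parseval[OF L2_torus_nth[OF u] L2_torus_nth[OF v], unfolded has_sum_iff]
  note f = infsum_finite_sum[of UNIV "%j m. coef (%x. u x $ j) m \<bullet> coef (%x. v x $ j) m" UNIV]
  show ?thesis unfolding has_sum_iff
  proof
   show "(%m. \<Sum>j\<in>UNIV. coef (%x. u x $ j) m \<bullet> coef (%x. v x $ j) m) summable_on UNIV"
    by (rule f(1)) (simp_all add: p)
   show "(\<Sum>\<^sub>\<infinity>m. \<Sum>j\<in>UNIV. coef (%x. u x $ j) m \<bullet> coef (%x. v x $ j) m) =
     (\<Sum>j\<in>UNIV. (LINT x|torus L. u x $ j * v x $ j) / L ^ 3)"
    by (subst f(2)) (simp_all add: p)
  qed
 qed
 moreover have "(LINT x|torus L. u x \<bullet> v x) = (\<Sum>j\<in>UNIV. (LINT x|torus L. u x $ j * v x $ j))"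
  unfolding inner_vec_def by simp (intro bochner_integral_sum L2_torus_mult_integrable L2_torus_nth u v)
 ultimately show ?thesis by (simp add: inner_vec_def[of "vcoef u _"] sum_divide_distrib)
qed

definition vsyn :: "(int^3 \<Rightarrow> complex^3) \<Rightarrow> real^3 \<Rightarrow> real^3" where
 "vsyn c x = (\<chi> j. of_fourier L (%k. c (inv wn k) $ j) x)"

definition ssyn :: "(int^3 \<Rightarrow> complex) \<Rightarrow> real^3 \<Rightarrow> real" where
 "ssyn c = of_fourier L (%k. c (inv wn k))"

lemma inv_wn [simp]: "inv wn (wn m) = m"
 by (rule inv_f_f) (simp add: inj_on_def wn_inject)

lemma inv_wn_minus [simp]: "inv wn (- wn m) = - m"
 using inv_wn[of "- m"] by (simp del: inv_wn)

lemma ssyn_spec: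
 assumes "hermitian c" "ell2 c"
 shows "ssyn c \<in> L2_torus L" "coef (ssyn c) = c"
 using of_fourier_spec[of "%k. c (inv wn k)"] assms by (auto simp: ssyn_def hermitian_def)

lemma vsyn_spec:
 assumes "\<And>m. c (- m) = vcnj (c m)" "ell2 c"
 shows "vsyn c \<in> L2_torus L" "vcoef (vsyn c) = c"
proof -
 have s: "(%x. vsyn c x $ j) = ssyn (%m. c m $ j)" for j by (simp add: vsyn_def ssyn_def fun_eq_iff)
 have h: "hermitian (%m. c m $ j)" for j using assms(1) by (simp add: hermitian_def)
 note sp = ssyn_spec[OF h ell2_component[OF assms(2)]]
 show "vsyn c \<in> L2_torus L" by (rule L2_torus_vec) (simp only: s sp(1))
 show "vcoef (vsyn c) = c" by (simp add: fun_eq_iff vec_eq_iff s sp(2))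
qed

lemma wavenumber_sum:
 fixes g :: "real^3 \<Rightarrow> real"
 assumes "g 0 = 0"
 shows "g summable_on (wavenumbers L - {0}) \<longleftrightarrow> (%m. g (wn m)) summable_on UNIV"
  "infsum g (wavenumbers L - {0}) = (\<Sum>\<^sub>\<infinity>m. g (wn m))"
proof -
 have "g summable_on (wavenumbers L - {0}) \<longleftrightarrow> g summable_on (wavenumbers L)"
  by (rule summable_on_cong_neutral) (use assms in auto)
 then show "g summable_on (wavenumbers L - {0}) \<longleftrightarrow> (%m. g (wn m)) summable_on UNIV"
  using summable_on_reindex_bij_betw[OF wn_bij, of g] by simp
 have "infsum g (wavenumbers L - {0}) = infsum g (wavenumbers L)"
  by (rule infsum_cong_neutral) (use assms in auto)
 then show "infsum g (wavenumbers L - {0}) = (\<Sum>\<^sub>\<infinity>m. g (wn m))"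
  using infsum_reindex_bij_betw[OF wn_bij, of g] by simp
qed

text \<open>Since 0 powr s = 0, the weight at the zero mode is 0 for every s, even s = 0. Sums over
  nonzero wave numbers thus become sums over all modes.\<close>

definition ws :: "real \<Rightarrow> int^3 \<Rightarrow> real" where "ws s m = norm (wn m) powr s"

lemma ws_simps: "ws s 0 = 0" "ws s (- m) = ws s m" "ws 1 m = norm (wn m)" "ws 2 m = (norm (wn m))^2"
 "m \<noteq> 0 \<Longrightarrow> ws 0 m = 1" "m \<noteq> 0 \<Longrightarrow> ws (- 1) m = 1 / norm (wn m)" "ws s m \<ge> 0" "m \<noteq> 0 \<Longrightarrow> ws s m > 0"
 using norm_wn_pos[of m] by (auto simp: ws_def powr_minus_divide)

lemma norm_ws_square: "(norm (ws s m *\<^sub>R c))^2 = norm (wn m) powr (2 * s) * (norm c)^2"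
proof -
 have "2 * s = s + s" by simp
 then have "norm (wn m) powr (2 * s) = (ws s m)^2" by (simp only: ws_def powr_add power2_eq_square)
 then show ?thesis by (simp add: power_mult_distrib)
qed

lemma Hdist_norm_eq: "Hdist_norm L s c = ell2_norm (%m. ws s m *\<^sub>R c (wn m))"
 unfolding Hdist_norm_def ell2_norm_def norm_ws_square by (subst wavenumber_sum) simp_all

lemma Hfun_norm_eq: "Hfun_norm L s u = ell2_norm (%m. ws s m *\<^sub>R vcoef u m)"
 by (simp add: Hfun_norm_def Hdist_norm_eq vcoef_def)

lemma Hfun_norm_diff:
 assumes "u \<in> L2_torus L" "v \<in> L2_torus L"
 shows "Hfun_norm L s (%x. u x - v x) = ell2_norm (%m. ws s m *\<^sub>R (vcoef u m - vcoef v m))"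
 by (simp add: Hfun_norm_eq vcoef_diff[OF assms])

lemma ell2_from_weight:
 assumes s: "s \<ge> 0" and 0: "c 0 = 0" and e: "ell2 (%m. ws s m *\<^sub>R c m)"
 shows "ell2 c" "ell2_norm c \<le> (2 * pi / L) powr (- s) * ell2_norm (%m. ws s m *\<^sub>R c m)"
proof -
 let ?C = "(2 * pi / L) powr (- s)"
 have le: "norm (c m) \<le> norm (?C *\<^sub>R (ws s m *\<^sub>R c m))" for m
 proof (cases "m = 0")
  case False
  have p: "2 * pi / L > 0" using L by simp
  have "(2 * pi / L) powr s \<le> ws s m"
   unfolding ws_def by (rule powr_mono2[OF s _ norm_wn_ge[OF False]]) (use p in auto)
  then have "?C * (2 * pi / L) powr s \<le> ?C * ws s m" by (intro mult_left_mono) auto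
  moreover have "?C * (2 * pi / L) powr s = 1" unfolding powr_add[symmetric] using p L by simp
  ultimately have "1 \<le> ?C * ws s m" by (simp only:)
  then have "1 * norm (c m) \<le> (?C * ws s m) * norm (c m)" by (intro mult_right_mono) auto
  then show ?thesis using ws_simps(7)[of s m] by (simp add: mult.assoc)
 qed (simp add: 0)
 note e2 = ell2_scaleR(1)[OF e, of ?C]
 show "ell2 c" by (rule ell2_mono(1)[OF e2 le])
 have "ell2_norm c \<le> ell2_norm (%m. ?C *\<^sub>R (ws s m *\<^sub>R c m))" by (rule ell2_mono(2)[OF e2 le])
 then show "ell2_norm c \<le> ?C * ell2_norm (%m. ws s m *\<^sub>R c m)"
  by (simp only: ell2_scaleR(2)) simp
qed

text \<open>The inhomogeneous H^1 weight: test fields may have nonzero mean, and it controls the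
  zero mode too.\<close>

definition sw :: "int^3 \<Rightarrow> real" where "sw m = sqrt (1 + (norm (wn m))^2)"

lemma sw_simps: "sw (- m) = sw m" "1 \<le> sw m" "norm (wn m) \<le> sw m" "(sw m)^2 = 1 + (norm (wn m))^2"
proof -
 have p: "0 \<le> 1 + (norm (wn m))^2" by (intro add_nonneg_nonneg) auto
 show "sw (- m) = sw m" "1 \<le> sw m" by (simp_all add: sw_def)
 show "(sw m)^2 = 1 + (norm (wn m))^2" using p by (simp add: sw_def)
 show "norm (wn m) \<le> sw m" unfolding sw_def by (rule real_le_rsqrt) simp
qed

lemma Sobolev1_iff: "u \<in> Sobolev1 L \<longleftrightarrow> u \<in> L2_torus L \<and> ell2 (%m. sw m *\<^sub>R coef u m)"
 and Sobolev1_norm_eq: "Sobolev1_norm L u = ell2_norm (%m. sw m *\<^sub>R coef u m)"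
proof -
 let ?g = "%k. (1 + (norm k)^2) * (norm (fourier L u k))^2"
 have e: "(norm (sw m *\<^sub>R coef u m))^2 = ?g (wn m)" for m
  by (simp only: norm_scaleR power_mult_distrib power2_abs sw_simps(4) coef_def)
 show "u \<in> Sobolev1 L \<longleftrightarrow> u \<in> L2_torus L \<and> ell2 (%m. sw m *\<^sub>R coef u m)"
  unfolding Sobolev1_def ell2_def e using summable_on_reindex_bij_betw[OF wn_bij, of ?g] by simp
 show "Sobolev1_norm L u = ell2_norm (%m. sw m *\<^sub>R coef u m)"
  unfolding Sobolev1_norm_def ell2_norm_def e using infsum_reindex_bij_betw[OF wn_bij, of ?g] by simp
qed

lemma Sobolev1_norm_diff:
 assumes "u \<in> L2_torus L" "v \<in> L2_torus L"
 shows "Sobolev1_norm L (%x. u x - v x) = ell2_norm (%m. sw m *\<^sub>R (coef u m - coef v m))"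
 by (simp add: Sobolev1_norm_eq coef_linear[OF L2_torus_integrable[OF assms(1)] L2_torus_integrable[OF assms(2)]])

lemma ell2_from_sw:
 assumes e: "ell2 (%m. sw m *\<^sub>R c m)" shows "ell2 c" "ell2_norm c \<le> ell2_norm (%m. sw m *\<^sub>R c m)"
  "ell2 (%m. norm (wn m) *\<^sub>R c m)" "ell2_norm (%m. norm (wn m) *\<^sub>R c m) \<le> ell2_norm (%m. sw m *\<^sub>R c m)"
proof -
 have "norm (c m) \<le> norm (sw m *\<^sub>R c m)" for m
  using mult_right_mono[OF sw_simps(2)[of m], of "norm (c m)"] sw_simps(2)[of m] by simp
 from ell2_mono[OF e this] show "ell2 c" "ell2_norm c \<le> ell2_norm (%m. sw m *\<^sub>R c m)" .
 have "norm (norm (wn m) *\<^sub>R c m) \<le> norm (sw m *\<^sub>R c m)" for m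
  using mult_right_mono[OF sw_simps(3)[of m], of "norm (c m)"] sw_simps(2)[of m] by simp
 from ell2_mono[OF e this] show "ell2 (%m. norm (wn m) *\<^sub>R c m)"
  "ell2_norm (%m. norm (wn m) *\<^sub>R c m) \<le> ell2_norm (%m. sw m *\<^sub>R c m)" .
qed

text \<open>The projection averages a family with the conjugate of its reflection; reality is the
  only constraint on a scalar field.\<close>

lemma Sobolev1_L2_time:
 fixes c :: "int^3 \<Rightarrow> real \<Rightarrow> complex"
 assumes meas: "\<And>k. c k \<in> borel_measurable (Leb T)"
  and adm: "AE t in Leb T. hermitian (slice c t) \<and> ell2 (%k. sw k *\<^sub>R c k t)"
  and int: "integrable (Leb T) (%t. (ell2_norm (%k. sw k *\<^sub>R c k t))^2)"
 shows "(%t. ssyn (slice c t)) \<in> L2_time T (Sobolev1 L) (Sobolev1_norm L)"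
proof (rule L2_time_from_coefficients[where J=uminus and K=1 and Adm=hermitian and q=sw and
  Q="%a k. (1/2) *\<^sub>R (a k + cnj (a (- k)))", OF meas adm int])
 fix a b :: "int^3 \<Rightarrow> complex"
 assume a: "hermitian a" "ell2 (%k. sw k *\<^sub>R a k)"
 note sa = ssyn_spec[OF a(1) ell2_from_sw(1)[OF a(2)]]
 show "ssyn a \<in> Sobolev1 L" using sa a by (simp add: Sobolev1_iff)
 show "Sobolev1_norm L (ssyn a) = ell2_norm (%k. sw k *\<^sub>R a k)" using sa by (simp add: Sobolev1_norm_eq)
 assume b: "hermitian b" "ell2 (%k. sw k *\<^sub>R b k)"
 note sb = ssyn_spec[OF b(1) ell2_from_sw(1)[OF b(2)]]
 show "Sobolev1_norm L (%x. ssyn a x - ssyn b x) = ell2_norm (%k. sw k *\<^sub>R (a k - b k))"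
  using sa sb by (simp add: Sobolev1_norm_diff)
next
 fix a :: "int^3 \<Rightarrow> complex"
 show "hermitian (%k. (1/2) *\<^sub>R (a k + cnj (a (- k))))" by (simp add: hermitian_def add.commute)
next
 fix a b :: "int^3 \<Rightarrow> complex" and k
 assume "hermitian b"
 then have "cnj (b (- k)) = b k" by (simp add: hermitian_def)
 then have "(1/2) *\<^sub>R (a k + cnj (a (- k))) - b k = (1/2) *\<^sub>R ((a k - b k) + cnj (a (- k) - b (- k)))"
  by (simp add: scaleR_conv_of_real algebra_simps)
 moreover have "norm ((a k - b k) + cnj (a (- k) - b (- k))) \<le> norm (a k - b k) + norm (a (- k) - b (- k))"
  by (metis complex_mod_cnj norm_triangle_ineq)
 moreover have "norm ((1/2) *\<^sub>R ((a k - b k) + cnj (a (- k) - b (- k)))) \<le> norm ((a k - b k) + cnj (a (- k) - b (- k)))"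
  by (simp only: norm_scaleR) simp
 ultimately show "norm ((1/2) *\<^sub>R (a k + cnj (a (- k))) - b k) \<le> 1 * (norm (a k - b k) + norm (a (- k) - b (- k)))"
  by (simp only: mult_1)
qed (simp_all add: hermitian_def sw_simps)

end

context torus_model
begin

lemma vcnj_vcnj [simp]: "vcnj (vcnj z) = z" by (simp add: vec_eq_iff)

lemma vcnj_linear: "vcnj (a + b) = vcnj a + vcnj b" "vcnj (a - b) = vcnj a - vcnj b" "vcnj (r *\<^sub>R a) = r *\<^sub>R vcnj a" "vcnj 0 = 0"
 by (simp_all add: vec_eq_iff)

lemma cdot_eq: "(\<Sum>j\<in>UNIV. of_real (x $ j) * z $ j) = cdot x z" by (simp add: cdot_def)

lemma Hdist_iff: "c \<in> Hdist L s \<longleftrightarrow> real_field (%m. c (wn m)) \<and> ell2 (%m. ws s m *\<^sub>R c (wn m))"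
 unfolding Hdist_def real_field_def ell2_def norm_ws_square wavenumbers_eq[symmetric] cdot_eq
 by (subst wavenumber_sum(1)) (auto simp: wavenumbers_eq vec_eq_iff)

lemma Hfun_iff: "u \<in> Hfun L s \<longleftrightarrow> u \<in> L2_torus L \<and> real_field (vcoef u) \<and> ell2 (%m. ws s m *\<^sub>R vcoef u m)"
 by (simp add: Hfun_def Hdist_iff vcoef_def[symmetric])

lemma real_fieldD: "real_field c \<Longrightarrow> c 0 = 0" "real_field c \<Longrightarrow> c (- k) = vcnj (c k)" "real_field c \<Longrightarrow> cdot (wn k) (c k) = 0"
 by (simp_all add: real_field_def)

lemma ws1_h1w: "(%m. ws 1 m *\<^sub>R c m) = h1w c" by (simp add: h1w_def ws_simps fun_eq_iff)
lemma ws2_lam: "ws 2 = lam" by (simp add: fun_eq_iff ws_simps lam_def)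
lemma ws0: "c 0 = (0 :: complex^3) \<Longrightarrow> (%m. ws 0 m *\<^sub>R c m) = c"
proof
 fix m show "c 0 = 0 \<Longrightarrow> ws 0 m *\<^sub>R c m = c m" by (cases "m = 0") (simp_all add: ws_simps)
qed

lemma Hfun1_iff: "u \<in> Hfun L 1 \<longleftrightarrow> u \<in> L2_torus L \<and> real_field (vcoef u) \<and> h1 (vcoef u)"
 unfolding Hfun_iff ws1_h1w h1_def by (auto simp: real_field_def)

text \<open>The projection restores reality by averaging, then zero divergence by
  \<open>leray\<close>, which commutes with the reflection, and sets the mean to zero.\<close>

lemma Hfun_L2_time:
 fixes c :: "int^3 \<Rightarrow> real \<Rightarrow> complex^3"
 assumes meas: "\<And>k. c k \<in> borel_measurable (Leb T)" and s: "s \<ge> 0"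
  and adm: "AE t in Leb T. real_field (slice c t) \<and> ell2 (%k. ws s k *\<^sub>R c k t)"
  and int: "integrable (Leb T) (%t. (ell2_norm (%k. ws s k *\<^sub>R c k t))^2)"
 shows "(%t. vsyn (slice c t)) \<in> L2_time T (Hfun L s) (Hfun_norm L s)"
proof (rule L2_time_from_coefficients[where J=uminus and K=2 and Adm=real_field and q="ws s" and
  Q="%a k. if k = 0 then 0 else leray (wn k) ((1/2) *\<^sub>R (a k + vcnj (a (- k))))", OF meas adm int])
 fix a b :: "int^3 \<Rightarrow> complex^3"
 assume a: "real_field a" "ell2 (%k. ws s k *\<^sub>R a k)"
 note sa = vsyn_spec[OF real_fieldD(2)[OF a(1)] ell2_from_weight(1)[OF s real_fieldD(1)[OF a(1)] a(2)]]
 show "vsyn a \<in> Hfun L s" using sa a by (simp add: Hfun_iff)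
 show "Hfun_norm L s (vsyn a) = ell2_norm (%k. ws s k *\<^sub>R a k)" using sa by (simp add: Hfun_norm_eq)
 assume b: "real_field b" "ell2 (%k. ws s k *\<^sub>R b k)"
 note sb = vsyn_spec[OF real_fieldD(2)[OF b(1)] ell2_from_weight(1)[OF s real_fieldD(1)[OF b(1)] b(2)]]
 show "Hfun_norm L s (%x. vsyn a x - vsyn b x) = ell2_norm (%k. ws s k *\<^sub>R (a k - b k))"
  using sa sb by (simp add: Hfun_norm_diff)
next
 fix a :: "int^3 \<Rightarrow> complex^3"
 let ?Q = "%k. if k = 0 then 0 else leray (wn k) ((1/2) *\<^sub>R (a k + vcnj (a (- k))))"
 have "?Q (- k) = vcnj (?Q k)" for k
 proof (cases "k = 0")
  case False
  have "(1/2) *\<^sub>R (a (- k) + vcnj (a k)) = vcnj ((1/2) *\<^sub>R (a k + vcnj (a (- k))))"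
   by (simp add: vcnj_linear add.commute)
  then show ?thesis using False by (simp add: leray_vcnj)
 qed (simp add: vcnj_linear)
 then show "real_field ?Q" by (simp add: real_field_def cdot_leray cdot_linear)
next
 fix a b :: "int^3 \<Rightarrow> complex^3" and k
 assume b: "real_field b"
 show "norm ((if k = 0 then 0 else leray (wn k) ((1/2) *\<^sub>R (a k + vcnj (a (- k))))) - b k)
   \<le> 2 * (norm (a k - b k) + norm (a (- k) - b (- k)))"
 proof (cases "k = 0")
  case False
  have "vcnj (b (- k)) = b k" using real_fieldD(2)[OF b, of k] by simp
  then have e: "(1/2) *\<^sub>R (a k + vcnj (a (- k))) - b k = (1/2) *\<^sub>R ((a k - b k) + vcnj (a (- k) - b (- k)))"
  proof -
   have "(1/2) *\<^sub>R ((x - z) + (y - z)) = (1/2) *\<^sub>R (x + y) - (1/2) *\<^sub>R (z + z)" for x y z :: "complex^3"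
    by (simp add: scaleR_add_right scaleR_diff_right)
   then show ?thesis using \<open>vcnj (b (- k)) = b k\<close> by (simp only: vcnj_linear scaleR_half_double)
  qed
  have "leray (wn k) ((1/2) *\<^sub>R (a k + vcnj (a (- k)))) - b k = leray (wn k) ((1/2) *\<^sub>R (a k + vcnj (a (- k))) - b k)"
   by (simp only: leray_linear leray_id[OF real_fieldD(3)[OF b]])
  also have "norm \<dots> \<le> 2 * norm ((1/2) *\<^sub>R ((a k - b k) + vcnj (a (- k) - b (- k))))"
   unfolding e by (rule norm_leray)
  also have "\<dots> \<le> norm (a k - b k) + norm (vcnj (a (- k) - b (- k)))"
   using norm_triangle_ineq[of "a k - b k" "vcnj (a (- k) - b (- k))"] by simp
  also have "\<dots> \<le> 2 * (norm (a k - b k) + norm (vcnj (a (- k) - b (- k))))" by simp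
  finally show ?thesis using False by (simp only: norm_vcnj if_False)
 qed (simp add: real_fieldD(1)[OF b])
qed (simp_all add: real_field_def ws_simps cdot_linear vcnj_linear)

end

section \<open>The weak form in terms of coefficients\<close>

lemma has_sum_finite_sum:
 fixes f :: "'i \<Rightarrow> 'k \<Rightarrow> real"
 assumes "finite I" "\<And>i. i \<in> I \<Longrightarrow> (f i has_sum x i) A"
 shows "((%k. \<Sum>i\<in>I. f i k) has_sum (\<Sum>i\<in>I. x i)) A"
proof -
 have s: "f i summable_on A" "infsum (f i) A = x i" if "i \<in> I" for i
  using assms(2)[OF that] by (auto simp: has_sum_iff)
 note f = infsum_finite_sum[of I f A, OF assms(1) s(1)]
 show ?thesis unfolding has_sum_iff using f s(2) by simp
qed

lemma scaleR_complex_nth: "(r *\<^sub>R (z :: complex^3)) $ i = of_real r * (z $ i)"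
 unfolding vector_scaleR_component by (rule scaleR_conv_of_real)

lemma inner_mult_of_real: "z \<bullet> (\<i> * of_real r * y) = - r * ((\<i> * z) \<bullet> (y :: complex))"
 "(\<i> * of_real r * z) \<bullet> (\<i> * of_real r * y) = r^2 * (z \<bullet> (y :: complex))"
 by (simp_all add: inner_complex_def algebra_simps power2_eq_square)

context torus_model
begin

lemma vgrad_coef:
 assumes e: "ell2 (%m. norm (wn m) *\<^sub>R vcoef u m)"
 shows "(%x. vgrad L u x $ i) \<in> L2_torus L"
  "vcoef (%x. vgrad L u x $ i) m = (\<chi> j. \<i> * of_real (wn m $ j) * vcoef u m $ i)"
proof -
 have eq: "(%x. vgrad L u x $ i $ j) = multiplier L (%k. \<i> * of_real (k $ j)) (%y. u y $ i)" for j
  by (simp add: vgrad_def grad_def partial_deriv_def fun_eq_iff)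
 have e': "ell2 (%m. \<i> * of_real (wn m $ j) * coef (%y. u y $ i) m)" for j
 proof (rule ell2_mono(1)[OF e])
  fix m
  have "norm (\<i> * of_real (wn m $ j) * coef (%y. u y $ i) m) = \<bar>wn m $ j\<bar> * norm (vcoef u m $ i)"
   by (simp add: norm_mult)
  also have "\<dots> \<le> norm (wn m) * norm (vcoef u m)"
   by (intro mult_mono component_le_norm_cart Finite_Cartesian_Product.norm_nth_le) auto
  finally show "norm (\<i> * of_real (wn m $ j) * coef (%y. u y $ i) m) \<le> norm (norm (wn m) *\<^sub>R vcoef u m)" by simp
 qed
 note sp = multiplier_spec[of "%k. \<i> * of_real (k $ _)", OF _ e']
 show "(%x. vgrad L u x $ i) \<in> L2_torus L" by (rule L2_torus_vec) (unfold eq, rule sp, simp)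
 show "vcoef (%x. vgrad L u x $ i) m = (\<chi> j. \<i> * of_real (wn m $ j) * vcoef u m $ i)"
  unfolding vec_eq_iff vcoef_nth eq by (subst sp(2)) simp_all
qed

lemma grad_coef:
 assumes e: "ell2 (%m. norm (wn m) *\<^sub>R coef q m)"
 shows "grad L q \<in> L2_torus L" "vcoef (grad L q) m = (\<chi> j. \<i> * of_real (wn m $ j) * coef q m)"
proof -
 have eq: "(%x. grad L q x $ j) = multiplier L (%k. \<i> * of_real (k $ j)) q" for j
  by (simp add: grad_def partial_deriv_def fun_eq_iff)
 have e': "ell2 (%m. \<i> * of_real (wn m $ j) * coef q m)" for j
 proof (rule ell2_mono(1)[OF e])
  fix m
  show "norm (\<i> * of_real (wn m $ j) * coef q m) \<le> norm (norm (wn m) *\<^sub>R coef q m)"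
   using mult_right_mono[OF component_le_norm_cart[of "wn m" j], of "norm (coef q m)"] by (simp add: norm_mult)
 qed
 note sp = multiplier_spec[of "%k. \<i> * of_real (k $ _)", OF _ e']
 show "grad L q \<in> L2_torus L" by (rule L2_torus_vec) (unfold eq, rule sp, simp)
 show "vcoef (grad L q) m = (\<chi> j. \<i> * of_real (wn m $ j) * coef q m)"
  unfolding vec_eq_iff vcoef_nth eq by (subst sp(2)) simp_all
qed

lemma deconv_coef:
 assumes u: "u \<in> L2_torus L"
 shows "deconv L \<alpha> N u \<in> L2_torus L" "coef (%x. deconv L \<alpha> N u x $ i) m = dec (vcoef u) i m"
proof -
 have eq: "(%x. deconv L \<alpha> N u x $ i) = multiplier L (%k. of_real (deconv_symbol \<alpha> N k)) (%y. u y $ i)" for i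
  by (simp add: deconv_def fun_eq_iff)
 have e': "ell2 (%m. of_real (deconv_symbol \<alpha> N (wn m)) * coef (%y. u y $ i) m)" for i
 proof (rule ell2_mono(1)[OF ell2_scaleR(1)[OF bessel(1)[OF L2_torus_nth[OF u, of i]], of "real N + 1"]])
  fix m
  show "norm (of_real (deconv_symbol \<alpha> N (wn m)) * coef (%y. u y $ i) m) \<le> norm ((real N + 1) *\<^sub>R coef (%y. u y $ i) m)"
   using mult_right_mono[OF deconv_symbol_bounds(2)[of \<alpha> N "wn m"], of "norm (coef (%y. u y $ i) m)"]
    deconv_symbol_bounds(1)[of \<alpha> N "wn m"] by (simp add: norm_mult)
 qed
 note sp = multiplier_spec[of "%k. of_real (deconv_symbol \<alpha> N k)", OF _ e']
 show "deconv L \<alpha> N u \<in> L2_torus L" by (rule L2_torus_vec) (unfold eq, rule sp, simp add: deconv_symbol_bounds(3))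
 show "coef (%x. deconv L \<alpha> N u x $ i) m = dec (vcoef u) i m"
  unfolding eq by (subst sp(2)) (simp_all add: dec_def scaleR_conv_of_real deconv_symbol_bounds(3))
qed

lemma filter_symbol_gsym: "filter_symbol \<alpha> (wn m) = gsym m"
 by (simp add: filter_symbol_def gsym_def lam_def)

text \<open>The tensor has products of square integrable functions as entries. That its filtered
  version is again square integrable comes from the coefficients: the convolution of two H_1
  families is square summable.\<close>

lemma tfilter_coef:
 assumes u: "u \<in> Hfun L 1"
 defines "A \<equiv> tfilter L \<alpha> (tensor (deconv L \<alpha> N u) (deconv L \<alpha> N u))"
 shows "(%x. A x $ i) \<in> L2_torus L"
  "vcoef (%x. A x $ i) m = (\<chi> j. of_real (gsym m) * tens (vcoef u) (vcoef u) i j m)"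
proof -
 let ?d = "deconv L \<alpha> N u"
 have u2: "u \<in> L2_torus L" and h: "h1 (vcoef u)" using u by (auto simp: Hfun1_iff)
 have eq: "(%x. A x $ i $ j) = multiplier L (%k. of_real (filter_symbol \<alpha> k)) (%y. ?d y $ i * ?d y $ j)" for j
  by (simp add: A_def tfilter_def gfilter_def tensor_def fun_eq_iff)
 have cp: "coef (%y. ?d y $ i * ?d y $ j) m = tens (vcoef u) (vcoef u) i j m" for j m
  using coef_product[OF L2_torus_nth[OF deconv_coef(1)[OF u2]] L2_torus_nth[OF deconv_coef(1)[OF u2]], of i j m]
  by (simp add: deconv_coef(2)[OF u2] tens_def conv_def)
 have e': "ell2 (%m. of_real (filter_symbol \<alpha> (wn m)) * coef (%y. ?d y $ i * ?d y $ j) m)" for j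
 proof (rule ell2_mono(1)[OF tens_ell2(1)[OF h h, of i j]])
  fix m
  show "norm (of_real (filter_symbol \<alpha> (wn m)) * coef (%y. ?d y $ i * ?d y $ j) m) \<le> norm (tens (vcoef u) (vcoef u) i j m)"
   using mult_right_mono[OF gsym_le[of m], of "norm (tens (vcoef u) (vcoef u) i j m)"] gsym_pos[of m]
   by (simp add: norm_mult cp filter_symbol_gsym)
 qed
 note sp = multiplier_spec[of "%k. of_real (filter_symbol \<alpha> k)", OF _ e']
 have cj: "of_real (filter_symbol \<alpha> (wn (- m))) = cnj (of_real (filter_symbol \<alpha> (wn m)))" for m
  by (simp add: filter_symbol_def)
 show "(%x. A x $ i) \<in> L2_torus L" by (rule L2_torus_vec) (unfold eq, rule sp, rule cj)
 show "vcoef (%x. A x $ i) m = (\<chi> j. of_real (gsym m) * tens (vcoef u) (vcoef u) i j m)"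
  unfolding vec_eq_iff vcoef_nth eq by (subst sp(2)[OF cj]) (simp_all add: cp filter_symbol_gsym)
qed

text \<open>By 2 a <= a^2 + 1 with a = \<alpha> |k|, the filter gains one derivative at the price 1
  / \<alpha>. It takes the force from H_{-1} to H_0 and the initial datum from H_0 to H_1.\<close>

lemma gsym_ws: assumes "m \<noteq> 0" shows "gsym m \<le> 1 / \<alpha> * ws (- 1) m"
proof -
 let ?n = "norm (wn m)"
 have n: "?n > 0" using norm_wn_pos[OF assms] .
 have p: "1 + \<alpha>^2 * ?n^2 > 0" by (intro add_pos_nonneg) auto
 have "2 * (\<alpha> * ?n) * 1 \<le> (\<alpha> * ?n)^2 + 1^2" by (rule sum_squares_bound)
 moreover have "\<alpha> * ?n > 0" using n params by simp
 ultimately have "\<alpha> * ?n \<le> 1 + \<alpha>^2 * ?n^2" by (simp add: power_mult_distrib)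
 then have "1 / (1 + \<alpha>^2 * ?n^2) \<le> 1 / (\<alpha> * ?n)" using \<open>\<alpha> * ?n > 0\<close> p by (intro divide_left_mono) auto
 then show ?thesis using assms by (simp add: gsym_def lam_def ws_simps)
qed

lemma filtered_ell2:
 assumes c: "c \<in> Hdist L (- 1)"
 shows "ell2 (%m. gsym m *\<^sub>R c (wn m))" "ell2_norm (%m. gsym m *\<^sub>R c (wn m)) \<le> 1 / \<alpha> * Hdist_norm L (- 1) c"
proof -
 have e: "ell2 (%m. (1 / \<alpha>) *\<^sub>R (ws (- 1) m *\<^sub>R c (wn m)))" using c by (intro ell2_scaleR) (simp add: Hdist_iff)
 have c0: "c 0 = 0" using c by (auto simp: Hdist_def)
 have le: "norm (gsym m *\<^sub>R c (wn m)) \<le> norm ((1 / \<alpha>) *\<^sub>R (ws (- 1) m *\<^sub>R c (wn m)))" for m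
 proof (cases "m = 0")
  case False
  have "norm (gsym m *\<^sub>R c (wn m)) = gsym m * norm (c (wn m))" using gsym_pos[of m] by simp
  also have "\<dots> \<le> (1 / \<alpha> * ws (- 1) m) * norm (c (wn m))" by (intro mult_right_mono gsym_ws False) simp
  also have "\<dots> = norm ((1 / \<alpha>) *\<^sub>R (ws (- 1) m *\<^sub>R c (wn m)))"
   using params ws_simps(7)[of "-1" m] by simp
  finally show ?thesis .
 qed (simp add: c0)
 show "ell2 (%m. gsym m *\<^sub>R c (wn m))" by (rule ell2_mono(1)[OF e le])
 have "ell2_norm (%m. gsym m *\<^sub>R c (wn m)) \<le> ell2_norm (%m. (1 / \<alpha>) *\<^sub>R (ws (- 1) m *\<^sub>R c (wn m)))"
  by (rule ell2_mono(2)[OF e le])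
 then show "ell2_norm (%m. gsym m *\<^sub>R c (wn m)) \<le> 1 / \<alpha> * Hdist_norm L (- 1) c"
  unfolding ell2_scaleR(2) Hdist_norm_eq using params by simp
qed

lemma filtered_real_field:
 assumes "real_field (%m. c (wn m))" shows "real_field (%m. gsym m *\<^sub>R c (wn m))"
 using assms by (simp add: real_field_def cdot_linear vcnj_linear)

lemma dfilter_coef:
 assumes c: "c \<in> Hdist L (- 1)"
 shows "dfilter L \<alpha> c \<in> L2_torus L" "vcoef (dfilter L \<alpha> c) m = gsym m *\<^sub>R c (wn m)"
proof -
 have eq: "(%x. dfilter L \<alpha> c x $ i) = of_fourier L (%k. of_real (filter_symbol \<alpha> k) * c k $ i)" for i
  by (simp add: dfilter_def fun_eq_iff)
 have e': "ell2 (%m. of_real (filter_symbol \<alpha> (wn m)) * c (wn m) $ i)" for i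
  using ell2_component[OF filtered_ell2(1)[OF c], of i]
  unfolding filter_symbol_gsym scaleR_complex_nth .
 have "c (wn (- m)) = vcnj (c (wn m))" for m using c unfolding Hdist_iff by (blast dest: real_fieldD(2))
 then have cj: "of_real (filter_symbol \<alpha> (wn (- m))) * c (wn (- m)) $ i = cnj (of_real (filter_symbol \<alpha> (wn m)) * c (wn m) $ i)" for m i
  by (simp add: filter_symbol_def)
 note sp = of_fourier_spec[of "%k. of_real (filter_symbol \<alpha> k) * c k $ _", OF cj e']
 show "dfilter L \<alpha> c \<in> L2_torus L" by (rule L2_torus_vec) (unfold eq, rule sp)
 show "vcoef (dfilter L \<alpha> c) m = gsym m *\<^sub>R c (wn m)"
  unfolding vec_eq_iff vcoef_nth eq sp(2) filter_symbol_gsym scaleR_complex_nth by simp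
qed

lemma matrix_parseval:
 fixes A B :: "real^3 \<Rightarrow> real^3^3"
 assumes A: "\<And>i. (%x. A x $ i) \<in> L2_torus L" and B: "\<And>i. (%x. B x $ i) \<in> L2_torus L"
 shows "((%m. \<Sum>i\<in>UNIV. vcoef (%x. A x $ i) m \<bullet> vcoef (%x. B x $ i) m) has_sum ((LINT x|torus L. A x \<bullet> B x) / L ^ 3)) UNIV"
proof -
 have "((%m. \<Sum>i\<in>UNIV. vcoef (%x. A x $ i) m \<bullet> vcoef (%x. B x $ i) m) has_sum
   (\<Sum>i\<in>UNIV. (LINT x|torus L. A x $ i \<bullet> B x $ i) / L ^ 3)) UNIV"
  by (rule has_sum_finite_sum) (simp_all add: vparseval A B del: vcoef_nth)
 moreover have "(LINT x|torus L. A x \<bullet> B x) = (\<Sum>i\<in>UNIV. (LINT x|torus L. A x $ i \<bullet> B x $ i))"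
  unfolding inner_vec_def[of "A _"] by (rule bochner_integral_sum) (rule L2_torus_inner_integrable[OF A B])
 ultimately show ?thesis by (simp only: sum_divide_distrib)
qed

text \<open>Integration by parts on coefficients: the factor i k_j moves from the test field to the
  tensor and changes the sign.\<close>

lemma flux_pairing:
 assumes u: "u \<in> Hfun L 1" and v: "v \<in> L2_torus L" "ell2 (%m. norm (wn m) *\<^sub>R vcoef v m)"
 shows "((%m. - (flux (vcoef u) (vcoef u) m \<bullet> vcoef v m)) has_sum
  ((LINT x|torus L. tfilter L \<alpha> (tensor (deconv L \<alpha> N u) (deconv L \<alpha> N u)) x \<bullet> vgrad L v x) / L ^ 3)) UNIV"
proof -
 have "(\<Sum>i\<in>UNIV. vcoef (%x. tfilter L \<alpha> (tensor (deconv L \<alpha> N u) (deconv L \<alpha> N u)) x $ i) m \<bullet> vcoef (%x. vgrad L v x $ i) m)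
   = - (flux (vcoef u) (vcoef u) m \<bullet> vcoef v m)" for m
 proof -
  let ?t = "%i j. tens (vcoef u) (vcoef u) i j m"
  have l: "(\<Sum>i\<in>UNIV. vcoef (%x. tfilter L \<alpha> (tensor (deconv L \<alpha> N u) (deconv L \<alpha> N u)) x $ i) m \<bullet> vcoef (%x. vgrad L v x $ i) m)
   = (\<Sum>i\<in>UNIV. \<Sum>j\<in>UNIV. - (gsym m * (wn m $ j * ((\<i> * ?t i j) \<bullet> vcoef v m $ i))))"
   unfolding tfilter_coef(2)[OF u] vgrad_coef(2)[OF v(2)]
   by (simp add: inner_vec_def inner_mult_of_real(1) inner_complex_of_real mult.left_commute[of \<i>] del: vcoef_nth)
     (simp add: mult.left_commute)
  have "(of_real (gsym m) * (\<Sum>j\<in>UNIV. \<i> * of_real (wn m $ j) * ?t i j)) \<bullet> vcoef v m $ i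
    = (\<Sum>j\<in>UNIV. gsym m * (wn m $ j * ((\<i> * ?t i j) \<bullet> vcoef v m $ i)))" for i
  proof -
   have "(\<i> * of_real (wn m $ j) * ?t i j) = of_real (wn m $ j) * (\<i> * ?t i j)" for j by (simp only: mult_ac)
   then show ?thesis by (simp only: inner_complex_of_real inner_sum_left sum_distrib_left)
  qed
  then show ?thesis unfolding l by (simp add: flux_def inner_vec_def sum_negf del: vcoef_nth)
 qed
 then show ?thesis using matrix_parseval[OF tfilter_coef(1)[OF u] vgrad_coef(1)[OF v(2)]] by (simp only:)
qed

lemma gradient_pairing:
 assumes u: "ell2 (%m. norm (wn m) *\<^sub>R vcoef u m)" and v: "ell2 (%m. norm (wn m) *\<^sub>R vcoef v m)"
 shows "((%m. (lam m *\<^sub>R vcoef u m) \<bullet> vcoef v m) has_sum ((LINT x|torus L. vgrad L u x \<bullet> vgrad L v x) / L ^ 3)) UNIV"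
proof -
 have "(\<Sum>i\<in>UNIV. vcoef (%x. vgrad L u x $ i) m \<bullet> vcoef (%x. vgrad L v x $ i) m) = (lam m *\<^sub>R vcoef u m) \<bullet> vcoef v m" for m
 proof -
  have "vcoef (%x. vgrad L u x $ i) m \<bullet> vcoef (%x. vgrad L v x $ i) m = lam m * (vcoef u m $ i \<bullet> vcoef v m $ i)" for i
  proof -
   have "lam m = (\<Sum>j\<in>UNIV. (wn m $ j)^2)" by (simp add: lam_def norm_vec_def L2_set_def sum_nonneg)
   then show ?thesis
    unfolding vgrad_coef(2)[OF u] vgrad_coef(2)[OF v]
    by (simp add: inner_vec_def inner_mult_of_real(2) sum_distrib_right del: vcoef_nth)
  qed
  then have "(\<Sum>i\<in>UNIV. vcoef (%x. vgrad L u x $ i) m \<bullet> vcoef (%x. vgrad L v x $ i) m) = lam m * (\<Sum>i\<in>UNIV. vcoef u m $ i \<bullet> vcoef v m $ i)"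
   by (simp only: sum_distrib_left)
  then show ?thesis by (simp only: inner_scaleR_left inner_vec_def[of "vcoef u m"])
 qed
 then show ?thesis using matrix_parseval[OF vgrad_coef(1)[OF u] vgrad_coef(1)[OF v]] by (simp only:)
qed

text \<open>Parseval at almost every time, followed by the exchange of sum and time integral. The
  majorant \<open>g + r\<close> comes from Cauchy-Schwarz and 2 a b <= a^2 + b^2; measurability of
  \<open>h\<close> follows from that of the series it equals.\<close>

lemma time_pairing:
 fixes G V :: "int^3 \<Rightarrow> real \<Rightarrow> complex^3" and h :: "real \<Rightarrow> real"
 assumes G: "\<And>m. G m \<in> borel_measurable (Leb T)" and V: "\<And>m. V m \<in> borel_measurable (Leb T)"
  and g: "AE t in Leb T. ell2 (slice G t) \<and> (ell2_norm (slice G t))^2 \<le> g t" "integrable (Leb T) g"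
  and r: "AE t in Leb T. ell2 (slice V t) \<and> (ell2_norm (slice V t))^2 \<le> r t" "integrable (Leb T) r"
  and hs: "AE t in Leb T. ((%m. G m t \<bullet> V m t) has_sum (h t / L ^ 3)) UNIV"
 shows "integrable (Leb T) (%t. G m t \<bullet> V m t)"
  "((%m. LINT t|Leb T. G m t \<bullet> V m t) has_sum ((LINT t|Leb T. h t) / L ^ 3)) UNIV"
proof -
 let ?M = "Leb T"
 have L3: "L ^ 3 > 0" using L by simp
 have m: "(%t. G m t \<bullet> V m t) \<in> borel_measurable ?M" for m by (intro borel_measurable_inner G V)
 have dom: "AE t in ?M. (%m. \<bar>G m t \<bullet> V m t\<bar>) summable_on UNIV \<and> (\<Sum>\<^sub>\<infinity>m. \<bar>G m t \<bullet> V m t\<bar>) \<le> g t + r t"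
  using g(1) r(1)
 proof eventually_elim
  case (elim t)
  let ?a = "ell2_norm (slice G t)" and ?b = "ell2_norm (slice V t)"
  have "2 * ?a * ?b \<le> ?a^2 + ?b^2" by (rule sum_squares_bound)
  moreover have "0 \<le> ?a * ?b" by simp
  ultimately have "?a * ?b \<le> g t + r t" using elim by linarith
  then show ?case using ell2_inner[of "%m. G m t" "%m. V m t"] elim by auto
 qed
 note d = infsum_integral_dominated[OF m dom bochner_integrable_add[OF g(2) r(2)]]
 show "integrable ?M (%t. G m t \<bullet> V m t)" by (rule d(1))
 have ae: "AE t in ?M. L ^ 3 * (\<Sum>\<^sub>\<infinity>m. G m t \<bullet> V m t) = h t"
  using hs by eventually_elim (use L3 in \<open>auto simp: has_sum_iff\<close>)
 have m2: "(%t. L ^ 3 * (\<Sum>\<^sub>\<infinity>m. G m t \<bullet> V m t)) \<in> borel_measurable ?M"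
  by (intro borel_measurable_times measurable_infsum_real m) simp
 have "(LINT t|?M. h t) = (LINT t|?M. L ^ 3 * (\<Sum>\<^sub>\<infinity>m. G m t \<bullet> V m t))"
  by (rule integral_cong_AE) (use ae borel_measurable_AE_lebesgue_on[OF m2 ae] m2 in \<open>auto elim: eventually_mono\<close>)
 also have "\<dots> = L ^ 3 * (LINT t|?M. (\<Sum>\<^sub>\<infinity>m. G m t \<bullet> V m t))" by (rule integral_mult_right_zero)
 finally have "(LINT t|?M. h t) / L ^ 3 = (LINT t|?M. (\<Sum>\<^sub>\<infinity>m. G m t \<bullet> V m t))" using L3 by simp
 then show "((%m. LINT t|?M. G m t \<bullet> V m t) has_sum ((LINT t|?M. h t) / L ^ 3)) UNIV"
  using d(5) by simp
qed

end

lemma has_sum_subtract: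
 fixes f g :: "'k \<Rightarrow> real"
 assumes "(f has_sum a) A" "(g has_sum b) A" shows "((%k. f k - g k) has_sum (a - b)) A"
 using has_sum_add[OF assms(1) has_sum_cmult_right[OF assms(2), of "- 1"]] by simp

section \<open>Coefficients of time-dependent fields, and the residual of the equation\<close>

context torus_model
begin

abbreviation lT :: "real measure" where "lT \<equiv> Leb T"

abbreviation "L2_Hfun s \<equiv> L2_time T (Hfun L s) (Hfun_norm L s)"
abbreviation "C_Hfun1 \<equiv> C_time T (Hfun L 1) (Hfun_norm L 1)"
abbreviation "L2_Sobolev1 \<equiv> L2_time T (Sobolev1 L) (Sobolev1_norm L)"
abbreviation "L2_Hdist \<equiv> L2_time T (Hdist L (- 1)) (Hdist_norm L (- 1))"

abbreviation "weak_lhs w' w q v \<equiv> (LINT t|lT. LINT x|torus L. w' t x \<bullet> v t x)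
 - (LINT t|lT. LINT x|torus L.
 tfilter L \<alpha> (tensor (deconv L \<alpha> N (w t)) (deconv L \<alpha> N (w t))) x \<bullet> vgrad L (v t) x)
 + \<nu> * (LINT t|lT. LINT x|torus L. vgrad L (w t) x \<bullet> vgrad L (v t) x)
 + (LINT t|lT. LINT x|torus L. grad L (q t) x \<bullet> v t x)"

abbreviation "weak_rhs f v \<equiv> (LINT t|lT. LINT x|torus L. dfilter L \<alpha> (f t) x \<bullet> v t x)"

lemma Hfun_coef:
 assumes u: "u \<in> L2_Hfun s"
 shows "(%t. vcoef (u t) m) \<in> borel_measurable lT" "AE t in lT. u t \<in> Hfun L s"
  "integrable lT (%t. (ell2_norm (%m. ws s m *\<^sub>R vcoef (u t) m))^2)"
proof -
 show "(%t. vcoef (u t) m) \<in> borel_measurable lT"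
 proof (rule L2_time_functional_measurable[OF u])
  fix a b assume ab: "a \<in> Hfun L s" "b \<in> Hfun L s"
  show "norm (vcoef a m - vcoef b m) \<le> (1 / ws s m) * Hfun_norm L s (%x. a x - b x)"
  proof (cases "m = 0")
   case True
   then show ?thesis using ab by (simp add: Hfun_iff real_fieldD(1) ws_simps del: vcoef_nth)
  next
   case False
   have e: "ell2 (%m. ws s m *\<^sub>R (vcoef a m - vcoef b m))"
    unfolding scaleR_diff_right using ab by (intro ell2_diff) (auto simp: Hfun_iff)
   have "ws s m * norm (vcoef a m - vcoef b m) \<le> Hfun_norm L s (%x. a x - b x)"
    using ell2_component_le[OF e, of m] ab ws_simps(7)[of s m] by (simp add: Hfun_norm_diff Hfun_iff)
   then show ?thesis using ws_simps(8)[OF False, of s] by (simp add: field_simps)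
  qed
 qed
 show "AE t in lT. u t \<in> Hfun L s" "integrable lT (%t. (ell2_norm (%m. ws s m *\<^sub>R vcoef (u t) m))^2)"
  using u by (auto simp: L2_time_def Hfun_norm_eq)
qed

lemma Sobolev1_coef:
 assumes u: "u \<in> L2_Sobolev1"
 shows "(%t. coef (u t) m) \<in> borel_measurable lT" "AE t in lT. u t \<in> Sobolev1 L"
  "integrable lT (%t. (ell2_norm (%m. sw m *\<^sub>R coef (u t) m))^2)"
proof -
 show "(%t. coef (u t) m) \<in> borel_measurable lT"
 proof (rule L2_time_functional_measurable[OF u])
  fix a b assume ab: "a \<in> Sobolev1 L" "b \<in> Sobolev1 L"
  have e: "ell2 (%m. sw m *\<^sub>R (coef a m - coef b m))"
   unfolding scaleR_diff_right using ab by (intro ell2_diff) (auto simp: Sobolev1_iff)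
  have "1 * norm (coef a m - coef b m) \<le> sw m * norm (coef a m - coef b m)"
   by (intro mult_right_mono sw_simps) simp
  also have "\<dots> \<le> Sobolev1_norm L (%x. a x - b x)"
   using ell2_component_le[OF e, of m] ab sw_simps(2)[of m] by (simp add: Sobolev1_norm_diff Sobolev1_iff)
  finally show "norm (coef a m - coef b m) \<le> 1 * Sobolev1_norm L (%x. a x - b x)" by simp
 qed
 show "AE t in lT. u t \<in> Sobolev1 L" "integrable lT (%t. (ell2_norm (%m. sw m *\<^sub>R coef (u t) m))^2)"
  using u by (auto simp: L2_time_def Sobolev1_norm_eq)
qed

lemma force_coef:
 assumes f: "f \<in> L2_Hdist"
 shows "(%t. gsym m *\<^sub>R f t (wn m)) \<in> borel_measurable lT" "AE t in lT. f t \<in> Hdist L (- 1)"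
  "integrable lT (%t. (Hdist_norm L (- 1) (f t))^2)"
proof -
 have "(%t. f t (wn m)) \<in> borel_measurable lT"
 proof (rule L2_time_functional_measurable[OF f, where l="%c. c (wn m)"])
  fix a b assume ab: "a \<in> Hdist L (- 1)" "b \<in> Hdist L (- 1)"
  show "norm (a (wn m) - b (wn m)) \<le> (1 / ws (- 1) m) * Hdist_norm L (- 1) (%x. a x - b x)"
  proof (cases "m = 0")
   case True
   then show ?thesis using ab by (simp add: Hdist_def ws_simps)
  next
   case False
   have e: "ell2 (%m. ws (- 1) m *\<^sub>R (a (wn m) - b (wn m)))"
    unfolding scaleR_diff_right using ab by (intro ell2_diff) (auto simp: Hdist_iff)
   have "ws (- 1) m * norm (a (wn m) - b (wn m)) \<le> Hdist_norm L (- 1) (%x. a x - b x)"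
    using ell2_component_le[OF e, of m] ws_simps(7)[of "-1" m] by (simp add: Hdist_norm_eq)
   then show ?thesis using ws_simps(8)[OF False, of "-1"] by (simp add: field_simps)
  qed
 qed
 then show "(%t. gsym m *\<^sub>R f t (wn m)) \<in> borel_measurable lT" by (intro borel_measurable_scaleR) auto
 show "AE t in lT. f t \<in> Hdist L (- 1)" "integrable lT (%t. (Hdist_norm L (- 1) (f t))^2)"
  using f by (auto simp: L2_time_def)
qed

lemma vector_Sobolev1_coef:
 assumes v: "\<And>j. (%t x. v t x $ j) \<in> L2_Sobolev1"
 shows "(%t. vcoef (v t) m) \<in> borel_measurable lT"
  "AE t in lT. v t \<in> L2_torus L \<and> ell2 (%m. norm (wn m) *\<^sub>R vcoef (v t) m)"
  "\<exists>r. integrable lT r \<and> (AE t in lT. ell2 (vcoef (v t)) \<and> (ell2_norm (vcoef (v t)))^2 \<le> r t)"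
proof -
 note c = Sobolev1_coef[OF v]
 have "(%t. \<chi> j. coef (%x. v t x $ j) m) \<in> borel_measurable lT" by (rule measurable_vec_lambda) (rule c(1))
 moreover have "(\<chi> j. coef (%x. v t x $ j) m) = vcoef (v t) m" for t by (simp add: vec_eq_iff)
 ultimately show "(%t. vcoef (v t) m) \<in> borel_measurable lT" by simp
 have "AE t in lT. \<forall>j\<in>UNIV. (%x. v t x $ j) \<in> Sobolev1 L" by (subst AE_finite_all) (auto intro: c(2))
 then have S: "AE t in lT. \<forall>j. (%x. v t x $ j) \<in> Sobolev1 L" by simp
 show "AE t in lT. v t \<in> L2_torus L \<and> ell2 (%m. norm (wn m) *\<^sub>R vcoef (v t) m)"
  using S
 proof eventually_elim
  case (elim t)
  have "ell2 (%m. (norm (wn m) *\<^sub>R vcoef (v t) m) $ j)" for j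
   unfolding vector_scaleR_component vcoef_nth
   by (rule ell2_from_sw(3)) (use elim[rule_format, of j] in \<open>simp add: Sobolev1_iff\<close>)
  then show ?case using elim by (auto simp: Sobolev1_iff intro!: L2_torus_vec ell2_components(1))
 qed
 define r where "r t = (\<Sum>j\<in>UNIV. (ell2_norm (%m. sw m *\<^sub>R coef (%x. v t x $ j) m))^2)" for t
 have "integrable lT r" unfolding r_def by (intro bochner_integrable_sum c(3))
 moreover have "AE t in lT. ell2 (vcoef (v t)) \<and> (ell2_norm (vcoef (v t)))^2 \<le> r t"
  using S
 proof eventually_elim
  case (elim t)
  have e: "ell2 (%m. sw m *\<^sub>R coef (%x. v t x $ j) m)" for j using elim by (simp add: Sobolev1_iff)
  have e2: "ell2 (%m. vcoef (v t) m $ j)" for j unfolding vcoef_nth by (rule ell2_from_sw(1)[OF e])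
  have "(ell2_norm (vcoef (v t)))^2 \<le> r t"
   unfolding ell2_components(2)[OF e2] r_def vcoef_nth
   by (intro sum_mono power_mono ell2_from_sw(2)[OF e]) simp
  then show ?case using ell2_components(1)[OF e2] by simp
 qed
 ultimately show "\<exists>r. integrable lT r \<and> (AE t in lT. ell2 (vcoef (v t)) \<and> (ell2_norm (vcoef (v t)))^2 \<le> r t)" by blast
qed

lemma C_time_coef:
 assumes w: "w \<in> C_Hfun1"
 shows "t \<in> {0..T} \<Longrightarrow> w t \<in> L2_torus L" "t \<in> {0..T} \<Longrightarrow> real_field (vcoef (w t))" "t \<in> {0..T} \<Longrightarrow> h1 (vcoef (w t))"
  "continuous_on {0..T} (%t. vcoef (w t) m)" "\<exists>R. \<forall>t\<in>{0..T}. h1n (vcoef (w t)) \<le> R"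
proof -
 have H: "w t \<in> L2_torus L" "real_field (vcoef (w t))" "h1 (vcoef (w t))" if "t \<in> {0..T}" for t
  using w that by (auto simp: C_time_def Hfun1_iff)
 then show "t \<in> {0..T} \<Longrightarrow> w t \<in> L2_torus L" "t \<in> {0..T} \<Longrightarrow> real_field (vcoef (w t))" "t \<in> {0..T} \<Longrightarrow> h1 (vcoef (w t))"
  by blast+
 have lim: "((%s. h1n (%m. vcoef (w s) m - vcoef (w t) m)) \<longlongrightarrow> 0) (at t within {0..T})" if t: "t \<in> {0..T}" for t
 proof (rule Lim_transform_eventually)
  show "((%s. Hfun_norm L 1 (%x. w s x - w t x)) \<longlongrightarrow> 0) (at t within {0..T})"
   using w t by (simp add: C_time_def)
  show "eventually (%s. Hfun_norm L 1 (%x. w s x - w t x) = h1n (%m. vcoef (w s) m - vcoef (w t) m)) (at t within {0..T})"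
   unfolding eventually_at_filter
   by (rule always_eventually) (use H t in \<open>auto simp: Hfun_norm_diff ws1_h1w h1n_def\<close>)
 qed
 have ev: "eventually (%s. s \<in> {0..T}) (at t within {0..T})" for t by (simp add: eventually_at_filter)
 show "continuous_on {0..T} (%t. vcoef (w t) m)"
  unfolding continuous_on_def
 proof
  fix t assume t: "t \<in> {0..T}"
  show "((%t. vcoef (w t) m) \<longlongrightarrow> vcoef (w t) m) (at t within {0..T})"
  proof (cases "m = 0")
   case True
   have "eventually (%s. 0 = vcoef (w s) m) (at t within {0..T})"
    using ev by eventually_elim (simp add: True real_fieldD(1)[OF H(2)])
   then show ?thesis using True real_fieldD(1)[OF H(2)[OF t]]
    by (intro Lim_transform_eventually[OF tendsto_const]) auto
  next
   case False
   have "((%s. vcoef (w s) m - vcoef (w t) m) \<longlongrightarrow> 0) (at t within {0..T})"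
   proof (rule Lim_null_comparison)
    show "eventually (%s. norm (vcoef (w s) m - vcoef (w t) m) \<le> h1n (%m. vcoef (w s) m - vcoef (w t) m) / norm (wn m)) (at t within {0..T})"
     using ev
    proof eventually_elim
     case (elim s)
     show ?case using h1_component[OF h1_diff[OF H(3)[OF elim] H(3)[OF t]], of m] norm_wn_pos[OF False]
      by (simp add: field_simps)
    qed
    show "((%s. h1n (%m. vcoef (w s) m - vcoef (w t) m) / norm (wn m)) \<longlongrightarrow> 0) (at t within {0..T})"
     using tendsto_divide[OF lim[OF t] tendsto_const, of "norm (wn m)"] norm_wn_pos[OF False] by simp
   qed
   then show ?thesis by (rule Lim_null[THEN iffD2])
  qed
 qed
 have "continuous_on {0..T} (%t. h1n (vcoef (w t)))"
  unfolding continuous_on_def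
 proof
  fix t assume t: "t \<in> {0..T}"
  have "((%s. h1n (vcoef (w s)) - h1n (vcoef (w t))) \<longlongrightarrow> 0) (at t within {0..T})"
  proof (rule Lim_null_comparison[OF _ lim[OF t]])
   show "eventually (%s. norm (h1n (vcoef (w s)) - h1n (vcoef (w t))) \<le> h1n (%m. vcoef (w s) m - vcoef (w t) m)) (at t within {0..T})"
    using ev by eventually_elim (use h1n_triangle_abs H(3) t in auto)
  qed
  then show "((%t. h1n (vcoef (w t))) \<longlongrightarrow> h1n (vcoef (w t))) (at t within {0..T})" by (rule Lim_null[THEN iffD2])
 qed
 then have "compact ((%t. h1n (vcoef (w t))) ` {0..T})" by (rule compact_continuous_image) simp
 then have "bounded ((%t. h1n (vcoef (w t))) ` {0..T})" by (rule compact_imp_bounded)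
 then obtain R where "\<forall>x\<in>(%t. h1n (vcoef (w t))) ` {0..T}. norm x \<le> R" unfolding bounded_iff by blast
 then show "\<exists>R. \<forall>t\<in>{0..T}. h1n (vcoef (w t)) \<le> R" by (intro exI[of _ R]) auto
qed

text \<open>Contains the unprojected flux and the pressure gradient, because the weak form admits
  test fields that are not divergence-free.\<close>

definition residual :: "(real^3 \<Rightarrow> real^3) \<Rightarrow> (real^3 \<Rightarrow> real^3) \<Rightarrow> (real^3 \<Rightarrow> real) \<Rightarrow> (real^3 \<Rightarrow> complex^3) \<Rightarrow> int^3 \<Rightarrow> complex^3" where
 "residual w' w q f m = vcoef w' m + flux (vcoef w) (vcoef w) m + (\<nu> * lam m) *\<^sub>R vcoef w m
   + (\<chi> j. \<i> * of_real (wn m $ j) * coef q m) - gsym m *\<^sub>R f (wn m)"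

lemma norm_gradient_coef: "norm (\<chi> j. \<i> * of_real (wn m $ j) * z :: complex^3) = norm (norm (wn m) *\<^sub>R z)"
proof -
 have "(norm (\<chi> j. \<i> * of_real (wn m $ j) * z :: complex^3))^2 = (norm (norm (wn m) *\<^sub>R z))^2"
  unfolding norm_square_components
  by (simp add: norm_mult power_mult_distrib norm_vec_def L2_set_def sum_nonneg sum_distrib_right)
 then show ?thesis by (rule power2_eq_imp_eq) auto
qed

text \<open>\<open>time_pairing\<close> applied to each of the five terms. The identity serves both
  directions: a vanishing residual gives the weak form, and special test fields recover the residual
  from it.\<close>

lemma weak_form_coefficients:
 assumes w2: "w \<in> L2_Hfun 2" and wC: "w \<in> C_Hfun1"
  and q: "q \<in> L2_Sobolev1" and w': "w' \<in> L2_Hfun 0"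
  and f: "f \<in> L2_Hdist"
  and v: "\<And>j. (%t x. v t x $ j) \<in> L2_Sobolev1"
 shows "integrable lT (%t. residual (w' t) (w t) (q t) (f t) m \<bullet> vcoef (v t) m)"
  "((%m. LINT t|lT. residual (w' t) (w t) (q t) (f t) m \<bullet> vcoef (v t) m) has_sum
   ((weak_lhs w' w q v
     - weak_rhs f v) / L ^ 3)) UNIV"
proof -
 note V = vector_Sobolev1_coef[OF v]
 obtain r where r: "integrable lT r" "AE t in lT. ell2 (vcoef (v t)) \<and> (ell2_norm (vcoef (v t)))^2 \<le> r t"
  using V(3) by blast
 note C = C_time_coef[OF wC]
 have sp: "AE t in lT. t \<in> {0..T}" by (rule AE_in_lebesgue_onI)
 note cw' = Hfun_coef[OF w'] and cw = Hfun_coef[OF w2] and cq = Sobolev1_coef[OF q] and cf = force_coef[OF f]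
 have a1: "AE t in lT. ell2 (%m. vcoef (w' t) m) \<and> (ell2_norm (%m. vcoef (w' t) m))^2 \<le> (ell2_norm (%m. ws 0 m *\<^sub>R vcoef (w' t) m))^2"
  using cw'(2)
 proof eventually_elim
  case (elim t)
  then have "w' t \<in> L2_torus L" "real_field (vcoef (w' t))" by (auto simp: Hfun_iff)
  then show ?case unfolding ws0[of "vcoef (w' t)", OF real_fieldD(1)[OF \<open>real_field (vcoef (w' t))\<close>]]
   using ell2_vcoef by blast
 qed
 have "AE t in lT. ((%m. vcoef (w' t) m \<bullet> vcoef (v t) m) has_sum ((LINT x|torus L. w' t x \<bullet> v t x) / L ^ 3)) UNIV"
  using cw'(2) V(2) by eventually_elim (simp add: Hfun_iff vparseval)
 note t1 = time_pairing[OF cw'(1) V(1) a1 cw'(3) r(2,1) this]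
 obtain R where R: "\<And>t. t \<in> {0..T} \<Longrightarrow> h1n (vcoef (w t)) \<le> R" using C(5) by blast
 have mf: "(%t. - flux (vcoef (w t)) (vcoef (w t)) m) \<in> borel_measurable lT" for m
  by (intro borel_measurable_uminus measurable_flux cw(1)) (auto intro: C(3))
 have a2: "AE t in lT. ell2 (%m. - flux (vcoef (w t)) (vcoef (w t)) m) \<and>
   (ell2_norm (%m. - flux (vcoef (w t)) (vcoef (w t)) m))^2 \<le> (Kf * R * R)^2 / (2 * pi / L)^2"
  using sp
 proof eventually_elim
  case (elim t)
  note h = C(3)[OF elim]
  have "h1n (flux (vcoef (w t)) (vcoef (w t))) \<le> Kf * h1n (vcoef (w t)) * h1n (vcoef (w t))" by (rule flux_h1(2)[OF h h])
  also have "\<dots> \<le> Kf * R * R"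
   using R[OF elim] Kf_nonneg order_trans[OF h1n_nonneg R[OF elim]] by (intro mult_mono) auto
  finally have "(h1n (flux (vcoef (w t)) (vcoef (w t))))^2 / (2 * pi / L)^2 \<le> (Kf * R * R)^2 / (2 * pi / L)^2"
   by (intro divide_right_mono power_mono) auto
  note k = h1_imp_ell2[OF flux_h1(1)[OF h h]]
  show ?case unfolding ell2_uminus by (intro conjI k(1) order_trans[OF k(2)]) fact
 qed
 have i2: "integrable lT (%t. (Kf * R * R)^2 / (2 * pi / L)^2)" by (rule continuous_imp_integrable_real) simp
 have "AE t in lT. ((%m. - flux (vcoef (w t)) (vcoef (w t)) m \<bullet> vcoef (v t) m) has_sum
   ((LINT x|torus L. tfilter L \<alpha> (tensor (deconv L \<alpha> N (w t)) (deconv L \<alpha> N (w t))) x \<bullet> vgrad L (v t) x) / L ^ 3)) UNIV"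
  using sp V(2)
 proof eventually_elim
  case (elim t)
  have "w t \<in> Hfun L 1" using C(1-3)[OF elim(1)] by (simp add: Hfun1_iff)
  then show ?case using flux_pairing elim(2) by (simp only: inner_minus_left)
 qed
 note t2 = time_pairing[OF mf V(1) a2 i2 r(2,1) this]
 have ml: "(%t. lam m *\<^sub>R vcoef (w t) m) \<in> borel_measurable lT" for m by (intro borel_measurable_scaleR cw(1)) simp
 have a3: "AE t in lT. ell2 (%m. lam m *\<^sub>R vcoef (w t) m) \<and>
   (ell2_norm (%m. lam m *\<^sub>R vcoef (w t) m))^2 \<le> (ell2_norm (%m. ws 2 m *\<^sub>R vcoef (w t) m))^2"
  using cw(2) by eventually_elim (simp add: Hfun_iff ws2_lam)
 have "AE t in lT. ((%m. (lam m *\<^sub>R vcoef (w t) m) \<bullet> vcoef (v t) m) has_sum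
   ((LINT x|torus L. vgrad L (w t) x \<bullet> vgrad L (v t) x) / L ^ 3)) UNIV"
  using sp V(2)
 proof eventually_elim
  case (elim t)
  have "ell2 (%m. norm (wn m) *\<^sub>R vcoef (w t) m)" using C(3)[OF elim(1)] by (simp add: h1_def h1w_def)
  then show ?case using gradient_pairing elim(2) by blast
 qed
 note t3 = time_pairing[OF ml V(1) a3 cw(3) r(2,1) this]
 have mq: "(%t. \<chi> j. \<i> * of_real (wn m $ j) * coef (q t) m) \<in> borel_measurable lT" for m
  by (intro measurable_vec_lambda borel_measurable_times cq(1)) simp_all
 have a4: "AE t in lT. ell2 (%m. \<chi> j. \<i> * of_real (wn m $ j) * coef (q t) m) \<and>
   (ell2_norm (%m. \<chi> j. \<i> * of_real (wn m $ j) * coef (q t) m))^2 \<le> (ell2_norm (%m. sw m *\<^sub>R coef (q t) m))^2"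
  using cq(2)
 proof eventually_elim
  case (elim t)
  then have e: "ell2 (%m. sw m *\<^sub>R coef (q t) m)" by (simp add: Sobolev1_iff)
  have n: "norm (\<chi> j. \<i> * of_real (wn m $ j) * coef (q t) m :: complex^3) \<le> norm (norm (wn m) *\<^sub>R coef (q t) m)" for m
   by (simp only: norm_gradient_coef order_refl)
  note m = ell2_mono[OF ell2_from_sw(3)[OF e] n]
  have "ell2_norm (%m. \<chi> j. \<i> * of_real (wn m $ j) * coef (q t) m) \<le> ell2_norm (%m. sw m *\<^sub>R coef (q t) m)"
   by (rule order_trans[OF m(2) ell2_from_sw(4)[OF e]])
  then show ?case using m(1) power_mono[OF _ ell2_norm_nonneg] by blast
 qed
 have "AE t in lT. ((%m. (\<chi> j. \<i> * of_real (wn m $ j) * coef (q t) m) \<bullet> vcoef (v t) m) has_sum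
   ((LINT x|torus L. grad L (q t) x \<bullet> v t x) / L ^ 3)) UNIV"
  using cq(2) V(2)
 proof eventually_elim
  case (elim t)
  have e: "ell2 (%m. norm (wn m) *\<^sub>R coef (q t) m)" by (rule ell2_from_sw(3)) (use elim(1) in \<open>simp add: Sobolev1_iff\<close>)
  show ?case using vparseval[OF grad_coef(1)[OF e], of "v t"] elim(2) unfolding grad_coef(2)[OF e] by blast
 qed
 note t4 = time_pairing[OF mq V(1) a4 cq(3) r(2,1) this]
 have a5: "AE t in lT. ell2 (%m. gsym m *\<^sub>R f t (wn m)) \<and>
   (ell2_norm (%m. gsym m *\<^sub>R f t (wn m)))^2 \<le> (1 / \<alpha>)^2 * (Hdist_norm L (- 1) (f t))^2"
  using cf(2)
 proof eventually_elim
  case (elim t)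
  have "(ell2_norm (%m. gsym m *\<^sub>R f t (wn m)))^2 \<le> (1 / \<alpha> * Hdist_norm L (- 1) (f t))^2"
   by (intro power_mono filtered_ell2(2)[OF elim]) simp
  then show ?case using filtered_ell2(1)[OF elim] by (simp only: power_mult_distrib)
 qed
 have i5: "integrable lT (%t. (1 / \<alpha>)^2 * (Hdist_norm L (- 1) (f t))^2)" using cf(3) by (rule integrable_mult_right)
 have "AE t in lT. ((%m. (gsym m *\<^sub>R f t (wn m)) \<bullet> vcoef (v t) m) has_sum
   ((LINT x|torus L. dfilter L \<alpha> (f t) x \<bullet> v t x) / L ^ 3)) UNIV"
  using cf(2) V(2)
 proof eventually_elim
  case (elim t)
  show ?case using vparseval[OF dfilter_coef(1)[OF elim(1)], of "v t"] elim(2) unfolding dfilter_coef(2)[OF elim(1)] by blast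
 qed
 note t5 = time_pairing[OF cf(1) V(1) a5 i5 r(2,1) this]
 have e: "residual (w' t) (w t) (q t) (f t) m \<bullet> vcoef (v t) m =
   vcoef (w' t) m \<bullet> vcoef (v t) m - (- flux (vcoef (w t)) (vcoef (w t)) m) \<bullet> vcoef (v t) m
   + \<nu> * ((lam m *\<^sub>R vcoef (w t) m) \<bullet> vcoef (v t) m)
   + (\<chi> j. \<i> * of_real (wn m $ j) * coef (q t) m) \<bullet> vcoef (v t) m - (gsym m *\<^sub>R f t (wn m)) \<bullet> vcoef (v t) m" for t m
  unfolding residual_def by (simp only: inner_add_left inner_diff_left inner_minus_left inner_scaleR_left)
 show "integrable lT (%t. residual (w' t) (w t) (q t) (f t) m \<bullet> vcoef (v t) m)"
  unfolding e
  by (intro bochner_integrable_add bochner_integrable_diff integrable_mult_right t1(1) t2(1) t3(1) t4(1) t5(1))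
 have ie: "(LINT t|lT. residual (w' t) (w t) (q t) (f t) m \<bullet> vcoef (v t) m) =
   (LINT t|lT. vcoef (w' t) m \<bullet> vcoef (v t) m) - (LINT t|lT. (- flux (vcoef (w t)) (vcoef (w t)) m) \<bullet> vcoef (v t) m)
   + \<nu> * (LINT t|lT. (lam m *\<^sub>R vcoef (w t) m) \<bullet> vcoef (v t) m)
   + (LINT t|lT. (\<chi> j. \<i> * of_real (wn m $ j) * coef (q t) m) \<bullet> vcoef (v t) m)
   - (LINT t|lT. (gsym m *\<^sub>R f t (wn m)) \<bullet> vcoef (v t) m)" for m
 proof -
  note i = t1(1)[of m] t2(1)[of m] integrable_mult_right[OF t3(1)[of m], of \<nu>] t4(1)[of m] t5(1)[of m]
  note j = bochner_integrable_diff[OF i(1,2)]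
  note k = bochner_integrable_add[OF j i(3)]
  note l = bochner_integrable_add[OF k i(4)]
  show ?thesis unfolding e bochner_integral_diff[OF l i(5)] bochner_integral_add[OF k i(4)]
   bochner_integral_add[OF j i(3)] bochner_integral_diff[OF i(1,2)]
   by (simp only: integral_mult_right_zero)
 qed
 have "((%m. LINT t|lT. residual (w' t) (w t) (q t) (f t) m \<bullet> vcoef (v t) m) has_sum
   ((LINT t|lT. LINT x|torus L. w' t x \<bullet> v t x) / L ^ 3
     - (LINT t|lT. LINT x|torus L.
       tfilter L \<alpha> (tensor (deconv L \<alpha> N (w t)) (deconv L \<alpha> N (w t))) x \<bullet> vgrad L (v t) x) / L ^ 3
     + \<nu> * ((LINT t|lT. LINT x|torus L. vgrad L (w t) x \<bullet> vgrad L (v t) x) / L ^ 3)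
     + (LINT t|lT. LINT x|torus L. grad L (q t) x \<bullet> v t x) / L ^ 3
     - (LINT t|lT. LINT x|torus L. dfilter L \<alpha> (f t) x \<bullet> v t x) / L ^ 3)) UNIV"
  unfolding ie by (intro has_sum_add has_sum_subtract has_sum_cmult_right t1(2) t2(2) t3(2) t4(2) t5(2))
 then show "((%m. LINT t|lT. residual (w' t) (w t) (q t) (f t) m \<bullet> vcoef (v t) m) has_sum
   ((weak_lhs w' w q v
     - weak_rhs f v) / L ^ 3)) UNIV"
  by (simp only: diff_divide_distrib add_divide_distrib times_divide_eq_right)
qed

end

section \<open>Uniqueness\<close>

lemma inner_vcnj: "vcnj a \<bullet> vcnj b = a \<bullet> b"
 by (simp add: inner_vec_def inner_complex_def)

lemma vcnj_gradient: "(\<chi> j. \<i> * of_real (- x $ j) * cnj z) = vcnj (\<chi> j. \<i> * of_real (x $ j) * z)"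
 by (simp add: vec_eq_iff)

lemma leray_gradient: "leray x (\<chi> j. \<i> * of_real (x $ j) * z) = 0"
proof -
 have "cdot x (\<chi> j. \<i> * of_real (x $ j) * z) = (\<Sum>j\<in>UNIV. of_real (x $ j * x $ j)) * (\<i> * z)"
  by (simp add: cdot_def sum_distrib_left mult_ac)
 also have "\<dots> = of_real ((norm x)^2) * (\<i> * z)" by (simp only: of_real_sum[symmetric] sum_square_vec)
 finally have c: "cdot x (\<chi> j. \<i> * of_real (x $ j) * z) = of_real ((norm x)^2) * (\<i> * z)" .
 show ?thesis
 proof (cases "x = 0")
  case False
  then have "complex_of_real ((norm x)^2) \<noteq> 0" by simp
  then show ?thesis unfolding leray_def c by (simp add: vec_eq_iff mult_ac)
 qed (simp add: leray_def vec_eq_iff)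
qed

section \<open>Testing with a single real mode\<close>

context torus_model
begin

text \<open>A real field needs the modes m and -m together. With the halves, pairing against a
  family with the same reflection symmetry gives exactly its value at m paired with
  \<open>Z\<close>.\<close>

definition single_mode :: "int^3 \<Rightarrow> complex^3 \<Rightarrow> int^3 \<Rightarrow> complex^3" where
 "single_mode m Z k = (if k = m then (1/2) *\<^sub>R Z else if k = - m then (1/2) *\<^sub>R vcnj Z else 0)"

lemma int_vec_neg_neq: assumes "m \<noteq> 0" shows "- m \<noteq> (m :: int^3)"
proof
 assume e: "- m = m"
 have "m $ i = 0" for i
 proof -
  have "(- m) $ i = m $ i" by (simp only: e)
  then show ?thesis by simp
 qed
 then show False using assms by (simp add: vec_eq_iff)
qed

lemma single_mode_finite: "finite {k. single_mode m Z k \<noteq> 0}"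
 by (rule finite_subset[of _ "{m, - m}"]) (auto simp: single_mode_def)

lemma single_mode_ell2: "ell2 (%k. r k *\<^sub>R single_mode m Z k)"
 unfolding ell2_def
 by (rule finite_nonzero_values_imp_summable_on) (rule finite_subset[OF _ single_mode_finite[of m Z]], auto)

lemma single_mode_spec:
 assumes m: "m \<noteq> 0"
 shows "vsyn (single_mode m Z) \<in> L2_torus L" "vcoef (vsyn (single_mode m Z)) = single_mode m Z"
  "(%x. vsyn (single_mode m Z) x $ j) \<in> Sobolev1 L"
proof -
 have c: "single_mode m Z (- k) = vcnj (single_mode m Z k)" for k
  using int_vec_neg_neq[OF m] by (auto simp: single_mode_def vcnj_linear minus_equation_iff)
 have e: "ell2 (single_mode m Z)" using single_mode_ell2[of "%k. 1" m Z] by simp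
 note s = vsyn_spec[OF c e]
 show "vsyn (single_mode m Z) \<in> L2_torus L" "vcoef (vsyn (single_mode m Z)) = single_mode m Z" using s by auto
 have "ell2 (%k. (sw k *\<^sub>R single_mode m Z k) $ j)" by (rule ell2_component[OF single_mode_ell2])
 then show "(%x. vsyn (single_mode m Z) x $ j) \<in> Sobolev1 L"
  unfolding Sobolev1_iff vector_scaleR_component
  by (intro conjI L2_torus_nth s(1)) (simp only: vcoef_nth[symmetric] s(2))
qed

lemma infsum_single_mode:
 assumes m: "m \<noteq> 0" and G: "G (- m) = vcnj (G m)"
 shows "(\<Sum>\<^sub>\<infinity>k. G k \<bullet> single_mode m Z k) = G m \<bullet> Z"
proof -
 have "(\<Sum>\<^sub>\<infinity>k. G k \<bullet> single_mode m Z k) = (\<Sum>\<^sub>\<infinity>k\<in>{m, - m}. G k \<bullet> single_mode m Z k)"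
  by (rule infsum_cong_neutral) (auto simp: single_mode_def)
 also have "\<dots> = G m \<bullet> single_mode m Z m + G (- m) \<bullet> single_mode m Z (- m)"
  using int_vec_neg_neq[OF m] by (simp add: eq_commute[of m])
 also have "\<dots> = G m \<bullet> Z" using int_vec_neg_neq[OF m] by (simp add: single_mode_def G inner_vcnj)
 finally show ?thesis .
qed

lemma integral_single_mode:
 assumes u: "u \<in> L2_torus L" and m: "m \<noteq> 0"
 shows "(LINT x|torus L. u x \<bullet> vsyn (single_mode m Z) x) = L ^ 3 * (vcoef u m \<bullet> Z)"
proof -
 have "(LINT x|torus L. u x \<bullet> vsyn (single_mode m Z) x) / L ^ 3 = vcoef u m \<bullet> Z"
  using vparseval[OF u single_mode_spec(1)[OF m, of Z]] infsum_single_mode[where G="vcoef u", OF m vcoef_minus, of Z]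
  unfolding single_mode_spec(2)[OF m] has_sum_iff by simp
 then show ?thesis using L by (simp add: field_simps)
qed

lemma residual_minus:
 assumes "real_field (vcoef w)" "f \<in> Hdist L (- 1)"
 shows "residual w' w q f (- m) = vcnj (residual w' w q f m)"
proof -
 have f: "f (wn (- m)) = vcnj (f (wn m))" using assms(2) unfolding Hdist_iff by (blast dest: real_fieldD(2))
 have "(\<chi> j. \<i> * of_real (wn (- m) $ j) * coef q (- m)) = vcnj (\<chi> j. \<i> * of_real (wn m $ j) * coef q m)"
  using vcnj_gradient[of "wn m" "coef q m"] by (simp add: coef_minus)
 then show ?thesis
  unfolding residual_def f flux_cnj[OF assms(1) assms(1)] vcoef_minus lam_minus gsym_minus
  by (simp only: vcnj_linear)
qed

lemma L2_time_zero_Sobolev1: "(%x. 0) \<in> Sobolev1 L" "Sobolev1_norm L (%x. 0) = 0"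
proof -
 have c: "coef (%x. 0) m = 0" for m by (simp add: coef_eq)
 have "(%x. 0 :: real) \<in> L2_torus L" by (rule L2_torus_continuous) (simp_all add: periodic_def)
 then show "(%x. 0) \<in> Sobolev1 L" by (simp add: Sobolev1_iff c)
 show "Sobolev1_norm L (%x. 0) = 0" by (simp add: Sobolev1_norm_eq c)
qed

text \<open>The test field is one mode times the indicator of a measurable set of times. The set
  being arbitrary, the real function residual paired with \<open>Z\<close> vanishes almost
  everywhere, and \<open>Z\<close> then runs through a basis.\<close>

lemma residual_zero:
 assumes w2: "w \<in> L2_Hfun 2" and wC: "w \<in> C_Hfun1"
  and q: "q \<in> L2_Sobolev1" and w': "w' \<in> L2_Hfun 0"
  and f: "f \<in> L2_Hdist"
  and weak: "\<forall>v. (\<forall>j. (%t x. v t x $ j) \<in> L2_Sobolev1) \<longrightarrow>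
     weak_lhs w' w q v
     = weak_rhs f v"
  and m: "m \<noteq> 0"
 shows "AE t in lT. residual (w' t) (w t) (q t) (f t) m = 0"
proof -
 let ?X = "%t m. residual (w' t) (w t) (q t) (f t) m"
 note C = C_time_coef[OF wC]
 have sp: "AE t in lT. t \<in> {0..T}" by (rule AE_in_lebesgue_onI)
 have Xc: "AE t in lT. ?X t (- m) = vcnj (?X t m)"
  using sp force_coef(2)[OF f] by eventually_elim (use C(2) residual_minus in blast)
 have A: "integrable lT (%t. indicator A t * (?X t m \<bullet> Z))" "(LINT t|lT. indicator A t * (?X t m \<bullet> Z)) = 0"
  if A: "A \<in> sets lT" for A Z
 proof -
  define v where "v t = (if t \<in> A then vsyn (single_mode m Z) else (%x. 0))" for t
  have vL: "(%t x. v t x $ j) \<in> L2_Sobolev1" for j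
  proof -
   have "(%t x. v t x $ j) = (%t. if t \<in> A then (%x. vsyn (single_mode m Z) x $ j) else (%x. 0))"
    by (auto simp: v_def fun_eq_iff)
   then show ?thesis by (simp only:) (rule L2_time_indicator; (rule single_mode_spec(3)[OF m] L2_time_zero_Sobolev1 A)+)
  qed
  have vc: "vcoef (v t) k = indicator A t *\<^sub>R single_mode m Z k" for t k
   by (simp add: v_def single_mode_spec(2)[OF m] del: vcoef_nth)
  note W = weak_form_coefficients[OF w2 wC q w' f vL] 
  have h0: "((%k. LINT t|lT. ?X t k \<bullet> vcoef (v t) k) has_sum 0) UNIV"
   using W(2) weak[rule_format, of v] vL by simp
  have i: "integrable lT (%t. ?X t k \<bullet> (indicator A t *\<^sub>R single_mode m Z k))" for k using W(1)[of k] by (simp only: vc)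
  have s0: "(\<Sum>\<^sub>\<infinity>k. LINT t|lT. ?X t k \<bullet> (indicator A t *\<^sub>R single_mode m Z k)) = 0"
   using h0 by (simp only: vc has_sum_iff)
  have "(\<Sum>\<^sub>\<infinity>k. LINT t|lT. ?X t k \<bullet> (indicator A t *\<^sub>R single_mode m Z k))
    = (\<Sum>\<^sub>\<infinity>k\<in>{m, - m}. LINT t|lT. ?X t k \<bullet> (indicator A t *\<^sub>R single_mode m Z k))"
   by (rule infsum_cong_neutral) (auto simp: single_mode_def)
  also have "\<dots> = (LINT t|lT. ?X t m \<bullet> (indicator A t *\<^sub>R single_mode m Z m)) + (LINT t|lT. ?X t (- m) \<bullet> (indicator A t *\<^sub>R single_mode m Z (- m)))"
   using int_vec_neg_neq[OF m] by (simp add: eq_commute[of m])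
  also have "\<dots> = (LINT t|lT. ?X t m \<bullet> (indicator A t *\<^sub>R single_mode m Z m) + ?X t (- m) \<bullet> (indicator A t *\<^sub>R single_mode m Z (- m)))"
   by (rule bochner_integral_add[symmetric]) (rule i)+
  finally have s1: "(LINT t|lT. ?X t m \<bullet> (indicator A t *\<^sub>R single_mode m Z m) + ?X t (- m) \<bullet> (indicator A t *\<^sub>R single_mode m Z (- m))) = 0"
   using s0 by simp
  have ia: "integrable lT (%t. 2 * (?X t m \<bullet> (indicator A t *\<^sub>R single_mode m Z m)))" by (rule integrable_mult_right[OF i])
  have eqf: "(%t. 2 * (?X t m \<bullet> (indicator A t *\<^sub>R single_mode m Z m))) = (%t. indicator A t * (?X t m \<bullet> Z))"
   by (simp add: single_mode_def fun_eq_iff)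
  show ii: "integrable lT (%t. indicator A t * (?X t m \<bullet> Z))" unfolding eqf[symmetric] by (rule ia)
  have ae: "AE t in lT. ?X t m \<bullet> (indicator A t *\<^sub>R single_mode m Z m) + ?X t (- m) \<bullet> (indicator A t *\<^sub>R single_mode m Z (- m))
    = indicator A t * (?X t m \<bullet> Z)"
   using Xc by eventually_elim (use int_vec_neg_neq[OF m] in \<open>simp add: single_mode_def inner_vcnj\<close>)
  have "(LINT t|lT. indicator A t * (?X t m \<bullet> Z)) =
    (LINT t|lT. ?X t m \<bullet> (indicator A t *\<^sub>R single_mode m Z m) + ?X t (- m) \<bullet> (indicator A t *\<^sub>R single_mode m Z (- m)))"
   by (rule integral_cong_AE[OF borel_measurable_integrable[OF ii] borel_measurable_integrable[OF bochner_integrable_add[OF i i]]])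
     (use ae in \<open>auto elim: eventually_mono\<close>)
  then show "(LINT t|lT. indicator A t * (?X t m \<bullet> Z)) = 0" using s1 by simp
 qed
 \<comment> \<open>The whole interval as the set of times gives integrability; the two sign sets
   then force the function to vanish.\<close>
 have "AE t in lT. ?X t m \<bullet> Z = 0" for Z
 proof -
  have "integrable lT (%t. indicator {0..T} t * (?X t m \<bullet> Z))" by (rule A(1)) (metis sets.top space_restrict_space Int_UNIV_right space_lebesgue_on)
  then have i: "integrable lT (%t. ?X t m \<bullet> Z)"
   by (rule bochner_integrable_cong[THEN iffD1, rotated 2]) simp_all
  have sgn: "(LINT t|lT. indicator {t. P (?X t m \<bullet> Z)} t * (?X t m \<bullet> Z)) = 0" if "P = (%x. 0 < x) \<or> P = (%x. x < (0::real))" for P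
  proof -
   have [measurable]: "(%t. ?X t m \<bullet> Z) \<in> borel_measurable lT" using i by (rule borel_measurable_integrable)
   have s: "{t \<in> space lT. P (?X t m \<bullet> Z)} \<in> sets lT" using that by (elim disjE) (simp only:, measurable)+
   have "(LINT t|lT. indicator {t. P (?X t m \<bullet> Z)} t * (?X t m \<bullet> Z)) = (LINT t|lT. indicator {t \<in> space lT. P (?X t m \<bullet> Z)} t * (?X t m \<bullet> Z))"
    by (rule bochner_integral_cong) (auto simp: indicator_def)
   then show ?thesis using A(2)[OF s] by simp
  qed
  show ?thesis
   by (rule AE_zero_if_sign_integrals_zero[OF i]) (rule sgn[of "%x. 0 < x"], simp, rule sgn[of "%x. x < 0"], simp)
 qed
 then have "AE t in lT. \<forall>Z\<in>Basis. ?X t m \<bullet> Z = 0" by (subst AE_finite_all) auto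
 then show ?thesis by eventually_elim (rule euclidean_eqI, simp)
qed

text \<open>The Leray projection of the residual removes the pressure and leaves the divergence-free
  terms unchanged. Testing the weak time derivative with single modes then turns it into an integral
  equation. At the zero mode everything vanishes.\<close>

lemma weak_solution_evolution:
 assumes w2: "w \<in> L2_Hfun 2" and wC: "w \<in> C_Hfun1"
  and w': "w' \<in> L2_Hfun 0"
  and f: "f \<in> L2_Hdist"
  and deriv: "weak_time_deriv L T w w'"
  and res: "\<And>m. m \<noteq> 0 \<Longrightarrow> AE t in lT. residual (w' t) (w t) (q t) (f t) m = 0"
 shows "AE t in lT. vcoef (w' t) m = (gsym m *\<^sub>R f t (wn m) - Bn (vcoef (w t)) (vcoef (w t)) m) - (\<nu> * lam m) *\<^sub>R vcoef (w t) m"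
  "linear_evolution T (\<nu> * lam m) (%t. gsym m *\<^sub>R f t (wn m) - Bn (%m. vcoef (w t) m) (%m. vcoef (w t) m) m) (%t. vcoef (w t) m)"
proof -
 note C = C_time_coef[OF wC]
 note cw' = Hfun_coef[OF w'] and cw = Hfun_coef[OF w2] and cf = force_coef[OF f]
 have sp: "AE t in lT. t \<in> {0..T}" by (rule AE_in_lebesgue_onI)
 have T0: "T > 0" "0 \<in> {0..T}" using params by auto
 let ?h = "%t. gsym m *\<^sub>R f t (wn m) - Bn (vcoef (w t)) (vcoef (w t)) m"
 show ae: "AE t in lT. vcoef (w' t) m = ?h t - (\<nu> * lam m) *\<^sub>R vcoef (w t) m"
 proof (cases "m = 0")
  case True
  show ?thesis using sp cw'(2) cf(2)
  proof eventually_elim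
   case (elim t)
   have "f t (wn 0) = 0" using elim(3) by (simp add: Hdist_def)
   moreover have "vcoef (w' t) 0 = 0" using elim(2) real_fieldD(1) by (auto simp: Hfun_iff simp del: vcoef_nth)
   ultimately show ?case
    using real_fieldD(1)[OF Bn_real_field[OF C(2) C(2)]] real_fieldD(1)[OF C(2)] elim(1)
    by (simp add: True del: vcoef_nth)
  qed
 next
  case False
  show ?thesis using res[OF False] sp cw'(2) cf(2)
  proof eventually_elim
   case (elim t)
   have rf: "real_field (vcoef (w' t))" "real_field (vcoef (w t))" "real_field (%m. gsym m *\<^sub>R f t (wn m))"
    using elim(2-4) C(2) filtered_real_field by (auto simp: Hfun_iff Hdist_iff)
   \<comment> \<open>Projecting the vanishing residual eliminates the unknown pressure and turns the
     flux into \<open>Bn\<close>.\<close>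
   have "leray (wn m) (residual (w' t) (w t) (q t) (f t) m) = 0" using elim(1) leray_linear(3)[of "wn m" 0 0] by (simp add: leray_def vec_eq_iff cdot_def)
   then have "vcoef (w' t) m + Bn (vcoef (w t)) (vcoef (w t)) m + (\<nu> * lam m) *\<^sub>R vcoef (w t) m + 0 - gsym m *\<^sub>R f t (wn m) = 0"
    unfolding residual_def leray_linear leray_gradient leray_id[OF real_fieldD(3)[OF rf(1)]] leray_id[OF real_fieldD(3)[OF rf(2)]]
    by (simp only: leray_linear[symmetric] leray_id[OF real_fieldD(3)[OF rf(3)]] Bn_def)
   then show ?case by (simp only: add_0_right) (simp add: algebra_simps eq_neg_iff_add_eq_0)
  qed
 qed
 have iw': "integrable lT (%t. vcoef (w' t) m)"
 proof (rule bochner_integrable_bound)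
  have "integrable lT (%t. 1 :: real)" by (rule continuous_imp_integrable_real) simp
  then show "integrable lT (%t. 1 + (ell2_norm (%m. ws 0 m *\<^sub>R vcoef (w' t) m))^2)"
   using cw'(3) by (rule bochner_integrable_add)
  show "AE t in lT. norm (vcoef (w' t) m) \<le> norm (1 + (ell2_norm (%m. ws 0 m *\<^sub>R vcoef (w' t) m))^2)"
   using cw'(2)
  proof eventually_elim
   case (elim t)
   then have r: "real_field (vcoef (w' t))" and e: "w' t \<in> L2_torus L" by (auto simp: Hfun_iff)
   have "norm (vcoef (w' t) m) \<le> ell2_norm (%m. ws 0 m *\<^sub>R vcoef (w' t) m)"
    unfolding ws0[of "vcoef (w' t)", OF real_fieldD(1)[OF r]] by (rule ell2_component_le[OF ell2_vcoef[OF e]])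
   moreover have "2 * ell2_norm (%m. ws 0 m *\<^sub>R vcoef (w' t) m) * 1 \<le> (ell2_norm (%m. ws 0 m *\<^sub>R vcoef (w' t) m))^2 + 1^2"
    by (rule sum_squares_bound)
   moreover have "0 \<le> ell2_norm (%m. ws 0 m *\<^sub>R vcoef (w' t) m)" by simp
   ultimately show ?case by (simp only: real_norm_def power_one)
  qed
 qed (rule cw'(1))
 have icw: "integrable lT (%t. (\<nu> * lam m) *\<^sub>R vcoef (w t) m)"
  by (rule integrable_scaleR_right, rule continuous_imp_integrable_real) (rule C(4))
 have ae': "AE t in lT. vcoef (w' t) m + (\<nu> * lam m) *\<^sub>R vcoef (w t) m = ?h t" using ae by eventually_elim simp
 have ih': "integrable lT (%t. vcoef (w' t) m + (\<nu> * lam m) *\<^sub>R vcoef (w t) m)" by (rule bochner_integrable_add[OF iw' icw])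
 have ih: "integrable lT ?h"
  by (rule integrable_cong_AE_imp[OF ih' borel_measurable_AE_lebesgue_on[OF borel_measurable_integrable[OF ih'] ae']])
    (use ae' in \<open>auto elim: eventually_mono\<close>)
 show "linear_evolution T (\<nu> * lam m) ?h (%t. vcoef (w t) m)"
  unfolding linear_evolution_def
 proof (intro conjI ballI ih C(4))
  fix t assume t: "t \<in> {0..T}"
  have sub: "AE s in Leb t. vcoef (w' s) m = ?h s - (\<nu> * lam m) *\<^sub>R vcoef (w s) m"
   by (rule AE_lebesgue_on_subset[OF ae]) (use t in auto)
  have it: "integrable (Leb t) (%s. vcoef (w' s) m)"
   using lebesgue_on_eq_integral(1)[OF iw', of 0 t] t by simp
  have im: "(LINT s|Leb t. ?h s - (\<nu> * lam m) *\<^sub>R vcoef (w s) m) = (LINT s|Leb t. vcoef (w' s) m)"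
  proof (rule integral_cong_AE)
   show "AE s in Leb t. ?h s - (\<nu> * lam m) *\<^sub>R vcoef (w s) m = vcoef (w' s) m" using sub by eventually_elim simp
   show m1: "(%s. vcoef (w' s) m) \<in> borel_measurable (Leb t)" using it by (rule borel_measurable_integrable)
   show "(%s. ?h s - (\<nu> * lam m) *\<^sub>R vcoef (w s) m) \<in> borel_measurable (Leb t)"
    by (rule borel_measurable_AE_lebesgue_on[OF m1 sub]) simp
  qed
  have "vcoef (w t) m = vcoef (w 0) m + (LINT s|Leb t. vcoef (w' s) m)"
  proof (cases "m = 0")
   case True
   have "AE s in lT. vcoef (w' s) m = 0" using cw'(2) by eventually_elim (simp add: True Hfun_iff real_fieldD(1) del: vcoef_nth)
   then have "AE s in Leb t. vcoef (w' s) m = 0" by (rule AE_lebesgue_on_subset) (use t in auto)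
   then have "(LINT s|Leb t. vcoef (w' s) m) = 0" by (rule integral_eq_zero_AE)
   then show ?thesis using True real_fieldD(1)[OF C(2)[OF t]] real_fieldD(1)[OF C(2)[OF T0(2)]] by (simp del: vcoef_nth)
  next
   case False
   show ?thesis
   proof (rule euclidean_eqI)
    fix Z :: "complex^3"
    have "vcoef (w t) m \<bullet> Z = vcoef (w 0) m \<bullet> Z + (LINT s|Leb t. vcoef (w' s) m \<bullet> Z)"
    proof (rule weak_derivative_imp_integral[OF _ _ T0(1) _ t])
     show "continuous_on {0..T} (%t. vcoef (w t) m \<bullet> Z)" by (intro continuous_intros C(4))
     show "integrable lT (%t. vcoef (w' t) m \<bullet> Z)" by (rule integrable_inner_left) (rule iw')
     fix \<phi> assume \<phi>: "test_function T \<phi>"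
     have l: "(LINT t|lT. deriv \<phi> t * (LINT x|torus L. w t x \<bullet> vsyn (single_mode m Z) x)) =
       (LINT t|lT. L ^ 3 * (deriv \<phi> t * (vcoef (w t) m \<bullet> Z)))"
      by (rule bochner_integral_cong[OF refl]) (use C(1) in \<open>simp add: integral_single_mode[OF _ False] del: vcoef_nth\<close>)
     have ae2: "AE t in lT. L ^ 3 * (\<phi> t * (vcoef (w' t) m \<bullet> Z)) = \<phi> t * (LINT x|torus L. w' t x \<bullet> vsyn (single_mode m Z) x)"
      using cw'(2) by eventually_elim (simp add: Hfun_iff integral_single_mode[OF _ False] del: vcoef_nth)
     have m2: "(%t. L ^ 3 * (\<phi> t * (vcoef (w' t) m \<bullet> Z))) \<in> borel_measurable lT"
      by (intro borel_measurable_times borel_measurable_inner cw'(1) continuous_borel_measurable_lebesgue_on test_function_deriv(2)[OF \<phi>]) simp_all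
     have r: "(LINT t|lT. \<phi> t * (LINT x|torus L. w' t x \<bullet> vsyn (single_mode m Z) x)) =
       (LINT t|lT. L ^ 3 * (\<phi> t * (vcoef (w' t) m \<bullet> Z)))"
      by (rule integral_cong_AE[OF borel_measurable_AE_lebesgue_on[OF m2 ae2] m2]) (use ae2 in \<open>auto elim: eventually_mono\<close>)
     have "L ^ 3 * (LINT t|lT. deriv \<phi> t * (vcoef (w t) m \<bullet> Z)) = - (L ^ 3 * (LINT t|lT. \<phi> t * (vcoef (w' t) m \<bullet> Z)))"
      by (rule deriv[unfolded weak_time_deriv_def, rule_format, OF \<phi> single_mode_spec(1)[OF False, of Z], unfolded l r integral_mult_right_zero])
     then show "(LINT t|lT. deriv \<phi> t * (vcoef (w t) m \<bullet> Z)) = - (LINT t|lT. \<phi> t * (vcoef (w' t) m \<bullet> Z))"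
      using L by (simp only: mult_minus_right[symmetric]) (simp only: mult_cancel_left power_eq_0_iff, simp)
    qed
    then show "vcoef (w t) m \<bullet> Z = (vcoef (w 0) m + (LINT s|Leb t. vcoef (w' s) m)) \<bullet> Z"
     using it by (simp add: inner_add_left del: vcoef_nth)
   qed
  qed
  then show "vcoef (w t) m = vcoef (w 0) m + (LINT s|Leb t. ?h s - (\<nu> * lam m) *\<^sub>R vcoef (w s) m)"
   unfolding im .
 qed
qed

text \<open>The derivative gained by the filter places the initial velocity in H_1.\<close>

lemma vfilter_coef:
 assumes u: "u \<in> Hfun L 0"
 shows "vfilter L \<alpha> u \<in> L2_torus L" "vcoef (vfilter L \<alpha> u) m = gsym m *\<^sub>R vcoef u m"
  "real_field (%m. gsym m *\<^sub>R vcoef u m)" "h1 (%m. gsym m *\<^sub>R vcoef u m)"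
proof -
 have u2: "u \<in> L2_torus L" and r: "real_field (vcoef u)" using u by (auto simp: Hfun_iff)
 have eq: "(%x. vfilter L \<alpha> u x $ i) = multiplier L (%k. of_real (filter_symbol \<alpha> k)) (%y. u y $ i)" for i
  by (simp add: vfilter_def gfilter_def fun_eq_iff)
 have e': "ell2 (%m. of_real (filter_symbol \<alpha> (wn m)) * coef (%y. u y $ i) m)" for i
 proof (rule ell2_mono(1)[OF bessel(1)[OF L2_torus_nth[OF u2, of i]]])
  fix m
  show "norm (of_real (filter_symbol \<alpha> (wn m)) * coef (%y. u y $ i) m) \<le> norm (coef (%y. u y $ i) m)"
   using mult_right_mono[OF gsym_le[of m], of "norm (coef (%y. u y $ i) m)"] gsym_pos[of m]
   by (simp add: norm_mult filter_symbol_gsym)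
 qed
 have cj: "of_real (filter_symbol \<alpha> (wn (- m))) = cnj (of_real (filter_symbol \<alpha> (wn m)))" for m
  by (simp add: filter_symbol_def)
 note sp = multiplier_spec[of "%k. of_real (filter_symbol \<alpha> k)", OF cj e']
 show "vfilter L \<alpha> u \<in> L2_torus L" by (rule L2_torus_vec) (unfold eq, rule sp)
 show "vcoef (vfilter L \<alpha> u) m = gsym m *\<^sub>R vcoef u m"
  unfolding vec_eq_iff vcoef_nth eq sp(2) filter_symbol_gsym scaleR_complex_nth by simp
 show rr: "real_field (%m. gsym m *\<^sub>R vcoef u m)"
  using r by (simp add: real_field_def cdot_linear vcnj_linear del: vcoef_nth)
 have "ell2 (%m. (1 / \<alpha>) *\<^sub>R vcoef u m)" by (rule ell2_scaleR(1)[OF ell2_vcoef[OF u2]])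
 then have "ell2 (h1w (%m. gsym m *\<^sub>R vcoef u m))"
 proof (rule ell2_mono(1))
  fix m
  show "norm (h1w (%m. gsym m *\<^sub>R vcoef u m) m) \<le> norm ((1 / \<alpha>) *\<^sub>R vcoef u m)"
  proof (cases "m = 0")
   case False
   have "norm (wn m) * gsym m \<le> norm (wn m) * (1 / \<alpha> * ws (- 1) m)" by (intro mult_left_mono gsym_ws False) simp
   also have "\<dots> = 1 / \<alpha>" using norm_wn_pos[OF False] False by (simp add: ws_simps)
   finally have "(norm (wn m) * gsym m) * norm (vcoef u m) \<le> 1 / \<alpha> * norm (vcoef u m)" by (intro mult_right_mono) auto
   then show ?thesis using gsym_pos[of m] params by (simp add: h1w_def mult.assoc del: vcoef_nth)
  qed (simp add: h1w_def)
 qed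
 then show "h1 (%m. gsym m *\<^sub>R vcoef u m)" using rr by (simp add: h1_def real_field_def)
qed

text \<open>Velocities agree by \<open>evolution_unique\<close> with a common bound for both
  solutions. The vanishing residuals then have equal pressure gradients, which determine all
  pressure modes but the zeroth; that one is fixed by the zero mean.\<close>

lemma regular_weak_solution_unique:
 assumes f: "f \<in> L2_Hdist" and u0: "u\<^sub>0 \<in> Hfun L 0"
  and a: "regular_weak_solution L T \<nu> \<alpha> N u\<^sub>0 f w q" and b: "regular_weak_solution L T \<nu> \<alpha> N u\<^sub>0 f v p"
 shows "(\<forall>t\<in>{0..T}. AE x in torus L. v t x = w t x) \<and> (AE t in lT. AE x in torus L. p t x = q t x)"
proof -
 have T0: "T > 0" "0 \<in> {0..T}" using params by auto
 \<comment> \<open>The initial condition is a limit in the H_1 norm; since each mode is continuous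
   at time 0, the value there must be that limit.\<close>
 have initial: "vcoef (w 0) m = gsym m *\<^sub>R vcoef u\<^sub>0 m"
  if wC: "w \<in> C_Hfun1"
   and i: "((%t. Hfun_norm L 1 (%x. w t x - vfilter L \<alpha> u\<^sub>0 x)) \<longlongrightarrow> 0) (at 0 within {0..T})" for w m
 proof -
  note C = C_time_coef[OF wC]
  have nb: "at 0 within {0..T} \<noteq> bot" by (simp add: at_within_Icc_at_right[OF T0(1)])
  have l1: "((%t. vcoef (w t) m) \<longlongrightarrow> vcoef (w 0) m) (at 0 within {0..T})"
   using C(4)[of m] T0(2) by (auto simp: continuous_on_def)
  have "((%t. vcoef (w t) m - gsym m *\<^sub>R vcoef u\<^sub>0 m) \<longlongrightarrow> 0) (at 0 within {0..T})"
  proof (cases "m = 0")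
   case True
   have "eventually (%s. 0 = vcoef (w s) m - gsym m *\<^sub>R vcoef u\<^sub>0 m) (at 0 within {0..T})"
    unfolding eventually_at_filter
    by (rule always_eventually) (use True C(2) u0 in \<open>auto simp: Hfun_iff real_fieldD(1) simp del: vcoef_nth\<close>)
   then show ?thesis by (rule Lim_transform_eventually[OF tendsto_const])
  next
   case False
   show ?thesis
   proof (rule Lim_null_comparison)
    show "eventually (%s. norm (vcoef (w s) m - gsym m *\<^sub>R vcoef u\<^sub>0 m) \<le> Hfun_norm L 1 (%x. w s x - vfilter L \<alpha> u\<^sub>0 x) / norm (wn m)) (at 0 within {0..T})"
     unfolding eventually_at_filter
    proof (rule always_eventually, intro allI impI)
     fix s assume "s \<in> {0..T}"
     then have h: "Hfun_norm L 1 (%x. w s x - vfilter L \<alpha> u\<^sub>0 x) = h1n (%m. vcoef (w s) m - gsym m *\<^sub>R vcoef u\<^sub>0 m)"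
      "h1 (%m. vcoef (w s) m - gsym m *\<^sub>R vcoef u\<^sub>0 m)"
      using C(1,3) vfilter_coef[OF u0] by (simp_all add: Hfun_norm_diff ws1_h1w h1n_def h1_diff del: vcoef_nth)
     show "norm (vcoef (w s) m - gsym m *\<^sub>R vcoef u\<^sub>0 m) \<le> Hfun_norm L 1 (%x. w s x - vfilter L \<alpha> u\<^sub>0 x) / norm (wn m)"
      using h1_component[OF h(2), of m] norm_wn_pos[OF False] unfolding h(1) by (simp add: field_simps del: vcoef_nth)
    qed
    show "((%s. Hfun_norm L 1 (%x. w s x - vfilter L \<alpha> u\<^sub>0 x) / norm (wn m)) \<longlongrightarrow> 0) (at 0 within {0..T})"
     using tendsto_divide[OF i tendsto_const, of "norm (wn m)"] norm_wn_pos[OF False] by simp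
   qed
  qed
  then have "((%t. vcoef (w t) m) \<longlongrightarrow> gsym m *\<^sub>R vcoef u\<^sub>0 m) (at 0 within {0..T})" by (rule Lim_null[THEN iffD2])
  then show ?thesis using tendsto_unique[OF nb l1] by simp
 qed
 from a obtain w' where w: "w \<in> L2_Hfun 2" "w \<in> C_Hfun1"
  "q \<in> L2_Sobolev1" "AE t in lT. (LINT x|torus L. q t x) = 0"
  "((%t. Hfun_norm L 1 (%x. w t x - vfilter L \<alpha> u\<^sub>0 x)) \<longlongrightarrow> 0) (at 0 within {0..T})"
  "w' \<in> L2_Hfun 0" "weak_time_deriv L T w w'"
  and ww: "\<forall>z. (\<forall>j. (%t x. z t x $ j) \<in> L2_Sobolev1) \<longrightarrow>
     weak_lhs w' w q z
     = weak_rhs f z"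
  unfolding regular_weak_solution_def by auto
 from b obtain v' where v: "v \<in> L2_Hfun 2" "v \<in> C_Hfun1"
  "p \<in> L2_Sobolev1" "AE t in lT. (LINT x|torus L. p t x) = 0"
  "((%t. Hfun_norm L 1 (%x. v t x - vfilter L \<alpha> u\<^sub>0 x)) \<longlongrightarrow> 0) (at 0 within {0..T})"
  "v' \<in> L2_Hfun 0" "weak_time_deriv L T v v'"
  and vv: "\<forall>z. (\<forall>j. (%t x. z t x $ j) \<in> L2_Sobolev1) \<longrightarrow>
     weak_lhs v' v p z
     = weak_rhs f z"
  unfolding regular_weak_solution_def by auto
 note rw = residual_zero[OF w(1,2,3,6) f ww] and rv = residual_zero[OF v(1,2,3,6) f vv]
 have ew: "AE t in lT. vcoef (w' t) m = (gsym m *\<^sub>R f t (wn m) - Bn (vcoef (w t)) (vcoef (w t)) m) - (\<nu> * lam m) *\<^sub>R vcoef (w t) m"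
  "linear_evolution T (\<nu> * lam m) (%t. gsym m *\<^sub>R f t (wn m) - Bn (%m. vcoef (w t) m) (%m. vcoef (w t) m) m) (%t. vcoef (w t) m)" for m
  by (rule weak_solution_evolution[OF w(1,2,6) f w(7)], erule rw)+
 have ev: "AE t in lT. vcoef (v' t) m = (gsym m *\<^sub>R f t (wn m) - Bn (vcoef (v t)) (vcoef (v t)) m) - (\<nu> * lam m) *\<^sub>R vcoef (v t) m"
  "linear_evolution T (\<nu> * lam m) (%t. gsym m *\<^sub>R f t (wn m) - Bn (%m. vcoef (v t) m) (%m. vcoef (v t) m) m) (%t. vcoef (v t) m)" for m
  by (rule weak_solution_evolution[OF v(1,2,6) f v(7)], erule rv)+
 note Cw = C_time_coef[OF w(2)] and Cv = C_time_coef[OF v(2)]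
 obtain R1 R2 where R: "\<And>t. t \<in> {0..T} \<Longrightarrow> h1n (vcoef (w t)) \<le> R1" "\<And>t. t \<in> {0..T} \<Longrightarrow> h1n (vcoef (v t)) \<le> R2"
  using Cw(5) Cv(5) by blast
 have R': "\<And>t. t \<in> {0..T} \<Longrightarrow> h1n (vcoef (w t)) \<le> max R1 R2" "\<And>t. t \<in> {0..T} \<Longrightarrow> h1n (vcoef (v t)) \<le> max R1 R2"
  using R by (auto intro: max.coboundedI1 max.coboundedI2)
 have i: "vcoef (w 0) m = vcoef (v 0) m" for m
  using initial[OF w(2,5), of m] initial[OF v(2,5), of m] by simp
 have eq: "vcoef (w t) m = vcoef (v t) m" if "t \<in> {0..T}" for t m
  by (rule evolution_unique[of "%m t. gsym m *\<^sub>R f t (wn m)" "%m t. vcoef (w t) m" "%m t. vcoef (v t) m",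
     OF ew(2) ev(2) Cw(3) R'(1) Cv(3) R'(2) i that])
 have "AE x in torus L. v t x = w t x" if "t \<in> {0..T}" for t
  by (rule vcoef_inject[OF Cv(1)[OF that] Cw(1)[OF that]]) (simp only: eq[OF that])
 moreover have "AE t in lT. AE x in torus L. p t x = q t x"
 proof -
  have sp: "AE t in lT. t \<in> {0..T}" by (rule AE_in_lebesgue_onI)
  have all: "AE t in lT. \<forall>m. coef (p t) m = coef (q t) m"
   unfolding AE_all_countable
  proof
   fix m
   show "AE t in lT. coef (p t) m = coef (q t) m"
   proof (cases "m = 0")
    case True
    have c0: "coef u 0 = of_real (LINT x|torus L. u x) / of_real (L ^ 3)" for u
     by (simp add: coef_eq)
    show ?thesis using w(4) v(4) by eventually_elim (simp add: True c0)
   next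
    case False
    \<comment> \<open>A nonzero component of the wave vector recovers the pressure coefficient from
      its gradient.\<close>
    then obtain j where j: "wn m $ j \<noteq> 0" using norm_wn_pos[OF False] by (auto simp: vec_eq_iff)
    show ?thesis using rw[OF False] rv[OF False] ew(1)[of m] ev(1)[of m] sp
    proof eventually_elim
     case (elim t)
     have cancel: "x = y" if "a + x - d = a + y - d" for a d x y :: "complex^3" using that by simp
     have f1: "vcoef (v t) = vcoef (w t)" using eq[OF elim(5)] by auto
     have f2: "vcoef (v' t) m = vcoef (w' t) m" unfolding elim(3,4) f1 ..
     have "residual (w' t) (w t) (q t) (f t) m = residual (v' t) (v t) (p t) (f t) m" using elim(1,2) by simp
     then have "(\<chi> j. \<i> * of_real (wn m $ j) * coef (q t) m) = (\<chi> j. \<i> * of_real (wn m $ j) * coef (p t) m)"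
      unfolding residual_def f1 f2 by (rule cancel)
     then have "\<i> * of_real (wn m $ j) * coef (q t) m = \<i> * of_real (wn m $ j) * coef (p t) m"
      unfolding vec_eq_iff using j by auto
     then show ?case using j by simp
    qed
   qed
  qed
  show ?thesis using all Sobolev1_coef(2)[OF w(3)] Sobolev1_coef(2)[OF v(3)]
  proof eventually_elim
   case (elim t)
   show ?case by (rule coef_inject) (use elim in \<open>auto simp: Sobolev1_iff intro: L2_torus_integrable\<close>)
  qed
 qed
 ultimately show ?thesis by blast
qed

end

section \<open>Existence\<close>

context torus_model
begin

lemma sw_le: assumes "m \<noteq> 0" shows "sw m \<le> (L / (2 * pi) + 1) * norm (wn m)"
proof -
 let ?n = "norm (wn m)"
 have "sqrt (1 + ?n^2) \<le> 1 + ?n" by (rule real_le_lsqrt) (auto simp: power2_sum)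
 moreover have "L / (2 * pi) * (2 * pi / L) \<le> L / (2 * pi) * ?n" using L by (intro mult_left_mono norm_wn_ge assms) auto
 moreover have "L / (2 * pi) * (2 * pi / L) = 1" using L by simp
 ultimately show ?thesis unfolding sw_def distrib_right by linarith
qed

lemma flux_bound:
 assumes h: "h1 c" and R: "h1n c \<le> R"
 shows "ell2 (flux c c)" "(ell2_norm (flux c c))^2 \<le> (Kf * R * R)^2 / (2 * pi / L)^2"
proof -
 have "h1n (flux c c) \<le> Kf * h1n c * h1n c" by (rule flux_h1(2)[OF h h])
 also have "\<dots> \<le> Kf * R * R"
  using R Kf_nonneg order_trans[OF h1n_nonneg R] by (intro mult_mono) auto
 finally have "(h1n (flux c c))^2 / (2 * pi / L)^2 \<le> (Kf * R * R)^2 / (2 * pi / L)^2"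
  by (intro divide_right_mono power_mono) auto
 then show "(ell2_norm (flux c c))^2 \<le> (Kf * R * R)^2 / (2 * pi / L)^2"
  using h1_imp_ell2(2)[OF flux_h1(1)[OF h h]] by linarith
 show "ell2 (flux c c)" by (rule h1_imp_ell2(1)[OF flux_h1(1)[OF h h]])
qed

text \<open>Solves the Poisson equation for the gradient part of the flux: i k times this
  coefficient is minus the component that \<open>leray\<close> removes. At k = 0 division by zero
  gives 0, hence zero mean.\<close>

definition pressure :: "(int^3 \<Rightarrow> complex^3) \<Rightarrow> int^3 \<Rightarrow> complex" where
 "pressure c k = \<i> * (cdot (wn k) (flux c c k) / of_real (lam k))"

lemma pressure_0: "pressure c 0 = 0" by (simp add: pressure_def)

lemma pressure_hermitian:
 assumes "real_field c" shows "hermitian (pressure c)"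
 unfolding hermitian_def pressure_def by (simp add: flux_cnj[OF assms assms] cdot_vcnj)

lemma pressure_leray: "flux c c k + (\<chi> j. \<i> * of_real (wn k $ j) * pressure c k) = Bn c c k"
proof -
 have "\<i> * a * (\<i> * b) = - (a * b)" for a b :: complex
  by (metis i_squared mult.assoc mult.left_commute mult_minus1)
 then show ?thesis by (simp add: vec_eq_iff Bn_def leray_def pressure_def lam_def)
qed

text \<open>Dividing by |k|^2 after pairing with k gains one derivative over the flux, which offsets
  the weight \<open>sw\<close> up to the constant of \<open>sw_le\<close>.\<close>

lemma pressure_le: "norm (sw k *\<^sub>R pressure c k) \<le> norm ((L / (2 * pi) + 1) *\<^sub>R flux c c k)"
proof (cases "k = 0")
 case False
 let ?n = "norm (wn k)"
 have n: "?n > 0" by (rule norm_wn_pos[OF False])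
 have C: "L / (2 * pi) + 1 \<ge> 0" using L by simp
 have "norm (cdot (wn k) (flux c c k)) \<le> ?n * norm (flux c c k)"
  using cdot_le[of "wn k" "flux c c k"] by (simp add: cdot_def)
 then have "norm (cdot (wn k) (flux c c k)) / lam k \<le> ?n * norm (flux c c k) / lam k" by (intro divide_right_mono) auto
 then have "norm (pressure c k) \<le> norm (flux c c k) / ?n"
  using n by (simp add: pressure_def norm_mult norm_divide lam_def power2_eq_square)
 then have "sw k * norm (pressure c k) \<le> ((L / (2 * pi) + 1) * ?n) * (norm (flux c c k) / ?n)"
  using C n sw_le[OF False] by (intro mult_mono) auto
 also have "\<dots> = (L / (2 * pi) + 1) * norm (flux c c k)" using n by simp
 finally show ?thesis using C sw_simps(2)[of k] by simp
qed (simp add: pressure_0)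

lemma pressure_ell2:
 assumes h: "h1 c" and R: "h1n c \<le> R"
 shows "ell2 (%k. sw k *\<^sub>R pressure c k)"
  "(ell2_norm (%k. sw k *\<^sub>R pressure c k))^2 \<le> (L / (2 * pi) + 1)^2 * ((Kf * R * R)^2 / (2 * pi / L)^2)"
proof -
 note e = ell2_mono[OF ell2_scaleR(1)[OF flux_bound(1)[OF h R], of "L / (2 * pi) + 1"] pressure_le]
 show "ell2 (%k. sw k *\<^sub>R pressure c k)" by (rule e(1))
 have "(ell2_norm (%k. sw k *\<^sub>R pressure c k))^2 \<le> (ell2_norm (%k. (L / (2 * pi) + 1) *\<^sub>R flux c c k))^2"
  by (intro power_mono e(2)) simp
 also have "\<dots> = (L / (2 * pi) + 1)^2 * (ell2_norm (flux c c))^2"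
  unfolding ell2_scaleR(2) power_mult_distrib power2_abs ..
 also have "\<dots> \<le> (L / (2 * pi) + 1)^2 * ((Kf * R * R)^2 / (2 * pi / L)^2)"
  by (intro mult_left_mono flux_bound(2)[OF h R]) simp
 finally show "(ell2_norm (%k. sw k *\<^sub>R pressure c k))^2 \<le> (L / (2 * pi) + 1)^2 * ((Kf * R * R)^2 / (2 * pi / L)^2)" .
qed

lemma integrable_const_time: "integrable lT (%t. c :: real)"
 by (rule continuous_imp_integrable_real) simp

text \<open>Each mode is integrated by parts against \<phi>; \<open>time_pairing\<close> then
  expresses both sides of the definition as sums over modes, which agree term by term.\<close>

lemma weak_time_deriv_from_coefficients:
 fixes w d :: "int^3 \<Rightarrow> real \<Rightarrow> complex^3"
 assumes w: "\<And>t. t \<in> {0..T} \<Longrightarrow> u t \<in> L2_torus L \<and> vcoef (u t) = (slice w t)"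
  and d: "AE t in lT. u' t \<in> L2_torus L \<and> vcoef (u' t) = (slice d t)"
  and wm: "\<And>k. continuous_on {0..T} (w k)" and wb: "\<And>t. t \<in> {0..T} \<Longrightarrow> (ell2_norm (slice w t))^2 \<le> S"
  and di: "\<And>k. integrable lT (d k)" and db: "AE t in lT. (ell2_norm (slice d t))^2 \<le> G t" "integrable lT G"
  and ode: "\<And>k t. t \<in> {0..T} \<Longrightarrow> w k t = w k 0 + (LINT s|Leb t. d k s)"
 shows "weak_time_deriv L T u u'"
 unfolding weak_time_deriv_def
proof (intro allI impI)
 fix \<phi> and \<psi> :: "real^3 \<Rightarrow> real^3" assume \<phi>: "test_function T \<phi>" and \<psi>: "\<psi> \<in> L2_torus L"
 note t = test_function_deriv[OF \<phi>]
 have sp: "AE t in lT. t \<in> {0..T}" by (rule AE_in_lebesgue_onI)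
 have bd: "\<exists>B. \<forall>t\<in>{0..T}. norm (g t) \<le> B" if "continuous_on {0..T} g" for g :: "real \<Rightarrow> real"
 proof -
  have "bounded (g ` {0..T})" by (intro compact_imp_bounded compact_continuous_image that) simp
  then show ?thesis unfolding bounded_iff by auto
 qed
 obtain B1 B2 where B: "\<And>t. t \<in> {0..T} \<Longrightarrow> \<bar>deriv \<phi> t\<bar> \<le> B1" "\<And>t. t \<in> {0..T} \<Longrightarrow> \<bar>\<phi> t\<bar> \<le> B2"
  using bd[OF t(3)] bd[OF t(2)] unfolding real_norm_def by blast
 have V: "(%t. vcoef \<psi> m) \<in> borel_measurable lT" for m by simp
 have r: "AE t in lT. ell2 (%m. vcoef \<psi> m) \<and> (ell2_norm (%m. vcoef \<psi> m))^2 \<le> (ell2_norm (%m. vcoef \<psi> m))^2"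
  using ell2_vcoef[OF \<psi>] by simp
 have scale: "(ell2_norm (%m. a *\<^sub>R c m))^2 \<le> b^2 * s" if "\<bar>a\<bar> \<le> b" "(ell2_norm c)^2 \<le> s" for a b s and c :: "int^3 \<Rightarrow> complex^3"
 proof -
  have "a^2 \<le> b^2" using power_mono[OF that(1), of 2] by simp
  then show ?thesis unfolding ell2_scaleR(2) power_mult_distrib power2_abs using that(2) by (intro mult_mono) auto
 qed
 have m1: "(%t. deriv \<phi> t *\<^sub>R w m t) \<in> borel_measurable lT" for m
  by (intro continuous_borel_measurable_lebesgue_on continuous_intros wm t(3))
 have g1: "AE t in lT. ell2 (%m. deriv \<phi> t *\<^sub>R w m t) \<and> (ell2_norm (%m. deriv \<phi> t *\<^sub>R w m t))^2 \<le> B1^2 * S"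
  using sp
 proof eventually_elim
  case (elim t)
  have "ell2 (slice w t)" using w[OF elim] ell2_vcoef by metis
  then show ?case using scale[OF B(1)[OF elim] wb[OF elim]] ell2_scaleR(1) by blast
 qed
 have h1: "AE t in lT. ((%m. (deriv \<phi> t *\<^sub>R w m t) \<bullet> vcoef \<psi> m) has_sum ((deriv \<phi> t * (LINT x|torus L. u t x \<bullet> \<psi> x)) / L ^ 3)) UNIV"
  using sp
 proof eventually_elim
  case (elim t)
  have "((%m. w m t \<bullet> vcoef \<psi> m) has_sum ((LINT x|torus L. u t x \<bullet> \<psi> x) / L ^ 3)) UNIV"
   using vparseval[of "u t", OF _ \<psi>] w[OF elim] by simp
  from has_sum_cmult_right[OF this, of "deriv \<phi> t"] show ?case by (simp only: inner_scaleR_left times_divide_eq_right)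
 qed
 note A = time_pairing(2)[OF m1 V g1 integrable_const_time r integrable_const_time h1]
 have m2: "(%t. \<phi> t *\<^sub>R d m t) \<in> borel_measurable lT" for m
  by (intro borel_measurable_scaleR continuous_borel_measurable_lebesgue_on t(2) borel_measurable_integrable di)
 have g2: "AE t in lT. ell2 (%m. \<phi> t *\<^sub>R d m t) \<and> (ell2_norm (%m. \<phi> t *\<^sub>R d m t))^2 \<le> B2^2 * G t"
  using sp d db(1)
 proof eventually_elim
  case (elim t)
  have "ell2 (slice d t)" using elim(2) ell2_vcoef by metis
  then show ?case using scale[OF B(2)[OF elim(1)] elim(3)] ell2_scaleR(1) by blast
 qed
 have h2: "AE t in lT. ((%m. (\<phi> t *\<^sub>R d m t) \<bullet> vcoef \<psi> m) has_sum ((\<phi> t * (LINT x|torus L. u' t x \<bullet> \<psi> x)) / L ^ 3)) UNIV"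
  using d
 proof eventually_elim
  case (elim t)
  have "((%m. d m t \<bullet> vcoef \<psi> m) has_sum ((LINT x|torus L. u' t x \<bullet> \<psi> x) / L ^ 3)) UNIV"
   using vparseval[of "u' t", OF _ \<psi>] elim by simp
  from has_sum_cmult_right[OF this, of "\<phi> t"] show ?case by (simp only: inner_scaleR_left times_divide_eq_right)
 qed
 note D = time_pairing(2)[OF m2 V g2 integrable_mult_right[OF db(2)] r integrable_const_time h2]
 have e: "(LINT t|lT. (deriv \<phi> t *\<^sub>R w m t) \<bullet> vcoef \<psi> m) = - (LINT t|lT. (\<phi> t *\<^sub>R d m t) \<bullet> vcoef \<psi> m)" for m
  unfolding inner_scaleR_left
 proof (rule test_function_integral_by_parts[OF \<phi> params(3)])
  show "integrable lT (%t. d m t \<bullet> vcoef \<psi> m)" by (rule integrable_inner_left) (rule di)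
  fix t assume t: "t \<in> {0..T}"
  have "integrable (Leb t) (d m)" using lebesgue_on_eq_integral(1)[OF di, of 0 t] t by simp
  then show "w m t \<bullet> vcoef \<psi> m = w m 0 \<bullet> vcoef \<psi> m + (LINT s|Leb t. d m s \<bullet> vcoef \<psi> m)"
   by (subst ode[OF t]) (simp add: inner_add_left del: vcoef_nth)
 qed
 have "((%m. - (LINT t|lT. (\<phi> t *\<^sub>R d m t) \<bullet> vcoef \<psi> m)) has_sum
   (- ((LINT t|lT. \<phi> t * (LINT x|torus L. u' t x \<bullet> \<psi> x)) / L ^ 3))) UNIV"
  using has_sum_cmult_right[OF D, of "- 1"] by simp
 from has_sum_unique[OF A[unfolded e] this]
 show "(LINT t|lT. deriv \<phi> t * (LINT x|torus L. u t x \<bullet> \<psi> x)) = - (LINT t|lT. \<phi> t * (LINT x|torus L. u' t x \<bullet> \<psi> x))"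
  using L by (simp only: minus_divide_left divide_cancel_right power_eq_0_iff) auto
qed

lemma regular_weak_solution_exists:
 assumes f: "f \<in> L2_Hdist" and u0: "u\<^sub>0 \<in> Hfun L 0"
 shows "\<exists>w q. regular_weak_solution L T \<nu> \<alpha> N u\<^sub>0 f w q"
proof -
 have T0: "T > 0" "0 \<in> {0..T}" using params by auto
 have sp: "AE t in lT. t \<in> {0..T}" by (rule AE_in_lebesgue_onI)
 note cf = force_coef[OF f]
 \<comment> \<open>Set to zero at the exceptional times at which \<open>f t\<close> is not in
   H_{-1}, so that the requirements of \<open>forced_model\<close> hold at all times.\<close>
 define F where "F k t = (if f t \<in> Hdist L (- 1) then gsym k *\<^sub>R f t (wn k) else 0)" for k t
 have Fm: "F k \<in> borel_measurable lT" for k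
  by (rule borel_measurable_AE_lebesgue_on[OF cf(1)[of k]]) (use cf(2) in \<open>auto simp: F_def elim: eventually_mono\<close>)
 have Fr: "real_field (slice F t)" and Fe: "ell2 (slice F t)" for t
 proof -
  have "real_field (slice F t) \<and> ell2 (slice F t)"
  proof (cases "f t \<in> Hdist L (- 1)")
   case True
   then have "real_field (%m. f t (wn m))" by (simp add: Hdist_iff)
   then show ?thesis using filtered_real_field filtered_ell2(1)[OF True] True by (simp add: F_def)
  qed (simp add: F_def real_field_def vcnj_linear cdot_linear)
  then show "real_field (slice F t)" "ell2 (slice F t)" by auto
 qed
 have Fi: "integrable lT (%t. (ell2_norm (slice F t))^2)"
 proof (rule bochner_integrable_bound)
  show "integrable lT (%t. (1 / \<alpha>)^2 * (Hdist_norm L (- 1) (f t))^2)" using cf(3) by (rule integrable_mult_right)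
  show "(%t. (ell2_norm (slice F t))^2) \<in> borel_measurable lT" by (intro borel_measurable_power measurable_ell2_norm Fm)
  show "AE t in lT. norm ((ell2_norm (slice F t))^2) \<le> norm ((1 / \<alpha>)^2 * (Hdist_norm L (- 1) (f t))^2)"
   using cf(2)
  proof eventually_elim
   case (elim t)
   have "(ell2_norm (slice F t))^2 \<le> (1 / \<alpha> * Hdist_norm L (- 1) (f t))^2"
    using filtered_ell2(2)[OF elim] elim by (intro power_mono) (auto simp: F_def)
   then show ?case by (simp only: power_mult_distrib) simp
  qed
 qed
 interpret fm: forced_model wn \<alpha> \<nu> T "(2 * pi / L)^2" "real N + 1" "%m. deconv_symbol \<alpha> N (wn m)" "%m. gsym m *\<^sub>R vcoef u\<^sub>0 m" F
  by unfold_locales (rule vfilter_coef(4)[OF u0] vfilter_coef(3)[OF u0] Fm Fr Fe Fi)+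
 from fm.coefficient_solution_exists obtain w R mb where
  ev: "\<And>k. w k 0 = gsym k *\<^sub>R vcoef u\<^sub>0 k" "\<And>k. linear_evolution T (\<nu> * lam k) (%t. F k t - Bn (slice w t) (slice w t) k) (w k)"
  and wh: "\<And>t. t \<in> {0..T} \<Longrightarrow> h1 (slice w t)" and wr: "\<And>t. t \<in> {0..T} \<Longrightarrow> real_field (slice w t)"
  and wR: "\<And>t. t \<in> {0..T} \<Longrightarrow> h1n (slice w t) \<le> R"
  and mb: "mb summable_on UNIV" "\<And>k t. t \<in> {0..T} \<Longrightarrow> lam k * (norm (w k t))^2 \<le> mb k"
  and s2: "(%k. (lam k)^2 * (LINT s|lT. (norm (w k s))^2)) summable_on UNIV"
  by blast
 note wc = linear_evolutionD(2)[OF ev(2)]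
 have wm: "w k \<in> borel_measurable lT" for k by (rule continuous_borel_measurable_lebesgue_on[OF wc])
 define u where "u t = vsyn (slice w t)" for t
 have us: "u t \<in> L2_torus L" "vcoef (u t) = (slice w t)" if "t \<in> {0..T}" for t
  unfolding u_def using vsyn_spec[OF real_fieldD(2)[OF wr[OF that]] h1_imp_ell2(1)[OF wh[OF that]]] by auto
 have u1: "u t \<in> Hfun L 1" if "t \<in> {0..T}" for t
  using us[OF that] wr[OF that] wh[OF that] by (simp add: Hfun1_iff)

 have sq: "(norm (ws 2 k *\<^sub>R w k t))^2 = (lam k)^2 * (norm (w k t))^2" for k t by (simp add: ws2_lam power_mult_distrib)
 have nn: "\<bar>(lam k)^2 * (norm (w k t))^2\<bar> = (lam k)^2 * (norm (w k t))^2" for k t by simp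
 have li: "integrable lT (%t. (lam k)^2 * (norm (w k t))^2)" for k
  by (rule continuous_imp_integrable_real) (intro continuous_intros wc)
 \<comment> \<open>The H_2 bound is known only after integration in time; monotone convergence turns
   it into H_2 membership at almost every time.\<close>
 have ls: "(%k. LINT t|lT. \<bar>(lam k)^2 * (norm (w k t))^2\<bar>) summable_on UNIV" using s2 by (simp add: abs_mult)
 note l2 = infsum_integral_summable[OF li ls]
 have e2: "AE t in lT. ell2 (%k. ws 2 k *\<^sub>R w k t)"
  using l2(1) by eventually_elim (simp only: ell2_def sq nn)
 have i2: "integrable lT (%t. (ell2_norm (%k. ws 2 k *\<^sub>R w k t))^2)"
  using l2(2) by (simp only: ell2_norm_square sq nn)
 have mem2: "u \<in> L2_Hfun 2"
  unfolding u_def by (rule Hfun_L2_time[OF wm _ _ i2]) (simp, use e2 sp in eventually_elim, simp add: wr)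

 \<comment> \<open>Continuity in H_1 from continuity of each mode, by dominated convergence for
   sums: a squared difference is at most four times the majorant \<open>mb\<close>.\<close>
 have lim: "((%s. h1n (%k. w k s - w k t)) \<longlongrightarrow> 0) (at t within {0..T})" if t: "t \<in> {0..T}" for t
 proof (cases "at t within {0..T} = bot")
  case False
  have "((%s. \<Sum>\<^sub>\<infinity>k. lam k * (norm (w k s - w k t))^2) \<longlongrightarrow> (\<Sum>\<^sub>\<infinity>k::int^3. 0)) (at t within {0..T})"
  proof (rule infsum_tannery[OF _ _ _ False])
   fix k
   have "((%s. w k s) \<longlongrightarrow> w k t) (at t within {0..T})" using wc[of k] t by (auto simp: continuous_on_def)
   then have "((%s. lam k * (norm (w k s - w k t))^2) \<longlongrightarrow> lam k * (norm (w k t - w k t))^2) (at t within {0..T})"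
    by (intro tendsto_intros)
   then show "((%s. lam k * (norm (w k s - w k t))^2) \<longlongrightarrow> 0) (at t within {0..T})" by simp
  next
   show "(%k. 4 * mb k) summable_on UNIV" by (rule summable_on_cmult_right[OF mb(1)])
   show "\<forall>\<^sub>F s in at t within {0..T}. \<forall>k. \<bar>lam k * (norm (w k s - w k t))^2\<bar> \<le> 4 * mb k"
    unfolding eventually_at_filter
   proof (rule always_eventually, intro allI impI)
    fix s k assume s: "s \<in> {0..T}"
    have "(norm (w k s - w k t))^2 \<le> (norm (w k s) + norm (w k t))^2" by (intro power_mono norm_triangle_ineq4) simp
    also have "\<dots> \<le> 2 * (norm (w k s))^2 + 2 * (norm (w k t))^2" by (rule square_sum_le)
    finally have "lam k * (norm (w k s - w k t))^2 \<le> lam k * (2 * (norm (w k s))^2 + 2 * (norm (w k t))^2)"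
     by (intro mult_left_mono) auto
    also have "\<dots> = 2 * (lam k * (norm (w k s))^2) + 2 * (lam k * (norm (w k t))^2)" by (simp add: algebra_simps)
    also have "\<dots> \<le> 4 * mb k" using mb(2)[OF s, of k] mb(2)[OF t, of k] by linarith
    finally show "\<bar>lam k * (norm (w k s - w k t))^2\<bar> \<le> 4 * mb k" by simp
   qed
  qed
  then have "((%s. sqrt (\<Sum>\<^sub>\<infinity>k. lam k * (norm (w k s - w k t))^2)) \<longlongrightarrow> sqrt (\<Sum>\<^sub>\<infinity>k::int^3. 0)) (at t within {0..T})"
   by (rule tendsto_real_sqrt)
  then show ?thesis unfolding h1n_square[symmetric] by simp
 qed simp
 have memC: "u \<in> C_Hfun1"
  unfolding C_time_def
 proof (intro CollectI ballI conjI u1)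
  fix t assume t: "t \<in> {0..T}"
  show "((%s. Hfun_norm L 1 (%x. u s x - u t x)) \<longlongrightarrow> 0) (at t within {0..T})"
  proof (rule Lim_transform_eventually[OF lim[OF t]])
   show "\<forall>\<^sub>F s in at t within {0..T}. h1n (%k. w k s - w k t) = Hfun_norm L 1 (%x. u s x - u t x)"
    unfolding eventually_at_filter
    by (rule always_eventually) (use us t in \<open>auto simp: Hfun_norm_diff ws1_h1w h1n_def\<close>)
  qed
 qed
 have init: "((%t. Hfun_norm L 1 (%x. u t x - vfilter L \<alpha> u\<^sub>0 x)) \<longlongrightarrow> 0) (at 0 within {0..T})"
 proof (rule Lim_transform_eventually[OF lim[OF T0(2)]])
  show "\<forall>\<^sub>F s in at 0 within {0..T}. h1n (%k. w k s - w k 0) = Hfun_norm L 1 (%x. u s x - vfilter L \<alpha> u\<^sub>0 x)"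
   unfolding eventually_at_filter ev(1)
   by (rule always_eventually) (use us vfilter_coef[OF u0] in \<open>auto simp: Hfun_norm_diff ws1_h1w h1n_def simp del: vcoef_nth\<close>)
 qed

 define p where "p k t = pressure (slice w t) k" for k t
 define q where "q t = ssyn (slice p t)" for t
 have pm: "p k \<in> borel_measurable lT" for k
 proof -
  have "(%t. flux (slice w t) (slice w t) k) \<in> borel_measurable lT" by (rule measurable_flux[OF wm wm]) (simp_all add: wh)
  from measurable_bounded_linear[OF bounded_linear_cdot this] show ?thesis
   unfolding p_def pressure_def by (intro borel_measurable_times borel_measurable_divide) simp_all
 qed
 have ph: "hermitian (slice p t)" and pe: "ell2 (%k. sw k *\<^sub>R p k t)" if "t \<in> {0..T}" for t
  unfolding p_def using pressure_hermitian[OF wr[OF that]] pressure_ell2(1)[OF wh[OF that] wR[OF that]] by simp_all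
 have pi: "integrable lT (%t. (ell2_norm (%k. sw k *\<^sub>R p k t))^2)"
 proof (rule integrable_lebesgue_on_bounded)
  show "(%t. (ell2_norm (%k. sw k *\<^sub>R p k t))^2) \<in> borel_measurable lT"
   by (intro borel_measurable_power measurable_ell2_norm borel_measurable_scaleR pm) simp
  show "norm ((ell2_norm (%k. sw k *\<^sub>R p k t))^2) \<le> (L / (2 * pi) + 1)^2 * ((Kf * R * R)^2 / (2 * pi / L)^2)" if "t \<in> {0..T}" for t
   using pressure_ell2(2)[OF wh[OF that] wR[OF that]] by (simp add: p_def)
 qed
 have memq: "q \<in> L2_Sobolev1"
  unfolding q_def by (rule Sobolev1_L2_time[OF pm _ pi]) (use sp in eventually_elim, simp add: ph pe)
 have qs: "coef (q t) = (slice p t)" if "t \<in> {0..T}" for t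
  unfolding q_def by (rule ssyn_spec(2)[OF ph[OF that] ell2_from_sw(1)[OF pe[OF that]]])
 have q0: "AE t in lT. (LINT x|torus L. q t x) = 0"
  using sp
 proof eventually_elim
  case (elim t)
  have "of_real (LINT x|torus L. q t x) / of_real (L ^ 3) = coef (q t) 0" by (simp add: coef_eq)
  also have "\<dots> = 0" by (simp add: qs[OF elim] p_def pressure_0)
  finally show ?case using L by simp
 qed

 \<comment> \<open>The right-hand side of the mode equation, hence the candidate for the
   coefficients of the time derivative.\<close>
 define d where "d k t = F k t - Bn (slice w t) (slice w t) k - (\<nu> * lam k) *\<^sub>R w k t" for k t
 have di: "integrable lT (d k)" for k
  unfolding d_def
  by (intro bochner_integrable_diff[OF linear_evolutionD(1)[OF ev(2)]] integrable_scaleR_right continuous_imp_integrable_real wc)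
 have dr: "real_field (slice d t)" if "t \<in> {0..T}" for t
  using Fr[of t] Bn_real_field[OF wr[OF that] wr[OF that]] wr[OF that]
  unfolding d_def real_field_def by (simp add: cdot_linear vcnj_linear)
 \<comment> \<open>A majorant for the squared H_0 norm of \<open>d\<close>, by splitting the square
   of a sum twice: force, nonlinear term, and viscous term. The last one is where the H_2 bound is
   used.\<close>
 define G where "G t = 2 * (2 * (ell2_norm (slice F t))^2 + 2 * ((2 * Kf * R * R)^2 / (2 * pi / L)^2)) + 2 * (\<nu>^2 * (ell2_norm (%k. ws 2 k *\<^sub>R w k t))^2)" for t
 have Gi: "integrable lT G"
  unfolding G_def by (intro bochner_integrable_add integrable_mult_right integrable_const_time Fi i2)
 have dG: "AE t in lT. ell2 (slice d t) \<and> (ell2_norm (slice d t))^2 \<le> G t"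
  using sp e2
 proof eventually_elim
  case (elim t)
  let ?B = "Bn (slice w t) (slice w t)"
  note h = wh[OF elim(1)]
  have lw: "(%k. (\<nu> * lam k) *\<^sub>R w k t) = (%k. \<nu> *\<^sub>R (ws 2 k *\<^sub>R w k t))" by (simp add: ws2_lam)
  have eB: "ell2 ?B" by (rule h1_imp_ell2(1)[OF Bn_h1(1)[OF h h]])
  have "h1n ?B \<le> 2 * Kf * h1n (slice w t) * h1n (slice w t)" by (rule Bn_h1(2)[OF h h])
  also have "\<dots> \<le> 2 * Kf * R * R"
   using wR[OF elim(1)] Kf_nonneg order_trans[OF h1n_nonneg wR[OF elim(1)]] by (intro mult_mono) auto
  finally have "(h1n ?B)^2 / (2 * pi / L)^2 \<le> (2 * Kf * R * R)^2 / (2 * pi / L)^2"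
   by (intro divide_right_mono power_mono) auto
  then have B: "(ell2_norm ?B)^2 \<le> (2 * Kf * R * R)^2 / (2 * pi / L)^2" using h1_imp_ell2(2)[OF Bn_h1(1)[OF h h]] by linarith
  note e1 = ell2_diff[OF Fe[of t] eB]
  have el: "ell2 (%k. (\<nu> * lam k) *\<^sub>R w k t)" unfolding lw by (rule ell2_scaleR(1)[OF elim(2)])
  note e3 = ell2_diff[OF e1(1) el]
  have "(ell2_norm (slice d t))^2 \<le> (ell2_norm (%k. F k t - ?B k) + ell2_norm (%k. (\<nu> * lam k) *\<^sub>R w k t))^2"
   unfolding d_def by (intro power_mono e3(2)) simp
  also have "\<dots> \<le> 2 * (ell2_norm (%k. F k t - ?B k))^2 + 2 * (ell2_norm (%k. (\<nu> * lam k) *\<^sub>R w k t))^2" by (rule square_sum_le)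
  also have "\<dots> \<le> G t"
  proof -
   have "(ell2_norm (%k. F k t - ?B k))^2 \<le> (ell2_norm (slice F t) + ell2_norm ?B)^2" by (intro power_mono e1(2)) simp
   also have "\<dots> \<le> 2 * (ell2_norm (slice F t))^2 + 2 * (ell2_norm ?B)^2" by (rule square_sum_le)
   also have "\<dots> \<le> 2 * (ell2_norm (slice F t))^2 + 2 * ((2 * Kf * R * R)^2 / (2 * pi / L)^2)" using B by linarith
   finally have 1: "(ell2_norm (%k. F k t - ?B k))^2 \<le> \<dots>" .
   have 2: "(ell2_norm (%k. (\<nu> * lam k) *\<^sub>R w k t))^2 = \<nu>^2 * (ell2_norm (%k. ws 2 k *\<^sub>R w k t))^2"
    unfolding lw ell2_scaleR(2) power_mult_distrib power2_abs ..
   show ?thesis unfolding G_def 2 by (intro add_mono mult_left_mono 1) auto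
  qed
  finally show ?case using e3(1) by (simp add: d_def)
 qed
 define u' where "u' t = vsyn (slice d t)" for t
 have us': "AE t in lT. u' t \<in> L2_torus L \<and> vcoef (u' t) = (slice d t)"
  using sp dG
 proof eventually_elim
  case (elim t)
  show ?case unfolding u'_def using vsyn_spec[where c="%k. d k t", OF real_fieldD(2)[OF dr[OF elim(1)]]] elim(2) by blast
 qed
 have d0: "AE t in lT. (%k. ws 0 k *\<^sub>R d k t) = (slice d t)"
  using sp
 proof eventually_elim
  case (elim t)
  show ?case by (rule ws0) (rule real_fieldD(1)[OF dr[OF elim]])
 qed
 have mem': "u' \<in> L2_Hfun 0"
  unfolding u'_def
 proof (rule Hfun_L2_time[OF borel_measurable_integrable[OF di]])
  show "AE t in lT. real_field (slice d t) \<and> ell2 (%k. ws 0 k *\<^sub>R d k t)"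
   using sp dG d0 by eventually_elim (simp add: dr)
  show "integrable lT (%t. (ell2_norm (%k. ws 0 k *\<^sub>R d k t))^2)"
  proof (rule bochner_integrable_bound[OF Gi])
   show "(%t. (ell2_norm (%k. ws 0 k *\<^sub>R d k t))^2) \<in> borel_measurable lT"
    by (intro borel_measurable_power measurable_ell2_norm borel_measurable_scaleR borel_measurable_integrable di) simp
   show "AE t in lT. norm ((ell2_norm (%k. ws 0 k *\<^sub>R d k t))^2) \<le> norm (G t)"
    using dG d0 by eventually_elim auto
  qed
 qed simp
 have wtd: "weak_time_deriv L T u u'"
 proof (rule weak_time_deriv_from_coefficients[OF _ us' wc _ di _ Gi])
  show "u t \<in> L2_torus L \<and> vcoef (u t) = (slice w t)" if "t \<in> {0..T}" for t using us[OF that] by simp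
  show "AE t in lT. (ell2_norm (slice d t))^2 \<le> G t" using dG by eventually_elim simp
  show "(ell2_norm (slice w t))^2 \<le> R^2 / (2 * pi / L)^2" if "t \<in> {0..T}" for t
  proof -
   have "(h1n (slice w t))^2 / (2 * pi / L)^2 \<le> R^2 / (2 * pi / L)^2"
    by (intro divide_right_mono power_mono wR that) auto
   then show ?thesis using h1_imp_ell2(2)[OF wh[OF that]] by linarith
  qed
  show "w k t = w k 0 + (LINT s|Leb t. d k s)" if "t \<in> {0..T}" for k t
   unfolding d_def by (rule linear_evolutionD(3)[OF ev(2) that])
 qed
 \<comment> \<open>Flux plus pressure gradient equals \<open>Bn\<close>, so the residual vanishes by
   the definition of \<open>d\<close>, in all modes including the zeroth.\<close>
 have res: "AE t in lT. \<forall>m. residual (u' t) (u t) (q t) (f t) m = 0"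
  using sp us' cf(2)
 proof eventually_elim
  case (elim t)
  show ?case
  proof
   fix m
   have Fm: "gsym m *\<^sub>R f t (wn m) = F m t" using elim(3) by (simp add: F_def)
   have P: "Bn (slice w t) (slice w t) m = flux (slice w t) (slice w t) m + (\<chi> j. \<i> * of_real (wn m $ j) * p m t)"
    unfolding p_def by (rule pressure_leray[symmetric])
   have v: "vcoef (u' t) = (slice d t)" using elim(2) by blast
   show "residual (u' t) (u t) (q t) (f t) m = 0"
    unfolding residual_def Fm v us(2)[OF elim(1)] qs[OF elim(1)] d_def P by (simp add: algebra_simps)
  qed
 qed
 have weak: "weak_lhs u' u q v
     = weak_rhs f v"
  if v: "\<forall>j. (%t x. v t x $ j) \<in> L2_Sobolev1" for v
 proof -
  note W = weak_form_coefficients(2)[OF mem2 memC memq mem' f v[rule_format]]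
  have z: "(LINT t|lT. residual (u' t) (u t) (q t) (f t) m \<bullet> vcoef (v t) m) = 0" for m
   by (rule integral_eq_zero_AE) (use res in \<open>eventually_elim, simp\<close>)
  have "((%m::int^3. 0 :: real) has_sum 0) UNIV" by simp
  from has_sum_unique[OF this W[unfolded z]] show ?thesis using L by simp
 qed
 show ?thesis
  unfolding regular_weak_solution_def using mem2 memC memq q0 init mem' wtd weak by blast
qed

end

theorem theorem3p1:
  fixes L \<nu> T \<alpha> :: real and N :: nat
    and u\<^sub>0 :: "real^3 \<Rightarrow> real^3" and f :: "real \<Rightarrow> real^3 \<Rightarrow> complex^3"
  assumes "L > 0" and "\<nu> > 0" and "T > 0" and "\<alpha> > 0"
    and "u\<^sub>0 \<in> Hfun L 0"
    and "f \<in> L2_time T (Hdist L (- 1)) (Hdist_norm L (- 1))"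
  shows "\<exists>w q. regular_weak_solution L T \<nu> \<alpha> N u\<^sub>0 f w q \<and>
    (\<forall>w' q'. regular_weak_solution L T \<nu> \<alpha> N u\<^sub>0 f w' q' \<longrightarrow>
      (\<forall>t\<in>{0..T}. AE x in torus L. w' t x = w t x) \<and>
      (AE t in lebesgue_on {0..T}. AE x in torus L. q' t x = q t x))"
proof -
  interpret torus_model L \<alpha> \<nu> T N by unfold_locales (use assms in auto)
  obtain w q where s: "regular_weak_solution L T \<nu> \<alpha> N u\<^sub>0 f w q"
    using regular_weak_solution_exists[OF assms(6,5)] by blast
  then show ?thesis using regular_weak_solution_unique[OF assms(6,5) s] by blast
qed

end
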